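(* Let $k$ be a perfect field, $G=\mathrm{GL}_3\times\mathrm{GL}_3\times\mathrm{GL}_2$ and $V=\mathbb{A}^3\otimes\mathbb{A}^3\otimes\mathbb{A}^2$ with the natural action of $G$. Let $\{S_\beta\}_{\beta\in\mathfrak{B}}$ be the strata of the GIT stratification of $V$ (see context). Consider the following $16$ elements of $\mathfrak{B}$: \begin{align*} &\beta_4=\tfrac16(-2,1,1,0,0,0,0,0), &&\beta_5=\tfrac16(0,0,0,-2,1,1,0,0),\\ &\beta_6=\tfrac1{66}(-4,2,2,-4,2,2,-3,3), &&\beta_{11}=\tfrac1{18}(-2,0,2,-2,0,2,-1,1),\\ &\beta_{22}=\tfrac1{12}(-1,-1,2,-1,-1,2,0,0), &&\beta_{28}=\tfrac16(-1,0,1,-1,0,1,-1,1),\\ &\beta_{29}=\tfrac16(-2,1,1,-2,1,1,0,0), &&\beta_{38}=\tfrac12(0,0,0,0,0,0,-1,1),\\ &\beta_{39}=\tfrac16(-2,0,2,-2,0,2,-1,1), &&\beta_{40}=\tfrac1{30}(-10,2,8,-4,2,2,-3,3),\\ &\beta_{41}=\tfrac1{30}(-4,2,2,-10,2,8,-3,3), &&\beta_{42}=\tfrac1{30}(-1,-1,2,-1,-1,2,-3,3),\\ &\beta_{45}=\tfrac16(-2,1,1,-2,1,1,-3,3), &&\beta_{47}=\tfrac16(-2,-2,4,-2,1,1,0,0),\\ &\beta_{48}=\tfrac16(-2,1,1,-2,-2,4,0,0), &&\beta_{49}=\tfrac16(-2,-2,4,-2,-2,4,-3,3). \end{align*} Then: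 (1) for $\beta\in\mathfrak{B}$, $S_\beta\neq\emptyset$ if and only if $\beta$ is one of these $16$ vectors; (2) for each of these $16$ vectors $\beta$ except $\beta=\beta_{29}$, $S_{\beta\,k}$ is a single $G_k$-orbit; (3) $G_k\backslash S_{\beta_{29}\,k}$ is in bijective correspondence with $\mathrm{Ex}_2(k)$.
   Context: $k$ is a perfect field with algebraic closure $\bar k$. $\mathrm{Ex}_2(k)$ is the set of isomorphism classes of separable field extensions of $k$ of degree up to two ($k$ itself included). Setting. $G=\mathrm{GL}_3\times\mathrm{GL}_3\times\mathrm{GL}_2$, $V=\mathbb{A}^3\otimes\mathbb{A}^3\otimes\mathbb{A}^2$, $G_{\mathrm{st}}=\mathrm{SL}_3\times\mathrm{SL}_3\times\mathrm{SL}_2$. $V$ has basis $e_{ijl}=\mathbb{e}_i\otimes\mathbb{e}_j\otimes\mathbb{f}_l$ ($i,j=1,2,3$, $l=1,2$) formed from the standard bases. Let $\mathfrak{t}^*=\{(a_{11},a_{12},a_{13},a_{21},a_{22},a_{23},a_{31},a_{32})\in\mathbb{R}^8\mid \sum_i a_{1i}=\sum_i a_{2i}=\sum_i a_{3i}=0\}$ with the standard inner product $(\ ,\ )_*$ of $\mathbb{R}^8$, and let $\mathfrak{t}^*_+$ be the set of those elements with $a_{11}\le a_{12}\le a_{13}$, $a_{21}\le a_{22}\le a_{23}$, $a_{31}\le a_{32}$. The weight $\gamma_{ijl}\in\mathfrak{t}^*$ of $e_{ijl}$ is the orthogonal projection to $\mathfrak{t}^*$ of the vector with entry $1$ at the positions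 $1i$, $2j$, $3l$ and $0$ elsewhere. GIT stratification. $\mathfrak{B}$ is the (finite) set of all non-zero $\beta\in\mathfrak{t}^*_+$ such that $\beta$ is the point closest to the origin of the convex hull of some non-empty set of weights $\gamma_{ijl}$. (It has $49$ elements $\beta_1,\dots,\beta_{49}$; the subscripts in the claim come from that numbering and are only labels.) For $\beta=(b_{11},\dots,b_{32})\in\mathfrak{B}$: - $Z_\beta$ (resp. $W_\beta$) is the span of the $e_{ijl}$ with $(\gamma_{ijl},\beta)_*=(\beta,\beta)_*$ (resp. $>(\beta,\beta)_*$), and $Y_\beta=Z_\beta\oplus W_\beta$. - $P_\beta\subset G$ (resp. $M_\beta\subset G$) consists of the $(g_1,g_2,g_3)$ such that, for each $m=1,2,3$, the $(i,j)$-entry of $g_m$ is $0$ unless $b_{mi}\ge b_{mj}$ (resp. unless $b_{mi}=b_{mj}$). Thus $P_\beta$ is a lower block triangular parabolic subgroup with Levi subgroup $M_\beta$. - $\chi_\beta$ is the indivisible character of $M_\beta$ proportional (with positive factor) to $\beta$, i.e. a product of the determinants of the diagonal blocks raised to powers proportional to the corresponding entries of $\beta$. $G_{\mathrm{st},\beta}$ is the identity component of $\{g\in M_\beta\cap G_{\mathrm{st}}\mid\chi_\beta(g)=1\}$. - $Z_\beta^{\mathrm{ss}}$ is the set of points of $Z_\beta$ (over $\bar k$) at which some non-constant homogeneous $G_{\mathrm{st},\beta}$-invariant polynomial on $Z_\beta$ does not vanish. $Y_\beta^{\mathrm{ss}}=\{z+w\mid z\in Z_\beta^{\mathrm{ss}},\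 w\in W_\beta\}$. - The stratum is $S_\beta=G\cdot Y_\beta^{\mathrm{ss}}\subset V$. $S_{\beta\,k}$ is its set of $k$-rational points. It is known that, as $k$ is perfect, $S_{\beta\,k}=G_k\cdot Y^{\mathrm{ss}}_{\beta\,k}\cong G_k\times_{P_{\beta\,k}}Y^{\mathrm{ss}}_{\beta\,k}$. A subscript $k$ denotes the set of $k$-rational points. *)

theory Defs
  imports "HOL-Algebra.Algebraic_Closure_Type" "HOL-Analysis.Analysis"
begin

text \<open>
  The algebraic closure of \<open>'k\<close> is the library type \<open>'k alg_closure\<close>, with embedding
  \<^const>\<open>to_ac\<close>. In the type \<open>3\<close> the numerals \<open>3\<close> and \<open>0\<close> denote the same element,
  so the index sets are always used through the names \<open>1, 2, 3\<close> and never through their order.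
\<close>

section \<open>Perfect fields and separable extensions of degree at most two\<close>

definition separable_poly :: "'k::field poly \<Rightarrow> bool" where
  "separable_poly p \<longleftrightarrow> rsquarefree (map_poly to_ac p)"

definition perfect_field :: "'k::field itself \<Rightarrow> bool" where
  "perfect_field _ \<longleftrightarrow> (\<forall>p :: 'k poly. irreducible p \<longrightarrow> separable_poly p)"

interpretation ac: vector_space "\<lambda>(c :: 'k::field) (x :: 'k alg_closure). to_ac c * x"
  by standard (simp_all add: algebra_simps)

definition intermediate_field :: "'k::field alg_closure set \<Rightarrow> bool" where
  "intermediate_field F \<longleftrightarrow> range to_ac \<subseteq> F \<and>
     (\<forall>x\<in>F. \<forall>y\<in>F. x + y \<in> F \<and> x - y \<in> F \<and> x * y \<in> F) \<and> (\<forall>x\<in>F. inverse x \<in> F)"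

definition separable_ext :: "'k::field alg_closure set \<Rightarrow> bool" where
  "separable_ext F \<longleftrightarrow>
     (\<forall>x\<in>F. \<exists>p :: 'k poly. irreducible p \<and> poly (map_poly to_ac p) x = 0 \<and> separable_poly p)"

definition degree_at_most :: "nat \<Rightarrow> 'k::field alg_closure set \<Rightarrow> bool" where
  "degree_at_most n F \<longleftrightarrow>
     (\<exists>B. ac.independent B \<and> ac.span B = F \<and> finite B \<and> card B \<le> n)"

definition ext_iso :: "'k::field alg_closure set \<Rightarrow> 'k alg_closure set \<Rightarrow> bool" where
  "ext_iso F F' \<longleftrightarrow> (\<exists>\<phi>. bij_betw \<phi> F F' \<and>
     (\<forall>x\<in>F. \<forall>y\<in>F. \<phi> (x + y) = \<phi> x + \<phi> y \<and> \<phi> (x * y) = \<phi> x * \<phi> y) \<and>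
     (\<forall>c. \<phi> (to_ac c) = to_ac c))"

text \<open>Every finite extension of \<open>'k\<close> embeds over \<open>'k\<close> into \<open>'k alg_closure\<close>, so all isomorphism
  classes are represented by intermediate fields.\<close>

definition sep_exts2 :: "'k::field alg_closure set set" where
  "sep_exts2 = {F. intermediate_field F \<and> separable_ext F \<and> degree_at_most 2 F}"

definition Ex2 :: "'k::field alg_closure set set set" where
  "Ex2 = sep_exts2 // {(F, F'). F \<in> sep_exts2 \<and> F' \<in> sep_exts2 \<and> ext_iso F F'}"

section \<open>The group, the representation and its weights\<close>

type_synonym 'f mats = "('f^3^3) \<times> ('f^3^3) \<times> ('f^2^2)"
type_synonym 'f tens = "('f, 3 \<times> 3 \<times> 2) vec"

definition GG :: "'f::field mats set" where
  "GG = {(g1, g2, g3). invertible g1 \<and> invertible g2 \<and> invertible g3}"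

definition G_st :: "'f::field mats set" where
  "G_st = {(g1, g2, g3). det g1 = 1 \<and> det g2 = 1 \<and> det g3 = 1}"

fun act :: "'f::field mats \<Rightarrow> 'f tens \<Rightarrow> 'f tens" where
  "act (g1, g2, g3) x = (\<chi> t. case t of (i, j, l) \<Rightarrow>
     \<Sum>i'\<in>UNIV. \<Sum>j'\<in>UNIV. \<Sum>l'\<in>UNIV. g1$i$i' * g2$j$j' * g3$l$l' * x$(i', j', l'))"

definition orbit :: "'f::field tens \<Rightarrow> 'f tens set" where
  "orbit x = (\<lambda>g. act g x) ` GG"

type_synonym wt = "(real^3) \<times> (real^3) \<times> (real^2)"

definition mk_wt :: "real list \<Rightarrow> real list \<Rightarrow> real list \<Rightarrow> wt" where
  "mk_wt as bs cs = (vector as, vector bs, vector cs)"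

definition tstar :: "wt set" where
  "tstar = {(a, b, c). (\<Sum>i\<in>UNIV. a$i) = 0 \<and> (\<Sum>i\<in>UNIV. b$i) = 0 \<and> (\<Sum>i\<in>UNIV. c$i) = 0}"

definition tstar_plus :: "wt set" where
  "tstar_plus = {(a, b, c) \<in> tstar.
     a$1 \<le> a$2 \<and> a$2 \<le> a$3 \<and> b$1 \<le> b$2 \<and> b$2 \<le> b$3 \<and> c$1 \<le> c$2}"

definition tstar_proj :: "wt \<Rightarrow> wt" where
  "tstar_proj v = (THE p. p \<in> tstar \<and> (\<forall>w\<in>tstar. orthogonal (v - p) w))"

fun weight :: "3 \<times> 3 \<times> 2 \<Rightarrow> wt" where
  "weight (i, j, l) = tstar_proj (axis i 1, axis j 1, axis l 1)"

definition BB :: "wt set" where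
  "BB = {\<beta> \<in> tstar_plus. \<beta> \<noteq> 0 \<and>
     (\<exists>A. A \<noteq> {} \<and> A \<subseteq> range weight \<and> \<beta> = closest_point (convex hull A) 0)}"

section \<open>Polynomial functions and the Zariski topology\<close>

text \<open>\<open>C\<close> is the set of coordinate functions of an affine space. This is only used over
  algebraically closed, hence infinite, fields, where polynomials and polynomial functions agree.\<close>

inductive_set poly_funs :: "('x \<Rightarrow> 'f::field) set \<Rightarrow> ('x \<Rightarrow> 'f) set" for C where
  const: "(\<lambda>_. c) \<in> poly_funs C"
| coord: "f \<in> C \<Longrightarrow> f \<in> poly_funs C"
| add: "f \<in> poly_funs C \<Longrightarrow> g \<in> poly_funs C \<Longrightarrow> (\<lambda>x. f x + g x) \<in> poly_funs C"
| mult: "f \<in> poly_funs C \<Longrightarrow> g \<in> poly_funs C \<Longrightarrow> (\<lambda>x. f x * g x) \<in> poly_funs C"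

inductive homogeneous :: "('x \<Rightarrow> 'f::field) set \<Rightarrow> nat \<Rightarrow> ('x \<Rightarrow> 'f) \<Rightarrow> bool" for C where
  const: "homogeneous C 0 (\<lambda>_. c)"
| coord: "f \<in> C \<Longrightarrow> homogeneous C 1 f"
| add: "homogeneous C d f \<Longrightarrow> homogeneous C d g \<Longrightarrow> homogeneous C d (\<lambda>x. f x + g x)"
| mult: "homogeneous C d f \<Longrightarrow> homogeneous C e g \<Longrightarrow> homogeneous C (d + e) (\<lambda>x. f x * g x)"

definition zariski :: "('x \<Rightarrow> 'f::field) set \<Rightarrow> 'x topology" where
  "zariski C = topology_generated_by {{x. f x \<noteq> 0} |f. f \<in> poly_funs C}"

definition tens_coords :: "('f::field tens \<Rightarrow> 'f) set" where
  "tens_coords = range (\<lambda>t x. x $ t)"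

definition mats_coords :: "('f::field mats \<Rightarrow> 'f) set" where
  "mats_coords = range (\<lambda>(i, j) (g1, g2, g3). g1 $ i $ j) \<union>
     range (\<lambda>(i, j) (g1, g2, g3). g2 $ i $ j) \<union> range (\<lambda>(i, j) (g1, g2, g3). g3 $ i $ j)"

section \<open>The stratification\<close>

definition Z_space :: "wt \<Rightarrow> 'f::field tens set" where
  "Z_space \<beta> = vec.span {axis t 1 |t. inner (weight t) \<beta> = inner \<beta> \<beta>}"

definition W_space :: "wt \<Rightarrow> 'f::field tens set" where
  "W_space \<beta> = vec.span {axis t 1 |t. inner (weight t) \<beta> > inner \<beta> \<beta>}"

definition block_diag :: "real^'n \<Rightarrow> 'f::field^'n^'n \<Rightarrow> bool" where
  "block_diag b g \<longleftrightarrow> (\<forall>i j. b$i \<noteq> b$j \<longrightarrow> g$i$j = 0)"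

fun M_grp :: "wt \<Rightarrow> 'f::field mats set" where
  "M_grp (b1, b2, b3) = {(g1, g2, g3) \<in> GG. block_diag b1 g1 \<and> block_diag b2 g2 \<and> block_diag b3 g3}"

text \<open>The determinant of the square submatrix of \<open>g\<close> with rows and columns in \<open>I\<close>, obtained by
  padding with the identity matrix.\<close>

definition sub_det :: "'n::finite set \<Rightarrow> 'f::field^'n^'n \<Rightarrow> 'f" where
  "sub_det I g = det (\<chi> i j. if i \<in> I \<and> j \<in> I then g$i$j else if i = j then 1 else 0)"

text \<open>The characters of \<open>M_grp \<beta>\<close> are the products of integer powers of the determinants of the
  diagonal blocks; such a product is indivisible iff the exponents have greatest common divisor 1.
  So the exponents of \<open>\<chi>\<^sub>\<beta>\<close> are the entries of \<open>r *\<^sub>R \<beta>\<close> for the unique \<open>r > 0\<close> that makes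
  them coprime integers (unique and existing for rational nonzero \<open>\<beta>\<close>, hence on \<^const>\<open>BB\<close>).\<close>

fun wt_entries :: "wt \<Rightarrow> real set" where
  "wt_entries (b1, b2, b3) = range (($) b1) \<union> range (($) b2) \<union> range (($) b3)"

definition primitive_factor :: "wt \<Rightarrow> real" where
  "primitive_factor \<beta> =
     (THE r. 0 < r \<and> (\<exists>N :: int set. wt_entries (r *\<^sub>R \<beta>) = of_int ` N \<and> Gcd N = 1))"

definition block_char :: "real^'n::finite \<Rightarrow> 'f::field^'n^'n \<Rightarrow> 'f" where
  "block_char n g = (\<Prod>c\<in>range (($) n). sub_det {i. n$i = c} g powi \<lfloor>c\<rfloor>)"

definition chi :: "wt \<Rightarrow> 'f::field mats \<Rightarrow> 'f" where
  "chi \<beta> = (\<lambda>(g1, g2, g3). case primitive_factor \<beta> *\<^sub>R \<beta> of (n1, n2, n3) \<Rightarrow>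
     block_char n1 g1 * block_char n2 g2 * block_char n3 g3)"

text \<open>The sort restricts to algebraically closed fields, where a variety is identified with its
  set of points.\<close>

definition G_st_beta :: "wt \<Rightarrow> 'f::alg_closed_field mats set" where
  "G_st_beta \<beta> = connected_component_of_set
     (subtopology (zariski mats_coords) {g \<in> M_grp \<beta> \<inter> G_st. chi \<beta> g = 1}) (mat 1, mat 1, mat 1)"

definition Z_ss :: "wt \<Rightarrow> 'f::alg_closed_field tens set" where
  "Z_ss \<beta> = {z \<in> Z_space \<beta>. \<exists>d f. homogeneous tens_coords d f \<and> \<not> f constant_on Z_space \<beta> \<and>
     (\<forall>g\<in>G_st_beta \<beta>. \<forall>x\<in>Z_space \<beta>. f (act g x) = f x) \<and> f z \<noteq> 0}"

definition Y_ss :: "wt \<Rightarrow> 'f::alg_closed_field tens set" where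
  "Y_ss \<beta> = {z + w |z w. z \<in> Z_ss \<beta> \<and> w \<in> W_space \<beta>}"

definition stratum :: "wt \<Rightarrow> 'f::alg_closed_field tens set" where
  "stratum \<beta> = {act g y |g y. g \<in> GG \<and> y \<in> Y_ss \<beta>}"

definition stratum_rat :: "wt \<Rightarrow> 'k::field tens set" where
  "stratum_rat \<beta> = {x. (\<chi> t. to_ac (x $ t)) \<in> (stratum \<beta> :: 'k alg_closure tens set)}"

section \<open>The sixteen vectors\<close>

definition "beta4  = (1/6)  *\<^sub>R mk_wt [-2, 1, 1] [0, 0, 0] [0, 0]"
definition "beta5  = (1/6)  *\<^sub>R mk_wt [0, 0, 0] [-2, 1, 1] [0, 0]"
definition "beta6  = (1/66) *\<^sub>R mk_wt [-4, 2, 2] [-4, 2, 2] [-3, 3]"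
definition "beta11 = (1/18) *\<^sub>R mk_wt [-2, 0, 2] [-2, 0, 2] [-1, 1]"
definition "beta22 = (1/12) *\<^sub>R mk_wt [-1, -1, 2] [-1, -1, 2] [0, 0]"
definition "beta28 = (1/6)  *\<^sub>R mk_wt [-1, 0, 1] [-1, 0, 1] [-1, 1]"
definition "beta29 = (1/6)  *\<^sub>R mk_wt [-2, 1, 1] [-2, 1, 1] [0, 0]"
definition "beta38 = (1/2)  *\<^sub>R mk_wt [0, 0, 0] [0, 0, 0] [-1, 1]"
definition "beta39 = (1/6)  *\<^sub>R mk_wt [-2, 0, 2] [-2, 0, 2] [-1, 1]"
definition "beta40 = (1/30) *\<^sub>R mk_wt [-10, 2, 8] [-4, 2, 2] [-3, 3]"
definition "beta41 = (1/30) *\<^sub>R mk_wt [-4, 2, 2] [-10, 2, 8] [-3, 3]"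
definition "beta42 = (1/30) *\<^sub>R mk_wt [-1, -1, 2] [-1, -1, 2] [-3, 3]"
definition "beta45 = (1/6)  *\<^sub>R mk_wt [-2, 1, 1] [-2, 1, 1] [-3, 3]"
definition "beta47 = (1/6)  *\<^sub>R mk_wt [-2, -2, 4] [-2, 1, 1] [0, 0]"
definition "beta48 = (1/6)  *\<^sub>R mk_wt [-2, 1, 1] [-2, -2, 4] [0, 0]"
definition "beta49 = (1/6)  *\<^sub>R mk_wt [-2, -2, 4] [-2, -2, 4] [-3, 3]"

definition sixteen :: "wt set" where
  "sixteen = {beta4, beta5, beta6, beta11, beta22, beta28, beta29, beta38, beta39, beta40,
     beta41, beta42, beta45, beta47, beta48, beta49}"

end

theory Submission
  imports Defs
begin

text \<open>
  If \<open>y\<close> is semistable for \<open>\<beta>\<close>, then \<open>\<beta>\<close> is the point closest to the origin of the convex hull of the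
  support of every translate of \<open>y\<close> under the lower triangular Borel subgroup, which lies in \<open>P\<^sub>\<beta>\<close>:
  otherwise a one-parameter subgroup would contract the part of that translate in \<open>Z\<^sub>\<beta>\<close> to a point where
  all non-constant homogeneous invariants vanish. By the Bruhat decomposition, two semistable points of one
  \<open>G\<close>-orbit then have a common \<open>\<beta>\<close>, so distinct strata are disjoint.

  A tensor is a pencil \<open>u A + v B\<close> of \<open>3 \<times> 3\<close> matrices. Positivity of the pairing of \<open>\<beta>\<close> with the support
  forces the binary cubic \<open>det (u A + v B)\<close> to have a double root, or to vanish, on every stratum;
  over a perfect field that root is rational. A Kronecker-style normal form then shows that such a pencil is
  zero, or equivalent to one of fifteen \<open>0/1\<close> tensors, or to a \<open>2 \<times> 2\<close> block whose determinant is
  \<open>- (u\<^sup>2 + b u v + c v\<^sup>2)\<close> with \<open>b\<^sup>2 \<noteq> 4 c\<close>. Explicit invariants place these in the sixteen strata, the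
  quadratic family in that of \<open>\<beta>\<^sub>2\<^sub>9\<close>, and disjointness does the rest. The orbits in the quadratic family
  correspond to the splitting field of the form: it is the smallest field over which some non-zero
  combination of the two slices has rank at most one, and a change of generator \<open>\<theta> \<mapsto> m + n \<theta>\<close> of the field
  is realised by \<open>G\<close>.
\<close>

text \<open>The elements of \<open>BB\<close> are never enumerated. Non-emptiness is decided from
  the tensor side: a point of any stratum has a normal form, the normal form lies in one of the
  sixteen explicit strata, and disjointness identifies the two vectors. That the sixteen belong to
  \<open>BB\<close> is likewise read off their semistable points.

  Rationality of the vectors matters twice. \<open>primitive_factor\<close> is a definite
  description, and a destabilising real direction must be cleared to integers before it gives a
  one-parameter subgroup of matrices. Both rest on the closest point of a rational polytope being
  rational.

  The normal forms are derived over any field in which t^2 - b t + c has a root whenever b^2 = 4 c.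
  Algebraically closed fields have this property, as part (1) requires, and so do perfect fields, as
  parts (2) and (3) require; one classification serves both. The characteristic is arbitrary, so
  quadratics are kept in this form and no argument divides by two in the ground field.\<close>

no_notation fps_nth (infixl "$" 75)

declare weight.simps [simp del]

section \<open>Weights in coordinates\<close>

lemma in_tstar: "(a, b, c) \<in> tstar \<longleftrightarrow>
    (\<Sum>i\<in>UNIV. a$i) = 0 \<and> (\<Sum>i\<in>UNIV. b$i) = 0 \<and> (\<Sum>i\<in>UNIV. c$i) = 0"
  by (simp add: tstar_def)

lemma inner_wt: "inner (a, b, c) (a', b', c') =
    (\<Sum>i\<in>UNIV. a$i * a'$i) + (\<Sum>i\<in>UNIV. b$i * b'$i) + (\<Sum>i\<in>UNIV. c$i * (c'$i :: real))"
  for a a' b b' :: "real^3" and c c' :: "real^2"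
  by (simp add: inner_vec_def)

text \<open>The orthogonal complement of \<open>tstar\<close> consists of the triples of constant
  vectors, so projecting subtracts from each component its mean, which is 1/3 or 1/2 for an axis
  vector.\<close>

lemma weight_eq: "weight (i, j, l) =
    (\<chi> i'. (if i' = i then 1 else 0) - 1/3, \<chi> j'. (if j' = j then 1 else 0) - 1/3,
     \<chi> l'. (if l' = l then 1 else 0) - 1/2)"
proof -
  let ?v = "(axis i 1, axis j 1, axis l 1) :: wt"
  let ?p = "(\<chi> i'. (if i' = i then 1 else 0) - 1/3, \<chi> j'. (if j' = j then 1 else 0) - 1/3,
     \<chi> l'. (if l' = l then 1 else 0) - 1/2) :: wt"
  have diff: "?v - ?p = (\<chi> i. 1/3, \<chi> i. 1/3, \<chi> i. 1/2)"
    by (auto simp: vec_eq_iff axis_def)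
  have p: "?p \<in> tstar"
    by (auto simp: tstar_def sum_subtractf)
  have perp: "orthogonal (?v - ?p) w" if "w \<in> tstar" for w
  proof -
    obtain a b c where w: "w = (a, b, c)" by (cases w) auto
    show ?thesis
      using that unfolding diff w orthogonal_def inner_wt tstar_def
      by (simp add: sum_divide_distrib[symmetric])
  qed
  have "tstar_proj ?v = ?p"
    unfolding tstar_proj_def
  proof (rule the_equality)
    fix q assume q: "q \<in> tstar \<and> (\<forall>w\<in>tstar. orthogonal (?v - q) w)"
    have "q - ?p \<in> tstar"
      using q p by (auto simp: tstar_def sum_subtractf)
    then have "orthogonal (?v - q) (q - ?p)" "orthogonal (?v - ?p) (q - ?p)"
      using q perp by blast+
    then have "inner ((?v - ?p) - (?v - q)) (q - ?p) = 0"
      unfolding orthogonal_def by (subst inner_diff_left) linarith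
    moreover have "(v - p) - (v - q) = q - p" for v p q :: wt
      by simp
    ultimately show "q = ?p"
      by (simp only: inner_eq_zero_iff right_minus_eq)
  qed (use p perp in blast)
  then show ?thesis by (simp add: weight.simps)
qed

lemma weight_in_tstar: "weight t \<in> tstar"
  by (cases t) (auto simp: weight_eq tstar_def sum_subtractf)

text \<open>Against vectors with zero sums the subtracted means disappear, so pairing with a weight
  is evaluation at its three indices.\<close>

lemma inner_weight:
  assumes "(a, b, c) \<in> tstar"
  shows "inner (weight (i, j, l)) (a, b, c) = a$i + b$j + c$l"
proof -
  have *: "(\<Sum>x\<in>UNIV. ((if x = k then 1 else 0) - r) * f x) = f k - r * (\<Sum>x\<in>UNIV. f x)"
    for k :: "'n::finite" and r :: real and f
    by (simp add: left_diff_distrib sum_subtractf sum_distrib_left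
        if_distrib[where f = "\<lambda>x. x * _"] cong: if_cong)
  show ?thesis
    using assms unfolding weight_eq inner_wt tstar_def by (simp add: *)
qed

lemma subspace_tstar: "subspace tstar"
  by (auto simp: subspace_def in_tstar zero_prod_def sum.distrib sum_distrib_left[symmetric])

text \<open>A rational linear functional on the reals fixing 1 turns real solutions of rational linear
  systems into rational ones.\<close>

lemma rational_functional_exists:
  obtains \<phi> :: "real \<Rightarrow> real" where
    "\<And>x y. \<phi> (x + y) = \<phi> x + \<phi> y" "\<And>q x. q \<in> \<rat> \<Longrightarrow> \<phi> (q * x) = q * \<phi> x"
    "\<phi> 1 = 1" "\<And>x. \<phi> x \<in> \<rat>"
proof -
  interpret R: vector_space_pair "\<lambda>(q::rat) (x::real). of_rat q * x" "\<lambda>(q::rat) (x::rat). q * x"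
    by standard (simp_all add: algebra_simps of_rat_add of_rat_mult)
  have "R.vs1.independent {1::real}"
    by (simp add: R.vs1.dependent_single)
  \<comment> \<open>Prescribing the value at 1 and extending along a basis of the reals over the
    rationals gives the functional.\<close>
  from R.linear_independent_extend[OF this, of "\<lambda>_. 1"]
  obtain g :: "real \<Rightarrow> rat" where g: "Vector_Spaces.linear (\<lambda>q x. of_rat q * x) (\<lambda>q x. q * x) g" "g 1 = 1"
    by auto
  interpret g: Vector_Spaces.linear "\<lambda>(q::rat) (x::real). of_rat q * x" "\<lambda>(q::rat) (x::rat). q * x" g
    by (rule g)
  show ?thesis
  proof (rule that[of "\<lambda>x. of_rat (g x)"])
    fix q x :: real assume "q \<in> \<rat>"
    then obtain r where "q = of_rat r" by (auto elim: Rats_cases)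
    then show "of_rat (g (q * x)) = q * of_rat (g x)"
      by (simp add: g.scale of_rat_mult)
  qed (use g in \<open>auto simp: g.add of_rat_add\<close>)
qed

section \<open>Rationality of closest points\<close>

definition rat_vec :: "'a::euclidean_space \<Rightarrow> bool" where
  "rat_vec v \<longleftrightarrow> (\<forall>b\<in>Basis. inner v b \<in> \<rat>)"

lemma rat_vec_diff: "rat_vec v \<Longrightarrow> rat_vec w \<Longrightarrow> rat_vec (v - w)"
  by (auto simp: rat_vec_def inner_diff_left)

text \<open>The closest point is a combination, with coefficients of sum one, of vectors of
  \<open>S\<close> that all have the same inner product with it. These are linear conditions with
  rational data, so a rational functional applied coordinatewise carries the point to a rational
  solution. Testing the conditions on both points shows that their difference has norm zero.\<close>

lemma closest_point_rational:
  fixes S :: "'a::euclidean_space set"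
  assumes S: "finite S" "S \<noteq> {}" "\<And>a. a \<in> S \<Longrightarrow> rat_vec a"
  shows "rat_vec (closest_point (convex hull S) 0)"
proof -
  obtain \<phi> :: "real \<Rightarrow> real" where add: "\<And>x y. \<phi> (x + y) = \<phi> x + \<phi> y"
    and scale: "\<And>q x. q \<in> \<rat> \<Longrightarrow> \<phi> (q * x) = q * \<phi> x"
    and one: "\<phi> 1 = 1" and rat: "\<And>x. \<phi> x \<in> \<rat>"
    using rational_functional_exists by blast
  have zero: "\<phi> 0 = 0" using scale[of 0 0] by simp
  have sum: "\<phi> (sum f A) = (\<Sum>x\<in>A. \<phi> (f x))" if "finite A" for f :: "'b \<Rightarrow> real" and A
    using that by (induction A rule: finite_induct) (auto simp: add zero)
  define \<beta> where "\<beta> = closest_point (convex hull S) 0"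
  have cl: "closed (convex hull S)"
    using S(1) finite_imp_compact_convex_hull compact_imp_closed by blast
  have "convex hull S \<noteq> {}" using S(2) by simp
  then have \<beta>: "\<beta> \<in> convex hull S"
    unfolding \<beta>_def using cl by (rule closest_point_in_set[rotated])
  have ge: "inner a \<beta> \<ge> inner \<beta> \<beta>" if "a \<in> S" for a
  proof -
    have "inner (0 - \<beta>) (a - \<beta>) \<le> 0"
      unfolding \<beta>_def using that cl by (intro closest_point_dot) (auto simp: hull_inc)
    then show ?thesis by (simp add: inner_diff_right inner_diff_left inner_commute)
  qed
  obtain c where c: "\<And>a. a \<in> S \<Longrightarrow> 0 \<le> c a" "sum c S = 1" "(\<Sum>a\<in>S. c a *\<^sub>R a) = \<beta>"
    using \<beta> unfolding convex_hull_finite[OF S(1)] by auto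
  \<comment> \<open>Complementary slackness: the weighted sum of the excesses over
    \<open>inner \<beta> \<beta>\<close> is zero and no term is negative.\<close>
  have tight: "inner a \<beta> = inner \<beta> \<beta>" if "a \<in> S" "c a \<noteq> 0" for a
  proof -
    have "(\<Sum>a\<in>S. c a * (inner a \<beta> - inner \<beta> \<beta>)) = inner (\<Sum>a\<in>S. c a *\<^sub>R a) \<beta> - inner \<beta> \<beta>"
      by (simp add: right_diff_distrib sum_subtractf inner_sum_left sum_distrib_right[symmetric] c(2))
    also have "\<dots> = 0" by (simp add: c)
    finally have "c a * (inner a \<beta> - inner \<beta> \<beta>) = 0"
      using sum_nonneg_eq_0_iff[of S "\<lambda>a. c a * (inner a \<beta> - inner \<beta> \<beta>)"] S(1) c(1) ge that
      by (auto simp: mult_nonneg_nonneg)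
    then show ?thesis using that by simp
  qed
  define \<Phi> :: "'a \<Rightarrow> 'a" where "\<Phi> = (\<lambda>v. \<Sum>b\<in>Basis. \<phi> (inner v b) *\<^sub>R b)"
  have \<Phi>b: "inner (\<Phi> v) b = \<phi> (inner v b)" if "b \<in> Basis" for v b
    using that by (simp add: \<Phi>_def)
  have rat\<Phi>: "rat_vec (\<Phi> v)" for v
    by (auto simp: rat_vec_def \<Phi>b rat)
  have inner\<Phi>: "inner (\<Phi> v) a = \<phi> (inner v a)" if "rat_vec a" for a v
    using that unfolding rat_vec_def
    by (subst (1 2) euclidean_inner) (simp add: sum \<Phi>b scale mult.commute[of _ "inner a _"])
  have \<Phi>\<beta>: "\<Phi> \<beta> = (\<Sum>a\<in>S. \<phi> (c a) *\<^sub>R a)"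
  proof (rule euclidean_eqI)
    fix b :: 'a assume b: "b \<in> Basis"
    have "\<phi> (inner \<beta> b) = (\<Sum>a\<in>S. \<phi> (c a * inner a b))"
      unfolding c(3)[symmetric] using S(1) by (simp add: inner_sum_left sum)
    also have "\<dots> = (\<Sum>a\<in>S. \<phi> (c a) * inner a b)"
      using S(3) b by (intro sum.cong refl) (subst mult.commute, auto simp: scale rat_vec_def)
    finally show "inner (\<Phi> \<beta>) b = inner (\<Sum>a\<in>S. \<phi> (c a) *\<^sub>R a) b"
      using b by (simp add: \<Phi>b inner_sum_left)
  qed
  have s1: "(\<Sum>a\<in>S. \<phi> (c a)) = 1"
    using sum[OF S(1), of c] c(2) one by simp
  define s where "s = \<phi> (inner \<beta> \<beta>)"
  have t: "inner a (\<Phi> \<beta>) = s" if "a \<in> S" "c a \<noteq> 0" for a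
    using inner\<Phi>[of a \<beta>] tight[OF that] S(3) that by (simp add: s_def inner_commute)
  have 1: "inner \<beta> (\<Phi> \<beta>) = s"
  proof -
    have "inner \<beta> (\<Phi> \<beta>) = (\<Sum>a\<in>S. c a * inner a (\<Phi> \<beta>))"
      by (subst (1) c(3)[symmetric]) (simp add: inner_sum_left)
    also have "\<dots> = (\<Sum>a\<in>S. c a * s)" using t by (intro sum.cong refl) auto
    finally show ?thesis by (simp add: sum_distrib_right[symmetric] c)
  qed
  have 2: "inner (\<Phi> \<beta>) v = r" if "\<And>a. a \<in> S \<Longrightarrow> c a \<noteq> 0 \<Longrightarrow> inner a v = r" for v r
  proof -
    have "inner (\<Phi> \<beta>) v = (\<Sum>a\<in>S. \<phi> (c a) * inner a v)"
      by (simp add: \<Phi>\<beta> inner_sum_left)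
    also have "\<dots> = (\<Sum>a\<in>S. \<phi> (c a) * r)"
      by (intro sum.cong refl) (metis that zero mult_zero_left)
    finally show ?thesis by (simp add: sum_distrib_right[symmetric] s1)
  qed
  have "inner (\<Phi> \<beta>) \<beta> = inner \<beta> \<beta>" "inner (\<Phi> \<beta>) (\<Phi> \<beta>) = s"
    using 2 tight t by blast+
  then have "inner (\<beta> - \<Phi> \<beta>) (\<beta> - \<Phi> \<beta>) = 0"
    using 1 by (simp add: inner_diff_left inner_diff_right inner_commute)
  then have "\<beta> = \<Phi> \<beta>" by simp
  then show ?thesis using rat\<Phi>[of \<beta>] by (simp add: \<beta>_def)
qed

lemma rat_vec_wt: "rat_vec (a, b, c) \<longleftrightarrow>
    (\<forall>i. a$i \<in> \<rat>) \<and> (\<forall>i. b$i \<in> \<rat>) \<and> (\<forall>i. c$i \<in> \<rat>)" for a b :: "real^3" and c :: "real^2"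
  by (auto simp: rat_vec_def Basis_prod_def Basis_vec_def inner_axis ball_Un)

lemma rat_vec_wt_entries: "rat_vec \<beta> \<longleftrightarrow> wt_entries \<beta> \<subseteq> \<rat>"
  by (cases \<beta>) (auto simp: rat_vec_wt)

lemma rat_vec_weight: "rat_vec (weight t)"
  by (cases t) (auto simp: weight_eq rat_vec_wt)

lemma BB_rational: "\<beta> \<in> BB \<Longrightarrow> rat_vec \<beta>"
  unfolding BB_def
  by (auto intro!: closest_point_rational rat_vec_weight intro: finite_subset)

text \<open>The direction is the point closest to the origin in the hull of \<open>S\<close>
  translated by -\<beta>. It inherits rationality from the data and orthogonality to \<beta> from
  the constant pairing. It is non-zero because \<beta> is outside the hull of \<open>S\<close>, so
  its pairing with each element of \<open>S\<close> is at least its own positive squared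
  norm.\<close>

lemma separating_weight:
  assumes "S \<subseteq> tstar" "finite S" "\<And>a. a \<in> S \<Longrightarrow> rat_vec a" "rat_vec \<beta>" "\<beta> \<in> tstar"
    "\<And>a. a \<in> S \<Longrightarrow> inner a \<beta> = inner \<beta> \<beta>" "\<beta> \<notin> convex hull S"
  obtains \<mu> where "\<mu> \<in> tstar" "rat_vec \<mu>" "inner \<mu> \<beta> = 0" "\<And>a. a \<in> S \<Longrightarrow> inner a \<mu> > 0"
proof (cases "S = {}")
  case True
  then show ?thesis
    using that[of 0] subspace_0[OF subspace_tstar] by (simp add: rat_vec_def)
next
  case False
  define S' where "S' = (\<lambda>a. a - \<beta>) ` S"
  define \<mu> where "\<mu> = closest_point (convex hull S') 0"
  have S': "finite S'" "S' \<noteq> {}" using assms(2) False by (auto simp: S'_def)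
  have "closed (convex hull S')"
    using S'(1) finite_imp_compact_convex_hull compact_imp_closed by blast
  moreover have hull: "convex hull S' = (\<lambda>a. a - \<beta>) ` (convex hull S)"
    unfolding S'_def using convex_hull_translation[of "-\<beta>" S] by simp
  ultimately have cl: "closed (convex hull S')" "convex hull S' \<noteq> {}" using S' by auto
  have \<mu>: "\<mu> \<in> convex hull S'" unfolding \<mu>_def by (rule closest_point_in_set[OF cl])
  have "\<mu> \<noteq> 0" using \<mu> assms(7) unfolding hull by auto
  have sub: "subspace {x \<in> tstar. inner x \<beta> = 0}"
    using subspace_tstar by (auto simp: subspace_def inner_add_left)
  have "S' \<subseteq> {x \<in> tstar. inner x \<beta> = 0}"
  proof
    fix x assume "x \<in> S'"
    then obtain a where "a \<in> S" "x = a - \<beta>" unfolding S'_def by blast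
    then show "x \<in> {x \<in> tstar. inner x \<beta> = 0}"
      using subspace_diff[OF subspace_tstar subsetD[OF assms(1)] assms(5), of a] assms(6)
      by (simp add: inner_diff_left)
  qed
  then have "convex hull S' \<subseteq> {x \<in> tstar. inner x \<beta> = 0}"
    by (rule hull_minimal) (rule subspace_imp_convex[OF sub])
  then have t: "\<mu> \<in> tstar" "inner \<mu> \<beta> = 0" using \<mu> by auto
  show ?thesis
  proof (rule that[OF t(1) _ t(2)])
    show "rat_vec \<mu>" unfolding \<mu>_def
    proof (intro closest_point_rational S')
      fix x assume "x \<in> S'"
      then obtain a where "a \<in> S" "x = a - \<beta>" unfolding S'_def by blast
      then show "rat_vec x" using assms(3,4) rat_vec_diff by blast
    qed
    fix a assume a: "a \<in> S"
    have "inner (0 - \<mu>) ((a - \<beta>) - \<mu>) \<le> 0"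
      unfolding \<mu>_def using a cl(1)
      by (intro closest_point_dot convex_convex_hull hull_inc) (simp_all add: S'_def)
    then have "inner a \<mu> \<ge> inner \<mu> \<mu>"
      using t(2) by (simp add: inner_diff_right inner_diff_left inner_commute)
    then show "inner a \<mu> > 0" using \<open>\<mu> \<noteq> 0\<close> by (smt (verit) inner_gt_zero_iff)
  qed
qed

section \<open>Primitive integral multiples\<close>

lemma clear_denominators:
  assumes "finite E" "E \<subseteq> (\<rat> :: real set)"
  obtains d :: nat where "d > 0" "\<And>x. x \<in> E \<Longrightarrow> of_nat d * x \<in> \<int>"
  using assms
proof (induction E arbitrary: thesis rule: finite_induct)
  case empty
  then show ?case by (metis empty_iff zero_less_one)
next
  case (insert x E)
  obtain d where d: "d > 0" "\<And>y. y \<in> E \<Longrightarrow> of_nat d * y \<in> \<int>"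
    using insert by auto
  obtain e where e: "e > 0" "of_nat e * x \<in> \<int>"
  proof -
    have "x \<in> \<rat>" using insert by auto
    then obtain a b where "x = of_int a / of_int b" "b > 0" by (auto elim: Rats_cases')
    then show thesis by (intro that[of "nat b"]) auto
  qed
  show ?case
  proof (rule insert.prems(1)[of "d * e"])
    fix y assume "y \<in> insert x E"
    then show "of_nat (d * e) * y \<in> \<int>"
    proof
      assume "y = x"
      then have "of_nat (d * e) * y = of_nat d * (of_nat e * x)" by simp
      then show ?thesis using e by (metis Ints_mult Ints_of_nat)
    next
      assume "y \<in> E"
      have "of_nat (d * e) * y = of_nat e * (of_nat d * y)" by simp
      then show ?thesis using d \<open>y \<in> E\<close> by (metis Ints_mult Ints_of_nat)
    qed
  qed (use d e in auto)
qed

text \<open>Existence clears denominators and divides by the gcd. For uniqueness, scaling each of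
  two primitive integral sets by the integer that the other assigns to \<open>e\<close> produces the
  same set; comparing gcds gives equal absolute values of these integers, hence
  \<open>r = r'\<close>.\<close>

lemma primitive_multiple_ex1:
  fixes E :: "real set"
  assumes "finite E" "E \<subseteq> \<rat>" "e \<in> E" "e \<noteq> 0"
  shows "\<exists>!r. 0 < r \<and> (\<exists>N :: int set. (*) r ` E = of_int ` N \<and> Gcd N = 1)"
proof (rule ex_ex1I)
  obtain d :: nat where d: "d > 0" "\<And>x. x \<in> E \<Longrightarrow> of_nat d * x \<in> \<int>"
    using clear_denominators[OF assms(1,2)] by blast
  define N0 :: "int set" where "N0 = {n. \<exists>x\<in>E. of_int n = of_nat d * x}"
  have N0: "(*) (of_nat d) ` E = of_int ` N0"
  proof (intro subset_antisym subsetI)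
    fix y assume "y \<in> (*) (of_nat d) ` E"
    then obtain x where x: "x \<in> E" "y = of_nat d * x" by blast
    then obtain n where n: "y = of_int n" using d(2)[OF x(1)] by (auto elim: Ints_cases)
    then have "n \<in> N0" using x by (auto simp: N0_def intro!: bexI[of _ x])
    then show "y \<in> of_int ` N0" using n by blast
  qed (auto simp: N0_def)
  define g where "g = Gcd N0"
  have "\<exists>n\<in>N0. n \<noteq> 0"
  proof -
    have "of_nat d * e \<in> of_int ` N0" using assms(3) N0 by blast
    then obtain n where "n \<in> N0" "of_nat d * e = of_int n" by blast
    then show ?thesis using assms(4) d(1) by (intro bexI[of _ n]) auto
  qed
  then have g: "g > 0"
    by (metis Gcd_0_iff Gcd_int_greater_eq_0 g_def insert_iff less_le singletonD subsetD)
  define N where "N = (\<lambda>n. n div g) ` N0"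
  have gN: "N0 = (*) g ` N"
  proof -
    have "(\<lambda>n. g * (n div g)) ` N0 = (\<lambda>n. n) ` N0"
      using Gcd_dvd[of _ N0] by (intro image_cong refl) (simp add: g_def)
    then show ?thesis by (simp add: N_def image_image)
  qed
  have "g * Gcd N = g"
    using Gcd_mult[of g N] g unfolding gN[symmetric] g_def[symmetric] by simp
  then have "Gcd N = 1" using g by simp
  moreover have "(*) (real d / real_of_int g) ` E = of_int ` N"
  proof -
    have "(*) (real d / real_of_int g) ` E = (\<lambda>x. x / of_int g) ` ((*) (of_nat d) ` E)"
      by (simp add: image_image)
    also have "\<dots> = (\<lambda>x. x / of_int g) ` (of_int ` (*) g ` N)" by (simp add: N0 gN)
    also have "\<dots> = of_int ` N" using g by (simp add: image_image)
    finally show ?thesis .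
  qed
  ultimately show "\<exists>r. 0 < r \<and> (\<exists>N :: int set. (*) r ` E = of_int ` N \<and> Gcd N = 1)"
    using d(1) g by (intro exI[of _ "real d / real_of_int g"]) auto
next
  fix r r' :: real
  assume "0 < r \<and> (\<exists>N :: int set. (*) r ` E = of_int ` N \<and> Gcd N = 1)"
    "0 < r' \<and> (\<exists>N :: int set. (*) r' ` E = of_int ` N \<and> Gcd N = 1)"
  then obtain N N' :: "int set" where r: "r > 0" "(*) r ` E = of_int ` N" "Gcd N = 1"
    and r': "r' > 0" "(*) r' ` E = of_int ` N'" "Gcd N' = 1" by auto
  obtain n n' where n: "r * e = of_int n" "r' * e = of_int n'"
    using assms(3) r(2) r'(2) by (metis imageE imageI)
  have "(*) n' ` N = (*) n ` N'"
  proof -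
    have "(of_int :: int \<Rightarrow> real) ` (*) n' ` N = (*) (of_int n') ` of_int ` N"
      by (simp add: image_image)
    also have "\<dots> = (\<lambda>x. r' * e * (r * x)) ` E" by (simp add: r(2)[symmetric] n[symmetric] image_image)
    also have "\<dots> = (\<lambda>x. r * e * (r' * x)) ` E" by (simp add: ac_simps)
    also have "\<dots> = (*) (of_int n) ` of_int ` N'" by (simp add: r'(2)[symmetric] n[symmetric] image_image)
    also have "\<dots> = (of_int :: int \<Rightarrow> real) ` (*) n ` N'" by (simp add: image_image)
    finally show ?thesis by (subst (asm) inj_image_eq_iff) (simp_all add: inj_on_def)
  qed
  then have "Gcd ((*) n' ` N) = Gcd ((*) n ` N')" by simp
  then have "\<bar>n'\<bar> = \<bar>n\<bar>" by (simp add: Gcd_mult r r' abs_mult)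
  then have "\<bar>r' * e\<bar> = \<bar>r * e\<bar>" by (simp add: n)
  then show "r = r'" using r(1) r'(1) assms(4) by (simp add: abs_mult)
qed

lemma wt_entries_scaleR: "wt_entries (r *\<^sub>R \<beta>) = (*) r ` wt_entries \<beta>"
  by (cases \<beta>) (auto simp: image_Un image_image)

lemma finite_wt_entries: "finite (wt_entries \<beta>)"
  by (cases \<beta>) auto

text \<open>This is what gives the definite description in \<open>primitive_factor\<close> a
  value.\<close>

lemma primitive_factor_ex1:
  assumes "rat_vec \<beta>" "\<beta> \<noteq> 0"
  shows "\<exists>!r. 0 < r \<and> (\<exists>N :: int set. wt_entries (r *\<^sub>R \<beta>) = of_int ` N \<and> Gcd N = 1)"
proof -
  obtain e where "e \<in> wt_entries \<beta>" "e \<noteq> 0"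
    using assms(2) by (cases \<beta>) (force simp: vec_eq_iff zero_prod_def)
  then show ?thesis
    unfolding wt_entries_scaleR
    using primitive_multiple_ex1[OF finite_wt_entries] assms(1) by (auto simp: rat_vec_wt_entries)
qed

lemma primitive_factor_props:
  assumes "rat_vec \<beta>" "\<beta> \<noteq> 0"
  shows "primitive_factor \<beta> > 0" "wt_entries (primitive_factor \<beta> *\<^sub>R \<beta>) \<subseteq> \<int>"
  using theI'[OF primitive_factor_ex1[OF assms]] unfolding primitive_factor_def by auto

lemma primitive_factor_eqI:
  assumes "rat_vec \<beta>" "\<beta> \<noteq> 0" "r > 0" "wt_entries (r *\<^sub>R \<beta>) = of_int ` N" "Gcd N = 1"
  shows "primitive_factor \<beta> = r"
  unfolding primitive_factor_def
  using assms primitive_factor_ex1[of \<beta>] by (intro the1_equality) auto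

section \<open>The group action\<close>

text \<open>Splitting the action into three commuting one-factor actions replaces triple sums by
  single ones.\<close>

definition act1 :: "'f::field^3^3 \<Rightarrow> 'f tens \<Rightarrow> 'f tens" where
  "act1 g x = (\<chi> t. case t of (i, j, l) \<Rightarrow> \<Sum>a\<in>UNIV. g$i$a * x$(a, j, l))"

definition act2 :: "'f::field^3^3 \<Rightarrow> 'f tens \<Rightarrow> 'f tens" where
  "act2 g x = (\<chi> t. case t of (i, j, l) \<Rightarrow> \<Sum>a\<in>UNIV. g$j$a * x$(i, a, l))"

definition act3 :: "'f::field^2^2 \<Rightarrow> 'f tens \<Rightarrow> 'f tens" where
  "act3 g x = (\<chi> t. case t of (i, j, l) \<Rightarrow> \<Sum>a\<in>UNIV. g$l$a * x$(i, j, a))"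

lemma act_split: "act (g1, g2, g3) x = act1 g1 (act2 g2 (act3 g3 x))"
  by (simp add: vec_eq_iff act1_def act2_def act3_def sum_distrib_left mult.assoc)

lemma act1_mult: "act1 (g ** h) x = act1 g (act1 h x)"
  by (simp add: vec_eq_iff act1_def matrix_matrix_mult_def sum_distrib_left sum_distrib_right mult.assoc)
    (intro allI, subst sum.swap, rule refl)

lemma act2_mult: "act2 (g ** h) x = act2 g (act2 h x)"
  by (simp add: vec_eq_iff act2_def matrix_matrix_mult_def sum_distrib_left sum_distrib_right mult.assoc)
    (intro allI, subst sum.swap, rule refl)

lemma act3_mult: "act3 (g ** h) x = act3 g (act3 h x)"
  by (simp add: vec_eq_iff act3_def matrix_matrix_mult_def sum_distrib_left sum_distrib_right mult.assoc)
    (intro allI, subst sum.swap, rule refl)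

lemma act2_act1: "act2 g (act1 h x) = act1 h (act2 g x)"
  by (simp add: vec_eq_iff act1_def act2_def sum_distrib_left mult.left_commute)
    (intro allI, subst sum.swap, rule refl)

lemma act3_act1: "act3 g (act1 h x) = act1 h (act3 g x)"
  by (simp add: vec_eq_iff act1_def act3_def sum_distrib_left mult.left_commute)
    (intro allI, subst sum.swap, rule refl)

lemma act3_act2: "act3 g (act2 h x) = act2 h (act3 g x)"
  by (simp add: vec_eq_iff act2_def act3_def sum_distrib_left mult.left_commute)
    (intro allI, subst sum.swap, rule refl)

fun gmul :: "'f::field mats \<Rightarrow> 'f mats \<Rightarrow> 'f mats" where
  "gmul (g1, g2, g3) (h1, h2, h3) = (g1 ** h1, g2 ** h2, g3 ** h3)"

fun ginv :: "'f::field mats \<Rightarrow> 'f mats" where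
  "ginv (g1, g2, g3) = (matrix_inv g1, matrix_inv g2, matrix_inv g3)"

lemma act_gmul: "act (gmul g h) x = act g (act h x)"
  by (cases g; cases h) (simp add: act_split act1_mult act2_mult act3_mult act2_act1 act3_act1 act3_act2
      del: act.simps)

lemma act1_one: "act1 (mat 1) x = x"
  and act2_one: "act2 (mat 1) x = x"
  and act3_one: "act3 (mat 1) x = x"
  by (simp_all add: vec_eq_iff act1_def act2_def act3_def mat_def if_distrib[where f = "\<lambda>x. x * _"] cong: if_cong)

lemma act_one: "act (mat 1, mat 1, mat 1) x = x"
  by (simp add: act_split act1_one act2_one act3_one del: act.simps)

lemma act_zero: "act g 0 = 0"
  by (cases g) (simp add: vec_eq_iff)

lemma act_add: "act g (x + y) = act g x + act g y"
  by (cases g) (simp add: vec_eq_iff ring_distribs sum.distrib)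

lemma GG_iff: "(g1, g2, g3) \<in> GG \<longleftrightarrow> invertible g1 \<and> invertible g2 \<and> invertible g3"
  by (simp add: GG_def)

lemma matrix_inv_mult:
  assumes "invertible (g :: 'f::field^'n^'n)"
  shows "matrix_inv g ** g = mat 1" "g ** matrix_inv g = mat 1"
  using someI_ex[OF assms[unfolded invertible_def]] unfolding matrix_inv_def by auto

lemma invertible_matrix_inv: "invertible (g :: 'f::field^'n^'n) \<Longrightarrow> invertible (matrix_inv g)"
  unfolding invertible_def[of "matrix_inv g"] using matrix_inv_mult by blast

lemma gmul_GG: "g \<in> GG \<Longrightarrow> h \<in> GG \<Longrightarrow> gmul g h \<in> GG"
  by (cases g; cases h) (simp add: GG_iff invertible_mult)

lemma ginv_GG: "g \<in> GG \<Longrightarrow> ginv g \<in> GG"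
  by (cases g) (simp add: GG_iff invertible_matrix_inv)

lemma one_GG: "(mat 1, mat 1, mat 1) \<in> GG"
  by (simp add: GG_iff invertible_def)

lemma ginv_gmul: "g \<in> GG \<Longrightarrow> gmul (ginv g) g = (mat 1, mat 1, mat 1)"
  by (cases g) (simp add: GG_iff matrix_inv_mult)

lemma act_ginv: "g \<in> GG \<Longrightarrow> act (ginv g) (act g x) = x"
  by (simp only: act_gmul[symmetric] ginv_gmul act_one)

lemma orbit_refl: "x \<in> orbit x"
  unfolding orbit_def by (rule image_eqI[where x = "(mat 1, mat 1, mat 1)"])
    (simp_all only: act_one one_GG)

lemma orbit_sym: "x \<in> orbit y \<Longrightarrow> y \<in> orbit x"
proof -
  assume "x \<in> orbit y"
  then obtain g where g: "g \<in> GG" "x = act g y" unfolding orbit_def by blast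
  then have "y = act (ginv g) x" by (simp only: act_ginv)
  then show ?thesis unfolding orbit_def using ginv_GG[OF g(1)] by (rule image_eqI)
qed

lemma orbit_trans: "x \<in> orbit y \<Longrightarrow> y \<in> orbit z \<Longrightarrow> x \<in> orbit z"
proof -
  assume "x \<in> orbit y" "y \<in> orbit z"
  then obtain g h where g: "g \<in> GG" "x = act g y" and h: "h \<in> GG" "y = act h z" unfolding orbit_def by blast
  then have "x = act (gmul g h) z" by (simp only: act_gmul)
  then show ?thesis unfolding orbit_def using gmul_GG[OF g(1) h(1)] by (rule image_eqI)
qed

lemma orbit_eq: "x \<in> orbit y \<Longrightarrow> orbit x = orbit y"
  using orbit_trans orbit_sym by blast

section \<open>Block diagonal matrices and their characters\<close>

lemma block_diag_mult:
  assumes "block_diag b g" "block_diag b h" shows "block_diag b (g ** h)"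
  unfolding block_diag_def
proof (intro allI impI)
  fix i j assume "b$i \<noteq> b$j"
  then have "g$i$k * h$k$j = 0" for k
    using assms unfolding block_diag_def by (cases "b$i = b$k") auto
  then show "(g ** h)$i$j = 0" unfolding matrix_matrix_mult_def by (simp only: vec_lambda_beta sum.neutral_const)
qed

text \<open>Block diagonal means commuting with the projections onto the blocks, a condition that
  visibly passes to inverses.\<close>

lemma block_diag_commute_iff:
  "block_diag b g \<longleftrightarrow> (\<forall>c. g ** (\<chi> i j. if i = j \<and> b$i = c then 1 else 0) = (\<chi> i j. if i = j \<and> b$i = c then 1 else 0) ** g)"
proof -
  have 1: "(g ** (\<chi> i j. if i = j \<and> b$i = c then 1 else 0)) $ i $ j = (if b$j = c then g$i$j else 0)" for c i j
  proof -
    have "(\<Sum>k\<in>UNIV. g$i$k * (if k = j \<and> b$k = c then 1 else 0)) = (\<Sum>k\<in>UNIV. if k = j then (if b$j = c then g$i$j else 0) else 0)"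
      by (intro sum.cong) auto
    then show ?thesis by (simp add: matrix_matrix_mult_def)
  qed
  have 2: "((\<chi> i j. if i = j \<and> b$i = c then 1 else 0) ** g) $ i $ j = (if b$i = c then g$i$j else 0)" for c i j
  proof -
    have "(\<Sum>k\<in>UNIV. (if i = k \<and> b$i = c then 1 else 0) * g$k$j) = (\<Sum>k\<in>UNIV. if i = k then (if b$i = c then g$i$j else 0) else 0)"
      by (intro sum.cong) auto
    then show ?thesis by (simp add: matrix_matrix_mult_def)
  qed
  show ?thesis
    unfolding block_diag_def vec_eq_iff 1 2 by (auto split: if_splits)
qed

lemma block_diag_inv:
  assumes "invertible (g :: 'f::field^'n^'n)" "block_diag b g" shows "block_diag b (matrix_inv g)"
  unfolding block_diag_commute_iff
proof
  fix c
  let ?E = "(\<chi> i j. if i = j \<and> b$i = c then 1 else 0) :: 'f^'n^'n"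
  have "matrix_inv g ** ?E = matrix_inv g ** (?E ** g) ** matrix_inv g"
    by (simp add: matrix_mul_assoc[symmetric] matrix_inv_mult assms(1))
  also have "\<dots> = matrix_inv g ** (g ** ?E) ** matrix_inv g"
    using assms(2) by (simp add: block_diag_commute_iff)
  also have "\<dots> = ?E ** matrix_inv g"
    by (simp add: matrix_mul_assoc matrix_inv_mult assms(1))
  finally show "matrix_inv g ** ?E = ?E ** matrix_inv g" .
qed

lemma block_diag_scaleR: "r \<noteq> 0 \<Longrightarrow> block_diag (r *\<^sub>R b) g \<longleftrightarrow> block_diag b g"
  by (simp add: block_diag_def)

lemma matrix_ext: "(\<And>i j. A$i$j = B$i$j) \<Longrightarrow> A = B"
  by (simp add: vec_eq_iff)

text \<open>Rows of \<open>g\<close> in \<open>I\<close> vanish outside \<open>I\<close>, so the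
  padded product is the product of the padded matrices and multiplicativity of the determinant
  applies.\<close>

lemma sub_det_mult_aux:
  fixes g h :: "'f::field^'n^'n"
  assumes g: "\<And>i j. i \<in> I \<Longrightarrow> j \<notin> I \<Longrightarrow> g$i$j = 0"
  shows "sub_det I (g ** h) = sub_det I g * sub_det I h"
proof -
  define P :: "'f^'n^'n \<Rightarrow> 'f^'n^'n"
    where "P = (\<lambda>g. \<chi> i j. if i \<in> I \<and> j \<in> I then g$i$j else if i = j then 1 else 0)"
  have P: "P g $ i $ j = (if i \<in> I \<and> j \<in> I then g$i$j else if i = j then 1 else 0)" for g i j
    by (simp add: P_def)
  have mm: "(a ** b) $ i $ j = (\<Sum>k\<in>UNIV. a$i$k * b$k$j)" for a b :: "'f^'n^'n" and i j
    by (simp add: matrix_matrix_mult_def)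
  have "P (g ** h) = P g ** P h"
  proof (rule matrix_ext)
    fix i j
    show "P (g ** h) $ i $ j = (P g ** P h) $ i $ j"
    proof (cases "i \<in> I \<and> j \<in> I")
      case True
      have "g$i$k * h$k$j = P g $i$k * P h $k$j" for k
        using True g unfolding P by (cases "k \<in> I") auto
      then show ?thesis using True by (simp only: P[of "g ** h"] mm if_True simp_thms)
    next
      case False
      have "P g $i$k * P h $k$j = (if k = i then (if i = j then 1 else 0) else 0)" for k
      proof -
        consider "i \<notin> I" | "i \<in> I" "j \<notin> I" using False by blast
        then show ?thesis
        proof cases
          case 1
          then show ?thesis by (cases "k = i") (simp_all add: P)
        next
          case 2
          then show ?thesis by (cases "k = j") (auto simp: P)
        qed
      qed
      then have "(P g ** P h) $ i $ j = (if i = j then 1 else 0)" unfolding mm by simp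
      moreover have "P (g ** h) $ i $ j = (if i = j then 1 else 0)"
        using False by (simp only: P if_False)
      ultimately show ?thesis by (simp only:)
    qed
  qed
  moreover have "sub_det I g = det (P g)" for g
    by (simp add: sub_det_def P_def)
  ultimately show ?thesis by (simp only: det_mul)
qed

lemma sub_det_mult:
  fixes g h :: "'f::field^'n^'n"
  assumes "block_diag n g"
  shows "sub_det {i. n$i = c} (g ** h) = sub_det {i. n$i = c} g * sub_det {i. n$i = c} h"
  using assms by (intro sub_det_mult_aux) (auto simp: block_diag_def)

lemma sub_det_one: "sub_det I (mat 1) = 1"
proof -
  have "(\<chi> i j. if i \<in> I \<and> j \<in> I then mat 1 $ i $ j else if i = j then 1 else 0) = (mat 1 :: 'a^'b^'b)"
    by (auto simp: vec_eq_iff mat_def)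
  then show ?thesis by (simp add: sub_det_def)
qed

lemma block_char_mult:
  assumes "block_diag n g"
  shows "block_char n (g ** h) = block_char n g * block_char n h"
  by (simp add: block_char_def sub_det_mult[OF assms] power_int_mult_distrib prod.distrib)

lemma block_char_one: "block_char n (mat 1) = 1"
  by (simp add: block_char_def sub_det_one)

text \<open>Conjugates enter because the destabilising torus is diagonal for a Levi translate of the
  semistable point, not for the point itself.\<close>

lemma block_char_conj:
  assumes "invertible g" "block_diag n g" "block_diag n d"
  shows "block_char n (matrix_inv g ** d ** g) = block_char n d"
proof -
  have "block_diag n (matrix_inv g)" using assms by (intro block_diag_inv)
  then have "block_char n (matrix_inv g ** d ** g)
      = block_char n (matrix_inv g) * block_char n g * block_char n d"
    using assms by (simp add: block_char_mult block_diag_mult)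
  also have "block_char n (matrix_inv g) * block_char n g = block_char n (matrix_inv g ** g)"
    using assms \<open>block_diag n (matrix_inv g)\<close> by (simp add: block_char_mult)
  finally show ?thesis using assms by (simp add: matrix_inv_mult block_char_one)
qed

definition torus :: "('n \<Rightarrow> int) \<Rightarrow> 'f::field \<Rightarrow> 'f^'n^'n" where
  "torus m s = (\<chi> i j. if i = j then s powi m i else 0)"

lemma block_diag_torus: "block_diag n (torus m s)"
  by (auto simp: block_diag_def torus_def)

lemma prod_powi:
  assumes "(s::'f::field) \<noteq> 0" "finite A" shows "(\<Prod>i\<in>A. s powi m i) = s powi (\<Sum>i\<in>A. m i)"
  using assms(2) by (induction A rule: finite_induct) (auto simp: power_int_add assms(1))

lemma power_int_prod_distrib: "(\<Prod>i\<in>A. f i) powi k = (\<Prod>i\<in>A. (f i :: 'f::field) powi k)"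
  by (induction A rule: infinite_finite_induct) (auto simp: power_int_mult_distrib)

text \<open>The exponent is the pairing of \<open>m\<close> with \<open>n\<close>, so integral
  directions orthogonal to \<beta> give one-parameter subgroups in the kernel of the
  character.\<close>

lemma block_char_torus:
  fixes n :: "real^'n::finite" and s :: "'f::field"
  assumes "s \<noteq> 0"
  shows "block_char n (torus m s) = s powi (\<Sum>i\<in>UNIV. m i * \<lfloor>n$i\<rfloor>)"
proof -
  have sd: "sub_det I (torus m s) = (\<Prod>i\<in>I. s powi m i)" for I :: "'n set"
  proof -
    have "sub_det I (torus m s) = (\<Prod>i\<in>UNIV. if i \<in> I then s powi m i else 1)"
      unfolding sub_det_def by (subst det_diagonal) (auto simp: torus_def intro!: prod.cong)
    then show ?thesis by (simp add: prod.If_cases)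
  qed
  have "block_char n (torus m s) = (\<Prod>c\<in>range (($) n). \<Prod>i\<in>{i. n$i = c}. s powi (m i * \<lfloor>n$i\<rfloor>))"
    unfolding block_char_def sd
    by (intro prod.cong refl) (auto simp: power_int_prod_distrib power_int_mult intro!: prod.cong)
  also have "\<dots> = (\<Prod>i\<in>UNIV. s powi (m i * \<lfloor>n$i\<rfloor>))"
    using prod.group[of UNIV "range (($) n)" "($) n" "\<lambda>i. s powi (m i * \<lfloor>n$i\<rfloor>)"] by simp
  finally show ?thesis using assms by (simp add: prod_powi)
qed

lemma det_torus:
  fixes s :: "'f::field" and m :: "'n::finite \<Rightarrow> int"
  assumes "s \<noteq> 0" "(\<Sum>i\<in>UNIV. m i) = 0" shows "det (torus m s) = 1"
proof -
  have "det (torus m s) = (\<Prod>i\<in>UNIV. s powi m i)"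
    by (subst det_diagonal) (auto simp: torus_def)
  then show ?thesis using assms by (simp add: prod_powi)
qed

lemma det_conj: "invertible (g :: 'f::field^'n^'n) \<Longrightarrow> det (matrix_inv g ** d ** g) = det (d :: 'f::field^'n^'n)"
proof -
  assume g: "invertible g"
  have "det (matrix_inv g ** d ** g) = det (matrix_inv g ** g) * det d"
    unfolding det_mul by (simp add: ac_simps)
  then show ?thesis using g by (simp add: matrix_inv_mult)
qed

lemma act_torus:
  assumes "s \<noteq> 0"
  shows "act (torus m1 s, torus m2 s, torus m3 s) x $ (i, j, l) = s powi (m1 i + m2 j + m3 l) * x $ (i, j, l)"
proof -
  have *: "(\<Sum>a\<in>UNIV. (if k = a then p else 0) * f a) = p * f k" for k :: "'n::finite" and p :: 'a and f
    by (simp add: if_distrib[where f = "\<lambda>x. x * _"] cong: if_cong)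
  have "s powi m1 i * (s powi m2 j * (s powi m3 l * x $ (i, j, l))) = s powi (m1 i + m2 j + m3 l) * x $ (i, j, l)"
    using assms by (simp add: power_int_add mult.assoc)
  then show ?thesis
    by (simp add: act_split act1_def act2_def act3_def torus_def * del: act.simps)
qed

section \<open>Polynomial functions along curves\<close>

lemma infinite_alg_closed: "infinite (UNIV :: 'f::alg_closed_field set)"
proof
  assume fin: "finite (UNIV :: 'f set)"
  define p where "p = (\<Prod>a\<in>(UNIV :: 'f set). [:-a, 1:]) + 1"
  have dp: "degree (\<Prod>a\<in>(UNIV :: 'f set). [:-a, 1:]) = card (UNIV :: 'f set)"
    by (subst degree_prod_eq_sum_degree) auto
  moreover have "card (UNIV :: 'f set) > 0" using fin by (simp add: card_gt_0_iff)
  ultimately have "degree p > 0"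
    unfolding p_def by (subst degree_add_eq_left) simp_all
  then obtain x where "poly p x = 0" using alg_closed_imp_poly_has_root by blast
  moreover have "poly (\<Prod>a\<in>(UNIV :: 'f set). [:-a, 1:]) x = 0"
    using fin by (subst poly_prod) (auto intro!: prod_zero)
  ultimately show False by (simp add: p_def)
qed

lemma homogeneous_scale:
  assumes "homogeneous tens_coords d f"
  shows "f (c *s x) = c ^ d * f x"
  using assms
proof induction
  case (coord f)
  then show ?case by (auto simp: tens_coords_def)
qed (simp_all add: algebra_simps power_add)

lemma homogeneous_0_const:
  assumes "homogeneous C d f" "d = 0"
  shows "\<exists>c. f = (\<lambda>_. c)"
  using assms by induction force+

lemma homogeneous_comp_curve:
  assumes "homogeneous tens_coords d f"
    and "\<And>t. \<exists>p. \<forall>s. c s $ t = poly p s"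
  shows "\<exists>p. \<forall>s. f (c s) = poly p s"
  using assms(1)
proof induction
  case (const a)
  then show ?case by (intro exI[of _ "[:a:]"]) simp
next
  case (coord f)
  then show ?case using assms(2) by (auto simp: tens_coords_def)
next
  case (add d f g)
  then obtain p q where "\<forall>s. f (c s) = poly p s" "\<forall>s. g (c s) = poly q s" by blast
  then show ?case by (intro exI[of _ "p + q"]) simp
next
  case (mult d f e g)
  then obtain p q where "\<forall>s. f (c s) = poly p s" "\<forall>s. g (c s) = poly q s" by blast
  then show ?case by (intro exI[of _ "p * q"]) simp
qed

text \<open>Laurent polynomial functions on the punctured line, encoded by a power of
  \<open>s\<close> that clears the pole; the value at the origin is left free.\<close>

definition laurent :: "('f::field \<Rightarrow> 'f) \<Rightarrow> bool" where
  "laurent F \<longleftrightarrow> (\<exists>p N. \<forall>s. s \<noteq> 0 \<longrightarrow> F s * s ^ N = poly p s)"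

lemma laurent_const: "laurent (\<lambda>_. c)"
  unfolding laurent_def by (intro exI[of _ "[:c:]"] exI[of _ 0]) simp

lemma laurent_mult:
  assumes "laurent F" "laurent G" shows "laurent (\<lambda>s. F s * G s)"
proof -
  obtain p N where p: "\<And>s. s \<noteq> 0 \<Longrightarrow> F s * s ^ N = poly p s"
    using assms(1) unfolding laurent_def by blast
  obtain q M where q: "\<And>s. s \<noteq> 0 \<Longrightarrow> G s * s ^ M = poly q s"
    using assms(2) unfolding laurent_def by blast
  note pq = p q
  show ?thesis unfolding laurent_def
  proof (intro exI[of _ "p * q"] exI[of _ "N + M"] allI impI)
    fix s :: 'a assume "s \<noteq> 0"
    have "F s * G s * s ^ (N + M) = (F s * s ^ N) * (G s * s ^ M)"
      by (simp only: power_add mult.assoc mult.commute mult.left_commute)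
    then show "F s * G s * s ^ (N + M) = poly (p * q) s" using pq \<open>s \<noteq> 0\<close> by simp
  qed
qed

lemma laurent_add:
  assumes "laurent F" "laurent G" shows "laurent (\<lambda>s. F s + G s)"
proof -
  obtain p N where p: "\<And>s. s \<noteq> 0 \<Longrightarrow> F s * s ^ N = poly p s"
    using assms(1) unfolding laurent_def by blast
  obtain q M where q: "\<And>s. s \<noteq> 0 \<Longrightarrow> G s * s ^ M = poly q s"
    using assms(2) unfolding laurent_def by blast
  note pq = p q
  have "(F s + G s) * s ^ (N + M) = poly (p * monom 1 M + q * monom 1 N) s" if "s \<noteq> 0" for s
  proof -
    have "(F s + G s) * s ^ (N + M) = F s * s ^ N * s ^ M + G s * s ^ M * s ^ N"
      by (simp add: power_add algebra_simps)
    then show ?thesis by (simp only: pq[OF that] poly_monom poly_add poly_mult mult_1)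
  qed
  then show ?thesis unfolding laurent_def by blast
qed

lemma laurent_sum: "(\<And>i. i \<in> A \<Longrightarrow> laurent (F i)) \<Longrightarrow> laurent (\<lambda>s. \<Sum>i\<in>A. F i s)"
  by (induction A rule: infinite_finite_induct) (auto intro: laurent_add laurent_const)

lemma laurent_powi: "laurent (\<lambda>s. s powi m)"
proof (cases "m \<ge> 0")
  case True
  then show ?thesis unfolding laurent_def
    by (intro exI[of _ "monom 1 (nat m)"] exI[of _ 0]) (simp add: poly_monom power_int_def)
next
  case False
  then show ?thesis unfolding laurent_def
    by (intro exI[of _ 1] exI[of _ "nat (-m)"]) (simp add: power_int_def field_simps)
qed

lemma laurent_poly_fun:
  assumes "f \<in> poly_funs C" "\<And>x. x \<in> C \<Longrightarrow> laurent (\<lambda>s. x (h s))"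
  shows "laurent (\<lambda>s. f (h s))"
  using assms(1) by induction (auto intro: laurent_const laurent_mult laurent_add assms(2))

text \<open>Irreducibility of the punctured line: the product of the two numerators and of the
  coordinate is a non-zero polynomial and has only finitely many roots.\<close>

lemma laurent_product_nonzero:
  fixes F G :: "'f::alg_closed_field \<Rightarrow> 'f"
  assumes "laurent F" "laurent G" "F a \<noteq> 0" "a \<noteq> 0" "G b \<noteq> 0" "b \<noteq> 0"
  obtains s where "s \<noteq> 0" "F s \<noteq> 0" "G s \<noteq> 0"
proof -
  obtain p N where p: "\<And>s. s \<noteq> 0 \<Longrightarrow> F s * s ^ N = poly p s"
    using assms(1) unfolding laurent_def by blast
  obtain q M where q: "\<And>s. s \<noteq> 0 \<Longrightarrow> G s * s ^ M = poly q s"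
    using assms(2) unfolding laurent_def by blast
  note pq = p q
  have "poly p a \<noteq> 0" "poly q b \<noteq> 0" using assms(3-6) pq(1)[of a, symmetric] pq(2)[of b, symmetric] by simp_all
  then have "p * q * [:0, 1:] \<noteq> 0" by auto
  then have "finite {s. poly (p * q * [:0, 1:]) s = 0}" by (rule poly_roots_finite)
  then obtain s where "poly (p * q * [:0, 1:]) s \<noteq> 0"
    using infinite_alg_closed by (metis (mono_tags, lifting) UNIV_I mem_Collect_eq rev_finite_subset subsetI)
  then have "s \<noteq> 0" "poly p s \<noteq> 0" "poly q s \<noteq> 0" by auto
  then show ?thesis using that[of s] pq[of s] by (metis mult_zero_left)
qed

text \<open>The principal open sets form a basis and not only a subbasis, because they are closed
  under intersection: multiply the functions.\<close>

lemma zariski_basis: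
  assumes "openin (zariski C) U" "x \<in> U"
  obtains f where "f \<in> poly_funs C" "f x \<noteq> 0" "{y. f y \<noteq> 0} \<subseteq> U"
proof -
  have "generate_topology_on {{x. f x \<noteq> 0} |f. f \<in> poly_funs C} U"
    using assms(1) unfolding zariski_def openin_topology_generated_by_iff .
  then have "\<exists>f\<in>poly_funs C. f x \<noteq> 0 \<and> {y. f y \<noteq> 0} \<subseteq> U" using assms(2)
  proof induction
    case (Int a b)
    then obtain f g where "f \<in> poly_funs C" "f x \<noteq> 0" "{y. f y \<noteq> 0} \<subseteq> a"
      "g \<in> poly_funs C" "g x \<noteq> 0" "{y. g y \<noteq> 0} \<subseteq> b" by auto
    then show ?case by (intro bexI[of _ "\<lambda>x. f x * g x"] poly_funs.mult) auto
  next
    case (UN K)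
    then obtain k where "k \<in> K" "x \<in> k" by blast
    then obtain f where "f \<in> poly_funs C" "f x \<noteq> 0" "{y. f y \<noteq> 0} \<subseteq> k" using UN by blast
    then show ?case using \<open>k \<in> K\<close> by (intro bexI[of _ f]) auto
  next
    case (Basis s)
    then show ?case by auto
  qed auto
  then show ?thesis using that by blast
qed

lemma topspace_zariski: "topspace (zariski C) = UNIV"
proof -
  have "x \<in> topspace (zariski C)" for x
    unfolding zariski_def topology_generated_by_topspace
    by (rule UnionI[of "{x. (1 :: 'b) \<noteq> 0}"]) (auto intro!: exI[of _ "\<lambda>_. 1"] poly_funs.const)
  then show ?thesis by blast
qed

text \<open>A separation of the image would pull back to two disjoint non-empty open subsets of the
  irreducible punctured line.\<close>

lemma connectedin_laurent_curve:
  fixes h :: "'f::alg_closed_field \<Rightarrow> 'x"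
  assumes "\<And>x. x \<in> C \<Longrightarrow> laurent (\<lambda>s. x (h s))"
  shows "connectedin (zariski C) (h ` {s. s \<noteq> 0})"
  unfolding connectedin
proof (intro conjI notI)
  assume "\<exists>E1 E2. openin (zariski C) E1 \<and> openin (zariski C) E2 \<and> h ` {s. s \<noteq> 0} \<subseteq> E1 \<union> E2 \<and>
    E1 \<inter> E2 \<inter> h ` {s. s \<noteq> 0} = {} \<and> E1 \<inter> h ` {s. s \<noteq> 0} \<noteq> {} \<and> E2 \<inter> h ` {s. s \<noteq> 0} \<noteq> {}"
  then obtain E1 E2 a b where E: "openin (zariski C) E1" "openin (zariski C) E2"
    "E1 \<inter> E2 \<inter> h ` {s. s \<noteq> 0} = {}" "h a \<in> E1" "a \<noteq> 0" "h b \<in> E2" "b \<noteq> 0" by blast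
  obtain f where f: "f \<in> poly_funs C" "f (h a) \<noteq> 0" "{y. f y \<noteq> 0} \<subseteq> E1"
    using zariski_basis[OF E(1,4)] by blast
  obtain g where g: "g \<in> poly_funs C" "g (h b) \<noteq> 0" "{y. g y \<noteq> 0} \<subseteq> E2"
    using zariski_basis[OF E(2,6)] by blast
  obtain s where "s \<noteq> 0" "f (h s) \<noteq> 0" "g (h s) \<noteq> 0"
    using laurent_product_nonzero[OF laurent_poly_fun[OF f(1)] laurent_poly_fun[OF g(1)], of h h a b]
      assms f(2) g(2) E(5,7) by blast
  then show False using E(3) f(3) g(3) by blast
qed (simp add: topspace_zariski)

section \<open>The weight spaces\<close>

lemma span_axis_iff: "x \<in> vec.span {axis t (1::'f::field) |t. P t} \<longleftrightarrow> (\<forall>t. x $ t \<noteq> 0 \<longrightarrow> P t)"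
proof
  assume "x \<in> vec.span {axis t (1::'f::field) |t. P t}"
  then show "\<forall>t. x $ t \<noteq> 0 \<longrightarrow> P t"
  proof (induction rule: vec.span_induct_alt)
    case (step c x y)
    show ?case
    proof (intro allI impI)
      fix t assume "(c *s x + y) $ t \<noteq> 0"
      then have "x $ t \<noteq> 0 \<or> y $ t \<noteq> 0" by auto
      then show "P t"
      proof
        assume "x $ t \<noteq> 0"
        then show ?thesis using step(1) by (auto simp: axis_def split: if_splits)
      qed (use step in blast)
    qed
  qed simp
next
  assume P: "\<forall>t. x $ t \<noteq> 0 \<longrightarrow> P t"
  have "x = (\<Sum>t\<in>UNIV. x $ t *s axis t 1)"
    by (simp add: basis_expansion)
  also have "\<dots> \<in> vec.span {axis t (1::'f::field) |t. P t}"
  proof (rule vec.span_sum)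
    fix t
    show "x $ t *s axis t 1 \<in> vec.span {axis t (1::'f::field) |t. P t}"
      using P by (cases "x $ t = 0") (auto intro: vec.span_zero vec.span_scale vec.span_base)
  qed
  finally show "x \<in> vec.span {axis t (1::'f::field) |t. P t}" .
qed

lemma Z_space_iff: "x \<in> Z_space \<beta> \<longleftrightarrow> (\<forall>t. x $ t \<noteq> 0 \<longrightarrow> inner (weight t) \<beta> = inner \<beta> \<beta>)"
  unfolding Z_space_def by (rule span_axis_iff)

lemma W_space_iff: "x \<in> W_space \<beta> \<longleftrightarrow> (\<forall>t. x $ t \<noteq> 0 \<longrightarrow> inner (weight t) \<beta> > inner \<beta> \<beta>)"
  unfolding W_space_def by (rule span_axis_iff)

lemma act_nonzeroE:
  assumes "act (g1, g2, g3) x $ (i, j, l) \<noteq> 0"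
  obtains i' j' l' where "g1$i$i' \<noteq> 0" "g2$j$j' \<noteq> 0" "g3$l$l' \<noteq> 0" "x$(i', j', l') \<noteq> 0"
proof -
  have "(\<Sum>i'\<in>UNIV. \<Sum>j'\<in>UNIV. \<Sum>l'\<in>UNIV. g1$i$i' * g2$j$j' * g3$l$l' * x$(i', j', l')) \<noteq> 0"
    using assms by simp
  then obtain i' where "(\<Sum>j'\<in>UNIV. \<Sum>l'\<in>UNIV. g1$i$i' * g2$j$j' * g3$l$l' * x$(i', j', l')) \<noteq> 0"
    by (meson sum.neutral)
  then obtain j' where "(\<Sum>l'\<in>UNIV. g1$i$i' * g2$j$j' * g3$l$l' * x$(i', j', l')) \<noteq> 0"
    by (meson sum.neutral)
  then obtain l' where "g1$i$i' * g2$j$j' * g3$l$l' * x$(i', j', l') \<noteq> 0"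
    by (meson sum.neutral)
  then show ?thesis using that by auto
qed

lemma act_Z_space:
  assumes "\<beta> \<in> tstar" "g \<in> M_grp \<beta>" "z \<in> Z_space \<beta>"
  shows "act g z \<in> Z_space \<beta>"
  unfolding Z_space_iff
proof (intro allI impI)
  fix t assume nz: "act g z $ t \<noteq> 0"
  obtain a b c where \<beta>: "\<beta> = (a, b, c)" by (cases \<beta>)
  obtain i j l where t: "t = (i, j, l)" by (cases t)
  obtain g1 g2 g3 where g: "g = (g1, g2, g3)" by (cases g)
  obtain i' j' l' where nz': "g1$i$i' \<noteq> 0" "g2$j$j' \<noteq> 0" "g3$l$l' \<noteq> 0" "z$(i', j', l') \<noteq> 0"
    using nz unfolding t g by (rule act_nonzeroE)
  have "block_diag a g1" "block_diag b g2" "block_diag c g3"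
    using assms(2) by (auto simp: \<beta> g)
  then have "a$i = a$i'" "b$j = b$j'" "c$l = c$l'"
    using nz'(1-3) unfolding block_diag_def by metis+
  moreover have "inner (weight (i', j', l')) \<beta> = inner \<beta> \<beta>"
    using assms(3) nz'(4) by (simp add: Z_space_iff)
  moreover have "(a, b, c) \<in> tstar" using assms(1) by (simp add: \<beta>)
  ultimately show "inner (weight t) \<beta> = inner \<beta> \<beta>"
    by (simp add: t \<beta> inner_weight)
qed

section \<open>Semistability and one-parameter subgroups\<close>

lemma laurent_torus_conj: "laurent (\<lambda>s. (h ** torus m s ** g) $ i $ j)"
proof -
  have "laurent (\<lambda>s. torus m s $ i $ j)" for i j
    unfolding torus_def by (cases "i = j") (simp_all add: laurent_powi laurent_const)
  then show ?thesis
    unfolding matrix_matrix_mult_def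
    by (simp, intro laurent_sum laurent_mult laurent_const)
qed

lemma torus_one: "torus m 1 = mat 1"
  by (simp add: torus_def mat_def vec_eq_iff)

text \<open>\<open>G_st_beta\<close> is an identity component, so membership requires a connected
  set through the identity. The curve of conjugated torus elements is one, with the identity at
  \<open>s = 1\<close>.\<close>

lemma torus_conj_in_G_st_beta:
  fixes g1 :: "'f::alg_closed_field^3^3" and g2 :: "'f^3^3" and g3 :: "'f^2^2"
  assumes \<beta>: "rat_vec \<beta>" "\<beta> \<noteq> 0" and g: "(g1, g2, g3) \<in> M_grp \<beta>"
    and m: "(\<Sum>i\<in>UNIV. m1 i) = 0" "(\<Sum>i\<in>UNIV. m2 i) = 0" "(\<Sum>i\<in>UNIV. m3 i) = 0"
    and perp: "inner (\<chi> i. of_int (m1 i), \<chi> i. of_int (m2 i), \<chi> i. of_int (m3 i)) \<beta> = 0"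
    and s: "s \<noteq> 0"
  shows "(matrix_inv g1 ** torus m1 s ** g1, matrix_inv g2 ** torus m2 s ** g2,
      matrix_inv g3 ** torus m3 s ** g3) \<in> G_st_beta \<beta>"
proof -
  let ?h = "\<lambda>s. (matrix_inv g1 ** torus m1 s ** g1, matrix_inv g2 ** torus m2 s ** g2,
      matrix_inv g3 ** torus m3 s ** g3)"
  obtain b1 b2 b3 where b: "\<beta> = (b1, b2, b3)" by (cases \<beta>)
  have inv: "invertible g1" "invertible g2" "invertible g3"
    and bd: "block_diag b1 g1" "block_diag b2 g2" "block_diag b3 g3"
    using g by (auto simp: b GG_iff)
  define r where "r = primitive_factor \<beta>"
  have r: "r > 0" and rint: "wt_entries (r *\<^sub>R \<beta>) \<subseteq> \<int>"
    using primitive_factor_props[OF \<beta>] by (auto simp: r_def)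
  have ent: "(r *\<^sub>R b1) $ i \<in> \<int>" "(r *\<^sub>R b2) $ i \<in> \<int>" "(r *\<^sub>R b3) $ j \<in> \<int>" for i j
    using rint unfolding b by (auto simp: image_subset_iff)
  have inM: "?h s \<in> M_grp \<beta>" "?h s \<in> G_st" "chi \<beta> (?h s) = 1" if s: "s \<noteq> 0" for s
  proof -
    have det: "det (torus m1 s :: 'f^3^3) = 1" "det (torus m2 s :: 'f^3^3) = 1" "det (torus m3 s :: 'f^2^2) = 1"
      using s m by (auto intro: det_torus)
    then have "invertible (torus m1 s :: 'f^3^3)" "invertible (torus m2 s :: 'f^3^3)" "invertible (torus m3 s :: 'f^2^2)"
      by (auto simp: invertible_det_nz)
    then show "?h s \<in> M_grp \<beta>"
      using inv bd by (simp add: b GG_iff invertible_mult invertible_matrix_inv block_diag_mult block_diag_inv block_diag_torus)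
    show "?h s \<in> G_st"
      using inv det by (simp add: G_st_def det_conj)
    have bd': "block_diag (r *\<^sub>R b1) g1" "block_diag (r *\<^sub>R b2) g2" "block_diag (r *\<^sub>R b3) g3"
      using bd r by (simp_all add: block_diag_scaleR)
    have "chi \<beta> (?h s) = block_char (r *\<^sub>R b1) (matrix_inv g1 ** torus m1 s ** g1) *
      block_char (r *\<^sub>R b2) (matrix_inv g2 ** torus m2 s ** g2) * block_char (r *\<^sub>R b3) (matrix_inv g3 ** torus m3 s ** g3)"
      by (simp add: chi_def r_def b)
    also have "\<dots> = block_char (r *\<^sub>R b1) (torus m1 s :: 'f^3^3) * block_char (r *\<^sub>R b2) (torus m2 s :: 'f^3^3) *
        block_char (r *\<^sub>R b3) (torus m3 s :: 'f^2^2)"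
      by (simp only: block_char_conj[OF inv(1) bd'(1) block_diag_torus]
        block_char_conj[OF inv(2) bd'(2) block_diag_torus] block_char_conj[OF inv(3) bd'(3) block_diag_torus])
    also have "\<dots> = s powi ((\<Sum>i\<in>UNIV. m1 i * \<lfloor>(r *\<^sub>R b1)$i\<rfloor>) + (\<Sum>i\<in>UNIV. m2 i * \<lfloor>(r *\<^sub>R b2)$i\<rfloor>) + (\<Sum>i\<in>UNIV. m3 i * \<lfloor>(r *\<^sub>R b3)$i\<rfloor>))"
      unfolding block_char_torus[OF s] using s by (simp only: power_int_add simp_thms)
    also have "(\<Sum>i\<in>UNIV. m1 i * \<lfloor>(r *\<^sub>R b1)$i\<rfloor>) + (\<Sum>i\<in>UNIV. m2 i * \<lfloor>(r *\<^sub>R b2)$i\<rfloor>) + (\<Sum>i\<in>UNIV. m3 i * \<lfloor>(r *\<^sub>R b3)$i\<rfloor>) = 0"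
    proof -
      \<comment> \<open>The floors in the character are exact because the primitive multiple is
        integral; the exponent is thus \<open>r\<close> times a pairing that vanishes.\<close>
      have fl: "real_of_int \<lfloor>x\<rfloor> = x" if "x \<in> \<int>" for x using that by (auto elim: Ints_cases)
      have "real_of_int ((\<Sum>i\<in>UNIV. m1 i * \<lfloor>(r *\<^sub>R b1)$i\<rfloor>) + (\<Sum>i\<in>UNIV. m2 i * \<lfloor>(r *\<^sub>R b2)$i\<rfloor>) + (\<Sum>i\<in>UNIV. m3 i * \<lfloor>(r *\<^sub>R b3)$i\<rfloor>))
        = r * inner (\<chi> i. of_int (m1 i), \<chi> i. of_int (m2 i), \<chi> i. of_int (m3 i)) \<beta>"
        unfolding of_int_add of_int_sum of_int_mult fl[OF ent(1)] fl[OF ent(2)] fl[OF ent(3)]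
        unfolding b inner_wt by (simp add: sum_distrib_left distrib_left mult.left_commute)
      then show ?thesis using perp by (simp only: mult_zero_right of_int_eq_0_iff)
    qed
    finally show "chi \<beta> (?h s) = 1" by simp
  qed
  have "connectedin (zariski mats_coords) (?h ` {s. s \<noteq> 0})"
    by (intro connectedin_laurent_curve) (auto simp: mats_coords_def laurent_torus_conj)
  then have con: "connectedin (subtopology (zariski mats_coords) {g \<in> M_grp \<beta> \<inter> G_st. chi \<beta> g = 1}) (?h ` {s. s \<noteq> 0})"
    using inM by (auto simp: connectedin_subtopology)
  have "?h 1 = (mat 1, mat 1, mat 1)" using inv by (simp add: matrix_inv_mult torus_one)
  then have "(mat 1, mat 1, mat 1) \<in> ?h ` {s. s \<noteq> 0}" by (metis (mono_tags, lifting) imageI mem_Collect_eq zero_neq_one)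
  moreover have "?h s \<in> ?h ` {s. s \<noteq> 0}" using s by blast
  ultimately show ?thesis
    unfolding G_st_beta_def connected_component_of_def mem_Collect_eq using con by blast
qed

text \<open>Homogeneous of degree zero means constant, so a non-constant invariant has positive
  degree and vanishes at the origin.\<close>

lemma Z_ssE:
  assumes "z \<in> Z_ss \<beta>"
  obtains d f where "homogeneous tens_coords d f" "f 0 = 0" "f z \<noteq> 0"
    "\<And>g x. g \<in> G_st_beta \<beta> \<Longrightarrow> x \<in> Z_space \<beta> \<Longrightarrow> f (act g x) = f x"
proof -
  obtain d f where f: "homogeneous tens_coords d f" "\<not> f constant_on Z_space \<beta>" "f z \<noteq> 0"
    "\<And>g x. g \<in> G_st_beta \<beta> \<Longrightarrow> x \<in> Z_space \<beta> \<Longrightarrow> f (act g x) = f x"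
    using assms unfolding Z_ss_def by blast
  have "d \<noteq> 0" using f(2) homogeneous_0_const[OF f(1)] by (auto simp: constant_on_def)
  then have "f 0 = 0" using homogeneous_scale[OF f(1), of 0 0] by (simp add: power_0_left)
  then show ?thesis using f that by blast
qed

text \<open>The elementary direction of the Hilbert-Mumford criterion. If the conclusion fails, a
  rational direction orthogonal to \<beta> is positive on the support of \<open>act g z\<close>. Its
  torus, conjugated back by \<open>g\<close>, fixes the value of the invariant while it moves
  \<open>z\<close> towards the origin.\<close>

lemma beta_in_hull_support:
  fixes z :: "'f::alg_closed_field tens"
  assumes \<beta>: "rat_vec \<beta>" "\<beta> \<noteq> 0" "\<beta> \<in> tstar" and z: "z \<in> Z_ss \<beta>" and g: "g \<in> M_grp \<beta>"
  shows "\<beta> \<in> convex hull (weight ` {t. act g z $ t \<noteq> 0})"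
proof (rule ccontr)
  define y where "y = act g z"
  assume "\<beta> \<notin> convex hull (weight ` {t. act g z $ t \<noteq> 0})"
  moreover have zZ: "z \<in> Z_space \<beta>" using z by (simp add: Z_ss_def)
  then have "act g z \<in> Z_space \<beta>" by (rule act_Z_space[OF \<beta>(3) g])
  ultimately obtain \<mu> where \<mu>: "\<mu> \<in> tstar" "rat_vec \<mu>" "inner \<mu> \<beta> = 0"
    "\<And>t. y $ t \<noteq> 0 \<Longrightarrow> inner (weight t) \<mu> > 0"
  proof -
    assume "act g z \<in> Z_space \<beta>" and notin: "\<beta> \<notin> convex hull (weight ` {t. act g z $ t \<noteq> 0})"
      and *: "\<And>\<mu>. \<mu> \<in> tstar \<Longrightarrow> rat_vec \<mu> \<Longrightarrow> inner \<mu> \<beta> = 0 \<Longrightarrow>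
        (\<And>t. y $ t \<noteq> 0 \<Longrightarrow> inner (weight t) \<mu> > 0) \<Longrightarrow> thesis"
    have tight: "\<And>a. a \<in> weight ` {t. act g z $ t \<noteq> 0} \<Longrightarrow> inner a \<beta> = inner \<beta> \<beta>"
      using \<open>act g z \<in> Z_space \<beta>\<close> unfolding Z_space_iff by blast
    show thesis
    proof (rule separating_weight[OF _ _ _ \<beta>(1,3) tight notin])
      fix \<mu> assume \<mu>: "\<mu> \<in> tstar" "rat_vec \<mu>" "inner \<mu> \<beta> = 0"
        and pos: "\<And>a. a \<in> weight ` {t. act g z $ t \<noteq> 0} \<Longrightarrow> 0 < inner a \<mu>"
      show thesis
      proof (rule *[OF \<mu>])
        fix t assume "y $ t \<noteq> 0"
        then show "inner (weight t) \<mu> > 0" unfolding y_def by (intro pos imageI CollectI)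
      qed
    next
      fix a assume "a \<in> weight ` {t. act g z $ t \<noteq> 0}"
      then show "rat_vec a" by (blast intro: rat_vec_weight)
    next
      show "weight ` {t. act g z $ t \<noteq> 0} \<subseteq> tstar" by (blast intro: weight_in_tstar)
    qed simp
  qed
  obtain u1 u2 u3 where u: "\<mu> = (u1, u2, u3)" by (cases \<mu>)
  obtain N :: nat where N: "N > 0" "\<And>x. x \<in> wt_entries \<mu> \<Longrightarrow> of_nat N * x \<in> \<int>"
    using clear_denominators[OF finite_wt_entries \<mu>(2)[unfolded rat_vec_wt_entries]] by blast
  define m1 m2 m3 where "m1 = (\<lambda>i. \<lfloor>N * u1$i\<rfloor>)" and "m2 = (\<lambda>i. \<lfloor>N * u2$i\<rfloor>)" and "m3 = (\<lambda>i. \<lfloor>N * u3$i\<rfloor>)"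
  have m: "of_int (m1 i) = N * u1$i" "of_int (m2 i) = N * u2$i" "of_int (m3 j) = N * u3$j" for i j
    using N(2) by (auto simp: m1_def m2_def m3_def u elim: Ints_cases)
  have "real_of_int (\<Sum>i\<in>UNIV. m1 i) = 0" "real_of_int (\<Sum>i\<in>UNIV. m2 i) = 0" "real_of_int (\<Sum>i\<in>UNIV. m3 i) = 0"
    using \<mu>(1) unfolding of_int_sum m u in_tstar sum_distrib_left[symmetric] by auto
  then have m0: "(\<Sum>i\<in>UNIV. m1 i) = 0" "(\<Sum>i\<in>UNIV. m2 i) = 0" "(\<Sum>i\<in>UNIV. m3 i) = 0"
    by (simp_all only: of_int_eq_0_iff)
  have perp: "inner (\<chi> i. of_int (m1 i), \<chi> i. of_int (m2 i), \<chi> i. of_int (m3 i)) \<beta> = 0"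
  proof -
    have "(\<chi> i. of_int (m1 i), \<chi> i. of_int (m2 i), \<chi> i. of_int (m3 i)) = real N *\<^sub>R \<mu>"
      by (simp add: m u vec_eq_iff)
    then show ?thesis using \<mu>(3) by simp
  qed
  obtain g1 g2 g3 where gg: "g = (g1, g2, g3)" by (cases g)
  have gGG: "g \<in> GG" using g by (cases \<beta>) (auto simp: gg)
  obtain d f where f: "homogeneous tens_coords d f" "f 0 = 0" "f z \<noteq> 0"
    "\<And>g x. g \<in> G_st_beta \<beta> \<Longrightarrow> x \<in> Z_space \<beta> \<Longrightarrow> f (act g x) = f x"
    using Z_ssE[OF z] by blast
  define n where "n = (\<lambda>(i, j, l). m1 i + m2 j + m3 l)"
  have n: "n t > 0" if "y $ t \<noteq> 0" for t
  proof -
    obtain i j l where t: "t = (i, j, l)" by (cases t)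
    have "real_of_int (n t) = N * inner (weight t) \<mu>"
      using \<mu>(1) by (simp add: t n_def m u inner_weight algebra_simps)
    then have "real_of_int (n t) > 0" using \<mu>(4)[OF that] N(1) by simp
    then show ?thesis by simp
  qed
  \<comment> \<open>All exponents on the support are positive, so the curve can be written with
    natural powers and extends to \<open>s = 0\<close>.\<close>
  define c0 where "c0 = (\<lambda>s. (\<chi> t. if y $ t = 0 then 0 else s ^ nat (n t) * y $ t))"
  define c where "c = (\<lambda>s. act (ginv g) (c0 s))"
  have fc: "f (c s) = f z" if "s \<noteq> 0" for s
  proof -
    let ?t = "(torus m1 s, torus m2 s, torus m3 s)"
    have "act ?t y = c0 s"
      unfolding vec_eq_iff
    proof
      fix t :: "3 \<times> 3 \<times> 2"
      obtain i j l where t: "t = (i, j, l)" by (cases t)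
      show "act ?t y $ t = c0 s $ t"
        using n[of t] that unfolding t act_torus[OF that] by (auto simp: c0_def n_def power_int_def)
    qed
    then have "c s = act (gmul (ginv g) (gmul ?t g)) z"
      by (simp only: act_gmul c_def y_def)
    also have "gmul (ginv g) (gmul ?t g) = (matrix_inv g1 ** torus m1 s ** g1, matrix_inv g2 ** torus m2 s ** g2,
      matrix_inv g3 ** torus m3 s ** g3)"
      by (simp add: gg matrix_mul_assoc)
    finally show ?thesis
      using f(4)[OF torus_conj_in_G_st_beta[OF \<beta>(1,2) g[unfolded gg] m0 perp that] zZ] by simp
  qed
  have "\<exists>p. \<forall>s. c s $ t = poly p s" for t
  proof -
    have c0: "\<exists>p. \<forall>s. c0 s $ t = poly p s" for t
    proof (cases "y $ t = 0")
      case True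
      then show ?thesis by (intro exI[of _ 0]) (simp add: c0_def)
    next
      case False
      then show ?thesis by (intro exI[of _ "monom (y $ t) (nat (n t))"]) (simp add: c0_def poly_monom)
    qed
    then obtain P where P: "\<And>t s. c0 s $ t = poly (P t) s" by metis
    obtain i j l where t: "t = (i, j, l)" by (cases t)
    show ?thesis
      by (rule exI[of _ "\<Sum>i'\<in>UNIV. \<Sum>j'\<in>UNIV. \<Sum>l'\<in>UNIV. smult (matrix_inv g1$i$i' * matrix_inv g2$j$j' * matrix_inv g3$l$l') (P (i', j', l'))"])
        (simp add: c_def gg t P poly_sum)
  qed
  then obtain p where p: "\<And>s. f (c s) = poly p s" using homogeneous_comp_curve[OF f(1)] by blast
  have "c 0 = 0"
  proof -
    have "c0 0 = 0" using n by (force simp: c0_def vec_eq_iff)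
    then show ?thesis by (simp only: c_def act_zero)
  qed
  then have "poly p 0 = 0" using p[of 0] f(2) by simp
  \<comment> \<open>Agreement at infinitely many points replaces continuity at the origin.\<close>
  moreover have "p = [:f z:]"
  proof (rule ccontr)
    assume "p \<noteq> [:f z:]"
    then have "finite {s. poly (p - [:f z:]) s = 0}" by (intro poly_roots_finite) simp
    moreover have "UNIV - {0} \<subseteq> {s. poly (p - [:f z:]) s = 0}" using p fc by auto
    ultimately have "finite (UNIV - {0 :: 'f})" by (rule rev_finite_subset)
    then show False using infinite_alg_closed[where 'f = 'f] by simp
  qed
  ultimately show False using f(3) by simp
qed

section \<open>Bruhat decomposition\<close>

text \<open>Lower unipotent matrices are listed entry by entry because the order of the type
  \<open>3\<close> does not follow the numerals.\<close>

definition lu3 :: "'f::field^3^3 \<Rightarrow> bool" where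
  "lu3 L \<longleftrightarrow> L$1$1 = 1 \<and> L$2$2 = 1 \<and> L$3$3 = 1 \<and> L$1$2 = 0 \<and> L$1$3 = 0 \<and> L$2$3 = 0"

definition lu2 :: "'f::field^2^2 \<Rightarrow> bool" where
  "lu2 L \<longleftrightarrow> L$1$1 = 1 \<and> L$2$2 = 1 \<and> L$1$2 = 0"

definition monomial_mat :: "('n \<Rightarrow> 'n) \<Rightarrow> 'f::field^'n^'n \<Rightarrow> bool" where
  "monomial_mat p N \<longleftrightarrow> bij p \<and> (\<forall>i j. N$i$j \<noteq> 0 \<longleftrightarrow> j = p i)"

text \<open>The second factor has in row \<open>q\<close> the row of \<open>r\<close> whose pivot is
  in column \<open>q\<close>, scaled to pivot one.\<close>

lemma monomial_factor:
  fixes r :: "'f::field^'n::finite^'n"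
  assumes "bij p" "\<And>i. r$i$(p i) \<noteq> 0"
  shows "(\<chi> i j. if j = p i then r$i$j else 0) ** (\<chi> q j. r$(inv_into UNIV p q)$j / r$(inv_into UNIV p q)$q) = r"
    "monomial_mat p (\<chi> i j. if j = p i then r$i$j else 0)"
proof -
  have [simp]: "inv_into UNIV p (p i) = i" for i using assms(1) by (simp add: bij_is_inj)
  show "(\<chi> i j. if j = p i then r$i$j else 0) ** (\<chi> q j. r$(inv_into UNIV p q)$j / r$(inv_into UNIV p q)$q) = r"
  proof (rule matrix_ext)
    fix i j
    have "(\<Sum>k\<in>UNIV. (if k = p i then r$i$k else 0) * (r$(inv_into UNIV p k)$j / r$(inv_into UNIV p k)$k)) =
      (\<Sum>k\<in>UNIV. if k = p i then r$i$j else 0)"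
      using assms(2) by (intro sum.cong) auto
    then show "((\<chi> i j. if j = p i then r$i$j else 0) ** (\<chi> q j. r$(inv_into UNIV p q)$j / r$(inv_into UNIV p q)$q)) $ i $ j = r$i$j"
      by (simp add: matrix_matrix_mult_def)
  qed
  show "monomial_mat p (\<chi> i j. if j = p i then r$i$j else 0)"
    using assms by (auto simp: monomial_mat_def)
qed

lemma monomial_nonzero: "monomial_mat p N \<Longrightarrow> N$i$(p i) \<noteq> 0"
  by (simp add: monomial_mat_def)

lemma monomial_sum:
  fixes N :: "'f::field^'n::finite^'n"
  assumes "monomial_mat p N"
  shows "(\<Sum>k\<in>UNIV. N$i$k * f k) = N$i$(p i) * f (p i)"
proof -
  have "(\<Sum>k\<in>UNIV. N$i$k * f k) = (\<Sum>k\<in>UNIV. if k = p i then N$i$(p i) * f (p i) else 0)"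
    using assms by (intro sum.cong) (auto simp: monomial_mat_def)
  then show ?thesis by simp
qed

lemma last_nonzero3:
  assumes "(v :: 'f::field^3) \<noteq> 0"
  obtains p where "v$p \<noteq> 0" "p = 1 \<Longrightarrow> v$2 = 0 \<and> v$3 = 0" "p = 2 \<Longrightarrow> v$3 = 0"
proof -
  consider "v$3 \<noteq> 0" | "v$3 = 0" "v$2 \<noteq> 0" | "v$3 = 0" "v$2 = 0" "v$1 \<noteq> 0"
    using assms by (auto simp: vec_eq_iff forall_3)
  then show ?thesis using that[of 3] that[of 2] that[of 1] by cases auto
qed

text \<open>Gaussian elimination downwards, with the last non-zero entry of each row as pivot. The
  pivot columns are cleared below, so the pivots form a permutation; since nothing lies to the right
  of a pivot, sorting the rows by pivots gives a lower triangular matrix.\<close>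

lemma bruhat3:
  fixes g :: "'f::field^3^3"
  assumes "invertible g"
  obtains L L' N p where "lu3 L" "lu3 L'" "monomial_mat p N" "L ** g = N ** L'"
proof -
  have det: "det g \<noteq> 0" using assms by (simp add: invertible_det_nz)
  define r1 where "r1 = g$1"
  have "r1 \<noteq> 0"
  proof
    assume "r1 = 0"
    then have "g$1$j = 0" for j by (simp add: r1_def vec_eq_iff)
    then show False using det by (simp add: det_3)
  qed
  then obtain p1 where p1: "r1$p1 \<noteq> 0" "p1 = 1 \<Longrightarrow> r1$2 = 0 \<and> r1$3 = 0" "p1 = 2 \<Longrightarrow> r1$3 = 0"
    using last_nonzero3 by blast
  define a where "a = - g$2$p1 / r1$p1"
  define r2 where "r2 = (\<chi> j. g$2$j + a * r1$j)"
  have r2p1: "r2$p1 = 0" using p1 by (simp add: r2_def a_def)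
  have "r2 \<noteq> 0"
  proof
    assume "r2 = 0"
    then have "g$2$j = - a * g$1$j" for j by (simp add: r2_def r1_def vec_eq_iff eq_neg_iff_add_eq_0)
    then have "det g = 0" by (simp add: det_3 algebra_simps)
    then show False using det by simp
  qed
  then obtain p2 where p2: "r2$p2 \<noteq> 0" "p2 = 1 \<Longrightarrow> r2$2 = 0 \<and> r2$3 = 0" "p2 = 2 \<Longrightarrow> r2$3 = 0"
    using last_nonzero3 by blast
  have p12: "p2 \<noteq> p1" using r2p1 p2 by auto
  define b where "b = - g$3$p1 / r1$p1"
  define c where "c = - (g$3$p2 + b * r1$p2) / r2$p2"
  define r3 where "r3 = (\<chi> j. g$3$j + b * r1$j + c * r2$j)"
  have r3p: "r3$p1 = 0" "r3$p2 = 0" using p1 p2 r2p1 by (simp_all add: r3_def b_def c_def)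
  have "r3 \<noteq> 0"
  proof
    assume "r3 = 0"
    then have "g$3$j = (- b - c * a) * g$1$j + (- c) * g$2$j" for j
    proof -
      have "g$3$j + b * g$1$j + c * (g$2$j + a * g$1$j) = 0"
        using \<open>r3 = 0\<close> by (simp add: r3_def r2_def r1_def vec_eq_iff)
      then show ?thesis by Groebner_Basis.algebra
    qed
    then have "g$3$1 = (- b - c * a) * g$1$1 + (- c) * g$2$1" "g$3$2 = (- b - c * a) * g$1$2 + (- c) * g$2$2"
      "g$3$3 = (- b - c * a) * g$1$3 + (- c) * g$2$3" by blast+
    then have "det g = 0" unfolding det_3 by Groebner_Basis.algebra
    then show False using det by simp
  qed
  then obtain p3 where p3: "r3$p3 \<noteq> 0" "p3 = 1 \<Longrightarrow> r3$2 = 0 \<and> r3$3 = 0" "p3 = 2 \<Longrightarrow> r3$3 = 0"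
    using last_nonzero3 by blast
  have p123: "p3 \<noteq> p1" "p3 \<noteq> p2" using r3p p3 by auto
  define r :: "'f^3^3" where "r = vector [r1, r2, r3]"
  define p where "p = (\<lambda>i::3. if i = 1 then p1 else if i = 2 then p2 else p3)"
  have "inj p"
  proof (rule injI)
    fix x y assume "p x = p y"
    then show "x = y"
      using p12 p123 exhaust_3[of x] exhaust_3[of y] by (auto simp: p_def)
  qed
  then have bij: "bij p" by (simp add: bij_def finite_UNIV_inj_surj)
  have rp: "r$i$(p i) \<noteq> 0" for i
    using exhaust_3[of i] p1(1) p2(1) p3(1) by (auto simp: r_def p_def)
  have low: "r$i$3 = 0" if "p i = 2" for i
    using that p1(3) p2(3) p3(3) exhaust_3[of i] by (auto simp: r_def p_def split: if_splits)
  have low': "r$i$2 = 0 \<and> r$i$3 = 0" if "p i = 1" for i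
    using that p1(2) p2(2) p3(2) exhaust_3[of i] by (auto simp: r_def p_def split: if_splits)
  have pinv: "p (inv_into UNIV p q) = q" for q using bij by (simp add: bij_is_surj surj_f_inv_f)
  show ?thesis
  proof (rule that)
    show "lu3 (vector [vector [1, 0, 0], vector [a, 1, 0], vector [b + c * a, c, 1]])"
      by (simp add: lu3_def)
    show "lu3 (\<chi> q j. r$(inv_into UNIV p q)$j / r$(inv_into UNIV p q)$q)"
      using low[OF pinv] low'[OF pinv] rp[of "inv_into UNIV p 1"] rp[of "inv_into UNIV p 2"] rp[of "inv_into UNIV p 3"] by (simp add: lu3_def pinv)
    show "monomial_mat p (\<chi> i j. if j = p i then r$i$j else 0)"
      by (rule monomial_factor(2)[OF bij rp])
    have "vector [vector [1, 0, 0], vector [a, 1, 0], vector [b + c * a, c, 1]] ** g = r"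
      by (simp add: r_def r3_def r2_def r1_def vec_eq_iff forall_3 matrix_matrix_mult_def sum_3 algebra_simps)
    then show "vector [vector [1, 0, 0], vector [a, 1, 0], vector [b + c * a, c, 1]] ** g
        = (\<chi> i j. if j = p i then r$i$j else 0) ** (\<chi> q j. r$(inv_into UNIV p q)$j / r$(inv_into UNIV p q)$q)"
      by (simp only: monomial_factor(1)[OF bij rp])
  qed
qed

lemma bruhat2:
  fixes g :: "'f::field^2^2"
  assumes "invertible g"
  obtains L L' N p where "lu2 L" "lu2 L'" "monomial_mat p N" "L ** g = N ** L'"
proof -
  have det: "det g \<noteq> 0" using assms by (simp add: invertible_det_nz)
  have last: "\<exists>p. v$p \<noteq> 0 \<and> (p = 1 \<longrightarrow> v$2 = 0)" if "v \<noteq> 0" for v :: "'f^2"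
    using that by (cases "v$2 = 0") (auto simp: vec_eq_iff forall_2)
  define r1 where "r1 = g$1"
  have "r1 \<noteq> 0"
  proof
    assume "r1 = 0"
    then have "g$1$j = 0" for j by (simp add: r1_def vec_eq_iff)
    then show False using det by (simp add: det_2)
  qed
  then obtain p1 where p1: "r1$p1 \<noteq> 0" "p1 = 1 \<Longrightarrow> r1$2 = 0"
    using last by blast
  define a where "a = - g$2$p1 / r1$p1"
  define r2 where "r2 = (\<chi> j. g$2$j + a * r1$j)"
  have r2p1: "r2$p1 = 0" using p1 by (simp add: r2_def a_def)
  have "r2 \<noteq> 0"
  proof
    assume "r2 = 0"
    then have "g$2$j = - a * g$1$j" for j by (simp add: r2_def r1_def vec_eq_iff eq_neg_iff_add_eq_0)
    then have "det g = 0" by (simp add: det_2 algebra_simps)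
    then show False using det by simp
  qed
  then obtain p2 where p2: "r2$p2 \<noteq> 0" "p2 = 1 \<Longrightarrow> r2$2 = 0"
    using last by blast
  have p12: "p2 \<noteq> p1" using r2p1 p2 by auto
  define r :: "'f^2^2" where "r = vector [r1, r2]"
  define p where "p = (\<lambda>i::2. if i = 1 then p1 else p2)"
  have "inj p" using p12 by (auto simp: inj_on_def p_def) (metis exhaust_2)+
  then have bij: "bij p" by (simp add: bij_def finite_UNIV_inj_surj)
  have rp: "r$i$(p i) \<noteq> 0" for i
    using exhaust_2[of i] p1(1) p2(1) by (auto simp: r_def p_def)
  have low: "r$i$2 = 0" if "p i = 1" for i
    using that p1(2) p2(2) exhaust_2[of i] by (auto simp: r_def p_def split: if_splits)
  have pinv: "p (inv_into UNIV p q) = q" for q using bij by (simp add: bij_is_surj surj_f_inv_f)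
  show ?thesis
  proof (rule that)
    show "lu2 (vector [vector [1, 0], vector [a, 1]])"
      by (simp add: lu2_def)
    show "lu2 (\<chi> q j. r$(inv_into UNIV p q)$j / r$(inv_into UNIV p q)$q)"
      using low[OF pinv] rp[of "inv_into UNIV p 1"] rp[of "inv_into UNIV p 2"] by (simp add: lu2_def pinv)
    show "monomial_mat p (\<chi> i j. if j = p i then r$i$j else 0)"
      by (rule monomial_factor(2)[OF bij rp])
    have "vector [vector [1, 0], vector [a, 1]] ** g = r"
      by (simp add: r_def r2_def r1_def vec_eq_iff forall_2 matrix_matrix_mult_def sum_2 algebra_simps)
    then show "vector [vector [1, 0], vector [a, 1]] ** g
        = (\<chi> i j. if j = p i then r$i$j else 0) ** (\<chi> q j. r$(inv_into UNIV p q)$j / r$(inv_into UNIV p q)$q)"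
      by (simp only: monomial_factor(1)[OF bij rp])
  qed
qed

section \<open>Disjointness of the strata\<close>

text \<open>The coordinates of \<beta> increase, so lower triangular matrices move entries only to
  indices of at least the same pairing. On the indices with pairing exactly
  \<open>inner \<beta> \<beta>\<close> the part in \<open>W_space\<close> contributes nothing, and
  the translate is the Levi part of the matrices applied to \<open>z\<close>.\<close>

lemma lower_triangular_action:
  fixes y :: "'f::alg_closed_field tens"
  assumes \<beta>: "rat_vec \<beta>" "\<beta> \<noteq> 0" "\<beta> \<in> tstar_plus" and y: "y \<in> Y_ss \<beta>"
    and L: "lu3 L1" "lu3 L2" "lu2 L3"
  shows "\<And>t. act (L1, L2, L3) y $ t \<noteq> 0 \<Longrightarrow> inner (weight t) \<beta> \<ge> inner \<beta> \<beta>"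
    and "\<beta> \<in> convex hull (weight ` {t. act (L1, L2, L3) y $ t \<noteq> 0})"
proof -
  obtain a b c where b: "\<beta> = (a, b, c)" by (cases \<beta>)
  have \<beta>t: "(a, b, c) \<in> tstar" "\<beta> \<in> tstar" using \<beta>(3) by (auto simp: tstar_plus_def b)
  have sorted: "a$1 \<le> a$2" "a$2 \<le> a$3" "b$1 \<le> b$2" "b$2 \<le> b$3" "c$1 \<le> c$2"
    using \<beta>(3) by (auto simp: tstar_plus_def b)
  have L1: "a$i' \<le> a$i" if "L1$i$i' \<noteq> 0" for i i'
    using that L(1) sorted exhaust_3[of i] exhaust_3[of i'] by (auto simp: lu3_def)
  have L2: "b$i' \<le> b$i" if "L2$i$i' \<noteq> 0" for i i'
    using that L(2) sorted exhaust_3[of i] exhaust_3[of i'] by (auto simp: lu3_def)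
  have L3: "c$i' \<le> c$i" if "L3$i$i' \<noteq> 0" for i i'
    using that L(3) sorted exhaust_2[of i] exhaust_2[of i'] by (auto simp: lu2_def)
  obtain z w where zw: "y = z + w" "z \<in> Z_ss \<beta>" "w \<in> W_space \<beta>"
    using y by (auto simp: Y_ss_def)
  have zZ: "z \<in> Z_space \<beta>" using zw(2) by (simp add: Z_ss_def)
  let ?q = "inner \<beta> \<beta>"
  have z: "a$i + b$j + c$l = ?q" if "z$(i, j, l) \<noteq> 0" for i j l
    using zZ that \<beta>t(1) by (auto simp: Z_space_iff b inner_weight)
  have w: "a$i + b$j + c$l > ?q" if "w$(i, j, l) \<noteq> 0" for i j l
    using zw(3) that \<beta>t(1) by (auto simp: W_space_iff b inner_weight)
  have y: "a$i + b$j + c$l \<ge> ?q" if "y$(i, j, l) \<noteq> 0" for i j l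
    using that z[of i j l] w[of i j l] by (cases "z$(i, j, l) = 0") (auto simp: zw(1))
  show ge: "inner (weight t) \<beta> \<ge> ?q" if nz: "act (L1, L2, L3) y $ t \<noteq> 0" for t
  proof -
    obtain i j l where t: "t = (i, j, l)" by (cases t)
    obtain i' j' l' where "L1$i$i' \<noteq> 0" "L2$j$j' \<noteq> 0" "L3$l$l' \<noteq> 0" "y$(i', j', l') \<noteq> 0"
      using nz unfolding t by (rule act_nonzeroE)
    then have "?q \<le> a$i + b$j + c$l" using L1 L2 L3 y by (meson add_mono order_trans)
    then show ?thesis using \<beta>t(1) by (simp add: t b inner_weight)
  qed
  \<comment> \<open>The Levi parts keep the entries between equal coordinates of \<beta>; they are
    again unipotent.\<close>
  define m1 m2 m3 where m_def: "m1 = (\<chi> i j. if a$i = a$j then L1$i$j else 0)"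
    "m2 = (\<chi> i j. if b$i = b$j then L2$i$j else 0)" "m3 = (\<chi> i j. if c$i = c$j then L3$i$j else 0)"
  have "lu3 m1" "lu3 m2" "lu2 m3" using L by (auto simp: lu3_def lu2_def m_def)
  then have "det m1 = 1" "det m2 = 1" "det m3 = 1" by (auto simp: lu3_def lu2_def det_3 det_2)
  then have mM: "(m1, m2, m3) \<in> M_grp \<beta>"
    by (auto simp: b GG_iff invertible_det_nz block_diag_def m_def)
  have eq: "act (L1, L2, L3) y $ t = act (m1, m2, m3) z $ t" if "inner (weight t) \<beta> = ?q" for t
  proof -
    obtain i j l where t: "t = (i, j, l)" by (cases t)
    have q: "a$i + b$j + c$l = ?q" using that \<beta>t(1) by (simp add: t b inner_weight)
    have 1: "act (L1, L2, L3) w $ (i, j, l) = 0"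
    proof (rule ccontr)
      assume "act (L1, L2, L3) w $ (i, j, l) \<noteq> 0"
      then obtain i' j' l' where "L1$i$i' \<noteq> 0" "L2$j$j' \<noteq> 0" "L3$l$l' \<noteq> 0" "w$(i', j', l') \<noteq> 0"
        by (rule act_nonzeroE)
      then show False using L1[of i i'] L2[of j j'] L3[of l l'] w[of i' j' l'] q by linarith
    qed
    have 2: "L1$i$i' * L2$j$j' * L3$l$l' * z$(i', j', l') = m1$i$i' * m2$j$j' * m3$l$l' * z$(i', j', l')" for i' j' l'
    proof (cases "L1$i$i' \<noteq> 0 \<and> L2$j$j' \<noteq> 0 \<and> L3$l$l' \<noteq> 0 \<and> z$(i', j', l') \<noteq> 0")
      case True
      then have "a$i = a$i'" "b$j = b$j'" "c$l = c$l'"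
        using L1[of i i'] L2[of j j'] L3[of l l'] z[of i' j' l'] q by linarith+
      then show ?thesis by (simp add: m_def)
    next
      case False
      then show ?thesis by (auto simp: m_def)
    qed
    show ?thesis
      unfolding zw(1) act_add vector_add_component t 1 by (simp add: 2)
  qed
  have "{t. act (m1, m2, m3) z $ t \<noteq> 0} \<subseteq> {t. act (L1, L2, L3) y $ t \<noteq> 0}"
    using eq act_Z_space[OF \<beta>t(2) mM zZ] unfolding Z_space_iff by auto
  then show "\<beta> \<in> convex hull (weight ` {t. act (L1, L2, L3) y $ t \<noteq> 0})"
    using beta_in_hull_support[OF \<beta>(1,2) \<beta>t(2) zw(2) mM] hull_mono image_mono by (metis (no_types, lifting) subsetD)
qed

text \<open>Each pair of hypotheses is the variational inequality for the point closest to the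
  origin. Evaluated at the other point and added, the two inequalities bound the squared distance by
  zero.\<close>

lemma hull_closest_unique:
  assumes "\<beta> \<in> convex hull S" "\<And>x. x \<in> S \<Longrightarrow> inner x \<beta> \<ge> inner \<beta> \<beta>"
    and "\<beta>' \<in> convex hull S" "\<And>x. x \<in> S \<Longrightarrow> inner x \<beta>' \<ge> inner \<beta>' \<beta>'"
  shows "\<beta> = \<beta>'"
proof -
  have half: "inner y b \<ge> r" if "y \<in> convex hull S" "\<And>x. x \<in> S \<Longrightarrow> inner x b \<ge> r" for y b and r :: real
  proof -
    have "convex hull S \<subseteq> {x. inner b x \<ge> r}"
      using that(2) by (intro hull_minimal convex_halfspace_ge) (auto simp: inner_commute)
    then show ?thesis using that(1) by (auto simp: inner_commute)
  qed
  have "inner \<beta> \<beta>' \<ge> inner \<beta>' \<beta>'" "inner \<beta>' \<beta> \<ge> inner \<beta> \<beta>"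
    using half[OF assms(1,4)] half[OF assms(3,2)] by blast+
  then have "inner (\<beta> - \<beta>') (\<beta> - \<beta>') \<le> 0"
    by (simp add: inner_diff_left inner_diff_right inner_commute)
  then show ?thesis by (metis inner_gt_zero_iff linorder_not_le right_minus_eq)
qed

lemma sorted3_perm_eq:
  fixes a a' :: "real^3"
  assumes "a$1 \<le> a$2" "a$2 \<le> a$3" "a'$1 \<le> a'$2" "a'$2 \<le> a'$3" "bij p" "\<And>i. a'$i = a$(p i)"
  shows "a = a'"
proof -
  have "p 1 \<noteq> p 2" "p 1 \<noteq> p 3" "p 2 \<noteq> p 3" using assms(5) by (auto simp: bij_def inj_eq)
  then show ?thesis
    using assms(1-4,6) exhaust_3[of "p 1"] exhaust_3[of "p 2"] exhaust_3[of "p 3"]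
    by (auto simp: vec_eq_iff forall_3)
qed

lemma sorted2_perm_eq:
  fixes a a' :: "real^2"
  assumes "a$1 \<le> a$2" "a'$1 \<le> a'$2" "bij p" "\<And>i. a'$i = a$(p i)"
  shows "a = a'"
proof -
  have "p 1 \<noteq> p 2" using assms(3) by (auto simp: bij_def inj_eq)
  then show ?thesis
    using assms(1,2,4) exhaust_2[of "p 1"] exhaust_2[of "p 2"]
    by (auto simp: vec_eq_iff forall_2)
qed

text \<open>The Bruhat factors turn the orbit relation into a monomial relation between lower
  triangular translates of \<open>y\<close> and \<open>y'\<close>, so the supports differ by
  permutations of the indices. Permutations act isometrically on weights and therefore match the
  closest points; both vectors are sorted, hence equal.\<close>

lemma Y_ss_orbit_unique:
  fixes y y' :: "'f::alg_closed_field tens"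
  assumes \<beta>: "rat_vec \<beta>" "\<beta> \<noteq> 0" "\<beta> \<in> tstar_plus" and y: "y \<in> Y_ss \<beta>"
    and \<beta>': "rat_vec \<beta>'" "\<beta>' \<noteq> 0" "\<beta>' \<in> tstar_plus" and y': "y' \<in> Y_ss \<beta>'"
    and orb: "y' \<in> orbit y"
  shows "\<beta> = \<beta>'"
proof -
  obtain g1 g2 g3 where g: "invertible g1" "invertible g2" "invertible g3" "y' = act (g1, g2, g3) y"
    using orb by (auto simp: orbit_def GG_def simp del: act.simps)
  obtain L1 L1' N1 p1 where 1: "lu3 L1" "lu3 L1'" "monomial_mat p1 N1" "L1 ** g1 = N1 ** L1'"
    using bruhat3[OF g(1)] by metis
  obtain L2 L2' N2 p2 where 2: "lu3 L2" "lu3 L2'" "monomial_mat p2 N2" "L2 ** g2 = N2 ** L2'"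
    using bruhat3[OF g(2)] by metis
  obtain L3 L3' N3 p3 where 3: "lu2 L3" "lu2 L3'" "monomial_mat p3 N3" "L3 ** g3 = N3 ** L3'"
    using bruhat2[OF g(3)] by metis
  define u where "u = act (L1', L2', L3') y"
  define u' where "u' = act (L1, L2, L3) y'"
  have "u' = act (gmul (L1, L2, L3) (g1, g2, g3)) y"
    by (simp only: u'_def g(4) act_gmul)
  also have "\<dots> = act (N1, N2, N3) u"
    by (simp only: u_def act_gmul[symmetric] gmul.simps 1(4) 2(4) 3(4))
  finally have uN: "u' = act (N1, N2, N3) u" .
  have p: "bij p1" "bij p2" "bij p3" using 1(3) 2(3) 3(3) by (auto simp: monomial_mat_def)
  have supp: "u' $ (i, j, l) \<noteq> 0 \<longleftrightarrow> u $ (p1 i, p2 j, p3 l) \<noteq> 0" for i j l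
    unfolding uN act_split act1_def act2_def act3_def
    by (simp add: monomial_sum[OF 1(3)] monomial_sum[OF 2(3)] monomial_sum[OF 3(3)]
        monomial_nonzero[OF 1(3)] monomial_nonzero[OF 2(3)] monomial_nonzero[OF 3(3)])
  \<comment> \<open>Coordinates move by the inverse permutations so that the weight at
    \<open>i\<close> becomes the weight at \<open>p1 i\<close>, as the supports require.\<close>
  define \<Phi> :: "wt \<Rightarrow> wt" where "\<Phi> = (\<lambda>(a, b, c). (\<chi> q. a$(inv_into UNIV p1 q), \<chi> q. b$(inv_into UNIV p2 q), \<chi> q. c$(inv_into UNIV p3 q)))"
  have lin: "linear \<Phi>"
    by (rule linearI) (auto simp: \<Phi>_def vec_eq_iff)
  have pinv: "(q = p1 i) = (inv_into UNIV p1 q = i)" "(q = p2 i) = (inv_into UNIV p2 q = i)" "(r = p3 l) = (inv_into UNIV p3 r = l)" for q i r l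
    using bij_inv_eq_iff[OF p(1)] bij_inv_eq_iff[OF p(2)] bij_inv_eq_iff[OF p(3)] by metis+
  have \<Phi>w: "\<Phi> (weight (i, j, l)) = weight (p1 i, p2 j, p3 l)" for i j l
    by (simp add: \<Phi>_def weight_eq pinv)
  have inner\<Phi>: "inner (\<Phi> x) (\<Phi> y) = inner x y" for x y
  proof -
    note s = sum.reindex_bij_betw[OF bij_imp_bij_inv]
    obtain a b c a' b' c' where xy: "x = (a, b, c)" "y = (a', b', c')" by (cases x; cases y)
    show ?thesis
      unfolding xy \<Phi>_def
      using s[OF p(1), of "\<lambda>q. a$q * a'$q"] s[OF p(2), of "\<lambda>q. b$q * b'$q"] s[OF p(3), of "\<lambda>q. c$q * c'$q"]
      by (simp add: inner_vec_def)
  qed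
  have im: "weight ` {t. u $ t \<noteq> 0} = \<Phi> ` weight ` {t. u' $ t \<noteq> 0}"
  proof (intro equalityI subsetI)
    fix x assume "x \<in> weight ` {t. u $ t \<noteq> 0}"
    then obtain i j l where x: "x = weight (i, j, l)" "u $ (i, j, l) \<noteq> 0" by auto
    have s: "p1 (inv_into UNIV p1 i) = i" "p2 (inv_into UNIV p2 j) = j" "p3 (inv_into UNIV p3 l) = l"
      using p by (auto simp: bij_is_surj surj_f_inv_f)
    then have "u' $ (inv_into UNIV p1 i, inv_into UNIV p2 j, inv_into UNIV p3 l) \<noteq> 0" using x(2) by (simp add: supp)
    moreover have "x = \<Phi> (weight (inv_into UNIV p1 i, inv_into UNIV p2 j, inv_into UNIV p3 l))" by (simp add: \<Phi>w s x(1))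
    ultimately show "x \<in> \<Phi> ` weight ` {t. u' $ t \<noteq> 0}" by blast
  next
    fix x assume "x \<in> \<Phi> ` weight ` {t. u' $ t \<noteq> 0}"
    then obtain i j l where x: "x = \<Phi> (weight (i, j, l))" "u' $ (i, j, l) \<noteq> 0" by auto
    then show "x \<in> weight ` {t. u $ t \<noteq> 0}" by (auto simp: \<Phi>w supp)
  qed
  have eq: "\<beta> = \<Phi> \<beta>'"
  proof (rule hull_closest_unique)
    show "\<beta> \<in> convex hull (weight ` {t. u $ t \<noteq> 0})"
      unfolding u_def by (rule lower_triangular_action(2)[OF \<beta> y 1(2) 2(2) 3(2)])
    show "inner \<beta> \<beta> \<le> inner x \<beta>" if "x \<in> weight ` {t. u $ t \<noteq> 0}" for x
      using that lower_triangular_action(1)[OF \<beta> y 1(2) 2(2) 3(2)] unfolding u_def by blast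
    have "\<Phi> \<beta>' \<in> \<Phi> ` (convex hull (weight ` {t. u' $ t \<noteq> 0}))"
      unfolding u'_def by (intro imageI lower_triangular_action(2)[OF \<beta>' y' 1(1) 2(1) 3(1)])
    then show "\<Phi> \<beta>' \<in> convex hull (weight ` {t. u $ t \<noteq> 0})"
      by (simp only: im convex_hull_linear_image[OF lin])
    show "inner (\<Phi> \<beta>') (\<Phi> \<beta>') \<le> inner x (\<Phi> \<beta>')" if x: "x \<in> weight ` {t. u $ t \<noteq> 0}" for x
    proof -
      obtain t where "x = \<Phi> (weight t)" "u' $ t \<noteq> 0" using x unfolding im by blast
      then show ?thesis
        using lower_triangular_action(1)[OF \<beta>' y' 1(1) 2(1) 3(1)] unfolding u'_def by (simp add: inner\<Phi>)
    qed
  qed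
  obtain a b c where b: "\<beta> = (a, b, c)" by (cases \<beta>)
  obtain a' b' c' where b': "\<beta>' = (a', b', c')" by (cases \<beta>')
  have e: "a = (\<chi> q. a'$(inv_into UNIV p1 q))" "b = (\<chi> q. b'$(inv_into UNIV p2 q))" "c = (\<chi> q. c'$(inv_into UNIV p3 q))"
    using eq unfolding b b' \<Phi>_def split_conv prod.inject by blast+
  have s: "a$1 \<le> a$2" "a$2 \<le> a$3" "b$1 \<le> b$2" "b$2 \<le> b$3" "c$1 \<le> c$2"
    "a'$1 \<le> a'$2" "a'$2 \<le> a'$3" "b'$1 \<le> b'$2" "b'$2 \<le> b'$3" "c'$1 \<le> c'$2"
    using \<beta>(3) \<beta>'(3) by (auto simp: tstar_plus_def b b')
  have "a$q = a'$(inv_into UNIV p1 q)" "b$q = b'$(inv_into UNIV p2 q)" "c$r = c'$(inv_into UNIV p3 r)" for q r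
    by (simp_all add: e)
  then have "a' = a" "b' = b" "c' = c"
    using sorted3_perm_eq[OF s(6,7,1,2) bij_imp_bij_inv[OF p(1)]]
      sorted3_perm_eq[OF s(8,9,3,4) bij_imp_bij_inv[OF p(2)]]
      sorted2_perm_eq[OF s(10,5) bij_imp_bij_inv[OF p(3)]] by blast+
  then show ?thesis by (simp add: b b')
qed

section \<open>The determinant of the pencil on an unstable tensor\<close>

definition slice :: "2 \<Rightarrow> 'f tens \<Rightarrow> 'f^3^3" where
  "slice l x = (\<chi> i j. x $ (i, j, l))"

text \<open>The coefficient of \<open>u\<^sup>2 v\<close> in the determinant of \<open>u A + v B\<close>.\<close>

definition dpol :: "'f::field^3^3 \<Rightarrow> 'f^3^3 \<Rightarrow> 'f" where
  "dpol A B = det (vector [B$1, A$2, A$3] :: 'f^3^3) + det (vector [A$1, B$2, A$3] :: 'f^3^3) +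
     det (vector [A$1, A$2, B$3] :: 'f^3^3)"

text \<open>Each monomial of these two coefficients uses every row index and every column index once
  and the second slice at most once. Its three pairings with \<beta> therefore add up to at most
  zero, whereas each non-zero entry of \<open>y\<close> has positive pairing.\<close>

lemma Y_ss_double_root:
  fixes y :: "'f::alg_closed_field tens"
  assumes \<beta>: "rat_vec \<beta>" "\<beta> \<noteq> 0" "\<beta> \<in> tstar_plus" and y: "y \<in> Y_ss \<beta>"
  shows "det (slice 1 y) = 0" "dpol (slice 1 y) (slice 2 y) = 0"
proof -
  obtain a b c where b: "\<beta> = (a, b, c)" by (cases \<beta>)
  have \<beta>t: "(a, b, c) \<in> tstar" using \<beta>(3) by (auto simp: tstar_plus_def b)
  have "lu3 (mat 1 :: 'f^3^3)" "lu2 (mat 1 :: 'f^2^2)" by (auto simp: lu3_def lu2_def mat_def)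
  from lower_triangular_action(1)[OF \<beta> y this(1) this]
  have ge: "inner (weight t) \<beta> \<ge> inner \<beta> \<beta>" if "y $ t \<noteq> 0" for t
    using that by (simp only: act_one)
  have "inner \<beta> \<beta> > 0" using \<beta>(2) by simp
  then have pos: "a$i + b$j + c$l > 0" if "y $ (i, j, l) \<noteq> 0" for i j l
    using ge[OF that] \<beta>t by (simp add: b inner_weight)
  have s: "a$1 + a$2 + a$3 = 0" "b$1 + b$2 + b$3 = 0" "c$1 + c$2 = 0" "c$1 \<le> c$2"
    using \<beta>(3) by (auto simp: tstar_plus_def b in_tstar sum_3 sum_2)
  have z: "y $ (1, j1, l1) * y $ (2, j2, l2) * y $ (3, j3, l3) = 0"
    if "b$j1 + b$j2 + b$j3 = 0" "c$l1 + c$l2 + c$l3 \<le> 0" for j1 j2 j3 l1 l2 l3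
    using pos[of 1 j1 l1] pos[of 2 j2 l2] pos[of 3 j3 l3] that s by force
  have bs: "b$1 + b$2 + b$3 = 0" "b$1 + b$3 + b$2 = 0" "b$2 + b$1 + b$3 = 0" "b$2 + b$3 + b$1 = 0"
    "b$3 + b$1 + b$2 = 0" "b$3 + b$2 + b$1 = 0" using s by auto
  have cs: "c$1 + c$1 + c$1 \<le> 0" "c$2 + c$1 + c$1 \<le> 0" "c$1 + c$2 + c$1 \<le> 0" "c$1 + c$1 + c$2 \<le> 0"
    using s by auto
  show "det (slice 1 y) = 0"
    by (simp add: det_3 slice_def z[OF bs(1) cs(1)] z[OF bs(2) cs(1)] z[OF bs(3) cs(1)] z[OF bs(4) cs(1)]
        z[OF bs(5) cs(1)] z[OF bs(6) cs(1)])
  note z2 = z[OF bs(1) cs(2)] z[OF bs(2) cs(2)] z[OF bs(3) cs(2)] z[OF bs(4) cs(2)]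
        z[OF bs(5) cs(2)] z[OF bs(6) cs(2)]
  note z3 = z[OF bs(1) cs(3)] z[OF bs(2) cs(3)] z[OF bs(3) cs(3)] z[OF bs(4) cs(3)]
        z[OF bs(5) cs(3)] z[OF bs(6) cs(3)]
  note z4 = z[OF bs(1) cs(4)] z[OF bs(2) cs(4)] z[OF bs(3) cs(4)] z[OF bs(4) cs(4)]
        z[OF bs(5) cs(4)] z[OF bs(6) cs(4)]
  show "dpol (slice 1 y) (slice 2 y) = 0"
    by (simp add: dpol_def det_3 slice_def z2 z3 z4)
qed

section \<open>Explicit semistable points\<close>

text \<open>Semistability certified by an invariant of the full group cut out by \<open>\<chi>\<^sub>\<beta> = 1\<close>, of which
  \<^const>\<open>G_st_beta\<close> is only a subgroup.\<close>

definition explicit_ss :: "wt \<Rightarrow> 'f::alg_closed_field tens set" where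
  "explicit_ss \<beta> = {z \<in> Z_space \<beta>. \<exists>d f. homogeneous tens_coords d f \<and> d > 0 \<and> f z \<noteq> 0 \<and>
     (\<forall>g1 g2 g3 x. (g1, g2, g3) \<in> M_grp \<beta> \<longrightarrow> det g1 = 1 \<longrightarrow> det g2 = 1 \<longrightarrow> det g3 = 1 \<longrightarrow>
      chi \<beta> (g1, g2, g3) = 1 \<longrightarrow> x \<in> Z_space \<beta> \<longrightarrow> f (act (g1, g2, g3) x) = f x)}"

lemma explicit_ssI:
  assumes "z \<in> Z_space \<beta>" "homogeneous tens_coords d f" "d > 0" "f z \<noteq> 0"
    and "\<And>g1 g2 g3 x. (g1, g2, g3) \<in> M_grp \<beta> \<Longrightarrow> det g1 = 1 \<Longrightarrow> det g2 = 1 \<Longrightarrow> det g3 = 1 \<Longrightarrow>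
      chi \<beta> (g1, g2, g3) = 1 \<Longrightarrow> x \<in> Z_space \<beta> \<Longrightarrow> f (act (g1, g2, g3) x) = f x"
  shows "z \<in> explicit_ss \<beta>"
  unfolding explicit_ss_def using assms by blast

lemma explicit_ss_Z_ss:
  assumes "z \<in> explicit_ss \<beta>"
  shows "z \<in> Z_ss \<beta>"
proof -
  obtain d f where z: "z \<in> Z_space \<beta>" "homogeneous tens_coords d f" "d > 0" "f z \<noteq> 0"
    and inv: "\<And>g1 g2 g3 x. (g1, g2, g3) \<in> M_grp \<beta> \<Longrightarrow> det g1 = 1 \<Longrightarrow> det g2 = 1 \<Longrightarrow> det g3 = 1 \<Longrightarrow>
      chi \<beta> (g1, g2, g3) = 1 \<Longrightarrow> x \<in> Z_space \<beta> \<Longrightarrow> f (act (g1, g2, g3) x) = f x"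
    using assms unfolding explicit_ss_def by blast
  have "f 0 = 0" using homogeneous_scale[OF z(2), of 0 0] z(3) by (simp add: power_0_left)
  moreover have "0 \<in> Z_space \<beta>" by (simp add: Z_space_iff)
  ultimately have nc: "\<not> f constant_on Z_space \<beta>"
    using z(1,4) unfolding constant_on_def by metis
  have "f (act g x) = f x" if "g \<in> G_st_beta \<beta>" "x \<in> Z_space \<beta>" for g x
  proof -
    have "G_st_beta \<beta> \<subseteq> {g \<in> M_grp \<beta> \<inter> G_st. chi \<beta> g = 1}"
      unfolding G_st_beta_def
      by (rule order.trans[OF connected_component_of_subset_topspace]) (simp add: topspace_subtopology)
    then have "g \<in> M_grp \<beta>" "g \<in> G_st" "chi \<beta> g = 1" using that(1) by auto
    then show ?thesis using inv that(2) by (cases g) (auto simp: G_st_def simp del: act.simps)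
  qed
  then show ?thesis using z nc unfolding Z_ss_def by blast
qed

section \<open>Coordinates and characters of integral vectors\<close>

definition nwt :: "int list \<Rightarrow> int list \<Rightarrow> int list \<Rightarrow> wt" where
  "nwt as bs cs = mk_wt (map of_int as) (map of_int bs) (map of_int cs)"

lemma range_vector3: "range (($) (vector [a, b, c] :: 'a::zero^3)) = {a, b, c}"
  by (auto simp: UNIV_3)

lemma range_vector2: "range (($) (vector [a, b] :: 'a::zero^2)) = {a, b}"
  by (auto simp: UNIV_2)

text \<open>One computation shared by the explicit vectors. The gcd condition identifies
  \<open>r\<close> as the primitive factor, so the integers listed are the exponents of the
  character.\<close>

lemma nwt_props:
  fixes a1 a2 a3 b1 b2 b3 c1 c2 :: int and r :: nat
  defines "\<beta> \<equiv> (1 / real r) *\<^sub>R nwt [a1, a2, a3] [b1, b2, b3] [c1, c2]"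
  assumes r: "r > 0" and sums: "a1 + a2 + a3 = 0" "b1 + b2 + b3 = 0" "c1 + c2 = 0"
    and gcd: "Gcd {a1, a2, a3, b1, b2, b3, c1, c2} = 1"
  shows "rat_vec \<beta>" "\<beta> \<in> tstar" "\<beta> \<noteq> 0"
    and "\<And>i j l. inner (weight (i, j, l)) \<beta> =
        ((vector [of_int a1, of_int a2, of_int a3] :: real^3) $ i + (vector [of_int b1, of_int b2, of_int b3] :: real^3) $ j +
          (vector [of_int c1, of_int c2] :: real^2) $ l) / real r"
    and "inner \<beta> \<beta> = of_int (a1\<^sup>2 + a2\<^sup>2 + a3\<^sup>2 + b1\<^sup>2 + b2\<^sup>2 + b3\<^sup>2 + c1\<^sup>2 + c2\<^sup>2) / (real r)\<^sup>2"
    and "\<And>(g1 :: 'f::field^3^3) g2 g3. chi \<beta> (g1, g2, g3) = block_char (vector [of_int a1, of_int a2, of_int a3]) g1 *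
        block_char (vector [of_int b1, of_int b2, of_int b3]) g2 * block_char (vector [of_int c1, of_int c2]) g3"
    and "\<And>(g1 :: 'f::field^3^3) g2 g3. (g1, g2, g3) \<in> M_grp \<beta> \<longleftrightarrow> (g1, g2, g3) \<in> GG \<and>
        block_diag (vector [of_int a1, of_int a2, of_int a3]) g1 \<and>
        block_diag (vector [of_int b1, of_int b2, of_int b3]) g2 \<and> block_diag (vector [of_int c1, of_int c2]) g3"
    and "\<And>x :: 'f tens. x \<in> Z_space \<beta> \<longleftrightarrow> (\<forall>i j l. x $ (i, j, l) \<noteq> 0 \<longrightarrow>
        real r * ((vector [of_int a1, of_int a2, of_int a3] :: real^3) $ i + (vector [of_int b1, of_int b2, of_int b3] :: real^3) $ j +
          (vector [of_int c1, of_int c2] :: real^2) $ l) = of_int (a1\<^sup>2 + a2\<^sup>2 + a3\<^sup>2 + b1\<^sup>2 + b2\<^sup>2 + b3\<^sup>2 + c1\<^sup>2 + c2\<^sup>2))"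
proof -
  define a :: "real^3" where "a = vector [of_int a1, of_int a2, of_int a3]"
  define b :: "real^3" where "b = vector [of_int b1, of_int b2, of_int b3]"
  define c :: "real^2" where "c = vector [of_int c1, of_int c2]"
  have \<beta>: "\<beta> = ((1 / real r) *\<^sub>R a, (1 / real r) *\<^sub>R b, (1 / real r) *\<^sub>R c)"
    by (simp add: \<beta>_def nwt_def mk_wt_def a_def b_def c_def)
  have ent: "a$1 = of_int a1" "a$2 = of_int a2" "a$3 = of_int a3" "b$1 = of_int b1" "b$2 = of_int b2"
    "b$3 = of_int b3" "c$1 = of_int c1" "c$2 = of_int c2"
    by (simp_all add: a_def b_def c_def)
  have n0: "(a, b, c) \<noteq> 0"
  proof
    assume "(a, b, c) = 0"
    then have "a = 0" "b = 0" "c = 0" by (auto simp: zero_prod_def)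
    then have "a1 = 0 \<and> a2 = 0 \<and> a3 = 0 \<and> b1 = 0 \<and> b2 = 0 \<and> b3 = 0 \<and> c1 = 0 \<and> c2 = 0"
      using ent by simp
    then show False using gcd by simp
  qed
  have rs: "r *\<^sub>R \<beta> = (a, b, c)" using r by (simp add: \<beta>)
  show rat: "rat_vec \<beta>"
    by (simp add: \<beta> rat_vec_wt forall_3 forall_2 ent)
  have "of_int (a1 + a2 + a3) = (0::real)" "of_int (b1 + b2 + b3) = (0::real)" "of_int (c1 + c2) = (0::real)"
    by (simp_all only: sums of_int_0)
  then show t: "\<beta> \<in> tstar"
    using r by (simp add: \<beta> in_tstar sum_3 sum_2 ent field_simps)
  show nz: "\<beta> \<noteq> 0" using n0 rs by auto
  show iw: "inner (weight (i, j, l)) \<beta> =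
        ((vector [of_int a1, of_int a2, of_int a3] :: real^3) $ i + (vector [of_int b1, of_int b2, of_int b3] :: real^3) $ j +
          (vector [of_int c1, of_int c2] :: real^2) $ l) / real r" for i j l
    using t unfolding \<beta> a_def[symmetric] b_def[symmetric] c_def[symmetric]
    by (simp add: inner_weight add_divide_distrib)
  show ib: "inner \<beta> \<beta> = of_int (a1\<^sup>2 + a2\<^sup>2 + a3\<^sup>2 + b1\<^sup>2 + b2\<^sup>2 + b3\<^sup>2 + c1\<^sup>2 + c2\<^sup>2) / (real r)\<^sup>2"
    unfolding \<beta> inner_wt by (simp add: sum_3 sum_2 ent power2_eq_square add_divide_distrib)
  have ra: "range (($) a) = of_int ` {a1, a2, a3}" "range (($) b) = of_int ` {b1, b2, b3}"
    "range (($) c) = of_int ` {c1, c2}"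
    unfolding a_def b_def c_def range_vector3 range_vector2 by auto
  have "primitive_factor \<beta> = real r"
  proof (rule primitive_factor_eqI[OF rat nz])
    show "wt_entries (real r *\<^sub>R \<beta>) = of_int ` {a1, a2, a3, b1, b2, b3, c1, c2}"
      unfolding rs wt_entries.simps ra image_Un[symmetric] by (rule arg_cong[where f = "image of_int"]) auto
  qed (use r gcd in auto)
  then have "primitive_factor \<beta> *\<^sub>R \<beta> = (a, b, c)" using rs by simp
  then show "chi \<beta> (g1, g2, g3) = block_char (vector [of_int a1, of_int a2, of_int a3]) g1 *
        block_char (vector [of_int b1, of_int b2, of_int b3]) g2 * block_char (vector [of_int c1, of_int c2]) g3"
    for g1 g2 :: "'f^3^3" and g3
    by (simp add: chi_def a_def b_def c_def)
  show "(g1, g2, g3) \<in> M_grp \<beta> \<longleftrightarrow> (g1, g2, g3) \<in> GG \<and>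
        block_diag (vector [of_int a1, of_int a2, of_int a3]) g1 \<and>
        block_diag (vector [of_int b1, of_int b2, of_int b3]) g2 \<and> block_diag (vector [of_int c1, of_int c2]) g3"
    for g1 g2 :: "'f^3^3" and g3
    using r unfolding \<beta> a_def[symmetric] b_def[symmetric] c_def[symmetric]
    by (auto simp: block_diag_scaleR)
  show "x \<in> Z_space \<beta> \<longleftrightarrow> (\<forall>i j l. x $ (i, j, l) \<noteq> 0 \<longrightarrow>
        real r * ((vector [of_int a1, of_int a2, of_int a3] :: real^3) $ i + (vector [of_int b1, of_int b2, of_int b3] :: real^3) $ j +
          (vector [of_int c1, of_int c2] :: real^2) $ l) = of_int (a1\<^sup>2 + a2\<^sup>2 + a3\<^sup>2 + b1\<^sup>2 + b2\<^sup>2 + b3\<^sup>2 + c1\<^sup>2 + c2\<^sup>2))"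
    for x :: "'f tens"
  proof -
    have "y / real r = z / (real r)\<^sup>2 \<longleftrightarrow> real r * y = z" for y z
      using r by (simp add: field_simps power2_eq_square)
    then show ?thesis
      by (simp only: Z_space_iff split_paired_All iw ib)
  qed
qed

lemma block_char_const3: "block_char (vector [0, 0, 0]) (g :: 'f::field^3^3) = 1"
  by (simp add: block_char_def range_vector3)

lemma block_char_const2: "block_char (vector [0, 0]) (g :: 'f::field^2^2) = 1"
  by (simp add: block_char_def range_vector2)

lemma block_char_122:
  "a \<noteq> b \<Longrightarrow> block_char (vector [a, b, b]) (g :: 'f::field^3^3) =
    g$1$1 powi \<lfloor>a\<rfloor> * (g$2$2 * g$3$3 - g$2$3 * g$3$2) powi \<lfloor>b\<rfloor>"
  by (simp add: block_char_def range_vector3 sub_det_def det_3)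

lemma block_char_112:
  "a \<noteq> b \<Longrightarrow> block_char (vector [a, a, b]) (g :: 'f::field^3^3) =
    (g$1$1 * g$2$2 - g$1$2 * g$2$1) powi \<lfloor>a\<rfloor> * g$3$3 powi \<lfloor>b\<rfloor>"
  by (simp add: block_char_def range_vector3 sub_det_def det_3)

lemma block_char_123:
  "a \<noteq> b \<Longrightarrow> b \<noteq> c \<Longrightarrow> a \<noteq> c \<Longrightarrow> block_char (vector [a, b, c]) (g :: 'f::field^3^3) =
    g$1$1 powi \<lfloor>a\<rfloor> * g$2$2 powi \<lfloor>b\<rfloor> * g$3$3 powi \<lfloor>c\<rfloor>"
  by (simp add: block_char_def range_vector3 sub_det_def det_3)

lemma block_char_12:
  "a \<noteq> b \<Longrightarrow> block_char (vector [a, b]) (g :: 'f::field^2^2) = g$1$1 powi \<lfloor>a\<rfloor> * g$2$2 powi \<lfloor>b\<rfloor>"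
  by (simp add: block_char_def range_vector2 sub_det_def det_2)

text \<open>When a determinant is one, complementary block determinants are inverse to each other;
  this turns the negative exponents in \<open>chi\<close> into natural powers.\<close>

lemma powi_inverse:
  assumes "(a :: 'f::field) * d = 1"
  shows "a powi (- numeral k) = d ^ numeral k"
  using inverse_unique[OF assms] by (simp add: power_int_minus power_inverse[symmetric])

definition tens01 :: "(3 \<times> 3 \<times> 2) set \<Rightarrow> 'f::field tens" where
  "tens01 S = (\<chi> t. if t \<in> S then 1 else 0)"

lemma homogeneous_pow: "homogeneous C d f \<Longrightarrow> homogeneous C (n * d) (\<lambda>x. f x ^ n)"
  by (induction n) (auto simp: homogeneous.const[of C 1, simplified] dest: homogeneous.mult)

lemma homogeneous_diff:
  assumes "homogeneous C d f" "homogeneous C d g" shows "homogeneous C d (\<lambda>x. f x - g x)"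
proof -
  have "homogeneous C (0 + d) (\<lambda>x. -1 * g x)" by (intro homogeneous.mult homogeneous.const assms)
  from homogeneous.add[OF assms(1) this[simplified]] show ?thesis by simp
qed

lemma homogeneous_tens: "homogeneous tens_coords 1 (\<lambda>x. x $ t)"
  by (rule homogeneous.coord) (simp add: tens_coords_def)

text \<open>On determinant-one elements \<open>chi\<close> is typically a proper power of a smaller
  character. A semi-invariant with that smaller character as multiplier becomes invariant after
  taking the same power.\<close>

lemma pow_semi_invariant: "y = k * x \<Longrightarrow> k ^ m = 1 \<Longrightarrow> y ^ m = x ^ m" for k x y :: "'f::field"
  by (simp add: power_mult_distrib)

lemma floor_minus_one: "\<lfloor>- 1 :: real\<rfloor> = - 1"
  using floor_of_int[of "-1", where 'a = real] by simp

lemmas block_char_simps = floor_minus_one block_char_const3 block_char_const2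
  block_char_112 block_char_122 block_char_123 block_char_12

section \<open>Invariants for the individual vectors\<close>

lemma beta49_nwt: "beta49 = (1 / real 6) *\<^sub>R nwt [-2, -2, 4] [-2, -2, 4] [-3, 3]"
  by (simp add: beta49_def nwt_def mk_wt_def vec_eq_iff forall_3 forall_2)

lemmas beta49_props = nwt_props[of 6 "-2" "-2" "4" "-2" "-2" "4" "-3" "3", folded beta49_nwt, simplified]

text \<open>\<open>Z_space\<close> is a line, and the sixth power of the multiplier of its
  coordinate is the character.\<close>

lemma beta49_ss: "tens01 {(3, 3, 2)} \<in> explicit_ss beta49"
proof (rule explicit_ssI)
  show "tens01 {(3, 3, 2)} \<in> (Z_space beta49 :: 'a tens set)"
    by (simp add: beta49_props forall_3 forall_2 tens01_def)
  show "homogeneous tens_coords (6 * 1) (\<lambda>x :: 'a tens. (x $ (3, 3, 2)) ^ 6)"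
    by (intro homogeneous_pow homogeneous_diff homogeneous.mult homogeneous_tens)
  show "((tens01 {(3, 3, 2)} $ (3, 3, 2)) ^ 6) \<noteq> (0 :: 'a)" by (simp add: tens01_def)
  fix g1 g2 :: "'a^3^3" and g3 :: "'a^2^2" and x :: "'a tens"
  assume M: "(g1, g2, g3) \<in> M_grp beta49" and d: "det g1 = 1" "det g2 = 1" "det g3 = 1"
    and chi: "chi beta49 (g1, g2, g3) = 1" and x: "x \<in> Z_space beta49"
  have g: "g1$1$3 = 0" "g1$2$3 = 0" "g1$3$1 = 0" "g1$3$2 = 0" "g2$1$3 = 0" "g2$2$3 = 0" "g2$3$1 = 0" "g2$3$2 = 0" "g3$1$2 = 0" "g3$2$1 = 0"
    using M by (simp_all add: beta49_props block_diag_def forall_3 forall_2)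
  have x0: "x $ (1, 1, 1) = 0" "x $ (1, 1, 2) = 0" "x $ (1, 2, 1) = 0" "x $ (1, 2, 2) = 0" "x $ (1, 3, 1) = 0" "x $ (1, 3, 2) = 0" "x $ (2, 1, 1) = 0" "x $ (2, 1, 2) = 0" "x $ (2, 2, 1) = 0" "x $ (2, 2, 2) = 0" "x $ (2, 3, 1) = 0" "x $ (2, 3, 2) = 0" "x $ (3, 1, 1) = 0" "x $ (3, 1, 2) = 0" "x $ (3, 2, 1) = 0" "x $ (3, 2, 2) = 0" "x $ (3, 3, 1) = 0"
    using x by (simp_all add: beta49_props forall_3 forall_2)
  have e: "(g1$1$1 * g1$2$2 - g1$1$2 * g1$2$1) * g1$3$3 = 1" "(g2$1$1 * g2$2$2 - g2$1$2 * g2$2$1) * g2$3$3 = 1" "g3$1$1 * g3$2$2 = 1"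
    using d by (simp_all add: det_3 det_2 g algebra_simps)
  have c: "(g1$3$3 * g2$3$3 * g3$2$2) ^ 6 = 1"
    using chi by (simp add: beta49_props block_char_simps powi_inverse[OF e(1)] inverse_unique[OF e(1)] powi_inverse[OF e(2)] inverse_unique[OF e(2)] powi_inverse[OF e(3)] inverse_unique[OF e(3)])
      (simp add: power_mult_distrib eval_nat_numeral ac_simps)
  have "act (g1, g2, g3) x $ (3, 3, 2) = (g1$3$3 * g2$3$3 * g3$2$2) * (x $ (3, 3, 2))"
    by (simp add: sum_3 sum_2 g x0)
  then show "(act (g1, g2, g3) x $ (3, 3, 2)) ^ 6 = (x $ (3, 3, 2)) ^ 6"
    by (rule pow_semi_invariant[OF _ c])
qed simp

lemma beta47_nwt: "beta47 = (1 / real 6) *\<^sub>R nwt [-2, -2, 4] [-2, 1, 1] [0, 0]"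
  by (simp add: beta47_def nwt_def mk_wt_def vec_eq_iff forall_3 forall_2)

lemmas beta47_props = nwt_props[of 6 "-2" "-2" "4" "-2" "1" "1" "0" "0", folded beta47_nwt, simplified]

text \<open>A point of \<open>Z_space\<close> is a 2 by 2 matrix in the last two indices; the
  invariant is a power of its determinant.\<close>

lemma beta47_ss: "tens01 {(3, 2, 1), (3, 3, 2)} \<in> explicit_ss beta47"
proof (rule explicit_ssI)
  show "tens01 {(3, 2, 1), (3, 3, 2)} \<in> (Z_space beta47 :: 'a tens set)"
    by (simp add: beta47_props forall_3 forall_2 tens01_def)
  \<comment> \<open>The degree stays unevaluated so that it unifies with the rules for powers,
    differences and products.\<close>
  show "homogeneous tens_coords (3 * (1 + 1)) (\<lambda>x :: 'a tens. (x $ (3, 2, 1) * x $ (3, 3, 2) - x $ (3, 2, 2) * x $ (3, 3, 1)) ^ 3)"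
    by (intro homogeneous_pow homogeneous_diff homogeneous.mult homogeneous_tens)
  show "((tens01 {(3, 2, 1), (3, 3, 2)} $ (3, 2, 1) * tens01 {(3, 2, 1), (3, 3, 2)} $ (3, 3, 2) - tens01 {(3, 2, 1), (3, 3, 2)} $ (3, 2, 2) * tens01 {(3, 2, 1), (3, 3, 2)} $ (3, 3, 1)) ^ 3) \<noteq> (0 :: 'a)" by (simp add: tens01_def)
  fix g1 g2 :: "'a^3^3" and g3 :: "'a^2^2" and x :: "'a tens"
  assume M: "(g1, g2, g3) \<in> M_grp beta47" and d: "det g1 = 1" "det g2 = 1" "det g3 = 1"
    and chi: "chi beta47 (g1, g2, g3) = 1" and x: "x \<in> Z_space beta47"
  have g: "g1$1$3 = 0" "g1$2$3 = 0" "g1$3$1 = 0" "g1$3$2 = 0" "g2$1$2 = 0" "g2$1$3 = 0" "g2$2$1 = 0" "g2$3$1 = 0"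
    using M by (simp_all add: beta47_props block_diag_def forall_3 forall_2)
  have x0: "x $ (1, 1, 1) = 0" "x $ (1, 1, 2) = 0" "x $ (1, 2, 1) = 0" "x $ (1, 2, 2) = 0" "x $ (1, 3, 1) = 0" "x $ (1, 3, 2) = 0" "x $ (2, 1, 1) = 0" "x $ (2, 1, 2) = 0" "x $ (2, 2, 1) = 0" "x $ (2, 2, 2) = 0" "x $ (2, 3, 1) = 0" "x $ (2, 3, 2) = 0" "x $ (3, 1, 1) = 0" "x $ (3, 1, 2) = 0"
    using x by (simp_all add: beta47_props forall_3 forall_2)
  have e: "(g1$1$1 * g1$2$2 - g1$1$2 * g1$2$1) * g1$3$3 = 1" "g2$1$1 * (g2$2$2 * g2$3$3 - g2$2$3 * g2$3$2) = 1" "det g3 = 1"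
    using d by (simp_all add: det_3 det_2 g algebra_simps)
  have c: "(g1$3$3 ^ 2 * (g2$2$2 * g2$3$3 - g2$2$3 * g2$3$2)) ^ 3 = 1"
    using chi by (simp add: beta47_props block_char_simps powi_inverse[OF e(1)] inverse_unique[OF e(1)] powi_inverse[OF e(2)] inverse_unique[OF e(2)])
      (simp add: power_mult_distrib eval_nat_numeral ac_simps)
  have "act (g1, g2, g3) x $ (3, 2, 1) * act (g1, g2, g3) x $ (3, 3, 2) - act (g1, g2, g3) x $ (3, 2, 2) * act (g1, g2, g3) x $ (3, 3, 1) = g1$3$3 ^ 2 * (g2$2$2 * g2$3$3 - g2$2$3 * g2$3$2) * det g3 * (x $ (3, 2, 1) * x $ (3, 3, 2) - x $ (3, 2, 2) * x $ (3, 3, 1))"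
    by (simp add: sum_3 sum_2 g x0 det_2 power2_eq_square algebra_simps)
  then have "act (g1, g2, g3) x $ (3, 2, 1) * act (g1, g2, g3) x $ (3, 3, 2) - act (g1, g2, g3) x $ (3, 2, 2) * act (g1, g2, g3) x $ (3, 3, 1) = (g1$3$3 ^ 2 * (g2$2$2 * g2$3$3 - g2$2$3 * g2$3$2)) * (x $ (3, 2, 1) * x $ (3, 3, 2) - x $ (3, 2, 2) * x $ (3, 3, 1))" using e by simp
  then show "(act (g1, g2, g3) x $ (3, 2, 1) * act (g1, g2, g3) x $ (3, 3, 2) - act (g1, g2, g3) x $ (3, 2, 2) * act (g1, g2, g3) x $ (3, 3, 1)) ^ 3 = (x $ (3, 2, 1) * x $ (3, 3, 2) - x $ (3, 2, 2) * x $ (3, 3, 1)) ^ 3"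
    by (rule pow_semi_invariant[OF _ c])
qed simp

lemma beta45_nwt: "beta45 = (1 / real 6) *\<^sub>R nwt [-2, 1, 1] [-2, 1, 1] [-3, 3]"
  by (simp add: beta45_def nwt_def mk_wt_def vec_eq_iff forall_3 forall_2)

lemmas beta45_props = nwt_props[of 6 "-2" "1" "1" "-2" "1" "1" "-3" "3", folded beta45_nwt, simplified]

text \<open>A point of \<open>Z_space\<close> is a 2 by 2 matrix in the first two indices, on which
  both Levi blocks act; again the determinant is used.\<close>

lemma beta45_ss: "tens01 {(2, 2, 2), (3, 3, 2)} \<in> explicit_ss beta45"
proof (rule explicit_ssI)
  show "tens01 {(2, 2, 2), (3, 3, 2)} \<in> (Z_space beta45 :: 'a tens set)"
    by (simp add: beta45_props forall_3 forall_2 tens01_def)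
  show "homogeneous tens_coords (3 * (1 + 1)) (\<lambda>x :: 'a tens. (x $ (2, 2, 2) * x $ (3, 3, 2) - x $ (2, 3, 2) * x $ (3, 2, 2)) ^ 3)"
    by (intro homogeneous_pow homogeneous_diff homogeneous.mult homogeneous_tens)
  show "((tens01 {(2, 2, 2), (3, 3, 2)} $ (2, 2, 2) * tens01 {(2, 2, 2), (3, 3, 2)} $ (3, 3, 2) - tens01 {(2, 2, 2), (3, 3, 2)} $ (2, 3, 2) * tens01 {(2, 2, 2), (3, 3, 2)} $ (3, 2, 2)) ^ 3) \<noteq> (0 :: 'a)" by (simp add: tens01_def)
  fix g1 g2 :: "'a^3^3" and g3 :: "'a^2^2" and x :: "'a tens"
  assume M: "(g1, g2, g3) \<in> M_grp beta45" and d: "det g1 = 1" "det g2 = 1" "det g3 = 1"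
    and chi: "chi beta45 (g1, g2, g3) = 1" and x: "x \<in> Z_space beta45"
  have g: "g1$1$2 = 0" "g1$1$3 = 0" "g1$2$1 = 0" "g1$3$1 = 0" "g2$1$2 = 0" "g2$1$3 = 0" "g2$2$1 = 0" "g2$3$1 = 0" "g3$1$2 = 0" "g3$2$1 = 0"
    using M by (simp_all add: beta45_props block_diag_def forall_3 forall_2)
  have x0: "x $ (1, 1, 1) = 0" "x $ (1, 1, 2) = 0" "x $ (1, 2, 1) = 0" "x $ (1, 2, 2) = 0" "x $ (1, 3, 1) = 0" "x $ (1, 3, 2) = 0" "x $ (2, 1, 1) = 0" "x $ (2, 1, 2) = 0" "x $ (2, 2, 1) = 0" "x $ (2, 3, 1) = 0" "x $ (3, 1, 1) = 0" "x $ (3, 1, 2) = 0" "x $ (3, 2, 1) = 0" "x $ (3, 3, 1) = 0"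
    using x by (simp_all add: beta45_props forall_3 forall_2)
  have e: "g1$1$1 * (g1$2$2 * g1$3$3 - g1$2$3 * g1$3$2) = 1" "g2$1$1 * (g2$2$2 * g2$3$3 - g2$2$3 * g2$3$2) = 1" "g3$1$1 * g3$2$2 = 1"
    using d by (simp_all add: det_3 det_2 g algebra_simps)
  have c: "((g1$2$2 * g1$3$3 - g1$2$3 * g1$3$2) * (g2$2$2 * g2$3$3 - g2$2$3 * g2$3$2) * g3$2$2 ^ 2) ^ 3 = 1"
    using chi by (simp add: beta45_props block_char_simps powi_inverse[OF e(1)] inverse_unique[OF e(1)] powi_inverse[OF e(2)] inverse_unique[OF e(2)] powi_inverse[OF e(3)] inverse_unique[OF e(3)])
      (simp add: power_mult_distrib eval_nat_numeral ac_simps)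
  have "act (g1, g2, g3) x $ (2, 2, 2) * act (g1, g2, g3) x $ (3, 3, 2) - act (g1, g2, g3) x $ (2, 3, 2) * act (g1, g2, g3) x $ (3, 2, 2) = ((g1$2$2 * g1$3$3 - g1$2$3 * g1$3$2) * (g2$2$2 * g2$3$3 - g2$2$3 * g2$3$2) * g3$2$2 ^ 2) * (x $ (2, 2, 2) * x $ (3, 3, 2) - x $ (2, 3, 2) * x $ (3, 2, 2))"
    by (simp add: sum_3 sum_2 g x0 power2_eq_square algebra_simps)
  then show "(act (g1, g2, g3) x $ (2, 2, 2) * act (g1, g2, g3) x $ (3, 3, 2) - act (g1, g2, g3) x $ (2, 3, 2) * act (g1, g2, g3) x $ (3, 2, 2)) ^ 3 = (x $ (2, 2, 2) * x $ (3, 3, 2) - x $ (2, 3, 2) * x $ (3, 2, 2)) ^ 3"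
    by (rule pow_semi_invariant[OF _ c])
qed simp

lemma beta39_nwt: "beta39 = (1 / real 6) *\<^sub>R nwt [-2, 0, 2] [-2, 0, 2] [-1, 1]"
  by (simp add: beta39_def nwt_def mk_wt_def vec_eq_iff forall_3 forall_2)

lemmas beta39_props = nwt_props[of 6 "-2" "0" "2" "-2" "0" "2" "-1" "1", folded beta39_nwt, simplified]

text \<open>The Levi subgroup is a torus, so a monomial is sought. Its exponents are proportional to
  the coefficients of \<beta> as a convex combination of the weights, here 1/3 each.\<close>

lemma beta39_ss: "tens01 {(3, 3, 1), (2, 3, 2), (3, 2, 2)} \<in> explicit_ss beta39"
proof (rule explicit_ssI)
  show "tens01 {(3, 3, 1), (2, 3, 2), (3, 2, 2)} \<in> (Z_space beta39 :: 'a tens set)"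
    by (simp add: beta39_props forall_3 forall_2 tens01_def)
  show "homogeneous tens_coords (2 * (1 + 1 + 1)) (\<lambda>x :: 'a tens. (x $ (3, 3, 1) * x $ (2, 3, 2) * x $ (3, 2, 2)) ^ 2)"
    by (intro homogeneous_pow homogeneous_diff homogeneous.mult homogeneous_tens)
  show "((tens01 {(3, 3, 1), (2, 3, 2), (3, 2, 2)} $ (3, 3, 1) * tens01 {(3, 3, 1), (2, 3, 2), (3, 2, 2)} $ (2, 3, 2) * tens01 {(3, 3, 1), (2, 3, 2), (3, 2, 2)} $ (3, 2, 2)) ^ 2) \<noteq> (0 :: 'a)" by (simp add: tens01_def)
  fix g1 g2 :: "'a^3^3" and g3 :: "'a^2^2" and x :: "'a tens"
  assume M: "(g1, g2, g3) \<in> M_grp beta39" and d: "det g1 = 1" "det g2 = 1" "det g3 = 1"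
    and chi: "chi beta39 (g1, g2, g3) = 1" and x: "x \<in> Z_space beta39"
  have g: "g1$1$2 = 0" "g1$1$3 = 0" "g1$2$1 = 0" "g1$2$3 = 0" "g1$3$1 = 0" "g1$3$2 = 0" "g2$1$2 = 0" "g2$1$3 = 0" "g2$2$1 = 0" "g2$2$3 = 0" "g2$3$1 = 0" "g2$3$2 = 0" "g3$1$2 = 0" "g3$2$1 = 0"
    using M by (simp_all add: beta39_props block_diag_def forall_3 forall_2)
  have x0: "x $ (1, 1, 1) = 0" "x $ (1, 1, 2) = 0" "x $ (1, 2, 1) = 0" "x $ (1, 2, 2) = 0" "x $ (1, 3, 1) = 0" "x $ (1, 3, 2) = 0" "x $ (2, 1, 1) = 0" "x $ (2, 1, 2) = 0" "x $ (2, 2, 1) = 0" "x $ (2, 2, 2) = 0" "x $ (2, 3, 1) = 0" "x $ (3, 1, 1) = 0" "x $ (3, 1, 2) = 0" "x $ (3, 2, 1) = 0" "x $ (3, 3, 2) = 0"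
    using x by (simp_all add: beta39_props forall_3 forall_2)
  have e: "g1$1$1 * (g1$2$2 * g1$3$3) = 1" "g2$1$1 * (g2$2$2 * g2$3$3) = 1" "g3$1$1 * g3$2$2 = 1"
    using d by (simp_all add: det_3 det_2 g algebra_simps)
  have c: "(g1$2$2 * g1$3$3 ^ 2 * g2$2$2 * g2$3$3 ^ 2 * g3$2$2) ^ 2 = 1"
    using chi by (simp add: beta39_props block_char_simps powi_inverse[OF e(1)] inverse_unique[OF e(1)] powi_inverse[OF e(2)] inverse_unique[OF e(2)] powi_inverse[OF e(3)] inverse_unique[OF e(3)])
      (simp add: power_mult_distrib eval_nat_numeral ac_simps)
  have "act (g1, g2, g3) x $ (3, 3, 1) * act (g1, g2, g3) x $ (2, 3, 2) * act (g1, g2, g3) x $ (3, 2, 2) = (g3$1$1 * g3$2$2) * (g1$2$2 * g1$3$3 ^ 2 * g2$2$2 * g2$3$3 ^ 2 * g3$2$2) * (x $ (3, 3, 1) * x $ (2, 3, 2) * x $ (3, 2, 2))"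
    by (simp add: sum_3 sum_2 g x0 power_mult_distrib, (simp add: eval_nat_numeral ac_simps)?)
  also have "(g3$1$1 * g3$2$2) = 1" by (simp add: e)
  finally have "act (g1, g2, g3) x $ (3, 3, 1) * act (g1, g2, g3) x $ (2, 3, 2) * act (g1, g2, g3) x $ (3, 2, 2) = (g1$2$2 * g1$3$3 ^ 2 * g2$2$2 * g2$3$3 ^ 2 * g3$2$2) * (x $ (3, 3, 1) * x $ (2, 3, 2) * x $ (3, 2, 2))" by simp
  then show "(act (g1, g2, g3) x $ (3, 3, 1) * act (g1, g2, g3) x $ (2, 3, 2) * act (g1, g2, g3) x $ (3, 2, 2)) ^ 2 = (x $ (3, 3, 1) * x $ (2, 3, 2) * x $ (3, 2, 2)) ^ 2"
    by (rule pow_semi_invariant[OF _ c])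
qed simp

lemma beta28_nwt: "beta28 = (1 / real 6) *\<^sub>R nwt [-1, 0, 1] [-1, 0, 1] [-1, 1]"
  by (simp add: beta28_def nwt_def mk_wt_def vec_eq_iff forall_3 forall_2)

lemmas beta28_props = nwt_props[of 6 "-1" "0" "1" "-1" "0" "1" "-1" "1", folded beta28_nwt, simplified]

text \<open>A torus again: \<beta> is the combination of the weights of (3,3,1), (1,3,2), (3,1,2),
  (2,2,2) with coefficients 2/6, 1/6, 1/6, 2/6, which are the exponents up to scale.\<close>

lemma beta28_ss: "tens01 {(3, 3, 1), (1, 3, 2), (2, 2, 2), (3, 1, 2)} \<in> explicit_ss beta28"
proof (rule explicit_ssI)
  show "tens01 {(3, 3, 1), (1, 3, 2), (2, 2, 2), (3, 1, 2)} \<in> (Z_space beta28 :: 'a tens set)"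
    by (simp add: beta28_props forall_3 forall_2 tens01_def)
  show "homogeneous tens_coords (2 * 1 + 1 + 1 + 2 * 1) (\<lambda>x :: 'a tens. x $ (3, 3, 1) ^ 2 * x $ (1, 3, 2) * x $ (3, 1, 2) * x $ (2, 2, 2) ^ 2)"
    by (intro homogeneous_pow homogeneous_diff homogeneous.mult homogeneous_tens)
  show "(tens01 {(3, 3, 1), (1, 3, 2), (2, 2, 2), (3, 1, 2)} $ (3, 3, 1) ^ 2 * tens01 {(3, 3, 1), (1, 3, 2), (2, 2, 2), (3, 1, 2)} $ (1, 3, 2) * tens01 {(3, 3, 1), (1, 3, 2), (2, 2, 2), (3, 1, 2)} $ (3, 1, 2) * tens01 {(3, 3, 1), (1, 3, 2), (2, 2, 2), (3, 1, 2)} $ (2, 2, 2) ^ 2) \<noteq> (0 :: 'a)" by (simp add: tens01_def)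
  fix g1 g2 :: "'a^3^3" and g3 :: "'a^2^2" and x :: "'a tens"
  assume M: "(g1, g2, g3) \<in> M_grp beta28" and d: "det g1 = 1" "det g2 = 1" "det g3 = 1"
    and chi: "chi beta28 (g1, g2, g3) = 1" and x: "x \<in> Z_space beta28"
  have g: "g1$1$2 = 0" "g1$1$3 = 0" "g1$2$1 = 0" "g1$2$3 = 0" "g1$3$1 = 0" "g1$3$2 = 0" "g2$1$2 = 0" "g2$1$3 = 0" "g2$2$1 = 0" "g2$2$3 = 0" "g2$3$1 = 0" "g2$3$2 = 0" "g3$1$2 = 0" "g3$2$1 = 0"
    using M by (simp_all add: beta28_props block_diag_def forall_3 forall_2)
  have x0: "x $ (1, 1, 1) = 0" "x $ (1, 1, 2) = 0" "x $ (1, 2, 1) = 0" "x $ (1, 2, 2) = 0" "x $ (1, 3, 1) = 0" "x $ (2, 1, 1) = 0" "x $ (2, 1, 2) = 0" "x $ (2, 2, 1) = 0" "x $ (2, 3, 1) = 0" "x $ (2, 3, 2) = 0" "x $ (3, 1, 1) = 0" "x $ (3, 2, 1) = 0" "x $ (3, 2, 2) = 0" "x $ (3, 3, 2) = 0"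
    using x by (simp_all add: beta28_props forall_3 forall_2)
  have e: "g1$1$1 * (g1$2$2 * g1$3$3) = 1" "g2$1$1 * (g2$2$2 * g2$3$3) = 1" "g3$1$1 * g3$2$2 = 1"
    using d by (simp_all add: det_3 det_2 g algebra_simps)
  have c: "(g1$2$2 * g1$3$3 ^ 2 * g2$2$2 * g2$3$3 ^ 2 * g3$2$2 ^ 2) = 1"
    using chi by (simp add: beta28_props block_char_simps powi_inverse[OF e(1)] inverse_unique[OF e(1)] powi_inverse[OF e(2)] inverse_unique[OF e(2)] powi_inverse[OF e(3)] inverse_unique[OF e(3)])
      (simp add: power_mult_distrib eval_nat_numeral ac_simps)
  have "act (g1, g2, g3) x $ (3, 3, 1) ^ 2 * act (g1, g2, g3) x $ (1, 3, 2) * act (g1, g2, g3) x $ (3, 1, 2) * act (g1, g2, g3) x $ (2, 2, 2) ^ 2 = (g1$1$1 * (g1$2$2 * g1$3$3)) * (g2$1$1 * (g2$2$2 * g2$3$3)) * (g3$1$1 * g3$2$2) ^ 2 * (g1$2$2 * g1$3$3 ^ 2 * g2$2$2 * g2$3$3 ^ 2 * g3$2$2 ^ 2) * (x $ (3, 3, 1) ^ 2 * x $ (1, 3, 2) * x $ (3, 1, 2) * x $ (2, 2, 2) ^ 2)"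
    by (simp add: sum_3 sum_2 g x0 power_mult_distrib, (simp add: eval_nat_numeral ac_simps)?)
  also have "(g1$1$1 * (g1$2$2 * g1$3$3)) * (g2$1$1 * (g2$2$2 * g2$3$3)) * (g3$1$1 * g3$2$2) ^ 2 = 1" by (simp add: e)
  finally have "act (g1, g2, g3) x $ (3, 3, 1) ^ 2 * act (g1, g2, g3) x $ (1, 3, 2) * act (g1, g2, g3) x $ (3, 1, 2) * act (g1, g2, g3) x $ (2, 2, 2) ^ 2 = (g1$2$2 * g1$3$3 ^ 2 * g2$2$2 * g2$3$3 ^ 2 * g3$2$2 ^ 2) * (x $ (3, 3, 1) ^ 2 * x $ (1, 3, 2) * x $ (3, 1, 2) * x $ (2, 2, 2) ^ 2)" by simp
  then show "act (g1, g2, g3) x $ (3, 3, 1) ^ 2 * act (g1, g2, g3) x $ (1, 3, 2) * act (g1, g2, g3) x $ (3, 1, 2) * act (g1, g2, g3) x $ (2, 2, 2) ^ 2 = x $ (3, 3, 1) ^ 2 * x $ (1, 3, 2) * x $ (3, 1, 2) * x $ (2, 2, 2) ^ 2"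
    by (simp only: c mult_1)
qed simp

lemma beta11_nwt: "beta11 = (1 / real 18) *\<^sub>R nwt [-2, 0, 2] [-2, 0, 2] [-1, 1]"
  by (simp add: beta11_def nwt_def mk_wt_def vec_eq_iff forall_3 forall_2)

lemmas beta11_props = nwt_props[of 18 "-2" "0" "2" "-2" "0" "2" "-1" "1", folded beta11_nwt, simplified]

text \<open>The weights of (3,2,1), (2,3,1), (1,3,2), (3,1,2) have coefficient 2/9 in \<beta> and
  that of (2,2,2) has 1/9, whence the exponents. The outer square is due to \<open>chi\<close> being
  a square on determinant-one elements.\<close>

lemma beta11_ss: "tens01 {(3, 2, 1), (2, 3, 1), (1, 3, 2), (2, 2, 2), (3, 1, 2)} \<in> explicit_ss beta11"
proof (rule explicit_ssI)
  show "tens01 {(3, 2, 1), (2, 3, 1), (1, 3, 2), (2, 2, 2), (3, 1, 2)} \<in> (Z_space beta11 :: 'a tens set)"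
    by (simp add: beta11_props forall_3 forall_2 tens01_def)
  show "homogeneous tens_coords (2 * (2 * (1 + 1) + 2 * (1 + 1) + 1)) (\<lambda>x :: 'a tens. ((x $ (3, 2, 1) * x $ (2, 3, 1)) ^ 2 * (x $ (1, 3, 2) * x $ (3, 1, 2)) ^ 2 * x $ (2, 2, 2)) ^ 2)"
    by (intro homogeneous_pow homogeneous_diff homogeneous.mult homogeneous_tens)
  show "(((tens01 {(3, 2, 1), (2, 3, 1), (1, 3, 2), (2, 2, 2), (3, 1, 2)} $ (3, 2, 1) * tens01 {(3, 2, 1), (2, 3, 1), (1, 3, 2), (2, 2, 2), (3, 1, 2)} $ (2, 3, 1)) ^ 2 * (tens01 {(3, 2, 1), (2, 3, 1), (1, 3, 2), (2, 2, 2), (3, 1, 2)} $ (1, 3, 2) * tens01 {(3, 2, 1), (2, 3, 1), (1, 3, 2), (2, 2, 2), (3, 1, 2)} $ (3, 1, 2)) ^ 2 * tens01 {(3, 2, 1), (2, 3, 1), (1, 3, 2), (2, 2, 2), (3, 1, 2)} $ (2, 2, 2)) ^ 2) \<noteq> (0 :: 'a)" by (simp add: tens01_def)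
  fix g1 g2 :: "'a^3^3" and g3 :: "'a^2^2" and x :: "'a tens"
  assume M: "(g1, g2, g3) \<in> M_grp beta11" and d: "det g1 = 1" "det g2 = 1" "det g3 = 1"
    and chi: "chi beta11 (g1, g2, g3) = 1" and x: "x \<in> Z_space beta11"
  have g: "g1$1$2 = 0" "g1$1$3 = 0" "g1$2$1 = 0" "g1$2$3 = 0" "g1$3$1 = 0" "g1$3$2 = 0" "g2$1$2 = 0" "g2$1$3 = 0" "g2$2$1 = 0" "g2$2$3 = 0" "g2$3$1 = 0" "g2$3$2 = 0" "g3$1$2 = 0" "g3$2$1 = 0"
    using M by (simp_all add: beta11_props block_diag_def forall_3 forall_2)
  have x0: "x $ (1, 1, 1) = 0" "x $ (1, 1, 2) = 0" "x $ (1, 2, 1) = 0" "x $ (1, 2, 2) = 0" "x $ (1, 3, 1) = 0" "x $ (2, 1, 1) = 0" "x $ (2, 1, 2) = 0" "x $ (2, 2, 1) = 0" "x $ (2, 3, 2) = 0" "x $ (3, 1, 1) = 0" "x $ (3, 2, 2) = 0" "x $ (3, 3, 1) = 0" "x $ (3, 3, 2) = 0"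
    using x by (simp_all add: beta11_props forall_3 forall_2)
  have e: "g1$1$1 * (g1$2$2 * g1$3$3) = 1" "g2$1$1 * (g2$2$2 * g2$3$3) = 1" "g3$1$1 * g3$2$2 = 1"
    using d by (simp_all add: det_3 det_2 g algebra_simps)
  have c: "(g1$2$2 * g1$3$3 ^ 2 * g2$2$2 * g2$3$3 ^ 2 * g3$2$2) ^ 2 = 1"
    using chi by (simp add: beta11_props block_char_simps powi_inverse[OF e(1)] inverse_unique[OF e(1)] powi_inverse[OF e(2)] inverse_unique[OF e(2)] powi_inverse[OF e(3)] inverse_unique[OF e(3)])
      (simp add: power_mult_distrib eval_nat_numeral ac_simps)
  have "(act (g1, g2, g3) x $ (3, 2, 1) * act (g1, g2, g3) x $ (2, 3, 1)) ^ 2 * (act (g1, g2, g3) x $ (1, 3, 2) * act (g1, g2, g3) x $ (3, 1, 2)) ^ 2 * act (g1, g2, g3) x $ (2, 2, 2) = (g1$1$1 * (g1$2$2 * g1$3$3)) ^ 2 * (g2$1$1 * (g2$2$2 * g2$3$3)) ^ 2 * (g3$1$1 * g3$2$2) ^ 4 * (g1$2$2 * g1$3$3 ^ 2 * g2$2$2 * g2$3$3 ^ 2 * g3$2$2) * ((x $ (3, 2, 1) * x $ (2, 3, 1)) ^ 2 * (x $ (1, 3, 2) * x $ (3, 1, 2)) ^ 2 * x $ (2, 2, 2))"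
    by (simp add: sum_3 sum_2 g x0 power_mult_distrib, (simp add: eval_nat_numeral ac_simps)?)
  also have "(g1$1$1 * (g1$2$2 * g1$3$3)) ^ 2 * (g2$1$1 * (g2$2$2 * g2$3$3)) ^ 2 * (g3$1$1 * g3$2$2) ^ 4 = 1" by (simp add: e)
  finally have "(act (g1, g2, g3) x $ (3, 2, 1) * act (g1, g2, g3) x $ (2, 3, 1)) ^ 2 * (act (g1, g2, g3) x $ (1, 3, 2) * act (g1, g2, g3) x $ (3, 1, 2)) ^ 2 * act (g1, g2, g3) x $ (2, 2, 2) = (g1$2$2 * g1$3$3 ^ 2 * g2$2$2 * g2$3$3 ^ 2 * g3$2$2) * ((x $ (3, 2, 1) * x $ (2, 3, 1)) ^ 2 * (x $ (1, 3, 2) * x $ (3, 1, 2)) ^ 2 * x $ (2, 2, 2))" by simp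
  then show "((act (g1, g2, g3) x $ (3, 2, 1) * act (g1, g2, g3) x $ (2, 3, 1)) ^ 2 * (act (g1, g2, g3) x $ (1, 3, 2) * act (g1, g2, g3) x $ (3, 1, 2)) ^ 2 * act (g1, g2, g3) x $ (2, 2, 2)) ^ 2 = ((x $ (3, 2, 1) * x $ (2, 3, 1)) ^ 2 * (x $ (1, 3, 2) * x $ (3, 1, 2)) ^ 2 * x $ (2, 2, 2)) ^ 2"
    by (rule pow_semi_invariant[OF _ c])
qed simp

lemma beta22_nwt: "beta22 = (1 / real 12) *\<^sub>R nwt [-1, -1, 2] [-1, -1, 2] [0, 0]"
  by (simp add: beta22_def nwt_def mk_wt_def vec_eq_iff forall_3 forall_2)

lemmas beta22_props = nwt_props[of 12 "-1" "-1" "2" "-1" "-1" "2" "0" "0", folded beta22_nwt, simplified]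

text \<open>\<open>Z_space\<close> is a pair of 2 by 2 matrices. The multiplier of either
  determinant alone has infinite order on the group in question; that of the product is
  \<open>g1$3$3 * g2$3$3\<close>, whose cube is the character.\<close>

lemma beta22_ss: "tens01 {(1, 3, 1), (3, 1, 1), (2, 3, 2), (3, 2, 2)} \<in> explicit_ss beta22"
proof (rule explicit_ssI)
  show "tens01 {(1, 3, 1), (3, 1, 1), (2, 3, 2), (3, 2, 2)} \<in> (Z_space beta22 :: 'a tens set)"
    by (simp add: beta22_props forall_3 forall_2 tens01_def)
  show "homogeneous tens_coords (3 * (1 + 1 + (1 + 1))) (\<lambda>x :: 'a tens. ((x $ (1, 3, 1) * x $ (2, 3, 2) - x $ (1, 3, 2) * x $ (2, 3, 1)) * (x $ (3, 1, 1) * x $ (3, 2, 2) - x $ (3, 1, 2) * x $ (3, 2, 1))) ^ 3)"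
    by (intro homogeneous_pow homogeneous_diff homogeneous.mult homogeneous_tens)
  show "(((tens01 {(1, 3, 1), (3, 1, 1), (2, 3, 2), (3, 2, 2)} $ (1, 3, 1) * tens01 {(1, 3, 1), (3, 1, 1), (2, 3, 2), (3, 2, 2)} $ (2, 3, 2) - tens01 {(1, 3, 1), (3, 1, 1), (2, 3, 2), (3, 2, 2)} $ (1, 3, 2) * tens01 {(1, 3, 1), (3, 1, 1), (2, 3, 2), (3, 2, 2)} $ (2, 3, 1)) * (tens01 {(1, 3, 1), (3, 1, 1), (2, 3, 2), (3, 2, 2)} $ (3, 1, 1) * tens01 {(1, 3, 1), (3, 1, 1), (2, 3, 2), (3, 2, 2)} $ (3, 2, 2) - tens01 {(1, 3, 1), (3, 1, 1), (2, 3, 2), (3, 2, 2)} $ (3, 1, 2) * tens01 {(1, 3, 1), (3, 1, 1), (2, 3, 2), (3, 2, 2)} $ (3, 2, 1))) ^ 3) \<noteq> (0 :: 'a)" by (simp add: tens01_def)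
  fix g1 g2 :: "'a^3^3" and g3 :: "'a^2^2" and x :: "'a tens"
  assume M: "(g1, g2, g3) \<in> M_grp beta22" and d: "det g1 = 1" "det g2 = 1" "det g3 = 1"
    and chi: "chi beta22 (g1, g2, g3) = 1" and x: "x \<in> Z_space beta22"
  have g: "g1$1$3 = 0" "g1$2$3 = 0" "g1$3$1 = 0" "g1$3$2 = 0" "g2$1$3 = 0" "g2$2$3 = 0" "g2$3$1 = 0" "g2$3$2 = 0"
    using M by (simp_all add: beta22_props block_diag_def forall_3 forall_2)
  have x0: "x $ (1, 1, 1) = 0" "x $ (1, 1, 2) = 0" "x $ (1, 2, 1) = 0" "x $ (1, 2, 2) = 0" "x $ (2, 1, 1) = 0" "x $ (2, 1, 2) = 0" "x $ (2, 2, 1) = 0" "x $ (2, 2, 2) = 0" "x $ (3, 3, 1) = 0" "x $ (3, 3, 2) = 0"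
    using x by (simp_all add: beta22_props forall_3 forall_2)
  have e: "(g1$1$1 * g1$2$2 - g1$1$2 * g1$2$1) * g1$3$3 = 1" "(g2$1$1 * g2$2$2 - g2$1$2 * g2$2$1) * g2$3$3 = 1" "det g3 = 1"
    using d by (simp_all add: det_3 det_2 g algebra_simps)
  have c: "(g1$3$3 * g2$3$3) ^ 3 = 1"
    using chi by (simp add: beta22_props block_char_simps powi_inverse[OF e(1)] inverse_unique[OF e(1)] powi_inverse[OF e(2)] inverse_unique[OF e(2)])
      (simp add: power_mult_distrib eval_nat_numeral ac_simps)
  let ?X = "act (g1, g2, g3) x"
  have 1: "?X $ (1, 3, 1) * ?X $ (2, 3, 2) - ?X $ (1, 3, 2) * ?X $ (2, 3, 1) =
      g2$3$3 ^ 2 * (g1$1$1 * g1$2$2 - g1$1$2 * g1$2$1) * det g3 * (x $ (1, 3, 1) * x $ (2, 3, 2) - x $ (1, 3, 2) * x $ (2, 3, 1))"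
    by (simp add: sum_3 sum_2 g x0 det_2 power2_eq_square algebra_simps)
  have 2: "?X $ (3, 1, 1) * ?X $ (3, 2, 2) - ?X $ (3, 1, 2) * ?X $ (3, 2, 1) =
      g1$3$3 ^ 2 * (g2$1$1 * g2$2$2 - g2$1$2 * g2$2$1) * det g3 * (x $ (3, 1, 1) * x $ (3, 2, 2) - x $ (3, 1, 2) * x $ (3, 2, 1))"
    by (simp add: sum_3 sum_2 g x0 det_2 power2_eq_square algebra_simps)
  have "(act (g1, g2, g3) x $ (1, 3, 1) * act (g1, g2, g3) x $ (2, 3, 2) - act (g1, g2, g3) x $ (1, 3, 2) * act (g1, g2, g3) x $ (2, 3, 1)) * (act (g1, g2, g3) x $ (3, 1, 1) * act (g1, g2, g3) x $ (3, 2, 2) - act (g1, g2, g3) x $ (3, 1, 2) * act (g1, g2, g3) x $ (3, 2, 1)) = ((g1$1$1 * g1$2$2 - g1$1$2 * g1$2$1) * g1$3$3) * ((g2$1$1 * g2$2$2 - g2$1$2 * g2$2$1) * g2$3$3) * (g1$3$3 * g2$3$3) * ((x $ (1, 3, 1) * x $ (2, 3, 2) - x $ (1, 3, 2) * x $ (2, 3, 1)) * (x $ (3, 1, 1) * x $ (3, 2, 2) - x $ (3, 1, 2) * x $ (3, 2, 1)))"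
    unfolding 1 2 e(3) by (simp only: power2_eq_square ac_simps mult_1)
  then have "(act (g1, g2, g3) x $ (1, 3, 1) * act (g1, g2, g3) x $ (2, 3, 2) - act (g1, g2, g3) x $ (1, 3, 2) * act (g1, g2, g3) x $ (2, 3, 1)) * (act (g1, g2, g3) x $ (3, 1, 1) * act (g1, g2, g3) x $ (3, 2, 2) - act (g1, g2, g3) x $ (3, 1, 2) * act (g1, g2, g3) x $ (3, 2, 1)) = (g1$3$3 * g2$3$3) * ((x $ (1, 3, 1) * x $ (2, 3, 2) - x $ (1, 3, 2) * x $ (2, 3, 1)) * (x $ (3, 1, 1) * x $ (3, 2, 2) - x $ (3, 1, 2) * x $ (3, 2, 1)))" unfolding e by simp
  then show "((act (g1, g2, g3) x $ (1, 3, 1) * act (g1, g2, g3) x $ (2, 3, 2) - act (g1, g2, g3) x $ (1, 3, 2) * act (g1, g2, g3) x $ (2, 3, 1)) * (act (g1, g2, g3) x $ (3, 1, 1) * act (g1, g2, g3) x $ (3, 2, 2) - act (g1, g2, g3) x $ (3, 1, 2) * act (g1, g2, g3) x $ (3, 2, 1))) ^ 3 = ((x $ (1, 3, 1) * x $ (2, 3, 2) - x $ (1, 3, 2) * x $ (2, 3, 1)) * (x $ (3, 1, 1) * x $ (3, 2, 2) - x $ (3, 1, 2) * x $ (3, 2, 1))) ^ 3"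
    by (rule pow_semi_invariant[OF _ c])
qed simp

lemma beta42_nwt: "beta42 = (1 / real 30) *\<^sub>R nwt [-1, -1, 2] [-1, -1, 2] [-3, 3]"
  by (simp add: beta42_def nwt_def mk_wt_def vec_eq_iff forall_3 forall_2)

lemmas beta42_props = nwt_props[of 30 "-1" "-1" "2" "-1" "-1" "2" "-3" "3", folded beta42_nwt, simplified]

text \<open>\<open>Z_space\<close> is a 2 by 2 matrix together with a scalar. The exponents 3 and 4
  reflect \<beta> = 3/10 + 3/10 + 4/10 in the weights of (1,1,2), (2,2,2), (3,3,1).\<close>

lemma beta42_ss: "tens01 {(3, 3, 1), (1, 1, 2), (2, 2, 2)} \<in> explicit_ss beta42"
proof (rule explicit_ssI)
  show "tens01 {(3, 3, 1), (1, 1, 2), (2, 2, 2)} \<in> (Z_space beta42 :: 'a tens set)"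
    by (simp add: beta42_props forall_3 forall_2 tens01_def)
  show "homogeneous tens_coords (3 * (3 * (1 + 1) + 4 * 1)) (\<lambda>x :: 'a tens. ((x $ (1, 1, 2) * x $ (2, 2, 2) - x $ (1, 2, 2) * x $ (2, 1, 2)) ^ 3 * x $ (3, 3, 1) ^ 4) ^ 3)"
    by (intro homogeneous_pow homogeneous_diff homogeneous.mult homogeneous_tens)
  show "(((tens01 {(3, 3, 1), (1, 1, 2), (2, 2, 2)} $ (1, 1, 2) * tens01 {(3, 3, 1), (1, 1, 2), (2, 2, 2)} $ (2, 2, 2) - tens01 {(3, 3, 1), (1, 1, 2), (2, 2, 2)} $ (1, 2, 2) * tens01 {(3, 3, 1), (1, 1, 2), (2, 2, 2)} $ (2, 1, 2)) ^ 3 * tens01 {(3, 3, 1), (1, 1, 2), (2, 2, 2)} $ (3, 3, 1) ^ 4) ^ 3) \<noteq> (0 :: 'a)" by (simp add: tens01_def)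
  fix g1 g2 :: "'a^3^3" and g3 :: "'a^2^2" and x :: "'a tens"
  assume M: "(g1, g2, g3) \<in> M_grp beta42" and d: "det g1 = 1" "det g2 = 1" "det g3 = 1"
    and chi: "chi beta42 (g1, g2, g3) = 1" and x: "x \<in> Z_space beta42"
  have g: "g1$1$3 = 0" "g1$2$3 = 0" "g1$3$1 = 0" "g1$3$2 = 0" "g2$1$3 = 0" "g2$2$3 = 0" "g2$3$1 = 0" "g2$3$2 = 0" "g3$1$2 = 0" "g3$2$1 = 0"
    using M by (simp_all add: beta42_props block_diag_def forall_3 forall_2)
  have x0: "x $ (1, 1, 1) = 0" "x $ (1, 2, 1) = 0" "x $ (1, 3, 1) = 0" "x $ (1, 3, 2) = 0" "x $ (2, 1, 1) = 0" "x $ (2, 2, 1) = 0" "x $ (2, 3, 1) = 0" "x $ (2, 3, 2) = 0" "x $ (3, 1, 1) = 0" "x $ (3, 1, 2) = 0" "x $ (3, 2, 1) = 0" "x $ (3, 2, 2) = 0" "x $ (3, 3, 2) = 0"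
    using x by (simp_all add: beta42_props forall_3 forall_2)
  have e: "(g1$1$1 * g1$2$2 - g1$1$2 * g1$2$1) * g1$3$3 = 1" "(g2$1$1 * g2$2$2 - g2$1$2 * g2$2$1) * g2$3$3 = 1" "g3$1$1 * g3$2$2 = 1"
    using d by (simp_all add: det_3 det_2 g algebra_simps)
  have c: "(g1$3$3 * g2$3$3 * g3$2$2 ^ 2) ^ 3 = 1"
    using chi by (simp add: beta42_props block_char_simps powi_inverse[OF e(1)] inverse_unique[OF e(1)] powi_inverse[OF e(2)] inverse_unique[OF e(2)] powi_inverse[OF e(3)] inverse_unique[OF e(3)])
      (simp add: power_mult_distrib eval_nat_numeral ac_simps)
  let ?X = "act (g1, g2, g3) x"
  have 1: "?X $ (1, 1, 2) * ?X $ (2, 2, 2) - ?X $ (1, 2, 2) * ?X $ (2, 1, 2) =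
      g3$2$2 ^ 2 * (g1$1$1 * g1$2$2 - g1$1$2 * g1$2$1) * (g2$1$1 * g2$2$2 - g2$1$2 * g2$2$1) * (x $ (1, 1, 2) * x $ (2, 2, 2) - x $ (1, 2, 2) * x $ (2, 1, 2))"
    by (simp add: sum_3 sum_2 g x0 power2_eq_square algebra_simps)
  have 2: "?X $ (3, 3, 1) = g1$3$3 * g2$3$3 * g3$1$1 * x $ (3, 3, 1)"
    by (simp add: sum_3 sum_2 g x0)
  have "(act (g1, g2, g3) x $ (1, 1, 2) * act (g1, g2, g3) x $ (2, 2, 2) - act (g1, g2, g3) x $ (1, 2, 2) * act (g1, g2, g3) x $ (2, 1, 2)) ^ 3 * act (g1, g2, g3) x $ (3, 3, 1) ^ 4 = ((g1$1$1 * g1$2$2 - g1$1$2 * g1$2$1) * g1$3$3) ^ 3 * ((g2$1$1 * g2$2$2 - g2$1$2 * g2$2$1) * g2$3$3) ^ 3 * (g3$1$1 * g3$2$2) ^ 4 * (g1$3$3 * g2$3$3 * g3$2$2 ^ 2) * ((x $ (1, 1, 2) * x $ (2, 2, 2) - x $ (1, 2, 2) * x $ (2, 1, 2)) ^ 3 * x $ (3, 3, 1) ^ 4)"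
    unfolding 1 2 power_mult_distrib by (simp add: power2_eq_square eval_nat_numeral ac_simps)
  then have "(act (g1, g2, g3) x $ (1, 1, 2) * act (g1, g2, g3) x $ (2, 2, 2) - act (g1, g2, g3) x $ (1, 2, 2) * act (g1, g2, g3) x $ (2, 1, 2)) ^ 3 * act (g1, g2, g3) x $ (3, 3, 1) ^ 4 = (g1$3$3 * g2$3$3 * g3$2$2 ^ 2) * ((x $ (1, 1, 2) * x $ (2, 2, 2) - x $ (1, 2, 2) * x $ (2, 1, 2)) ^ 3 * x $ (3, 3, 1) ^ 4)" unfolding e by simp
  then show "((act (g1, g2, g3) x $ (1, 1, 2) * act (g1, g2, g3) x $ (2, 2, 2) - act (g1, g2, g3) x $ (1, 2, 2) * act (g1, g2, g3) x $ (2, 1, 2)) ^ 3 * act (g1, g2, g3) x $ (3, 3, 1) ^ 4) ^ 3 = ((x $ (1, 1, 2) * x $ (2, 2, 2) - x $ (1, 2, 2) * x $ (2, 1, 2)) ^ 3 * x $ (3, 3, 1) ^ 4) ^ 3"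
    by (rule pow_semi_invariant[OF _ c])
qed simp

lemma beta40_nwt: "beta40 = (1 / real 30) *\<^sub>R nwt [-10, 2, 8] [-4, 2, 2] [-3, 3]"
  by (simp add: beta40_def nwt_def mk_wt_def vec_eq_iff forall_3 forall_2)

lemmas beta40_props = nwt_props[of 30 "-10" "2" "8" "-4" "2" "2" "-3" "3", folded beta40_nwt, simplified]

text \<open>The entries at (3,j,1) and at (2,j,2) with j = 2, 3 are two plane vectors, paired by a 2
  by 2 determinant; the entry at (3,1,2) is a scalar. The exponents 2 and 1 come from the convex
  coefficients 2/5, 2/5, 1/5.\<close>

lemma beta40_ss: "tens01 {(3, 3, 1), (2, 2, 2), (3, 1, 2)} \<in> explicit_ss beta40"
proof (rule explicit_ssI)
  show "tens01 {(3, 3, 1), (2, 2, 2), (3, 1, 2)} \<in> (Z_space beta40 :: 'a tens set)"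
    by (simp add: beta40_props forall_3 forall_2 tens01_def)
  show "homogeneous tens_coords (6 * (2 * (1 + 1) + 1)) (\<lambda>x :: 'a tens. ((x $ (3, 2, 1) * x $ (2, 3, 2) - x $ (3, 3, 1) * x $ (2, 2, 2)) ^ 2 * x $ (3, 1, 2)) ^ 6)"
    by (intro homogeneous_pow homogeneous_diff homogeneous.mult homogeneous_tens)
  show "(((tens01 {(3, 3, 1), (2, 2, 2), (3, 1, 2)} $ (3, 2, 1) * tens01 {(3, 3, 1), (2, 2, 2), (3, 1, 2)} $ (2, 3, 2) - tens01 {(3, 3, 1), (2, 2, 2), (3, 1, 2)} $ (3, 3, 1) * tens01 {(3, 3, 1), (2, 2, 2), (3, 1, 2)} $ (2, 2, 2)) ^ 2 * tens01 {(3, 3, 1), (2, 2, 2), (3, 1, 2)} $ (3, 1, 2)) ^ 6) \<noteq> (0 :: 'a)" by (simp add: tens01_def)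
  fix g1 g2 :: "'a^3^3" and g3 :: "'a^2^2" and x :: "'a tens"
  assume M: "(g1, g2, g3) \<in> M_grp beta40" and d: "det g1 = 1" "det g2 = 1" "det g3 = 1"
    and chi: "chi beta40 (g1, g2, g3) = 1" and x: "x \<in> Z_space beta40"
  have g: "g1$1$2 = 0" "g1$1$3 = 0" "g1$2$1 = 0" "g1$2$3 = 0" "g1$3$1 = 0" "g1$3$2 = 0" "g2$1$2 = 0" "g2$1$3 = 0" "g2$2$1 = 0" "g2$3$1 = 0" "g3$1$2 = 0" "g3$2$1 = 0"
    using M by (simp_all add: beta40_props block_diag_def forall_3 forall_2)
  have x0: "x $ (1, 1, 1) = 0" "x $ (1, 1, 2) = 0" "x $ (1, 2, 1) = 0" "x $ (1, 2, 2) = 0" "x $ (1, 3, 1) = 0" "x $ (1, 3, 2) = 0" "x $ (2, 1, 1) = 0" "x $ (2, 1, 2) = 0" "x $ (2, 2, 1) = 0" "x $ (2, 3, 1) = 0" "x $ (3, 1, 1) = 0" "x $ (3, 2, 2) = 0" "x $ (3, 3, 2) = 0"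
    using x by (simp_all add: beta40_props forall_3 forall_2)
  have e: "g1$1$1 * (g1$2$2 * g1$3$3) = 1" "g2$1$1 * (g2$2$2 * g2$3$3 - g2$2$3 * g2$3$2) = 1" "g3$1$1 * g3$2$2 = 1"
    using d by (simp_all add: det_3 det_2 g algebra_simps)
  have c: "(g1$2$2 ^ 2 * g1$3$3 ^ 3 * (g2$2$2 * g2$3$3 - g2$2$3 * g2$3$2) * g3$2$2) ^ 6 = 1"
    using chi by (simp add: beta40_props block_char_simps powi_inverse[OF e(1)] inverse_unique[OF e(1)] powi_inverse[OF e(2)] inverse_unique[OF e(2)] powi_inverse[OF e(3)] inverse_unique[OF e(3)])
      (simp add: power_mult_distrib eval_nat_numeral ac_simps)
  let ?X = "act (g1, g2, g3) x"
  have 1: "?X $ (3, 2, 1) * ?X $ (2, 3, 2) - ?X $ (3, 3, 1) * ?X $ (2, 2, 2) =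
      g1$2$2 * g1$3$3 * (g3$1$1 * g3$2$2) * (g2$2$2 * g2$3$3 - g2$2$3 * g2$3$2) * (x $ (3, 2, 1) * x $ (2, 3, 2) - x $ (3, 3, 1) * x $ (2, 2, 2))"
    by (simp add: sum_3 sum_2 g x0 algebra_simps)
  have 2: "?X $ (3, 1, 2) = g1$3$3 * g2$1$1 * g3$2$2 * x $ (3, 1, 2)"
    by (simp add: sum_3 sum_2 g x0)
  have "(act (g1, g2, g3) x $ (3, 2, 1) * act (g1, g2, g3) x $ (2, 3, 2) - act (g1, g2, g3) x $ (3, 3, 1) * act (g1, g2, g3) x $ (2, 2, 2)) ^ 2 * act (g1, g2, g3) x $ (3, 1, 2) = (g2$1$1 * (g2$2$2 * g2$3$3 - g2$2$3 * g2$3$2)) * (g1$2$2 ^ 2 * g1$3$3 ^ 3 * (g2$2$2 * g2$3$3 - g2$2$3 * g2$3$2) * g3$2$2) * ((x $ (3, 2, 1) * x $ (2, 3, 2) - x $ (3, 3, 1) * x $ (2, 2, 2)) ^ 2 * x $ (3, 1, 2))"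
    unfolding 1 2 power_mult_distrib e(3) by (simp only: power2_eq_square power3_eq_cube power_one ac_simps mult_1)
  then have "(act (g1, g2, g3) x $ (3, 2, 1) * act (g1, g2, g3) x $ (2, 3, 2) - act (g1, g2, g3) x $ (3, 3, 1) * act (g1, g2, g3) x $ (2, 2, 2)) ^ 2 * act (g1, g2, g3) x $ (3, 1, 2) = (g1$2$2 ^ 2 * g1$3$3 ^ 3 * (g2$2$2 * g2$3$3 - g2$2$3 * g2$3$2) * g3$2$2) * ((x $ (3, 2, 1) * x $ (2, 3, 2) - x $ (3, 3, 1) * x $ (2, 2, 2)) ^ 2 * x $ (3, 1, 2))" unfolding e by simp
  then show "((act (g1, g2, g3) x $ (3, 2, 1) * act (g1, g2, g3) x $ (2, 3, 2) - act (g1, g2, g3) x $ (3, 3, 1) * act (g1, g2, g3) x $ (2, 2, 2)) ^ 2 * act (g1, g2, g3) x $ (3, 1, 2)) ^ 6 = ((x $ (3, 2, 1) * x $ (2, 3, 2) - x $ (3, 3, 1) * x $ (2, 2, 2)) ^ 2 * x $ (3, 1, 2)) ^ 6"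
    by (rule pow_semi_invariant[OF _ c])
qed simp

lemma beta6_nwt: "beta6 = (1 / real 66) *\<^sub>R nwt [-4, 2, 2] [-4, 2, 2] [-3, 3]"
  by (simp add: beta6_def nwt_def mk_wt_def vec_eq_iff forall_3 forall_2)

lemmas beta6_props = nwt_props[of 66 "-4" "2" "2" "-4" "2" "2" "-3" "3", folded beta6_nwt, simplified]

text \<open>\<open>Z_space\<close> consists of a 2 by 2 matrix M in the first slice, and a row r and
  a column c in the second. The basic semi-invariants are det M and r adj(M) c, the latter being the
  long cubic. With exponents 1 and 3 the multiplier becomes a sixth root of the character.\<close>

lemma beta6_ss: "tens01 {(2, 2, 1), (3, 3, 1), (1, 2, 2), (2, 1, 2)} \<in> explicit_ss beta6"
proof (rule explicit_ssI)
  show "tens01 {(2, 2, 1), (3, 3, 1), (1, 2, 2), (2, 1, 2)} \<in> (Z_space beta6 :: 'a tens set)"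
    by (simp add: beta6_props forall_3 forall_2 tens01_def)
  show "homogeneous tens_coords (6 * (1 + 1 + 3 * (1 + 1 + 1))) (\<lambda>x :: 'a tens. ((x $ (2, 2, 1) * x $ (3, 3, 1) - x $ (2, 3, 1) * x $ (3, 2, 1)) * ((x $ (1, 2, 2) * x $ (3, 3, 1) * x $ (2, 1, 2) - x $ (1, 2, 2) * x $ (2, 3, 1) * x $ (3, 1, 2)) - (x $ (1, 3, 2) * x $ (3, 2, 1) * x $ (2, 1, 2) - x $ (1, 3, 2) * x $ (2, 2, 1) * x $ (3, 1, 2))) ^ 3) ^ 6)"
    by (intro homogeneous_pow homogeneous_diff homogeneous.mult homogeneous_tens)
  show "(((tens01 {(2, 2, 1), (3, 3, 1), (1, 2, 2), (2, 1, 2)} $ (2, 2, 1) * tens01 {(2, 2, 1), (3, 3, 1), (1, 2, 2), (2, 1, 2)} $ (3, 3, 1) - tens01 {(2, 2, 1), (3, 3, 1), (1, 2, 2), (2, 1, 2)} $ (2, 3, 1) * tens01 {(2, 2, 1), (3, 3, 1), (1, 2, 2), (2, 1, 2)} $ (3, 2, 1)) * ((tens01 {(2, 2, 1), (3, 3, 1), (1, 2, 2), (2, 1, 2)} $ (1, 2, 2) * tens01 {(2, 2, 1), (3, 3, 1), (1, 2, 2), (2, 1, 2)} $ (3, 3, 1) * tens01 {(2, 2, 1), (3, 3, 1), (1, 2, 2), (2, 1, 2)} $ (2, 1, 2) - tens01 {(2, 2, 1), (3, 3, 1), (1, 2, 2), (2, 1, 2)} $ (1, 2, 2) * tens01 {(2,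 2, 1), (3, 3, 1), (1, 2, 2), (2, 1, 2)} $ (2, 3, 1) * tens01 {(2, 2, 1), (3, 3, 1), (1, 2, 2), (2, 1, 2)} $ (3, 1, 2)) - (tens01 {(2, 2, 1), (3, 3, 1), (1, 2, 2), (2, 1, 2)} $ (1, 3, 2) * tens01 {(2, 2, 1), (3, 3, 1), (1, 2, 2), (2, 1, 2)} $ (3, 2, 1) * tens01 {(2, 2, 1), (3, 3, 1), (1, 2, 2), (2, 1, 2)} $ (2, 1, 2) - tens01 {(2, 2, 1), (3, 3, 1), (1, 2, 2), (2, 1, 2)} $ (1, 3, 2) * tens01 {(2, 2, 1), (3, 3, 1), (1, 2, 2), (2, 1, 2)} $ (2, 2, 1) * tens01 {(2, 2, 1), (3, 3, 1), (1, 2, 2), (2, 1, 2)} $ (3, 1, 2))) ^ 3) ^ 6) \<noteq> (0 :: 'a)" by (simp add: tens01_def)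
  fix g1 g2 :: "'a^3^3" and g3 :: "'a^2^2" and x :: "'a tens"
  assume M: "(g1, g2, g3) \<in> M_grp beta6" and d: "det g1 = 1" "det g2 = 1" "det g3 = 1"
    and chi: "chi beta6 (g1, g2, g3) = 1" and x: "x \<in> Z_space beta6"
  have g: "g1$1$2 = 0" "g1$1$3 = 0" "g1$2$1 = 0" "g1$3$1 = 0" "g2$1$2 = 0" "g2$1$3 = 0" "g2$2$1 = 0" "g2$3$1 = 0" "g3$1$2 = 0" "g3$2$1 = 0"
    using M by (simp_all add: beta6_props block_diag_def forall_3 forall_2)
  have x0: "x $ (1, 1, 1) = 0" "x $ (1, 1, 2) = 0" "x $ (1, 2, 1) = 0" "x $ (1, 3, 1) = 0" "x $ (2, 1, 1) = 0" "x $ (2, 2, 2) = 0" "x $ (2, 3, 2) = 0" "x $ (3, 1, 1) = 0" "x $ (3, 2, 2) = 0" "x $ (3, 3, 2) = 0"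
    using x by (simp_all add: beta6_props forall_3 forall_2)
  have e: "g1$1$1 * (g1$2$2 * g1$3$3 - g1$2$3 * g1$3$2) = 1" "g2$1$1 * (g2$2$2 * g2$3$3 - g2$2$3 * g2$3$2) = 1" "g3$1$1 * g3$2$2 = 1"
    using d by (simp_all add: det_3 det_2 g algebra_simps)
  have c: "((g1$2$2 * g1$3$3 - g1$2$3 * g1$3$2) * (g2$2$2 * g2$3$3 - g2$2$3 * g2$3$2) * g3$2$2) ^ 6 = 1"
    using chi by (simp add: beta6_props block_char_simps powi_inverse[OF e(1)] inverse_unique[OF e(1)] powi_inverse[OF e(2)] inverse_unique[OF e(2)] powi_inverse[OF e(3)] inverse_unique[OF e(3)])
      (simp add: power_mult_distrib eval_nat_numeral ac_simps)
  let ?X = "act (g1, g2, g3) x"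
  have 1: "?X $ (2, 2, 1) * ?X $ (3, 3, 1) - ?X $ (2, 3, 1) * ?X $ (3, 2, 1) =
      g3$1$1 ^ 2 * (g1$2$2 * g1$3$3 - g1$2$3 * g1$3$2) * (g2$2$2 * g2$3$3 - g2$2$3 * g2$3$2) * (x $ (2, 2, 1) * x $ (3, 3, 1) - x $ (2, 3, 1) * x $ (3, 2, 1))"
    by (simp add: sum_3 sum_2 g x0 power2_eq_square algebra_simps)
  have 2: "(?X $ (1, 2, 2) * ?X $ (3, 3, 1) * ?X $ (2, 1, 2) - ?X $ (1, 2, 2) * ?X $ (2, 3, 1) * ?X $ (3, 1, 2)) -
      (?X $ (1, 3, 2) * ?X $ (3, 2, 1) * ?X $ (2, 1, 2) - ?X $ (1, 3, 2) * ?X $ (2, 2, 1) * ?X $ (3, 1, 2)) =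
      (g3$1$1 * g3$2$2) * g3$2$2 * (g1$1$1 * (g1$2$2 * g1$3$3 - g1$2$3 * g1$3$2)) * (g2$1$1 * (g2$2$2 * g2$3$3 - g2$2$3 * g2$3$2)) *
      ((x $ (1, 2, 2) * x $ (3, 3, 1) * x $ (2, 1, 2) - x $ (1, 2, 2) * x $ (2, 3, 1) * x $ (3, 1, 2)) -
       (x $ (1, 3, 2) * x $ (3, 2, 1) * x $ (2, 1, 2) - x $ (1, 3, 2) * x $ (2, 2, 1) * x $ (3, 1, 2)))"
    by (simp add: sum_3 sum_2 g x0 algebra_simps)
  have "(act (g1, g2, g3) x $ (2, 2, 1) * act (g1, g2, g3) x $ (3, 3, 1) - act (g1, g2, g3) x $ (2, 3, 1) * act (g1, g2, g3) x $ (3, 2, 1)) * ((act (g1, g2, g3) x $ (1, 2, 2) * act (g1, g2, g3) x $ (3, 3, 1) * act (g1, g2, g3) x $ (2, 1, 2) - act (g1, g2, g3) x $ (1, 2, 2) * act (g1, g2, g3) x $ (2, 3, 1) * act (g1, g2, g3) x $ (3, 1, 2)) - (act (g1, g2, g3) x $ (1, 3, 2) * act (g1, g2, g3) x $ (3, 2, 1) * act (g1, g2, g3) x $ (2, 1, 2) - act (g1, g2, g3) x $ (1, 3, 2) * act (g1, g2, g3) x $ (2, 2, 1) * act (g1, g2, g3) x $ (3, 1, 2))) ^ 3 = (g3$1$1 * g3$2$2) ^ 2 * ((g1$2$2 * g1$3$3 - g1$2$3 * g1$3$2) * (g2$2$2 * g2$3$3 - g2$2$3 * g2$3$2) * g3$2$2)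 * ((x $ (2, 2, 1) * x $ (3, 3, 1) - x $ (2, 3, 1) * x $ (3, 2, 1)) * ((x $ (1, 2, 2) * x $ (3, 3, 1) * x $ (2, 1, 2) - x $ (1, 2, 2) * x $ (2, 3, 1) * x $ (3, 1, 2)) - (x $ (1, 3, 2) * x $ (3, 2, 1) * x $ (2, 1, 2) - x $ (1, 3, 2) * x $ (2, 2, 1) * x $ (3, 1, 2))) ^ 3)"
    unfolding 1 2[unfolded e mult_1 mult_1_right] power_mult_distrib by (simp only: power2_eq_square power3_eq_cube power_one ac_simps mult_1 mult_1_right)
  then have "(act (g1, g2, g3) x $ (2, 2, 1) * act (g1, g2, g3) x $ (3, 3, 1) - act (g1, g2, g3) x $ (2, 3, 1) * act (g1, g2, g3) x $ (3, 2, 1)) * ((act (g1, g2, g3) x $ (1, 2, 2) * act (g1, g2, g3) x $ (3, 3, 1) * act (g1, g2, g3) x $ (2, 1, 2) - act (g1, g2, g3) x $ (1, 2, 2) * act (g1, g2, g3) x $ (2, 3, 1) * act (g1, g2, g3) x $ (3, 1, 2)) - (act (g1, g2, g3) x $ (1, 3, 2) * act (g1, g2, g3) x $ (3, 2, 1) * act (g1, g2, g3) x $ (2, 1, 2) - act (g1, g2, g3) x $ (1, 3, 2) * act (g1, g2, g3) x $ (2, 2, 1) * act (g1, g2, g3) x $ (3, 1, 2))) ^ 3 = ((g1$2$2 * g1$3$3 - g1$2$3 * g1$3$2) * (g2$2$2 * g2$3$3 - g2$2$3 * g2$3$2) * g3$2$2) * ((x $ (2, 2, 1) * x $ (3, 3,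 1) - x $ (2, 3, 1) * x $ (3, 2, 1)) * ((x $ (1, 2, 2) * x $ (3, 3, 1) * x $ (2, 1, 2) - x $ (1, 2, 2) * x $ (2, 3, 1) * x $ (3, 1, 2)) - (x $ (1, 3, 2) * x $ (3, 2, 1) * x $ (2, 1, 2) - x $ (1, 3, 2) * x $ (2, 2, 1) * x $ (3, 1, 2))) ^ 3)" unfolding e by simp
  then show "((act (g1, g2, g3) x $ (2, 2, 1) * act (g1, g2, g3) x $ (3, 3, 1) - act (g1, g2, g3) x $ (2, 3, 1) * act (g1, g2, g3) x $ (3, 2, 1)) * ((act (g1, g2, g3) x $ (1, 2, 2) * act (g1, g2, g3) x $ (3, 3, 1) * act (g1, g2, g3) x $ (2, 1, 2) - act (g1, g2, g3) x $ (1, 2, 2) * act (g1, g2, g3) x $ (2, 3, 1) * act (g1, g2, g3) x $ (3, 1, 2)) - (act (g1, g2, g3) x $ (1, 3, 2) * act (g1, g2, g3) x $ (3, 2, 1) * act (g1, g2, g3) x $ (2, 1, 2) - act (g1, g2, g3) x $ (1, 3, 2) * act (g1, g2, g3) x $ (2, 2, 1) * act (g1, g2, g3) x $ (3, 1, 2))) ^ 3) ^ 6 = ((x $ (2, 2, 1) * x $ (3, 3, 1) - x $ (2, 3, 1) * x $ (3, 2, 1)) * ((x $ (1, 2, 2) * x $ (3, 3, 1) * x $ (2, 1, 2) - x $ (1, 2, 2) * x $ (2, 3, 1) * x $ (3, 1, 2)) - (x $ (1, 3, 2) * x $ (3, 2, 1) * x $ (2, 1, 2) - x $ (1, 3, 2)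 * x $ (2, 2, 1) * x $ (3, 1, 2))) ^ 3) ^ 6"
    by (rule pow_semi_invariant[OF _ c])
qed simp

lemma slice_act: "slice l (act (g1, g2, g3) x) =
    g1 ** (\<chi> i j. \<Sum>k\<in>UNIV. g3$l$k * x$(i, j, k)) ** transpose g2"
proof (rule matrix_ext)
  fix i j
  have "slice l (act (g1, g2, g3) x) $ i $ j = (\<Sum>a\<in>UNIV. \<Sum>b\<in>UNIV. \<Sum>k\<in>UNIV. g1$i$a * (g2$j$b * (g3$l$k * x$(a, b, k))))"
    by (simp add: slice_def act_split act1_def act2_def act3_def sum_distrib_left del: act.simps)
  also have "\<dots> = (\<Sum>b\<in>UNIV. \<Sum>a\<in>UNIV. \<Sum>k\<in>UNIV. g1$i$a * (g2$j$b * (g3$l$k * x$(a, b, k))))"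
    by (rule sum.swap)
  finally show "slice l (act (g1, g2, g3) x) $ i $ j =
      (g1 ** (\<chi> i j. \<Sum>k\<in>UNIV. g3$l$k * x$(i, j, k)) ** transpose g2) $ i $ j"
    by (simp add: matrix_matrix_mult_def transpose_def sum_distrib_left sum_distrib_right ac_simps)
qed

lemma power_power_eq_1: "x ^ n = 1 \<Longrightarrow> (x ^ m) ^ n = (1 :: 'f::field)"
  by (metis power_mult mult.commute power_one)

lemma homogeneous_det_slice: "homogeneous tens_coords (1 + 1 + 1) (\<lambda>x. det (slice l x))"
  unfolding det_3 slice_def vec_lambda_beta
  by (intro homogeneous_diff homogeneous.add homogeneous.mult homogeneous_tens)

lemma beta38_nwt: "beta38 = (1 / real 2) *\<^sub>R nwt [0, 0, 0] [0, 0, 0] [-1, 1]"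
  by (simp add: beta38_def nwt_def mk_wt_def vec_eq_iff forall_3 forall_2)

lemmas beta38_props = nwt_props[of 2 0 0 0 0 0 0 "-1" 1, folded beta38_nwt, simplified]

text \<open>\<open>Z_space\<close> is the second slice alone. Its determinant has multiplier
  \<open>g3$2$2 ^ 3\<close>, and the character condition makes \<open>g3$2$2\<close> a square root
  of one.\<close>

lemma beta38_ss: "tens01 {(1, 1, 2), (2, 2, 2), (3, 3, 2)} \<in> explicit_ss beta38"
proof (rule explicit_ssI)
  show "tens01 {(1, 1, 2), (2, 2, 2), (3, 3, 2)} \<in> (Z_space beta38 :: 'a tens set)"
    by (simp add: beta38_props forall_3 forall_2 tens01_def)
  show "homogeneous tens_coords (2 * (1 + 1 + 1)) (\<lambda>x :: 'a tens. det (slice 2 x) ^ 2)"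
    by (intro homogeneous_pow homogeneous_det_slice)
  show "det (slice 2 (tens01 {(1, 1, 2), (2, 2, 2), (3, 3, 2)})) ^ 2 \<noteq> (0 :: 'a)"
    by (simp add: tens01_def slice_def det_3)
  fix g1 g2 :: "'a^3^3" and g3 :: "'a^2^2" and x :: "'a tens"
  assume M: "(g1, g2, g3) \<in> M_grp beta38" and d: "det g1 = 1" "det g2 = 1" "det g3 = 1"
    and chi: "chi beta38 (g1, g2, g3) = 1" and x: "x \<in> Z_space beta38"
  have g: "g3$1$2 = 0" "g3$2$1 = 0"
    using M by (simp_all add: beta38_props block_diag_def forall_2)
  have e: "g3$1$1 * g3$2$2 = 1" using d by (simp add: det_2 g)
  have "g3$2$2 ^ 2 = 1"
    using chi by (simp add: beta38_props floor_minus_one block_char_const3 block_char_12 inverse_unique[OF e] power2_eq_square)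
  then have c: "(g3$2$2 ^ 3) ^ 2 = 1" by (rule power_power_eq_1)
  have "det (slice 2 (act (g1, g2, g3) x)) = det (\<chi> i j. g3$2$2 * x$(i, j, 2))"
    unfolding slice_act by (simp add: det_mul d det_transpose sum_2 g)
  also have "\<dots> = g3$2$2 ^ 3 * det (slice 2 x)"
    by (simp add: det_3 slice_def power3_eq_cube algebra_simps)
  finally show "det (slice 2 (act (g1, g2, g3) x)) ^ 2 = det (slice 2 x) ^ 2"
    by (rule pow_semi_invariant[OF _ c])
qed simp

text \<open>Cayley's hyperdeterminant of the block with \<open>i, j \<in> {2, 3}\<close>: the discriminant of the binary
  quadratic form given by the determinant of the pencil.\<close>

definition hdetA :: "2 \<Rightarrow> 'f::field tens \<Rightarrow> 'f" where
  "hdetA l x = x$(2, 2, l) * x$(3, 3, l) - x$(2, 3, l) * x$(3, 2, l)"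

definition hmix :: "'f::field tens \<Rightarrow> 'f" where
  "hmix x = x$(2, 2, 1) * x$(3, 3, 2) + x$(3, 3, 1) * x$(2, 2, 2) - x$(2, 3, 1) * x$(3, 2, 2) - x$(3, 2, 1) * x$(2, 3, 2)"

text \<open>The factor four of the discriminant is hidden in two sums so that homogeneity follows
  from the introduction rules.\<close>

definition hyperdet :: "'f::field tens \<Rightarrow> 'f" where
  "hyperdet x = hmix x * hmix x - (hdetA 1 x + hdetA 1 x) * (hdetA 2 x + hdetA 2 x)"

text \<open>The first two factors multiply the quadratic form by block determinants, the third
  substitutes linearly in it. Treating them one at a time keeps the polynomial identities
  small.\<close>

lemma hyperdet_act:
  assumes "g1$2$1 = 0" "g1$3$1 = 0" "g2$2$1 = 0" "g2$3$1 = 0"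
  shows "hyperdet (act (g1, g2, g3) x) = ((g1$2$2 * g1$3$3 - g1$2$3 * g1$3$2) * (g2$2$2 * g2$3$3 - g2$2$3 * g2$3$2)) ^ 2 *
    (det g3) ^ 2 * hyperdet x"
proof -
  define y where "y = act3 g3 x"
  define z where "z = act2 g2 y"
  define D1 D2 where "D1 = g1$2$2 * g1$3$3 - g1$2$3 * g1$3$2" and "D2 = g2$2$2 * g2$3$3 - g2$2$3 * g2$3$2"
  have X: "act (g1, g2, g3) x = act1 g1 z" by (simp only: act_split z_def y_def)
  have 1: "hdetA l (act1 g1 z) = D1 * hdetA l z" "hmix (act1 g1 z) = D1 * hmix z" for l
    by (simp_all add: hdetA_def hmix_def act1_def sum_3 assms D1_def algebra_simps)
  have 2: "hdetA l (act2 g2 y) = D2 * hdetA l y" "hmix (act2 g2 y) = D2 * hmix y" for l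
    by (simp_all add: hdetA_def hmix_def act2_def sum_3 assms D2_def algebra_simps)
  have 3: "hdetA l y = g3$l$1 ^ 2 * hdetA 1 x + g3$l$1 * g3$l$2 * hmix x + g3$l$2 ^ 2 * hdetA 2 x" for l
    by (simp add: hdetA_def hmix_def y_def act3_def sum_2 power2_eq_square algebra_simps)
  have 4: "hmix y = (g3$1$1 * g3$2$1) * (hdetA 1 x + hdetA 1 x) + (g3$1$1 * g3$2$2 + g3$1$2 * g3$2$1) * hmix x +
      (g3$1$2 * g3$2$2) * (hdetA 2 x + hdetA 2 x)"
    by (simp add: hdetA_def hmix_def y_def act3_def sum_2 algebra_simps)
  have "hyperdet y = (det g3) ^ 2 * hyperdet x"
    unfolding hyperdet_def 3 4 det_2 by (simp add: power2_eq_square algebra_simps)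
  moreover have "hyperdet (act1 g1 z) = (D1 * D2) ^ 2 * hyperdet y"
    unfolding hyperdet_def 1 2[folded z_def] by (simp add: power2_eq_square algebra_simps)
  ultimately show ?thesis by (simp only: X D1_def D2_def mult.assoc)
qed

text \<open>The determinant -(u^2 + b u v + c v^2) of its 2 by 2 block vanishes at (-\<theta>, 1)
  for the roots \<theta> of t^2 - b t + c. The tensor is symmetric in the first two indices.\<close>

definition quad_tens :: "'f::field \<Rightarrow> 'f \<Rightarrow> 'f tens" where
  "quad_tens b c = (\<chi> t. if t \<in> {(2, 3, 1), (3, 2, 1), (3, 3, 2)} then 1 else if t = (2, 2, 1) then - b
     else if t = (2, 2, 2) then - c else 0)"

lemma beta29_nwt: "beta29 = (1 / real 6) *\<^sub>R nwt [-2, 1, 1] [-2, 1, 1] [0, 0]"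
  by (simp add: beta29_def nwt_def mk_wt_def vec_eq_iff forall_3 forall_2)

lemmas beta29_props = nwt_props[of 6 "-2" 1 1 "-2" 1 1 0 0, folded beta29_nwt, simplified]

lemma beta29_ss:
  fixes b c :: "'f::alg_closed_field"
  assumes "b\<^sup>2 \<noteq> 4 * c"
  shows "quad_tens b c \<in> explicit_ss beta29"
proof (rule explicit_ssI)
  show "quad_tens b c \<in> Z_space beta29"
    by (simp add: beta29_props forall_3 forall_2 quad_tens_def)
  show "homogeneous tens_coords (3 * (1 + 1 + (1 + 1))) (\<lambda>x :: 'f tens. hyperdet x ^ 3)"
    unfolding hyperdet_def hdetA_def hmix_def
    by (intro homogeneous_pow homogeneous_diff homogeneous.add homogeneous.mult homogeneous_tens)
  have "hyperdet (quad_tens b c) = b\<^sup>2 - 4 * c"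
    by (simp add: quad_tens_def hyperdet_def hdetA_def hmix_def power2_eq_square)
  then show "hyperdet (quad_tens b c) ^ 3 \<noteq> 0" using assms by simp
  fix g1 g2 :: "'f^3^3" and g3 :: "'f^2^2" and x :: "'f tens"
  assume M: "(g1, g2, g3) \<in> M_grp beta29" and d: "det g1 = 1" "det g2 = 1" "det g3 = 1"
    and chi: "chi beta29 (g1, g2, g3) = 1" and x: "x \<in> Z_space beta29"
  have g: "g1$1$2 = 0" "g1$1$3 = 0" "g1$2$1 = 0" "g1$3$1 = 0" "g2$1$2 = 0" "g2$1$3 = 0" "g2$2$1 = 0" "g2$3$1 = 0"
    using M by (simp_all add: beta29_props block_diag_def forall_3)
  let ?P = "g1$2$2 * g1$3$3 - g1$2$3 * g1$3$2" and ?Q = "g2$2$2 * g2$3$3 - g2$2$3 * g2$3$2"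
  have e: "g1$1$1 * ?P = 1" "g2$1$1 * ?Q = 1"
    using d by (simp_all add: det_3 g algebra_simps)
  have "(?P * ?Q) ^ 3 = 1"
    using chi by (simp add: beta29_props block_char_const2 block_char_122 powi_inverse[OF e(1)] powi_inverse[OF e(2)])
      (simp add: power_mult_distrib eval_nat_numeral ac_simps)
  then have c: "((?P * ?Q) ^ 2) ^ 3 = 1" by (rule power_power_eq_1)
  have "hyperdet (act (g1, g2, g3) x) = (?P * ?Q) ^ 2 * hyperdet x"
    by (simp only: hyperdet_act[OF g(3,4,7,8)] d power_one mult_1_right)
  then show "hyperdet (act (g1, g2, g3) x) ^ 3 = hyperdet x ^ 3"
    by (rule pow_semi_invariant[OF _ c])
qed simp

definition minor3 :: "'f::field tens \<Rightarrow> 3 \<times> 2 \<Rightarrow> 3 \<times> 2 \<Rightarrow> 3 \<times> 2 \<Rightarrow> 'f" where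
  "minor3 x p q r = det (vector [\<chi> j. x$(fst p, j, snd p), \<chi> j. x$(fst q, j, snd q), \<chi> j. x$(fst r, j, snd r)] :: 'f^3^3)"

text \<open>The kernel of the \<open>3 \<times> 4\<close> matrix of a \<open>2 \<times> 3 \<times> 2\<close> tensor is spanned by its maximal minors,
  arranged as a \<open>2 \<times> 2\<close> matrix; this is its determinant.\<close>

definition ker_det :: "'f::field tens \<Rightarrow> 'f" where
  "ker_det x = minor3 x (2, 2) (3, 1) (3, 2) * minor3 x (2, 1) (2, 2) (3, 1) -
     minor3 x (2, 1) (3, 1) (3, 2) * minor3 x (2, 1) (2, 2) (3, 2)"

lemma minor3_act2: "minor3 (act2 g x) p q r = det g * minor3 x p q r"
proof -
  have "(vector [\<chi> j. act2 g x$(fst p, j, snd p), \<chi> j. act2 g x$(fst q, j, snd q), \<chi> j. act2 g x$(fst r, j, snd r)] :: 'a^3^3)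
    = vector [\<chi> j. x$(fst p, j, snd p), \<chi> j. x$(fst q, j, snd q), \<chi> j. x$(fst r, j, snd r)] ** transpose g"
    by (simp add: vec_eq_iff forall_3 act2_def matrix_matrix_mult_def transpose_def ac_simps)
  then show ?thesis by (simp add: minor3_def det_mul det_transpose)
qed

lemma ker_det_act2: "ker_det (act2 g x) = det g ^ 2 * ker_det x"
  by (simp add: ker_det_def minor3_act2 power2_eq_square algebra_simps)

text \<open>Up to the common factor \<open>P\<close> the 2 by 2 matrix of minors is multiplied by
  the cofactor matrix of the block, which has determinant \<open>P\<close>; in total the determinant
  gains the cube.\<close>

lemma ker_det_act1:
  fixes g :: "'f::field^3^3"
  assumes "g$2$1 = 0" "g$3$1 = 0"
  shows "ker_det (act1 g x) = (g$2$2 * g$3$3 - g$2$3 * g$3$2) ^ 3 * ker_det x"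
proof -
  define P where "P = g$2$2 * g$3$3 - g$2$3 * g$3$2"
  define s t u v where "s = minor3 x (2, 2) (3, 1) (3, 2)" and "t = minor3 x (2, 1) (3, 1) (3, 2)"
    and "u = minor3 x (2, 1) (2, 2) (3, 2)" and "v = minor3 x (2, 1) (2, 2) (3, 1)"
  have m: "minor3 (act1 g x) (2, 2) (3, 1) (3, 2) = P * (g$3$3 * s - g$3$2 * u)"
    "minor3 (act1 g x) (2, 1) (3, 1) (3, 2) = P * (g$3$3 * t - g$3$2 * v)"
    "minor3 (act1 g x) (2, 1) (2, 2) (3, 2) = P * (g$2$2 * u - g$2$3 * s)"
    "minor3 (act1 g x) (2, 1) (2, 2) (3, 1) = P * (g$2$2 * v - g$2$3 * t)"
    by (simp_all add: minor3_def det_3 act1_def sum_3 assms P_def s_def t_def u_def v_def algebra_simps)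
  have "ker_det (act1 g x) = P ^ 2 * ((g$3$3 * s - g$3$2 * u) * (g$2$2 * v - g$2$3 * t) - (g$3$3 * t - g$3$2 * v) * (g$2$2 * u - g$2$3 * s))"
    unfolding ker_det_def m by (simp add: power2_eq_square algebra_simps)
  also have "\<dots> = P ^ 2 * (P * (s * v - t * u))"
    by (simp add: P_def algebra_simps)
  finally show ?thesis
    by (simp add: ker_det_def s_def t_def u_def v_def P_def power3_eq_cube power2_eq_square)
qed

lemma ker_det_act3:
  fixes h :: "'f::field^2^2"
  shows "ker_det (act3 h x) = det h ^ 3 * ker_det x"
proof -
  define s t u v where "s = minor3 x (2, 2) (3, 1) (3, 2)" and "t = minor3 x (2, 1) (3, 1) (3, 2)"
    and "u = minor3 x (2, 1) (2, 2) (3, 2)" and "v = minor3 x (2, 1) (2, 2) (3, 1)"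
  have m: "minor3 (act3 h x) (2, 2) (3, 1) (3, 2) = det h * (h$2$1 * t + h$2$2 * s)"
    "minor3 (act3 h x) (2, 1) (3, 1) (3, 2) = det h * (h$1$1 * t + h$1$2 * s)"
    "minor3 (act3 h x) (2, 1) (2, 2) (3, 2) = det h * (h$2$1 * v + h$2$2 * u)"
    "minor3 (act3 h x) (2, 1) (2, 2) (3, 1) = det h * (h$1$1 * v + h$1$2 * u)"
    by (simp_all add: minor3_def det_3 det_2 act3_def sum_2 s_def t_def u_def v_def algebra_simps)
  have "ker_det (act3 h x) = det h ^ 2 * ((h$2$1 * t + h$2$2 * s) * (h$1$1 * v + h$1$2 * u) - (h$1$1 * t + h$1$2 * s) * (h$2$1 * v + h$2$2 * u))"
    unfolding ker_det_def m by (simp add: power2_eq_square algebra_simps)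
  also have "\<dots> = det h ^ 2 * (det h * (s * v - t * u))"
    by (simp add: det_2 algebra_simps)
  finally show ?thesis
    by (simp add: ker_det_def s_def t_def u_def v_def power3_eq_cube power2_eq_square)
qed

lemma beta4_nwt: "beta4 = (1 / real 6) *\<^sub>R nwt [-2, 1, 1] [0, 0, 0] [0, 0]"
  by (simp add: beta4_def nwt_def mk_wt_def vec_eq_iff forall_3 forall_2)

lemmas beta4_props = nwt_props[of 6 "-2" 1 1 0 0 0 0 0, folded beta4_nwt, simplified]

lemma beta4_ss: "tens01 {(2, 1, 1), (2, 2, 2), (3, 2, 1), (3, 3, 2)} \<in> explicit_ss beta4"
proof (rule explicit_ssI)
  show "tens01 {(2, 1, 1), (2, 2, 2), (3, 2, 1), (3, 3, 2)} \<in> (Z_space beta4 :: 'a tens set)"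
    by (simp add: beta4_props forall_3 forall_2 tens01_def)
  show "homogeneous tens_coords (1 + 1 + 1 + (1 + 1 + 1)) (\<lambda>x :: 'a tens. ker_det x)"
    unfolding ker_det_def minor3_def det_3 vector_3 vec_lambda_beta fst_conv snd_conv
    by (intro homogeneous_diff homogeneous.add homogeneous.mult homogeneous_tens)
  show "ker_det (tens01 {(2, 1, 1), (2, 2, 2), (3, 2, 1), (3, 3, 2)}) \<noteq> (0 :: 'a)"
    by (simp add: tens01_def ker_det_def minor3_def det_3)
  fix g1 g2 :: "'a^3^3" and g3 :: "'a^2^2" and x :: "'a tens"
  assume M: "(g1, g2, g3) \<in> M_grp beta4" and d: "det g1 = 1" "det g2 = 1" "det g3 = 1"
    and chi: "chi beta4 (g1, g2, g3) = 1" and x: "x \<in> Z_space beta4"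
  have g: "g1$1$2 = 0" "g1$1$3 = 0" "g1$2$1 = 0" "g1$3$1 = 0"
    using M by (simp_all add: beta4_props block_diag_def forall_3)
  let ?P = "g1$2$2 * g1$3$3 - g1$2$3 * g1$3$2"
  have e: "g1$1$1 * ?P = 1"
    using d by (simp_all add: det_3 g algebra_simps)
  have c: "?P ^ 3 = 1"
    using chi by (simp add: beta4_props block_char_const3 block_char_const2 block_char_122 powi_inverse[OF e(1)])
      (simp add: eval_nat_numeral ac_simps)
  show "ker_det (act (g1, g2, g3) x) = ker_det x"
    by (simp only: act_split ker_det_act1[OF g(3,4)] ker_det_act2 ker_det_act3 d c power_one mult_1)
qed simp

section \<open>Swapping the two factors of dimension three\<close>

definition swap_tens :: "'f tens \<Rightarrow> 'f tens" where
  "swap_tens x = (\<chi> t. case t of (i, j, l) \<Rightarrow> x $ (j, i, l))"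

lemma swap_tens_nth [simp]: "swap_tens x $ (i, j, l) = x $ (j, i, l)"
  by (simp add: swap_tens_def)

lemma swap_tens_swap [simp]: "swap_tens (swap_tens x) = x"
  by (simp add: vec_eq_iff)

lemma swap_tens_act: "swap_tens (act (g1, g2, g3) x) = act (g2, g1, g3) (swap_tens x)"
  unfolding vec_eq_iff split_paired_All
  by (simp, intro allI, subst sum.swap) (simp add: ac_simps)

fun swap_wt :: "wt \<Rightarrow> wt" where
  "swap_wt (a, b, c) = (b, a, c)"

lemma swap_orbit: "swap_tens x \<in> orbit (swap_tens y) \<longleftrightarrow> x \<in> orbit y"
proof -
  have "swap_tens x \<in> orbit (swap_tens y)" if "x \<in> orbit y" for x y :: "'a tens"
  proof -
    obtain g1 g2 g3 where "(g1, g2, g3) \<in> GG" "x = act (g1, g2, g3) y"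
      using \<open>x \<in> orbit y\<close> unfolding orbit_def by fast
    then show ?thesis
      unfolding orbit_def by (intro image_eqI[of _ _ "(g2, g1, g3)"]) (simp_all add: swap_tens_act GG_iff del: act.simps)
  qed
  from this[of x y] this[of "swap_tens x" "swap_tens y"] show ?thesis by auto
qed

lemma primitive_factor_swap: "primitive_factor (swap_wt \<beta>) = primitive_factor \<beta>"
proof -
  have "wt_entries (r *\<^sub>R swap_wt \<beta>) = wt_entries (r *\<^sub>R \<beta>)" for r
    by (cases \<beta>) auto
  then show ?thesis by (simp add: primitive_factor_def)
qed

lemma chi_swap: "chi (swap_wt \<beta>) (g1, g2, g3) = chi \<beta> (g2, g1, g3)"
  unfolding chi_def primitive_factor_swap by (cases \<beta>) (simp add: ac_simps)

lemma M_grp_swap: "(g1, g2, g3) \<in> M_grp (swap_wt \<beta>) \<longleftrightarrow> (g2, g1, g3) \<in> M_grp \<beta>"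
  by (cases \<beta>) (auto simp: GG_iff)

lemma tstar_swap: "swap_wt \<beta> \<in> tstar \<longleftrightarrow> \<beta> \<in> tstar"
  by (cases \<beta>) (auto simp: in_tstar)

lemma Z_space_swap: "\<beta> \<in> tstar \<Longrightarrow> x \<in> Z_space (swap_wt \<beta>) \<longleftrightarrow> swap_tens x \<in> Z_space \<beta>"
proof -
  assume "\<beta> \<in> tstar"
  obtain a b c where \<beta>: "\<beta> = (a, b, c)" by (cases \<beta>)
  have "(a, b, c) \<in> tstar" "(b, a, c) \<in> tstar" using \<open>\<beta> \<in> tstar\<close> tstar_swap[of \<beta>] by (auto simp: \<beta>)
  then show ?thesis
    unfolding Z_space_iff split_paired_All \<beta> swap_wt.simps
    by (simp add: inner_weight ac_simps) (auto simp: ac_simps)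
qed

lemma homogeneous_swap: "homogeneous tens_coords d f \<Longrightarrow> homogeneous tens_coords d (\<lambda>x. f (swap_tens x))"
proof (induction rule: homogeneous.induct)
  case (coord f)
  then show ?case by (auto simp: tens_coords_def split_paired_All intro!: homogeneous_tens[simplified])
qed (auto intro: homogeneous.intros)

text \<open>The swap exchanges \<open>beta4\<close> with \<open>beta5\<close>, \<open>beta40\<close>
  with \<open>beta41\<close> and \<open>beta47\<close> with \<open>beta48\<close>, so one invariant
  serves both members of each pair.\<close>

lemma explicit_ss_swap:
  fixes z :: "'f::alg_closed_field tens"
  assumes "\<beta> \<in> tstar" "z \<in> explicit_ss \<beta>"
  shows "swap_tens z \<in> explicit_ss (swap_wt \<beta>)"
proof -
  obtain d f where z: "z \<in> Z_space \<beta>" "homogeneous tens_coords d f" "d > 0" "f z \<noteq> 0"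
    and inv: "\<And>g1 g2 g3 x. (g1, g2, g3) \<in> M_grp \<beta> \<Longrightarrow> det g1 = 1 \<Longrightarrow> det g2 = 1 \<Longrightarrow> det g3 = 1 \<Longrightarrow>
      chi \<beta> (g1, g2, g3) = 1 \<Longrightarrow> x \<in> Z_space \<beta> \<Longrightarrow> f (act (g1, g2, g3) x) = f x"
    using assms(2) unfolding explicit_ss_def by blast
  show ?thesis
  proof (rule explicit_ssI[OF _ homogeneous_swap[OF z(2)] z(3)])
    fix g1 g2 :: "'f^3^3" and g3 and x :: "'f tens"
    assume "(g1, g2, g3) \<in> M_grp (swap_wt \<beta>)" "det g1 = 1" "det g2 = 1" "det g3 = 1"
      "chi (swap_wt \<beta>) (g1, g2, g3) = 1" "x \<in> Z_space (swap_wt \<beta>)"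
    then show "f (swap_tens (act (g1, g2, g3) x)) = f (swap_tens x)"
      unfolding swap_tens_act using assms(1)
      by (intro inv) (simp_all only: M_grp_swap chi_swap Z_space_swap)
  qed (use z assms(1) in \<open>simp_all add: Z_space_swap\<close>)
qed

lemma swap_tens01: "swap_tens (tens01 S) = tens01 ((\<lambda>(i, j, l). (j, i, l)) ` S)"
proof -
  have "(i, j, l) \<in> (\<lambda>(i, j, l). (j, i, l)) ` S \<longleftrightarrow> (j, i, l) \<in> S" for i j l
    by force
  then show ?thesis
    unfolding vec_eq_iff split_paired_All by (simp add: tens01_def)
qed

lemma beta5_ss: "tens01 {(1, 2, 1), (2, 2, 2), (2, 3, 1), (3, 3, 2)} \<in> explicit_ss beta5"
  using explicit_ss_swap[OF beta4_props(2) beta4_ss] by (simp add: swap_tens01 beta4_def beta5_def mk_wt_def)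

lemma beta41_ss: "tens01 {(3, 3, 1), (2, 2, 2), (1, 3, 2)} \<in> explicit_ss beta41"
  using explicit_ss_swap[OF beta40_props(2) beta40_ss] by (simp add: swap_tens01 beta40_def beta41_def mk_wt_def)

lemma beta48_ss: "tens01 {(2, 3, 1), (3, 3, 2)} \<in> explicit_ss beta48"
  using explicit_ss_swap[OF beta47_props(2) beta47_ss] by (simp add: swap_tens01 beta47_def beta48_def mk_wt_def)

section \<open>Frames\<close>

definition d3 :: "'f::field^3 \<Rightarrow> 'f^3 \<Rightarrow> 'f^3 \<Rightarrow> 'f" where
  "d3 p q r = det (vector [p, q, r] :: 'f^3^3)"

definition dot3 :: "'f::field^3 \<Rightarrow> 'f^3 \<Rightarrow> 'f" where
  "dot3 m p = m$1 * p$1 + m$2 * p$2 + m$3 * p$3"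

lemma d3_expand: "d3 p q r = p$1 * q$2 * r$3 + p$2 * q$3 * r$1 + p$3 * q$1 * r$2
    - p$1 * q$3 * r$2 - p$2 * q$1 * r$3 - p$3 * q$2 * r$1"
  by (simp add: d3_def det_3)

lemma vec3_eq_iff: "(u :: 'a^3) = v \<longleftrightarrow> u$1 = v$1 \<and> u$2 = v$2 \<and> u$3 = v$3"
  by (simp add: vec_eq_iff forall_3)

lemma mv_lin:
  fixes A :: "'f::field^3^3"
  shows "A *v (u + v) = A *v u + A *v v" "A *v (u - v) = A *v u - A *v v" "A *v (c *s u) = c *s (A *v u)" "A *v 0 = 0"
  by (simp_all add: vec3_eq_iff matrix_vector_mult_def sum_3 algebra_simps)

lemma singular_kernel:
  fixes A :: "'f::field^3^3"
  assumes "det A = 0"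
  obtains v where "v \<noteq> 0" "A *v v = 0"
proof -
  have "\<not> (\<exists>B. B ** A = mat 1)"
    using assms invertible_left_inverse[of A] invertible_det_nz[of A] by simp
  then have "\<exists>v. A *v v = 0 \<and> v \<noteq> 0" unfolding matrix_left_invertible_ker by simp
  then show ?thesis using that by metis
qed

lemma d3_dependent:
  assumes "d3 p q r = 0"
  obtains a b c where "a \<noteq> 0 \<or> b \<noteq> 0 \<or> c \<noteq> 0" "a *s p + b *s q + c *s r = 0"
proof -
  have "det (transpose (vector [p, q, r] :: 'a^3^3)) = 0" using assms by (simp add: d3_def det_transpose)
  then obtain v where v: "v \<noteq> 0" "transpose (vector [p, q, r] :: 'a^3^3) *v v = 0" by (rule singular_kernel)
  have "v$1 *s p + v$2 *s q + v$3 *s r = transpose (vector [p, q, r] :: 'a^3^3) *v v"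
    by (simp add: vec3_eq_iff matrix_vector_mult_def transpose_def sum_3 ac_simps)
  then show ?thesis using that[of "v$1" "v$2" "v$3"] v by (auto simp: vec3_eq_iff)
qed

lemma d3_perp:
  assumes "d3 p q r = 0"
  obtains m where "m \<noteq> 0" "dot3 m p = 0" "dot3 m q = 0" "dot3 m r = 0"
proof -
  have "det (vector [p, q, r] :: 'a^3^3) = 0" using assms by (simp add: d3_def)
  then obtain v where v: "v \<noteq> 0" "(vector [p, q, r] :: 'a^3^3) *v v = 0" by (rule singular_kernel)
  then show ?thesis
    using that[of v] by (simp add: vec3_eq_iff matrix_vector_mult_def dot3_def sum_3 ac_simps)
qed

lemma extend1:
  assumes "(p :: 'f::field^3) \<noteq> 0"
  obtains s t where "d3 p s t \<noteq> 0"
proof -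
  consider "p$1 \<noteq> 0" | "p$2 \<noteq> 0" | "p$3 \<noteq> 0" using assms by (auto simp: vec3_eq_iff)
  then show ?thesis
  proof cases
    case 1
    then show ?thesis by (intro that[of "vector [0, 1, 0]" "vector [0, 0, 1]"]) (simp add: d3_expand)
  next
    case 2
    then show ?thesis by (intro that[of "vector [0, 0, 1]" "vector [1, 0, 0]"]) (simp add: d3_expand)
  next
    case 3
    then show ?thesis by (intro that[of "vector [1, 0, 0]" "vector [0, 1, 0]"]) (simp add: d3_expand)
  qed
qed

definition parallel3 :: "'f::field^3 \<Rightarrow> 'f^3 \<Rightarrow> bool" where
  "parallel3 p q \<longleftrightarrow> p$1 * q$2 = p$2 * q$1 \<and> p$1 * q$3 = p$3 * q$1 \<and> p$2 * q$3 = p$3 * q$2"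

lemma extend2:
  assumes "\<not> parallel3 p q"
  obtains t where "d3 p q t \<noteq> 0"
proof -
  consider "p$1 * q$2 - p$2 * q$1 \<noteq> 0" | "p$1 * q$3 - p$3 * q$1 \<noteq> 0" | "p$2 * q$3 - p$3 * q$2 \<noteq> 0"
    using assms by (auto simp: parallel3_def)
  then show ?thesis
  proof cases
    case 1
    then show ?thesis by (intro that[of "vector [0, 0, 1]"]) (simp add: d3_expand)
  next
    case 2
    then show ?thesis by (intro that[of "vector [0, 1, 0]"]) (simp add: d3_expand)
  next
    case 3
    then show ?thesis by (intro that[of "vector [1, 0, 0]"]) (simp add: d3_expand)
  qed
qed

text \<open>Allowing the multiples to be zero gives a common direction also for zero vectors and
  saves case distinctions.\<close>

lemma parallel3E:
  assumes "parallel3 p q"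
  obtains a u b where "p = a *s u" "q = b *s u"
proof (cases "p = 0")
  case True
  then show ?thesis by (intro that[of 0 q 1]) auto
next
  case False
  then obtain i where i: "p$i \<noteq> 0" by (auto simp: vec_eq_iff)
  have "p$i * q$j = p$j * q$i" for j
    using assms exhaust_3[of i] exhaust_3[of j] by (auto simp: parallel3_def ac_simps)
  then have "q$j = q$i / p$i * p$j" for j using i by (simp add: field_simps)
  then have "q = (q$i / p$i) *s p" unfolding vec_eq_iff vector_smult_component by blast
  then show ?thesis by (intro that[of 1 p "q$i / p$i"]) simp_all
qed

text \<open>The tool for all normal forms: if the two slices, as linear maps, have the entries of
  \<open>y\<close> as matrices with respect to a source basis p and a target basis q, then two base
  changes carry \<open>y\<close> to \<open>x\<close>.\<close>

lemma frame_orbit: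
  fixes x y :: "'f::field tens"
  assumes P: "d3 p1 p2 p3 \<noteq> 0" and Q: "d3 q1 q2 q3 \<noteq> 0"
    and "slice 1 x *v p1 = y$(1,1,1) *s q1 + y$(2,1,1) *s q2 + y$(3,1,1) *s q3"
      "slice 1 x *v p2 = y$(1,2,1) *s q1 + y$(2,2,1) *s q2 + y$(3,2,1) *s q3"
      "slice 1 x *v p3 = y$(1,3,1) *s q1 + y$(2,3,1) *s q2 + y$(3,3,1) *s q3"
      "slice 2 x *v p1 = y$(1,1,2) *s q1 + y$(2,1,2) *s q2 + y$(3,1,2) *s q3"
      "slice 2 x *v p2 = y$(1,2,2) *s q1 + y$(2,2,2) *s q2 + y$(3,2,2) *s q3"
      "slice 2 x *v p3 = y$(1,3,2) *s q1 + y$(2,3,2) *s q2 + y$(3,3,2) *s q3"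
  shows "x \<in> orbit y"
proof -
  define P Q where "P = transpose (vector [p1, p2, p3] :: 'f^3^3)" and "Q = transpose (vector [q1, q2, q3] :: 'f^3^3)"
  have inv: "invertible P" "invertible Q"
    using assms(1,2) by (auto simp: P_def Q_def invertible_det_nz det_transpose d3_def)
  have eq: "slice l x ** P = Q ** slice l y" for l
  proof (rule matrix_ext)
    fix i j
    have 1: "(slice l x ** P) $ i $ j = (slice l x *v (vector [p1, p2, p3] $ j)) $ i"
      by (simp add: P_def matrix_matrix_mult_def matrix_vector_mult_def transpose_def)
    have 2: "(Q ** slice l y) $ i $ j = (y$(1,j,l) *s q1 + y$(2,j,l) *s q2 + y$(3,j,l) *s q3) $ i"
      by (simp add: Q_def matrix_matrix_mult_def transpose_def slice_def sum_3 ac_simps)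
    show "(slice l x ** P) $ i $ j = (Q ** slice l y) $ i $ j"
      unfolding 1 2 using assms(3-8) exhaust_3[of j] exhaust_2[of l] by auto
  qed
  have "x = act (Q, transpose (matrix_inv P), mat 1) y"
  proof -
    have "slice l x = slice l (act (Q, transpose (matrix_inv P), mat 1) y)" for l
    proof -
      have "slice l x = slice l x ** P ** matrix_inv P"
        by (simp add: matrix_mul_assoc[symmetric] matrix_inv_mult inv)
      also have "\<dots> = Q ** slice l y ** matrix_inv P" by (simp only: eq)
      also have "slice l y = (\<chi> i j. \<Sum>k\<in>UNIV. mat 1$l$k * y$(i, j, k))"
        by (simp add: slice_def mat_def if_distrib[where f = "\<lambda>x. x * _"] cong: if_cong)
      finally show ?thesis by (simp add: slice_act transpose_transpose del: act.simps)
    qed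
    then have "slice l x $ i $ j = slice l (act (Q, transpose (matrix_inv P), mat 1) y) $ i $ j" for i j l
      by simp
    then show ?thesis unfolding vec_eq_iff[of x] split_paired_All by (simp add: slice_def del: act.simps)
  qed
  moreover have "(Q, transpose (matrix_inv P), mat 1) \<in> GG"
    using inv by (simp add: GG_iff invertible_matrix_inv invertible_det_nz det_transpose)
      (metis invertible_det_nz invertible_matrix_inv inv(1))
  ultimately show ?thesis unfolding orbit_def by blast
qed

lemma act3_orbit: "det h \<noteq> 0 \<Longrightarrow> act3 h x \<in> orbit x"
  unfolding orbit_def
  by (intro image_eqI[of _ _ "(mat 1, mat 1, h)"])
    (simp_all add: act_split act1_one act2_one GG_iff invertible_det_nz del: act.simps)

lemma act3_orbitD: "det h \<noteq> 0 \<Longrightarrow> act3 h x \<in> orbit y \<Longrightarrow> x \<in> orbit y"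
  by (rule orbit_trans[OF orbit_sym[OF act3_orbit]])

lemma slice_act3: "slice l (act3 h x) *v p = h$l$1 *s (slice 1 x *v p) + h$l$2 *s (slice 2 x *v p)"
  by (simp add: vec3_eq_iff slice_def act3_def matrix_vector_mult_def sum_3 sum_2 algebra_simps)

lemma slice_act3_nth: "slice l (act3 h x) $ i $ j = h$l$1 * slice 1 x $ i $ j + h$l$2 * slice 2 x $ i $ j"
  by (simp add: slice_def act3_def sum_2)

lemma slice_swap: "slice l (swap_tens x) = transpose (slice l x)"
  by (simp add: slice_def transpose_def)

section \<open>The determinant of a pencil as a polynomial\<close>

text \<open>The pencil as a matrix over the polynomial ring: multiplicativity of one determinant
  transforms all four coefficients of the cubic at once.\<close>

definition pencil :: "'f::field^3^3 \<Rightarrow> 'f^3^3 \<Rightarrow> 'f poly^3^3" where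
  "pencil A B = (\<chi> i j. [:A$i$j, B$i$j:])"

lemma det_pencil: "det (pencil A B) = [:det A, dpol A B, dpol B A, det B:]"
  by (simp add: pencil_def dpol_def det_3 algebra_simps)

lemma pencil_mult_left: "pencil (R ** A) (R ** B) = (\<chi> i j. [:R$i$j:]) ** pencil A B"
  by (simp add: pencil_def vec_eq_iff matrix_matrix_mult_def forall_3 sum_3)

lemma pencil_mult_right: "pencil (A ** R) (B ** R) = pencil A B ** (\<chi> i j. [:R$i$j:])"
  by (simp add: pencil_def vec_eq_iff matrix_matrix_mult_def forall_3 sum_3 mult.commute)

lemma det_const_poly: "det ((\<chi> i j. [:R$i$j:]) :: 'f::field poly^3^3) = [:det R:]"
  by (simp add: det_3)

lemma dpol_mult_left: "dpol (R ** A) (R ** B) = det R * dpol A B"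
proof -
  have "det (pencil (R ** A) (R ** B)) = [:det R:] * det (pencil A B)"
    by (simp only: pencil_mult_left det_mul det_const_poly)
  then show ?thesis by (simp add: det_pencil)
qed

lemma dpol_mult_right: "dpol (A ** R) (B ** R) = det R * dpol A B"
proof -
  have "det (pencil (A ** R) (B ** R)) = det (pencil A B) * [:det R:]"
    by (simp only: pencil_mult_right det_mul det_const_poly)
  then show ?thesis by (simp add: det_pencil mult.commute)
qed

section \<open>Classification of the pencils with a double root\<close>

text \<open>Each vector is paired with the support of its certified 0/1 point. The vector
  \<open>beta29\<close> is absent because its points form the family
  \<open>quad_tens\<close>.\<close>

definition reps :: "(wt \<times> (3 \<times> 3 \<times> 2) set) set" where
  "reps = {(beta4, {(2, 1, 1), (2, 2, 2), (3, 2, 1), (3, 3, 2)}),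
     (beta5, {(1, 2, 1), (2, 2, 2), (2, 3, 1), (3, 3, 2)}),
     (beta6, {(2, 2, 1), (3, 3, 1), (1, 2, 2), (2, 1, 2)}),
     (beta11, {(3, 2, 1), (2, 3, 1), (1, 3, 2), (2, 2, 2), (3, 1, 2)}),
     (beta22, {(1, 3, 1), (3, 1, 1), (2, 3, 2), (3, 2, 2)}),
     (beta28, {(3, 3, 1), (1, 3, 2), (2, 2, 2), (3, 1, 2)}),
     (beta38, {(1, 1, 2), (2, 2, 2), (3, 3, 2)}),
     (beta39, {(3, 3, 1), (2, 3, 2), (3, 2, 2)}),
     (beta40, {(3, 3, 1), (2, 2, 2), (3, 1, 2)}),
     (beta41, {(3, 3, 1), (2, 2, 2), (1, 3, 2)}),
     (beta42, {(3, 3, 1), (1, 1, 2), (2, 2, 2)}),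
     (beta45, {(2, 2, 2), (3, 3, 2)}),
     (beta47, {(3, 2, 1), (3, 3, 2)}),
     (beta48, {(2, 3, 1), (3, 3, 2)}),
     (beta49, {(3, 3, 2)})}"

definition classified :: "'f::field tens \<Rightarrow> bool" where
  "classified x \<longleftrightarrow> x = 0 \<or> (\<exists>(\<beta>, S)\<in>reps. x \<in> orbit (tens01 S)) \<or>
     (\<exists>b c. b\<^sup>2 \<noteq> 4 * c \<and> x \<in> orbit (quad_tens b c))"

lemma classified_rep: "S \<in> snd ` reps \<Longrightarrow> x \<in> orbit (tens01 S) \<Longrightarrow> classified x"
proof -
  assume "S \<in> snd ` reps" "x \<in> orbit (tens01 S)"
  then obtain \<beta> where "(\<beta>, S) \<in> reps" by auto
  then show ?thesis unfolding classified_def using \<open>x \<in> orbit (tens01 S)\<close> by blast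
qed

lemma orbit_zero: "x \<in> orbit 0 \<Longrightarrow> x = 0"
proof -
  assume "x \<in> orbit 0"
  then obtain g where "x = act g 0" unfolding orbit_def by blast
  then show ?thesis by (simp only: act_zero)
qed

lemma classified_orbit:
  assumes "x \<in> orbit y" "classified y" shows "classified x"
proof -
  consider "y = 0" | \<beta> S where "(\<beta>, S) \<in> reps" "y \<in> orbit (tens01 S)"
    | b c where "b\<^sup>2 \<noteq> 4 * c" "y \<in> orbit (quad_tens b c)"
    using assms(2) unfolding classified_def by blast
  then show ?thesis
  proof cases
    case 1
    then show ?thesis using assms(1) orbit_zero unfolding classified_def by blast
  next
    case 2
    then have "x \<in> orbit (tens01 S)" using assms(1) orbit_trans by blast
    then show ?thesis using 2(1) unfolding classified_def by blast
  next
    case 3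
    then have "x \<in> orbit (quad_tens b c)" using assms(1) orbit_trans by blast
    then show ?thesis using 3(1) unfolding classified_def by blast
  qed
qed

lemma swap_quad_tens: "swap_tens (quad_tens b c) = quad_tens b c"
  unfolding vec_eq_iff split_paired_All by (simp add: quad_tens_def forall_3 forall_2)

lemma reps_swap: "S \<in> snd ` reps \<Longrightarrow> (\<lambda>(i, j, l). (j, i, l)) ` S \<in> snd ` reps"
  unfolding reps_def image_insert image_empty snd_conv insert_iff empty_iff
  by (elim disjE; simp only: image_insert image_empty prod.case insert_commute simp_thms)

lemma classified_swap:
  assumes "classified (swap_tens x)" shows "classified x"
proof -
  consider "swap_tens x = 0" | \<beta> S where "(\<beta>, S) \<in> reps" "swap_tens x \<in> orbit (tens01 S)"
    | b c where "b\<^sup>2 \<noteq> 4 * c" "swap_tens x \<in> orbit (quad_tens b c)"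
    using assms unfolding classified_def by blast
  then show ?thesis
  proof cases
    case 1
    then have "x = 0" unfolding vec_eq_iff split_paired_All by simp
    then show ?thesis by (simp add: classified_def)
  next
    case 2
    have "x \<in> orbit (swap_tens (tens01 S))"
      using 2(2) swap_orbit[of x "swap_tens (tens01 S)"] by simp
    moreover have "(\<lambda>(i, j, l). (j, i, l)) ` S \<in> snd ` reps"
      using 2(1) by (intro reps_swap) force
    ultimately show ?thesis unfolding swap_tens01 by (intro classified_rep)
  next
    case 3
    have "x \<in> orbit (quad_tens b c)"
      using 3(2) swap_orbit[of x "quad_tens b c"] by (simp add: swap_quad_tens)
    then show ?thesis using 3(1) unfolding classified_def by blast
  qed
qed

subsection \<open>Regular pencils\<close>

lemma mv3: "((A :: 'f::field^3^3) *v v) $ i = A$i$1 * v$1 + A$i$2 * v$2 + A$i$3 * v$3"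
  by (simp add: matrix_vector_mult_def sum_3)

lemma mv_axis: "((A :: 'f::field^3^3) *v axis j 1) $ i = A$i$j"
  using exhaust_3[of j] by (auto simp: mv3 axis_def)

lemma rank_one_factor:
  fixes N :: "'f::field^3^3"
  assumes "\<And>i j k l. N$i$k * N$j$l = N$i$l * N$j$k"
  obtains u f where "\<And>v. N *v v = dot3 f v *s u"
proof (cases "N = 0")
  case True
  then show ?thesis by (intro that[of 0 0]) (simp add: vec3_eq_iff mv3)
next
  case False
  then obtain a b where ab: "N$a$b \<noteq> 0" by (auto simp: vec_eq_iff)
  have N: "N$i$j = N$i$b * (N$a$j / N$a$b)" for i j
    using assms[of i j a b] ab by (simp add: eq_divide_eq)
  show ?thesis
  proof (rule that[of "\<chi> j. N$a$j / N$a$b" "\<chi> i. N$i$b"])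
    fix v
    have "(dot3 (\<chi> j. N$a$j / N$a$b) v *s (\<chi> i. N$i$b)) $ i = (N *v v) $ i" for i
    proof -
      have "(dot3 (\<chi> j. N$a$j / N$a$b) v *s (\<chi> i. N$i$b)) $ i = N$i$b * (N$a$1 / N$a$b) * v$1 +
          N$i$b * (N$a$2 / N$a$b) * v$2 + N$i$b * (N$a$3 / N$a$b) * v$3"
        by (simp add: dot3_def algebra_simps)
      then show ?thesis by (simp only: N[symmetric] mv3)
    qed
    then show "N *v v = dot3 (\<chi> j. N$a$j / N$a$b) v *s (\<chi> i. N$i$b)" by (simp add: vec_eq_iff)
  qed
qed

lemma cayley_hamilton3:
  fixes N :: "'f::field^3^3"
  shows "N *v (N *v (N *v y)) = (N$1$1 + N$2$2 + N$3$3) *s (N *v (N *v y))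
    - dpol N (mat 1) *s (N *v y) + det N *s y"
  by (simp add: vec3_eq_iff matrix_vector_mult_def sum_3 det_3 dpol_def mat_def algebra_simps)

text \<open>The adjugate of N is N^2 - tr(N) N + s2, with s2 the second coefficient of the
  characteristic polynomial. The hypotheses make it zero, so all 2 by 2 minors vanish.\<close>

lemma adjugate_square:
  fixes N :: "'f::field^3^3"
  assumes s2: "dpol N (mat 1) = 0" and sq: "\<And>y. N *v (N *v y) = (N$1$1 + N$2$2 + N$3$3) *s (N *v y)"
  obtains u f where "\<And>v. N *v v = dot3 f v *s u"
proof -
  have e: "(N *v (N *v axis j 1)) $ i = (N$1$1 + N$2$2 + N$3$3) * N$i$j" for i j
    by (simp only: sq vector_smult_component mv_axis)
  have e': "(N *v (N *v axis j 1)) $ i = N$i$1 * N$1$j + N$i$2 * N$2$j + N$i$3 * N$3$j" for i j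
    by (simp only: mv3[of N "N *v axis j 1"] mv_axis)
  have q: "N$i$1 * N$1$j + N$i$2 * N$2$j + N$i$3 * N$3$j = (N$1$1 + N$2$2 + N$3$3) * N$i$j" for i j
    using e e' by simp
  have s: "N$1$1 * N$2$2 - N$1$2 * N$2$1 + N$1$1 * N$3$3 - N$1$3 * N$3$1 + N$2$2 * N$3$3 - N$2$3 * N$3$2 = 0"
    using s2 by (simp add: dpol_def det_3 mat_def algebra_simps)
  \<comment> \<open>The nine cofactors: the diagonal ones combine a diagonal entry of the square
    relation with \<open>s\<close>, the others are single off-diagonal entries of it.\<close>
  have c1: "N$2$2 * N$3$3 = N$2$3 * N$3$2" using q[of 1 1] s by Groebner_Basis.algebra
  have c2: "N$1$1 * N$3$3 = N$1$3 * N$3$1" using q[of 2 2] s by Groebner_Basis.algebra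
  have c3: "N$1$1 * N$2$2 = N$1$2 * N$2$1" using q[of 3 3] s by Groebner_Basis.algebra
  have d1: "N$1$2 * N$3$3 = N$1$3 * N$3$2" using q[of 1 2] by Groebner_Basis.algebra
  have d2: "N$1$3 * N$2$2 = N$1$2 * N$2$3" using q[of 1 3] by Groebner_Basis.algebra
  have d3: "N$2$1 * N$3$3 = N$2$3 * N$3$1" using q[of 2 1] by Groebner_Basis.algebra
  have d4: "N$2$3 * N$1$1 = N$2$1 * N$1$3" using q[of 2 3] by Groebner_Basis.algebra
  have d5: "N$3$1 * N$2$2 = N$3$2 * N$2$1" using q[of 3 1] by Groebner_Basis.algebra
  have d6: "N$3$2 * N$1$1 = N$3$1 * N$1$2" using q[of 3 2] by Groebner_Basis.algebra
  note c = c1 c2 c3 and d = d1 d2 d3 d4 d5 d6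
  have "N$i$k * N$j$l = N$i$l * N$j$k" for i j k l
    using exhaust_3[of i] exhaust_3[of j] exhaust_3[of k] exhaust_3[of l] c d by (elim disjE) (simp_all add: ac_simps)
  then obtain u f where "\<And>v. N *v v = dot3 f v *s u" by (rule rank_one_factor[of N]) blast
  then show ?thesis by (rule that)
qed

lemma dot3_lin: "dot3 f (a - b) = dot3 f a - dot3 f b" "dot3 f (a + b) = dot3 f a + dot3 f b" "dot3 f (c *s a) = c * dot3 f a"
  by (simp_all add: dot3_def algebra_simps)

lemma dot3_nonzero: "f \<noteq> 0 \<Longrightarrow> \<exists>y. dot3 f y \<noteq> 0"
proof -
  assume "f \<noteq> 0"
  then obtain i where "f$i \<noteq> 0" by (auto simp: vec_eq_iff)
  then have "dot3 f (axis i 1) \<noteq> 0" using exhaust_3[of i] by (auto simp: dot3_def axis_def)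
  then show ?thesis by blast
qed

text \<open>With identity second slice the first slice N has characteristic polynomial t^2 (t - b),
  b the trace. Whether b = 0 and whether N^2 = b N decide the Jordan type: a nilpotent 2-block with
  an eigenvalue b, a nilpotent 3-block, diag(0, 0, b), or a nilpotent matrix of rank at most
  one.\<close>

lemma regular_normalized:
  fixes x :: "'f::field tens"
  assumes B: "slice 2 x = mat 1" and d: "det (slice 1 x) = 0" and s2: "dpol (slice 1 x) (mat 1) = 0"
  shows "classified x"
proof -
  define N where "N = slice 1 x"
  define b where "b = N$1$1 + N$2$2 + N$3$3"
  have CH: "N *v (N *v (N *v y)) = b *s (N *v (N *v y))" for y
    using cayley_hamilton3[of N y] d s2 by (simp add: N_def b_def)
  \<comment> \<open>Subtracting N / b from the identity makes the second slice kill the eigenvectors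
    for b, as the normal forms of \<open>beta6\<close> and \<open>beta42\<close> require.\<close>
  define x' where "x' = act3 (vector [vector [1, 0], vector [- 1 / b, 1]]) x"
  have x': "x \<in> orbit y" if "x' \<in> orbit y" for y
    using that unfolding x'_def by (rule act3_orbitD[rotated]) (simp add: det_2)
  have sl: "slice 1 x' *v p = N *v p" "slice 2 x' *v p = p - (1 / b) *s (N *v p)" for p
    unfolding x'_def slice_act3 N_def[symmetric] B by (simp_all add: vec3_eq_iff)
  show ?thesis
  proof (cases "\<forall>y. N *v (N *v y) = b *s (N *v y)")
    case False
    then obtain y where y: "N *v (N *v y) \<noteq> b *s (N *v y)" by blast
    show ?thesis
    proof (cases "b = 0")
      case b0: False
      \<comment> \<open>Applying N - b projects \<open>y\<close> into the generalised kernel, where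
        m and n form a Jordan chain.\<close>
      define n m where "n = N *v (N *v y) - b *s (N *v y)" and "m = N *v y - b *s y"
      have n: "n \<noteq> 0" "N *v m = n" "N *v n = 0" using y by (auto simp: n_def m_def mv_lin CH)
      \<comment> \<open>Otherwise N^2 would have trace zero; this trace is b^2 - 2 s2 = b^2.\<close>
      have "\<exists>z. N *v (N *v z) \<noteq> 0"
      proof (rule ccontr)
        assume "\<not> ?thesis"
        then have "(N *v (N *v axis j 1)) $ j = 0" for j by simp
        then have q: "N$j$1 * N$1$j + N$j$2 * N$2$j + N$j$3 * N$3$j = 0" for j
          by (simp only: mv3[of N "N *v axis j 1" for j] mv_axis)
        have s: "N$1$1 * N$2$2 - N$1$2 * N$2$1 + N$1$1 * N$3$3 - N$1$3 * N$3$1 + N$2$2 * N$3$3 - N$2$3 * N$3$2 = 0"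
          using s2 by (simp add: N_def dpol_def det_3 mat_def algebra_simps)
        have "b * b = 0" unfolding b_def using q[of 1] q[of 2] q[of 3] s by Groebner_Basis.algebra
        then show False using b0 by simp
      qed
      then obtain z where z: "N *v (N *v z) \<noteq> 0" by blast
      define w where "w = N *v (N *v z)"
      have w: "w \<noteq> 0" "N *v w = b *s w" using z by (auto simp: w_def CH)
      have D: "d3 n m w \<noteq> 0"
      proof
        assume "d3 n m w = 0"
        then obtain c1 c2 c3 where c: "c1 \<noteq> 0 \<or> c2 \<noteq> 0 \<or> c3 \<noteq> 0" "c1 *s n + c2 *s m + c3 *s w = 0"
          by (rule d3_dependent)
        have "N *v (c1 *s n + c2 *s m + c3 *s w) = 0" unfolding c(2) by (simp add: mv_lin)
        then have c': "c2 *s n + (c3 * b) *s w = 0" by (simp add: mv_lin n w)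
        have "N *v (c2 *s n + (c3 * b) *s w) = 0" unfolding c' by (simp add: mv_lin)
        then have "c3 = 0" using b0 w(1) by (simp add: mv_lin n w)
        moreover from this have "c2 = 0" using c' n(1) by simp
        ultimately show False using c n(1) by simp
      qed
      have "x' \<in> orbit (tens01 {(2, 2, 1), (3, 3, 1), (1, 2, 2), (2, 1, 2)})"
      proof (rule frame_orbit[OF D])
        have "d3 (m - (1 / b) *s n) n (b *s w) = - b * d3 n m w" by (simp add: d3_expand algebra_simps)
        then show "d3 (m - (1 / b) *s n) n (b *s w) \<noteq> 0" using D b0 by simp
      qed (use b0 in \<open>simp_all add: sl n w tens01_def\<close>)
      then show ?thesis by (intro classified_rep x') (simp_all add: reps_def)
    next
      case True
      define n where "n = N *v (N *v y)"
      have n: "n \<noteq> 0" "N *v n = 0" using y CH[of y] True by (auto simp: n_def)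
      have D: "d3 n (N *v y) y \<noteq> 0"
      proof
        assume "d3 n (N *v y) y = 0"
        then obtain c1 c2 c3 where c: "c1 \<noteq> 0 \<or> c2 \<noteq> 0 \<or> c3 \<noteq> 0" "c1 *s n + c2 *s (N *v y) + c3 *s y = 0"
          by (rule d3_dependent)
        have "N *v (c1 *s n + c2 *s (N *v y) + c3 *s y) = 0" unfolding c(2) by (simp add: mv_lin)
        then have c': "c2 *s n + c3 *s (N *v y) = 0" by (simp add: mv_lin n n_def[symmetric])
        have "N *v (c2 *s n + c3 *s (N *v y)) = 0" unfolding c' by (simp add: mv_lin)
        then have "c3 = 0" using n(1) by (simp add: mv_lin n n_def[symmetric])
        moreover from this have "c2 = 0" using c' n(1) by simp
        ultimately show False using c n(1) by simp
      qed
      have "x \<in> orbit (tens01 {(3, 2, 1), (2, 3, 1), (1, 3, 2), (2, 2, 2), (3, 1, 2)})"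
      proof (rule frame_orbit[OF D])
        have "d3 y (N *v y) n = - d3 n (N *v y) y" by (simp add: d3_expand)
        then show "d3 y (N *v y) n \<noteq> 0" using D by simp
      qed (simp_all add: B N_def[symmetric] n n_def[symmetric] tens01_def)
      then show ?thesis by (intro classified_rep) (simp_all add: reps_def)
    qed
  next
    case sq: True
    obtain u f where uf: "\<And>v. N *v v = dot3 f v *s u"
      using adjugate_square[of N] s2 sq unfolding b_def N_def by blast
    have bf: "b = dot3 f u"
    proof -
      have "N$i$i = f$i * u$i" for i
      proof -
        have "N$i$i = (N *v axis i 1) $ i"
          by (simp only: mv_axis)
        then show ?thesis unfolding uf using exhaust_3[of i] by (auto simp: dot3_def axis_def)
      qed
      then show ?thesis by (simp add: b_def dot3_def)
    qed
    show ?thesis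
    proof (cases "b = 0")
      case b0: False
      have "u \<noteq> 0" using b0 bf by (auto simp: dot3_def)
      then obtain s0 t0 where st: "d3 u s0 t0 \<noteq> 0" by (rule extend1)
      define s t where "s = s0 - (dot3 f s0 / b) *s u" and "t = t0 - (dot3 f t0 / b) *s u"
      have z: "dot3 f s = 0" "dot3 f t = 0" using b0 by (simp_all add: s_def t_def dot3_lin bf)
      have D: "d3 s t u \<noteq> 0"
      proof -
        have "d3 s t u = d3 u s0 t0" by (simp add: s_def t_def d3_expand algebra_simps)
        then show ?thesis using st by simp
      qed
      have "x' \<in> orbit (tens01 {(3, 3, 1), (1, 1, 2), (2, 2, 2)})"
      proof (rule frame_orbit[OF D])
        have "d3 s t (b *s u) = b * d3 s t u" by (simp add: d3_expand algebra_simps)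
        then show "d3 s t (b *s u) \<noteq> 0" using D b0 by simp
      qed (use b0 in \<open>simp_all add: sl uf z bf[symmetric] tens01_def\<close>)
      then show ?thesis by (intro classified_rep x') (simp_all add: reps_def)
    next
      case True
      show ?thesis
      proof (cases "u = 0 \<or> f = 0")
        case True
        then have "N *v axis j 1 = 0" for j by (auto simp: uf dot3_def)
        then have "N$i$j = 0" for i j
          using mv_axis[of N j i] by simp
        then have "x = tens01 {(1, 1, 2), (2, 2, 2), (3, 3, 2)}"
          using B unfolding vec_eq_iff split_paired_All N_def
          by (simp add: slice_def tens01_def forall_3 forall_2 mat_def)
        then show ?thesis using orbit_refl by (intro classified_rep[of "{(1, 1, 2), (2, 2, 2), (3, 3, 2)}"]) (simp_all add: reps_def)
      next
        case False
        obtain y where y: "dot3 f y \<noteq> 0" using dot3_nonzero False by blast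
        have "\<not> parallel3 u y"
        proof
          assume "parallel3 u y"
          then obtain a z b' where z: "u = a *s z" "y = b' *s z" by (rule parallel3E)
          then have "a * dot3 f z = 0" "b' * dot3 f z \<noteq> 0" using True bf y by (auto simp: dot3_lin)
          then show False using False z by auto
        qed
        then obtain t where t: "d3 u y t \<noteq> 0" by (rule extend2)
        define s where "s = t - (dot3 f t / dot3 f y) *s y"
        have z: "dot3 f s = 0" "dot3 f u = 0" using y True bf by (simp_all add: s_def dot3_lin)
        have D: "d3 (dot3 f y *s u) s y \<noteq> 0"
        proof -
          have "d3 (dot3 f y *s u) s y = - dot3 f y * d3 u y t"
            by (simp add: s_def d3_expand algebra_simps)
          then show ?thesis using t y by simp
        qed
        have "x \<in> orbit (tens01 {(3, 3, 1), (1, 3, 2), (2, 2, 2), (3, 1, 2)})"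
        proof (rule frame_orbit[OF D])
          have "d3 y s (dot3 f y *s u) = - d3 (dot3 f y *s u) s y" by (simp add: d3_expand)
          then show "d3 y s (dot3 f y *s u) \<noteq> 0" using D by simp
        qed (simp_all add: B N_def[symmetric] uf z dot3_lin tens01_def)
        then show ?thesis by (intro classified_rep) (simp_all add: reps_def)
      qed
    qed
  qed
qed

lemma slice_left: "slice l (act (g, mat 1, mat 1) x) = g ** slice l x"
proof -
  have "slice l x = (\<chi> i j. \<Sum>k\<in>UNIV. mat 1$l$k * x$(i, j, k))"
    by (simp add: slice_def mat_def if_distrib[where f = "\<lambda>x. x * _"] cong: if_cong)
  then show ?thesis by (simp add: slice_act transpose_mat del: act.simps)
qed

lemma det_lin_comb:
  fixes A B :: "'f::field^3^3"
  shows "det (\<chi> i j. a * A$i$j + b * B$i$j) = a ^ 3 * det A + a\<^sup>2 * b * dpol A B + a * b\<^sup>2 * dpol B A + b ^ 3 * det B"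
  by (simp add: det_3 dpol_def power2_eq_square power3_eq_cube algebra_simps)

lemma dpol_lin_comb:
  fixes A B :: "'f::field^3^3"
  shows "dpol (\<chi> i j. a * A$i$j + b * B$i$j) (\<chi> i j. c * A$i$j + d * B$i$j) =
    3 * a\<^sup>2 * c * det A + (a\<^sup>2 * d + 2 * a * b * c) * dpol A B + (b\<^sup>2 * c + 2 * a * b * d) * dpol B A + 3 * b\<^sup>2 * d * det B"
  by (simp add: det_3 dpol_def power2_eq_square algebra_simps)

lemma regular_classified:
  fixes x :: "'f::field tens"
  assumes d: "det (slice 1 x) = 0" "dpol (slice 1 x) (slice 2 x) = 0" and nz: "det (slice 2 x) \<noteq> 0"
  shows "classified x"
proof -
  have inv: "invertible (slice 2 x)" using nz by (simp add: invertible_det_nz)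
  define g where "g = matrix_inv (slice 2 x)"
  define x' where "x' = act (g, mat 1, mat 1) x"
  have g: "invertible g" "g ** slice 2 x = mat 1"
    using inv by (simp_all add: g_def matrix_inv_mult invertible_matrix_inv)
  have "x' \<in> orbit x"
    unfolding orbit_def x'_def using g one_GG by (intro imageI) (simp add: GG_iff)
  moreover have "classified x'"
  proof (rule regular_normalized)
    show "slice 2 x' = mat 1" by (simp only: x'_def slice_left g)
    show "det (slice 1 x') = 0" by (simp only: x'_def slice_left det_mul d mult_zero_right)
    have "dpol (slice 1 x') (mat 1) = dpol (g ** slice 1 x) (g ** slice 2 x)"
      by (simp only: x'_def slice_left g)
    then show "dpol (slice 1 x') (mat 1) = 0" by (simp add: dpol_mult_left d)
  qed
  ultimately show ?thesis using classified_orbit orbit_sym by blast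
qed

lemma regular_pencil_classified:
  fixes x :: "'f::field tens"
  assumes d: "det (slice 1 x) = 0" "dpol (slice 1 x) (slice 2 x) = 0"
    and nz: "dpol (slice 2 x) (slice 1 x) \<noteq> 0 \<or> det (slice 2 x) \<noteq> 0"
  shows "classified x"
proof (cases "det (slice 2 x) = 0")
  case True
  \<comment> \<open>When the other three coefficients vanish, det (A + B) equals
    \<open>dpol B A\<close>, so adding the first slice to the second makes the latter invertible and
    keeps the double root.\<close>
  define x' where "x' = act3 (vector [vector [1, 0], vector [1, 1]]) x"
  have sl: "slice 1 x' = (\<chi> i j. 1 * slice 1 x $i$j + 0 * slice 2 x $i$j)"
    "slice 2 x' = (\<chi> i j. 1 * slice 1 x $i$j + 1 * slice 2 x $i$j)"
    by (simp_all add: vec_eq_iff x'_def slice_act3_nth)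
  have "classified x'"
    by (rule regular_classified; unfold sl det_lin_comb dpol_lin_comb) (use d nz True in simp_all)
  moreover have "x' \<in> orbit x" unfolding x'_def by (rule act3_orbit) (simp add: det_2)
  ultimately show ?thesis using classified_orbit orbit_sym by blast
qed (use regular_classified d in blast)

subsection \<open>Singular pencils\<close>

text \<open>The \<open>2 \<times> 2\<close> block with \<open>i, j \<in> {2, 3}\<close>.\<close>

definition block_tens :: "'f::field \<Rightarrow> 'f \<Rightarrow> 'f \<Rightarrow> 'f \<Rightarrow> 'f \<Rightarrow> 'f \<Rightarrow> 'f \<Rightarrow> 'f \<Rightarrow> 'f tens" where
  "block_tens a b c d a' b' c' d' = (\<chi> t. case t of (i, j, l) \<Rightarrow>
     if i = 1 \<or> j = 1 then 0
     else if l = 1 then (if i = 2 then (if j = 2 then a else b) else (if j = 2 then c else d))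
     else (if i = 2 then (if j = 2 then a' else b') else (if j = 2 then c' else d')))"

definition vec2 :: "'f::field \<Rightarrow> 'f \<Rightarrow> 'f^3" where
  "vec2 a b = vector [0, a, b]"

lemma tens_eq_iff: "x = y \<longleftrightarrow> (\<forall>i j l. x $ (i, j, l) = y $ (i, j, l))"
  by (simp add: vec_eq_iff)

lemma block_tens_nth:
  "block_tens a b c d a' b' c' d' $ (1, j, l) = 0" "block_tens a b c d a' b' c' d' $ (i, 1, l) = 0"
  "block_tens a b c d a' b' c' d' $ (2, 2, 1) = a" "block_tens a b c d a' b' c' d' $ (2, 3, 1) = b"
  "block_tens a b c d a' b' c' d' $ (3, 2, 1) = c" "block_tens a b c d a' b' c' d' $ (3, 3, 1) = d"
  "block_tens a b c d a' b' c' d' $ (2, 2, 2) = a'" "block_tens a b c d a' b' c' d' $ (2, 3, 2) = b'"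
  "block_tens a b c d a' b' c' d' $ (3, 2, 2) = c'" "block_tens a b c d a' b' c' d' $ (3, 3, 2) = d'"
  by (simp_all add: block_tens_def)

lemma slice_block_axis:
  "slice l (block_tens a b c d a' b' c' d') *v vector [1, 0, 0] = 0"
  by (simp add: vec3_eq_iff mv3 slice_def block_tens_nth)

lemma slice_block_vec2:
  "slice 1 (block_tens a b c d a' b' c' d') *v vec2 u v = vec2 (a * u + b * v) (c * u + d * v)"
  "slice 2 (block_tens a b c d a' b' c' d') *v vec2 u v = vec2 (a' * u + b' * v) (c' * u + d' * v)"
  by (simp_all add: vec3_eq_iff mv3 slice_def block_tens_nth vec2_def)

lemma vec2_lin: "vec2 a b + vec2 c d = vec2 (a + c) (b + d)" "r *s vec2 a b = vec2 (r * a) (r * b)" "vec2 0 0 = 0"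
  by (simp_all add: vec3_eq_iff vec2_def)

lemma vec2_eq_iff: "vec2 a b = vec2 c d \<longleftrightarrow> a = c \<and> b = d"
  by (simp add: vec3_eq_iff vec2_def)

lemma d3_vec2: "d3 (vector [1, 0, 0]) (vec2 a b) (vec2 c d) = a * d - b * c"
  by (simp add: d3_expand vec2_def)

lemma block_frame:
  fixes y :: "'f::field tens"
  assumes y0: "\<And>j l. y $ (1, j, l) = 0" "\<And>i l. y $ (i, 1, l) = 0"
    and "m * n' - m' * n \<noteq> 0" "k * h' - k' * h \<noteq> 0"
    and "a * m + b * m' = y$(2,2,1) * k + y$(3,2,1) * h" "c * m + d * m' = y$(2,2,1) * k' + y$(3,2,1) * h'"
      "a * n + b * n' = y$(2,3,1) * k + y$(3,3,1) * h" "c * n + d * n' = y$(2,3,1) * k' + y$(3,3,1) * h'"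
      "a' * m + b' * m' = y$(2,2,2) * k + y$(3,2,2) * h" "c' * m + d' * m' = y$(2,2,2) * k' + y$(3,2,2) * h'"
      "a' * n + b' * n' = y$(2,3,2) * k + y$(3,3,2) * h" "c' * n + d' * n' = y$(2,3,2) * k' + y$(3,3,2) * h'"
  shows "block_tens a b c d a' b' c' d' \<in> orbit y"
proof (rule frame_orbit)
  show "d3 (vector [1, 0, 0]) (vec2 m m') (vec2 n n') \<noteq> 0" "d3 (vector [1, 0, 0]) (vec2 k k') (vec2 h h') \<noteq> 0"
    using assms(3,4) by (simp_all add: d3_vec2)
qed (use assms in \<open>simp_all add: slice_block_axis slice_block_vec2 vec2_lin vec2_eq_iff\<close>)

lemma block_mix:
  assumes "\<alpha> * \<delta> - \<beta> * \<gamma> \<noteq> 0"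
    and "block_tens (\<alpha>*a+\<beta>*a') (\<alpha>*b+\<beta>*b') (\<alpha>*c+\<beta>*c') (\<alpha>*d+\<beta>*d') (\<gamma>*a+\<delta>*a') (\<gamma>*b+\<delta>*b') (\<gamma>*c+\<delta>*c') (\<gamma>*d+\<delta>*d') \<in> orbit y"
  shows "block_tens a b c d a' b' c' d' \<in> orbit y"
proof -
  have "act3 (vector [vector [\<alpha>, \<beta>], vector [\<gamma>, \<delta>]]) (block_tens a b c d a' b' c' d') =
    block_tens (\<alpha>*a+\<beta>*a') (\<alpha>*b+\<beta>*b') (\<alpha>*c+\<beta>*c') (\<alpha>*d+\<beta>*d') (\<gamma>*a+\<delta>*a') (\<gamma>*b+\<delta>*b') (\<gamma>*c+\<delta>*c') (\<gamma>*d+\<delta>*d')"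
    unfolding tens_eq_iff by (simp add: act3_def sum_2 block_tens_def forall_2)
  then have "act3 (vector [vector [\<alpha>, \<beta>], vector [\<gamma>, \<delta>]]) (block_tens a b c d a' b' c' d') \<in> orbit y"
    using assms(2) by (simp only:)
  then show ?thesis
    by (rule act3_orbitD[rotated]) (use assms(1) in \<open>simp add: det_2\<close>)
qed

text \<open>Here v = (y, y') is a cyclic vector of the matrix M with entries p, q, r, s. In the
  source basis M v - tr(M) v, v and the target basis v, M v the pencil takes the symmetric form of
  \<open>quad_tens\<close>, by Cayley-Hamilton.\<close>

lemma block_identity_quad:
  assumes "y * (r * y + s * y') - y' * (p * y + q * y') \<noteq> 0"
  shows "block_tens 1 0 0 1 p q r s \<in> orbit (quad_tens (p + s) (p * s - q * r :: 'f::field))"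
proof (rule block_frame[where m = "- (p + s) * y + (p * y + q * y')" and m' = "- (p + s) * y' + (r * y + s * y')"
    and n = y and n' = y' and k = y and k' = y' and h = "p * y + q * y'" and h' = "r * y + s * y'"])
  show "(- (p + s) * y + (p * y + q * y')) * y' - (- (p + s) * y' + (r * y + s * y')) * y \<noteq> 0"
    using assms by (simp add: algebra_simps)
  show "y * (r * y + s * y') - y' * (p * y + q * y') \<noteq> 0" by (rule assms)
qed (simp_all add: quad_tens_def algebra_simps)

lemma quad_tens_00: "quad_tens 0 0 \<in> orbit (tens01 {(3, 3, 1), (2, 3, 2), (3, 2, 2)} :: 'f::field tens)"
proof -
  have "act3 (vector [vector [0, 1], vector [1, 0]]) (quad_tens 0 0) = (tens01 {(3, 3, 1), (2, 3, 2), (3, 2, 2)} :: 'f tens)"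
    unfolding tens_eq_iff by (simp add: act3_def sum_2 quad_tens_def tens01_def forall_2 forall_3)
  then have "act3 (vector [vector [0, 1], vector [1, 0]]) (quad_tens 0 0) \<in> orbit (tens01 {(3, 3, 1), (2, 3, 2), (3, 2, 2)} :: 'f tens)"
    by (simp only: orbit_refl)
  then show ?thesis
    by (rule act3_orbitD[rotated]) (simp add: det_2)
qed

text \<open>A scalar matrix gives \<open>beta45\<close>. Otherwise there is a cyclic vector; for
  vanishing discriminant the eigenvalue lies in the field, subtracting it leaves a nilpotent matrix,
  and \<open>quad_tens 0 0\<close> belongs to \<open>beta39\<close>.\<close>

lemma block_identity_classified:
  fixes p q r s :: "'f::field"
  assumes root: "\<And>b c :: 'f. b\<^sup>2 = 4 * c \<Longrightarrow> \<exists>r. r\<^sup>2 - b * r + c = 0"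
  shows "classified (block_tens 1 0 0 1 p q r s)"
proof (cases "q = 0 \<and> r = 0 \<and> p = s")
  case True
  have "block_tens 1 0 0 1 p q r s \<in> orbit (tens01 {(2, 2, 2), (3, 3, 2)})"
  proof (rule block_mix[of "- s" 0 1 1])
    have "block_tens 0 0 0 0 1 0 0 1 = (tens01 {(2, 2, 2), (3, 3, 2)} :: 'f tens)"
      unfolding tens_eq_iff by (simp add: block_tens_def tens01_def forall_3 forall_2)
    then show "block_tens (- s * 1 + 1 * p) (- s * 0 + 1 * q) (- s * 0 + 1 * r) (- s * 1 + 1 * s)
       (1 * 1 + 0 * p) (1 * 0 + 0 * q) (1 * 0 + 0 * r) (1 * 1 + 0 * s) \<in> orbit (tens01 {(2, 2, 2), (3, 3, 2)})"
      using True orbit_refl by simp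
  qed simp
  then show ?thesis by (intro classified_rep) (simp_all add: reps_def)
next
  case False
  \<comment> \<open>A non-scalar 2 by 2 matrix has a cyclic vector among (1, 0), (0, 1) and (1,
    1).\<close>
  obtain y y' where y: "y * (r * y + s * y') - y' * (p * y + q * y') \<noteq> 0"
  proof -
    consider "r \<noteq> 0" | "q \<noteq> 0" | "q = 0" "r = 0" "p \<noteq> s" using False by blast
    then show ?thesis
      by cases (use that[of 1 0] that[of 0 1] that[of 1 1] in auto)
  qed
  show ?thesis
  proof (cases "(p + s)\<^sup>2 = 4 * (p * s - q * r)")
    case False
    then show ?thesis using block_identity_quad[OF y] unfolding classified_def by blast
  next
    case True
    obtain \<rho> where \<rho>: "\<rho>\<^sup>2 - (p + s) * \<rho> + (p * s - q * r) = 0" using root[OF True] by blast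
    \<comment> \<open>This identity holds in every characteristic and shows that \<rho> is a double
      eigenvalue.\<close>
    have "(2 * \<rho> - (p + s))\<^sup>2 = 4 * (\<rho>\<^sup>2 - (p + s) * \<rho> + (p * s - q * r)) + ((p + s)\<^sup>2 - 4 * (p * s - q * r))"
      by (simp add: power2_eq_square algebra_simps)
    then have "2 * \<rho> - (p + s) = 0" using \<rho> True by simp
    then have tr: "(p - \<rho>) + (s - \<rho>) = 0" by (simp add: algebra_simps)
    have dt: "(p - \<rho>) * (s - \<rho>) - q * r = 0" using \<rho> by (simp add: power2_eq_square algebra_simps)
    have "block_tens 1 0 0 1 p q r s \<in> orbit (quad_tens 0 0)"
    proof (rule block_mix[of 1 1 0 "- \<rho>"])
      have "y * (r * y + (s - \<rho>) * y') - y' * ((p - \<rho>) * y + q * y') \<noteq> 0"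
        using y by (simp add: algebra_simps)
      from block_identity_quad[OF this]
      show "block_tens (1 * 1 + 0 * p) (1 * 0 + 0 * q) (1 * 0 + 0 * r) (1 * 1 + 0 * s)
       (- \<rho> * 1 + 1 * p) (- \<rho> * 0 + 1 * q) (- \<rho> * 0 + 1 * r) (- \<rho> * 1 + 1 * s) \<in> orbit (quad_tens 0 0)"
        by (simp add: tr dt)
    qed simp
    then have "block_tens 1 0 0 1 p q r s \<in> orbit (tens01 {(3, 3, 1), (2, 3, 2), (3, 2, 2)})"
      using quad_tens_00 orbit_trans by blast
    then show ?thesis by (intro classified_rep) (simp_all add: reps_def)
  qed
qed

lemma block_invertible_classified:
  fixes a b c d a' b' c' d' :: "'f::field"
  assumes root: "\<And>b c :: 'f. b\<^sup>2 = 4 * c \<Longrightarrow> \<exists>r. r\<^sup>2 - b * r + c = 0" and D: "a * d - b * c \<noteq> 0"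
  shows "classified (block_tens a b c d a' b' c' d')"
proof -
  define D where "D = a * d - b * c"
  have D0: "D \<noteq> 0" using D by (simp add: D_def)
  \<comment> \<open>The new second slice is the inverse of the first times the second, by Cramer's
    rule.\<close>
  define y where "y = block_tens 1 0 0 1 ((a' * d - b * c') / D) ((b' * d - b * d') / D) ((a * c' - c * a') / D) ((a * d' - c * b') / D)"
  have "block_tens a b c d a' b' c' d' \<in> orbit y"
  proof (rule block_frame[where m = 1 and m' = 0 and n = 0 and n' = 1 and k = a and k' = c and h = b and h' = d])
    show "a * d - c * b \<noteq> 0" using D by (simp add: mult.commute)
  qed (use D0 in \<open>simp_all add: y_def block_tens_nth eq_divide_eq add_divide_distrib[symmetric]\<close>, simp_all add: D_def algebra_simps)
  then show ?thesis unfolding y_def by (rule classified_orbit) (rule block_identity_classified, rule root)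
qed

text \<open>Both slices have image in the line of (u, v). Independent row vectors lead to
  \<open>beta47\<close>; proportional ones leave a single matrix of rank at most one, hence
  \<open>beta49\<close> or zero.\<close>

lemma block_row_classified:
  fixes u v f1 f2 g1 g2 :: "'f::field"
  shows "classified (block_tens (u * f1) (u * f2) (v * f1) (v * f2) (u * g1) (u * g2) (v * g1) (v * g2))"
proof (cases "u = 0 \<and> v = 0")
  case True
  then have "block_tens (u * f1) (u * f2) (v * f1) (v * f2) (u * g1) (u * g2) (v * g1) (v * g2) = 0"
    unfolding tens_eq_iff by (simp add: block_tens_def)
  then show ?thesis by (simp add: classified_def)
next
  case uv: False
  obtain w z where wz: "w * v - z * u \<noteq> 0"
  proof (cases "v = 0")
    case True
    then show ?thesis using uv that[of 0 1] by auto
  next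
    case False
    then show ?thesis using that[of 1 0] by auto
  qed
  show ?thesis
  proof (cases "f1 * g2 - f2 * g1 = 0")
    case False
    define \<delta> where "\<delta> = f1 * g2 - f2 * g1"
    have "block_tens (u * f1) (u * f2) (v * f1) (v * f2) (u * g1) (u * g2) (v * g1) (v * g2) \<in> orbit (tens01 {(3, 2, 1), (3, 3, 2)})"
    proof (rule block_frame[where m = g2 and m' = "- g1" and n = "- f2" and n' = f1
          and k = w and k' = z and h = "\<delta> * u" and h' = "\<delta> * v"])
      have "w * (\<delta> * v) - z * (\<delta> * u) = \<delta> * (w * v - z * u)" by (simp add: algebra_simps)
      then show "w * (\<delta> * v) - z * (\<delta> * u) \<noteq> 0" using wz False by (simp add: \<delta>_def)
      show "g2 * f1 - - g1 * - f2 \<noteq> 0" using False by (simp add: algebra_simps)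
    qed (simp_all add: tens01_def \<delta>_def algebra_simps)
    then show ?thesis by (intro classified_rep) (simp_all add: reps_def)
  next
    case True
    obtain \<alpha> \<beta> t1 t2 where t: "f1 = \<alpha> * t1" "f2 = \<alpha> * t2" "g1 = \<beta> * t1" "g2 = \<beta> * t2"
    proof -
      have "parallel3 (vec2 f1 f2) (vec2 g1 g2)" using True by (simp add: parallel3_def vec2_def algebra_simps)
      then obtain a w b where "vec2 f1 f2 = a *s w" "vec2 g1 g2 = b *s w" by (rule parallel3E)
      then show ?thesis using that[of a "w$2" "w$3" b] by (simp add: vec3_eq_iff vec2_def)
    qed
    show ?thesis
    proof (cases "(\<alpha> = 0 \<and> \<beta> = 0) \<or> (t1 = 0 \<and> t2 = 0)")
      case True
      then have "block_tens (u * f1) (u * f2) (v * f1) (v * f2) (u * g1) (u * g2) (v * g1) (v * g2) = 0"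
        unfolding tens_eq_iff by (auto simp: block_tens_def t)
      then show ?thesis by (simp add: classified_def)
    next
      case nz: False
      \<comment> \<open>The row vectors are \<alpha> and \<beta> times a common vector, so mixing
        with (\<beta>, -\<alpha>) kills the first slice; the other row completes this to an
        invertible mix.\<close>
      obtain \<gamma> \<epsilon> where k: "\<beta> * \<epsilon> + \<alpha> * \<gamma> \<noteq> 0"
        using nz that[of 0 1] that[of 1 0] by (cases "\<alpha> = 0") auto
      define \<kappa> where "\<kappa> = \<beta> * \<epsilon> + \<alpha> * \<gamma>"
      obtain e1 e2 where e: "t1 * e1 + t2 * e2 \<noteq> 0"
        using nz that[of 0 1] that[of 1 0] by (cases "t1 = 0") auto
      have "block_tens (u * f1) (u * f2) (v * f1) (v * f2) (u * g1) (u * g2) (v * g1) (v * g2) \<in> orbit (tens01 {(3, 3, 2)})"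
      proof (rule block_mix[of \<beta> \<epsilon> "- \<alpha>" \<gamma>])
        show "\<beta> * \<epsilon> - - \<alpha> * \<gamma> \<noteq> 0" using k by simp
        have m: "\<beta> * (x * (\<alpha> * t)) + - \<alpha> * (x * (\<beta> * t)) = 0" "\<gamma> * (x * (\<alpha> * t)) + \<epsilon> * (x * (\<beta> * t)) = \<kappa> * x * t" for x t
          by (simp_all add: \<kappa>_def algebra_simps)
        show "block_tens (\<beta> * (u * f1) + - \<alpha> * (u * g1)) (\<beta> * (u * f2) + - \<alpha> * (u * g2))
           (\<beta> * (v * f1) + - \<alpha> * (v * g1)) (\<beta> * (v * f2) + - \<alpha> * (v * g2))
           (\<gamma> * (u * f1) + \<epsilon> * (u * g1)) (\<gamma> * (u * f2) + \<epsilon> * (u * g2))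
           (\<gamma> * (v * f1) + \<epsilon> * (v * g1)) (\<gamma> * (v * f2) + \<epsilon> * (v * g2)) \<in> orbit (tens01 {(3, 3, 2)})"
          unfolding t m
        proof (rule block_frame[where m = "- t2" and m' = t1 and n = e1 and n' = e2
              and k = w and k' = z and h = "\<kappa> * (t1 * e1 + t2 * e2) * u" and h' = "\<kappa> * (t1 * e1 + t2 * e2) * v"])
          have "w * (\<kappa> * (t1 * e1 + t2 * e2) * v) - z * (\<kappa> * (t1 * e1 + t2 * e2) * u) =
              \<kappa> * (t1 * e1 + t2 * e2) * (w * v - z * u)" by (simp add: algebra_simps)
          then show "w * (\<kappa> * (t1 * e1 + t2 * e2) * v) - z * (\<kappa> * (t1 * e1 + t2 * e2) * u) \<noteq> 0"
            using wz e k by (simp add: \<kappa>_def)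
          have "- t2 * e2 - t1 * e1 = - (t1 * e1 + t2 * e2)" by simp
          then show "- t2 * e2 - t1 * e1 \<noteq> 0" using e by (simp only: neg_equal_0_iff_equal not_False_eq_True)
        qed (simp_all add: tens01_def algebra_simps)
      qed
      then show ?thesis by (intro classified_rep) (simp_all add: reps_def)
    qed
  qed
qed

lemma swap_block_tens: "swap_tens (block_tens a b c d a' b' c' d') = block_tens a c b d a' c' b' d'"
  unfolding tens_eq_iff by (simp add: block_tens_def)

lemma rank_one_2x2:
  fixes a b c d :: "'f::field"
  assumes "a * d = b * c"
  obtains u v f g where "a = u * f" "b = u * g" "c = v * f" "d = v * g"
proof -
  have "parallel3 (vec2 a b) (vec2 c d)" using assms by (simp add: parallel3_def vec2_def)
  then obtain u w v where "vec2 a b = u *s w" "vec2 c d = v *s w" by (rule parallel3E)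
  then show ?thesis using that[of u "w$2" "w$3" v] by (simp add: vec3_eq_iff vec2_def)
qed

text \<open>If one of A, B, A + B is invertible it can serve as the first slice. Otherwise A and B
  have rank at most one, and det (A + B) factors into the determinant of the column directions and
  that of the row directions, so one of the two directions is shared.\<close>

lemma block_classified:
  fixes a b c d a' b' c' d' :: "'f::field"
  assumes root: "\<And>b c :: 'f. b\<^sup>2 = 4 * c \<Longrightarrow> \<exists>r. r\<^sup>2 - b * r + c = 0"
  shows "classified (block_tens a b c d a' b' c' d')"
proof -
  consider "a * d - b * c \<noteq> 0" | "a' * d' - b' * c' \<noteq> 0" | "(a + a') * (d + d') - (b + b') * (c + c') \<noteq> 0"
    | "a * d = b * c" "a' * d' = b' * c'" "(a + a') * (d + d') = (b + b') * (c + c')"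
    by auto
  then show ?thesis
  proof cases
    case 1
    show ?thesis by (rule block_invertible_classified[OF _ 1]) (rule root)
  next
    case 2
    have "block_tens a b c d a' b' c' d' \<in> orbit (block_tens a' b' c' d' a b c d)"
      by (rule block_mix[of 0 0 1 1]) (simp_all add: orbit_refl)
    then show ?thesis by (rule classified_orbit) (rule block_invertible_classified[OF _ 2], rule root)
  next
    case 3
    have "block_tens a b c d a' b' c' d' \<in> orbit (block_tens (a + a') (b + b') (c + c') (d + d') a' b' c' d')"
      by (rule block_mix[of 1 1 1 0]) (simp_all add: orbit_refl)
    then show ?thesis by (rule classified_orbit) (rule block_invertible_classified[OF _ 3], rule root)
  next
    case 4
    obtain u v f g where A: "a = u * f" "b = u * g" "c = v * f" "d = v * g" by (rule rank_one_2x2[OF 4(1)])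
    obtain u' v' f' g' where B: "a' = u' * f'" "b' = u' * g'" "c' = v' * f'" "d' = v' * g'" by (rule rank_one_2x2[OF 4(2)])
    have "(u * v' - v * u') * (f * g' - g * f') = (a + a') * (d + d') - (b + b') * (c + c')"
      unfolding A B by (simp add: algebra_simps)
    then consider "u * v' = v * u'" | "f * g' = g * f'" using 4(3) by auto
    then show ?thesis
    proof cases
      case 1
      obtain \<alpha> \<beta> s t where st: "u = \<alpha> * s" "v = \<alpha> * t" "u' = \<beta> * s" "v' = \<beta> * t"
        by (rule rank_one_2x2[OF 1])
      have "block_tens a b c d a' b' c' d' = block_tens (s * (\<alpha> * f)) (s * (\<alpha> * g)) (t * (\<alpha> * f)) (t * (\<alpha> * g))
        (s * (\<beta> * f')) (s * (\<beta> * g')) (t * (\<beta> * f')) (t * (\<beta> * g'))"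
        unfolding A B st by (simp only: ac_simps)
      then show ?thesis by (simp only: block_row_classified)
    next
      case 2
      obtain \<alpha> \<beta> s t where st: "f = \<alpha> * s" "g = \<alpha> * t" "f' = \<beta> * s" "g' = \<beta> * t"
        by (rule rank_one_2x2[OF 2])
      have "swap_tens (block_tens a b c d a' b' c' d') = block_tens (s * (\<alpha> * u)) (s * (\<alpha> * v)) (t * (\<alpha> * u)) (t * (\<alpha> * v))
        (s * (\<beta> * u')) (s * (\<beta> * v')) (t * (\<beta> * u')) (t * (\<beta> * v'))"
        unfolding swap_block_tens A B st by (simp only: ac_simps)
      then have "classified (swap_tens (block_tens a b c d a' b' c' d'))" by (simp only: block_row_classified)
      then show ?thesis by (rule classified_swap)
    qed
  qed
qed

section \<open>Pencils with a common kernel\<close>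

lemma d3_zero_of_perp:
  assumes "m \<noteq> 0" "dot3 m p = 0" "dot3 m q = 0" "dot3 m r = 0"
  shows "d3 p q r = 0"
proof -
  obtain i where i: "m$i \<noteq> 0" using assms(1) by (auto simp: vec_eq_iff)
  have e: "m$1 * p$1 + m$2 * p$2 + m$3 * p$3 = 0" "m$1 * q$1 + m$2 * q$2 + m$3 * q$3 = 0"
    "m$1 * r$1 + m$2 * r$2 + m$3 * r$3 = 0"
    using assms(2-4) by (simp_all add: dot3_def)
  have "m$1 * d3 p q r = 0" unfolding d3_expand using e by Groebner_Basis.algebra
  moreover have "m$2 * d3 p q r = 0" unfolding d3_expand using e by Groebner_Basis.algebra
  moreover have "m$3 * d3 p q r = 0" unfolding d3_expand using e by Groebner_Basis.algebra
  ultimately show ?thesis using i exhaust_3[of i] by auto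
qed

lemma cramer3: "d3 p q r *s v = d3 v q r *s p + d3 p v r *s q + d3 p q v *s r"
  by (simp add: vec3_eq_iff d3_expand algebra_simps)

text \<open>The matrices of the slices in two given bases, written out by Cramer's rule.\<close>

definition frame_coords :: "'f::field^3 \<Rightarrow> 'f^3 \<Rightarrow> 'f^3 \<Rightarrow> 'f^3 \<Rightarrow> 'f^3 \<Rightarrow> 'f^3 \<Rightarrow> 'f tens \<Rightarrow> 'f tens" where
  "frame_coords p1 p2 p3 q1 q2 q3 x = (\<chi> t. case t of (i, j, l) \<Rightarrow>
     let v = slice l x *v (if j = 1 then p1 else if j = 2 then p2 else p3) in
     (if i = 1 then d3 v q2 q3 else if i = 2 then d3 q1 v q3 else d3 q1 q2 v) / d3 q1 q2 q3)"

lemma frame_coords_orbit: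
  assumes "d3 p1 p2 p3 \<noteq> 0" and Q: "d3 q1 q2 q3 \<noteq> 0"
  shows "x \<in> orbit (frame_coords p1 p2 p3 q1 q2 q3 x)"
proof -
  have v: "v = (d3 v q2 q3 / d3 q1 q2 q3) *s q1 + (d3 q1 v q3 / d3 q1 q2 q3) *s q2 + (d3 q1 q2 v / d3 q1 q2 q3) *s q3" for v
  proof -
    have "v = (1 / d3 q1 q2 q3) *s (d3 q1 q2 q3 *s v)" using Q by simp
    also have "\<dots> = (d3 v q2 q3 / d3 q1 q2 q3) *s q1 + (d3 q1 v q3 / d3 q1 q2 q3) *s q2 + (d3 q1 q2 v / d3 q1 q2 q3) *s q3"
      unfolding cramer3[of q1 q2 q3 v] by (simp add: vector_add_ldistrib)
    finally show ?thesis .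
  qed
  show ?thesis
    by (rule frame_orbit[OF assms]; simp only: frame_coords_def Let_def vec_lambda_beta prod.case)
      (simp, rule v)+
qed

text \<open>Beyond the common kernel two source vectors remain. If some covector kills all images,
  the pencil is a 2 by 2 block. Otherwise the four images span the target, so they satisfy one
  linear relation (s, t; u, v); a non-degenerate relation gives the Kronecker block of
  \<open>beta5\<close>, a rank-one relation gives \<open>beta41\<close>.\<close>

lemma right_kernel_classified:
  fixes x :: "'f::field tens"
  assumes root: "\<And>b c :: 'f. b\<^sup>2 = 4 * c \<Longrightarrow> \<exists>r. r\<^sup>2 - b * r + c = 0"
    and n: "n \<noteq> 0" "slice 1 x *v n = 0" "slice 2 x *v n = 0"
  shows "classified x"
proof -
  obtain p2 p3 where P: "d3 n p2 p3 \<noteq> 0" using extend1[OF n(1)] by blast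
  have sn: "slice l x *v n = 0" for l using n exhaust_2[of l] by auto
  show ?thesis
  proof (cases "\<exists>m. m \<noteq> 0 \<and> (\<forall>v l. dot3 m (slice l x *v v) = 0)")
    case True
    then obtain m where m: "m \<noteq> 0" "\<And>v l. dot3 m (slice l x *v v) = 0" by blast
    obtain q1 where q1: "dot3 m q1 \<noteq> 0" using dot3_nonzero[OF m(1)] by blast
    then have "q1 \<noteq> 0" by (auto simp: dot3_def)
    then obtain s t where st: "d3 q1 s t \<noteq> 0" by (rule extend1)
    define q2 q3 where "q2 = s - (dot3 m s / dot3 m q1) *s q1" and "q3 = t - (dot3 m t / dot3 m q1) *s q1"
    have mq: "dot3 m q2 = 0" "dot3 m q3 = 0" using q1 by (simp_all add: q2_def q3_def dot3_lin)
    have "d3 q1 q2 q3 = d3 q1 s t" by (simp add: q2_def q3_def d3_expand algebra_simps)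
    then have Q: "d3 q1 q2 q3 \<noteq> 0" using st by simp
    define y where "y = frame_coords n p2 p3 q1 q2 q3 x"
    have "x \<in> orbit y" unfolding y_def by (rule frame_coords_orbit[OF P Q])
    moreover have "y = block_tens (y$(2,2,1)) (y$(2,3,1)) (y$(3,2,1)) (y$(3,3,1)) (y$(2,2,2)) (y$(2,3,2)) (y$(3,2,2)) (y$(3,3,2))"
    proof -
      have "d3 (slice l x *v v) q2 q3 = 0" for l v by (rule d3_zero_of_perp[OF m mq])
      then have "y$(1, j, l) = 0" for j l by (simp add: y_def frame_coords_def)
      moreover have "d3 0 q r = 0" "d3 q 0 r = 0" "d3 q r 0 = 0" for q r :: "'f^3" by (simp_all add: d3_expand)
      then have "y$(i, 1, l) = 0" for i l by (simp add: y_def frame_coords_def sn)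
      ultimately show ?thesis unfolding tens_eq_iff[of y] by (simp add: forall_3 forall_2 block_tens_nth)
    qed
    ultimately show ?thesis using block_classified[OF root] classified_orbit by metis
  next
    case False
    \<comment> \<open>Three vectors whose annihilator also kills the images of p2 and p3 are a
      basis, since no non-zero covector kills all images.\<close>
    have Q: "d3 q1 q2 q3 \<noteq> 0" if "\<And>m l. dot3 m q1 = 0 \<Longrightarrow> dot3 m q2 = 0 \<Longrightarrow> dot3 m q3 = 0 \<Longrightarrow>
        dot3 m (slice l x *v p2) = 0 \<and> dot3 m (slice l x *v p3) = 0" for q1 q2 q3
    proof
      assume "d3 q1 q2 q3 = 0"
      then obtain m where m: "m \<noteq> 0" "dot3 m q1 = 0" "dot3 m q2 = 0" "dot3 m q3 = 0" by (rule d3_perp)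
      have "dot3 m (slice l x *v v) = 0" for v l
      proof -
        have "d3 n p2 p3 * dot3 m (slice l x *v v) = dot3 m (slice l x *v (d3 n p2 p3 *s v))"
          by (simp add: mv_lin dot3_lin)
        also have "\<dots> = 0"
          unfolding cramer3[of n p2 p3 v] using that[OF m(2-4), of l] by (simp add: mv_lin dot3_lin sn dot3_def[of m 0])
        finally show ?thesis using P by simp
      qed
      then show False using False m(1) by blast
    qed
    let ?A = "slice 1 x" and ?B = "slice 2 x"
    \<comment> \<open>Four vectors in a three-dimensional space are dependent.\<close>
    obtain s t u v where rel: "s \<noteq> 0 \<or> t \<noteq> 0 \<or> u \<noteq> 0 \<or> v \<noteq> 0"
      "s *s (?A *v p2) + t *s (?A *v p3) + u *s (?B *v p2) + v *s (?B *v p3) = 0"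
    proof (cases "d3 (?A *v p2) (?A *v p3) (?B *v p2) = 0")
      case True
      then obtain a b c where "a \<noteq> 0 \<or> b \<noteq> 0 \<or> c \<noteq> 0" "a *s (?A *v p2) + b *s (?A *v p3) + c *s (?B *v p2) = 0"
        by (rule d3_dependent)
      then show ?thesis by (intro that[of a b c 0]) auto
    next
      case D: False
      define d where "d = d3 (?A *v p2) (?A *v p3) (?B *v p2)"
      show ?thesis
      proof (rule that[of "d3 (?B *v p3) (?A *v p3) (?B *v p2)" "d3 (?A *v p2) (?B *v p3) (?B *v p2)"
            "d3 (?A *v p2) (?A *v p3) (?B *v p3)" "- d"])
        show "d3 (?B *v p3) (?A *v p3) (?B *v p2) *s (?A *v p2) + d3 (?A *v p2) (?B *v p3) (?B *v p2) *s (?A *v p3) +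
            d3 (?A *v p2) (?A *v p3) (?B *v p3) *s (?B *v p2) + - d *s (?B *v p3) = 0"
          using cramer3[of "?A *v p2" "?A *v p3" "?B *v p2" "?B *v p3"] by (simp add: d_def vec3_eq_iff)
      qed (use D in \<open>simp add: d_def\<close>)
    qed
    show ?thesis
    proof (cases "s * v - t * u = 0")
      case nz: False
      \<comment> \<open>Regrouped by slices, the relation reads A y = B z.\<close>
      define y z where "y = s *s p2 + t *s p3" and "z = (- u) *s p2 + (- v) *s p3"
      have "?A *v y - ?B *v z = s *s (?A *v p2) + t *s (?A *v p3) + u *s (?B *v p2) + v *s (?B *v p3)"
        unfolding y_def z_def mv_lin by (simp add: vec3_eq_iff)
      then have AB: "?A *v y = ?B *v z" using rel(2) by simp
      have Pyz: "d3 n z y = (s * v - t * u) * d3 n p2 p3" by (simp add: y_def z_def d3_expand algebra_simps)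
      have p23: "(s * v - t * u) *s p2 = v *s y + t *s z" "(s * v - t * u) *s p3 = (- u) *s y + (- s) *s z"
        by (simp_all add: y_def z_def vec3_eq_iff algebra_simps)
      have "x \<in> orbit (tens01 {(1, 2, 1), (2, 2, 2), (2, 3, 1), (3, 3, 2)})"
      proof (rule frame_orbit)
        show "d3 n z y \<noteq> 0" using Pyz nz P by simp
        show "d3 (?A *v z) (?B *v z) (?B *v y) \<noteq> 0"
        proof (rule Q)
          fix m l assume m: "dot3 m (?A *v z) = 0" "dot3 m (?B *v z) = 0" "dot3 m (?B *v y) = 0"
          have my: "dot3 m (slice l x *v y) = 0" "dot3 m (slice l x *v z) = 0"
            using m AB exhaust_2[of l] by auto
          have "(s * v - t * u) * dot3 m (slice l x *v p2) = dot3 m (slice l x *v ((s * v - t * u) *s p2))"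
            "(s * v - t * u) * dot3 m (slice l x *v p3) = dot3 m (slice l x *v ((s * v - t * u) *s p3))"
            by (simp_all only: mv_lin dot3_lin)
          then have "(s * v - t * u) * dot3 m (slice l x *v p2) = 0" "(s * v - t * u) * dot3 m (slice l x *v p3) = 0"
            unfolding p23 by (simp_all only: mv_lin dot3_lin my mult_zero_right add_0)
          then show "dot3 m (slice l x *v p2) = 0 \<and> dot3 m (slice l x *v p3) = 0" using nz by simp
        qed
      qed (simp_all add: sn tens01_def AB)
      then show ?thesis by (intro classified_rep) (simp_all add: reps_def)
    next
      case True
      have "s * v = t * u" using True by simp
      \<comment> \<open>A rank-one relation says that the combination e A + f B kills y = \<sigma>
        p2 + \<tau> p3.\<close>
      then obtain e f \<sigma> \<tau> where st: "s = e * \<sigma>" "t = e * \<tau>" "u = f * \<sigma>" "v = f * \<tau>"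
        by (rule rank_one_2x2)
      have ef: "e \<noteq> 0 \<or> f \<noteq> 0" "\<sigma> \<noteq> 0 \<or> \<tau> \<noteq> 0" using rel(1) st by auto
      obtain g h where gh: "e * h - f * g \<noteq> 0"
        using ef(1) that[of 0 1] that[of 1 0] by (cases "e = 0") auto
      define y where "y = \<sigma> *s p2 + \<tau> *s p3"
      obtain c c' where cc: "\<sigma> * c' - \<tau> * c \<noteq> 0"
        using ef(2) that[of 0 1] that[of 1 0] by (cases "\<sigma> = 0") auto
      define z where "z = c *s p2 + c' *s p3"
      have Pyz: "d3 n y z = (\<sigma> * c' - \<tau> * c) * d3 n p2 p3" by (simp add: y_def z_def d3_expand algebra_simps)
      have p23: "(\<sigma> * c' - \<tau> * c) *s p2 = c' *s y - \<tau> *s z" "(\<sigma> * c' - \<tau> * c) *s p3 = \<sigma> *s z - c *s y"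
        by (simp_all add: y_def z_def vec3_eq_iff algebra_simps)
      define x' where "x' = act3 (vector [vector [e, f], vector [g, h]]) x"
      have sl: "slice 1 x' *v w = e *s (?A *v w) + f *s (?B *v w)" "slice 2 x' *v w = g *s (?A *v w) + h *s (?B *v w)" for w
        by (simp_all add: x'_def slice_act3)
      have Ay: "slice 1 x' *v y = 0"
        using rel(2) unfolding sl st y_def by (simp add: mv_lin vec3_eq_iff algebra_simps)
      have unmix: "(e * h - f * g) *s (?A *v w) = h *s (slice 1 x' *v w) - f *s (slice 2 x' *v w)"
        "(e * h - f * g) *s (?B *v w) = e *s (slice 2 x' *v w) - g *s (slice 1 x' *v w)" for w
        unfolding sl by (simp_all add: vec3_eq_iff algebra_simps)
      have "x' \<in> orbit (tens01 {(3, 3, 1), (2, 2, 2), (1, 3, 2)})"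
      proof (rule frame_orbit)
        show "d3 n y z \<noteq> 0" using Pyz cc P by simp
        show "d3 (slice 2 x' *v z) (slice 2 x' *v y) (slice 1 x' *v z) \<noteq> 0"
        proof (rule Q)
          fix m l assume m: "dot3 m (slice 2 x' *v z) = 0" "dot3 m (slice 2 x' *v y) = 0" "dot3 m (slice 1 x' *v z) = 0"
          have m0: "dot3 m 0 = 0" by (simp add: dot3_def)
          have "dot3 m ((e * h - f * g) *s (?A *v w)) = 0" "dot3 m ((e * h - f * g) *s (?B *v w)) = 0" if "w = y \<or> w = z" for w
            unfolding unmix using that m Ay by (auto simp: dot3_lin m0)
          then have "(e * h - f * g) * dot3 m (?A *v w) = 0" "(e * h - f * g) * dot3 m (?B *v w) = 0" if "w = y \<or> w = z" for w
            using that by (simp_all only: dot3_lin)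
          then have "(e * h - f * g) * dot3 m (slice l x *v w) = 0" if "w = y \<or> w = z" for w
            using that exhaust_2[of l] by metis
          then have my: "dot3 m (slice l x *v y) = 0" "dot3 m (slice l x *v z) = 0" using gh by auto
          have "(\<sigma> * c' - \<tau> * c) * dot3 m (slice l x *v p2) = dot3 m (slice l x *v ((\<sigma> * c' - \<tau> * c) *s p2))"
            "(\<sigma> * c' - \<tau> * c) * dot3 m (slice l x *v p3) = dot3 m (slice l x *v ((\<sigma> * c' - \<tau> * c) *s p3))"
            by (simp_all only: mv_lin dot3_lin)
          then have "(\<sigma> * c' - \<tau> * c) * dot3 m (slice l x *v p2) = 0" "(\<sigma> * c' - \<tau> * c) * dot3 m (slice l x *v p3) = 0"
            unfolding p23 by (simp_all only: mv_lin dot3_lin my mult_zero_right diff_self)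
          then show "dot3 m (slice l x *v p2) = 0 \<and> dot3 m (slice l x *v p3) = 0" using cc by simp
        qed
      qed (simp_all add: Ay tens01_def, simp_all add: sl sn)
      then have "x \<in> orbit (tens01 {(3, 3, 1), (2, 2, 2), (1, 3, 2)})"
        unfolding x'_def by (rule act3_orbitD[rotated]) (use gh in \<open>simp add: det_2\<close>)
      then show ?thesis by (intro classified_rep) (simp_all add: reps_def)
    qed
  qed
qed

lemma left_kernel_classified:
  fixes x :: "'f::field tens"
  assumes root: "\<And>b c :: 'f. b\<^sup>2 = 4 * c \<Longrightarrow> \<exists>r. r\<^sup>2 - b * r + c = 0"
    and m: "m \<noteq> 0" "\<And>v. dot3 m (slice 1 x *v v) = 0" "\<And>v. dot3 m (slice 2 x *v v) = 0"
  shows "classified x"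
proof -
  have e: "(transpose M *v m) $ j = dot3 m (M *v axis j 1)" for M :: "'f^3^3" and j
    by (simp only: mv3[of "transpose M" m] dot3_def mv_axis) (simp add: transpose_def mult.commute)
  have "slice l (swap_tens x) *v m = 0" for l
    unfolding slice_swap vec_eq_iff e using m exhaust_2[of l] by auto
  then have "classified (swap_tens x)" using right_kernel_classified[OF root m(1)] by blast
  then show ?thesis by (rule classified_swap)
qed

section \<open>Pencils whose determinant vanishes identically\<close>

definition singular_pencil :: "'f::field tens \<Rightarrow> bool" where
  "singular_pencil x \<longleftrightarrow> det (pencil (slice 1 x) (slice 2 x)) = 0"

lemma singular_pencil_iff: "singular_pencil x \<longleftrightarrow> det (slice 1 x) = 0 \<and> dpol (slice 1 x) (slice 2 x) = 0 \<and>
    dpol (slice 2 x) (slice 1 x) = 0 \<and> det (slice 2 x) = 0"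
  by (simp add: singular_pencil_def det_pencil)

lemma slice_act_split: "slice l (act (g1, g2, g3) x) = g1 ** slice l (act3 g3 x) ** transpose g2"
  unfolding slice_act by (simp add: slice_def act3_def)

lemma slice_act3_lin: "slice l (act3 h x) = (\<chi> i j. h$l$1 * slice 1 x$i$j + h$l$2 * slice 2 x$i$j)"
  by (simp add: vec_eq_iff slice_act3_nth)

lemma singular_pencil_orbit:
  assumes "x \<in> orbit y" "singular_pencil y" shows "singular_pencil x"
proof -
  obtain g1 g2 g3 where x: "x = act (g1, g2, g3) y" using assms(1) unfolding orbit_def by fast
  show ?thesis
    using assms(2) unfolding singular_pencil_iff x slice_act_split det_mul dpol_mult_left dpol_mult_right
      slice_act3_lin det_lin_comb dpol_lin_comb by simp
qed

lemma rank_cases: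
  fixes A :: "'f::field^3^3"
  assumes "det A = 0"
  obtains u f where "\<And>v. A *v v = dot3 f v *s u"
  | p1 p2 n where "d3 p1 p2 n \<noteq> 0" "A *v n = 0" "\<not> parallel3 (A *v p1) (A *v p2)"
proof -
  obtain n where n: "n \<noteq> 0" "A *v n = 0" using singular_kernel[OF assms] by blast
  obtain s t where D: "d3 n s t \<noteq> 0" using extend1[OF n(1)] by blast
  have D': "d3 s t n \<noteq> 0" using D by (simp add: d3_expand algebra_simps)
  show ?thesis
  proof (cases "parallel3 (A *v s) (A *v t)")
    case False
    then show ?thesis using that(2)[OF D' n(2)] by blast
  next
    case True
    then obtain a u b where ab: "A *v s = a *s u" "A *v t = b *s u" by (rule parallel3E)
    \<comment> \<open>Up to \<open>d3 n s t\<close>, the coordinate functionals of s and t in the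
      basis n, s, t, written as cross products.\<close>
    define K L :: "'f^3" where "K = vector [n$3 * t$2 - n$2 * t$3, n$1 * t$3 - n$3 * t$1, n$2 * t$1 - n$1 * t$2]"
      and "L = vector [n$2 * s$3 - n$3 * s$2, n$3 * s$1 - n$1 * s$3, n$1 * s$2 - n$2 * s$1]"
    have KL: "d3 n v t = dot3 K v" "d3 n s v = dot3 L v" for v
      by (simp_all add: K_def L_def dot3_def d3_expand algebra_simps)
    define f where "f = (1 / d3 n s t) *s (a *s K + b *s L)"
    have "A *v v = dot3 f v *s u" for v
    proof -
      have fv: "d3 n s t * dot3 f v = a * d3 n v t + b * d3 n s v"
      proof -
        have "d3 n s t * dot3 f v = d3 n s t * (1 / d3 n s t) * dot3 (a *s K + b *s L) v"
          by (simp add: f_def dot3_def algebra_simps)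
        also have "\<dots> = a * dot3 K v + b * dot3 L v" using D by (simp add: dot3_def algebra_simps)
        finally show ?thesis by (simp only: KL)
      qed
      have "d3 n s t *s (A *v v) = A *v (d3 n s t *s v)" by (simp add: mv_lin)
      also have "\<dots> = (d3 n s t * dot3 f v) *s u"
        unfolding cramer3[of n s t v] fv by (simp add: mv_lin n ab vec3_eq_iff algebra_simps)
      finally have "d3 n s t *s (A *v v) = d3 n s t *s (dot3 f v *s u)" by simp
      then show ?thesis using D by (simp add: vec3_eq_iff)
    qed
    then show ?thesis by (rule that(1))
  qed
qed

text \<open>Normalise the first slice to diag(1, 1, 0). The vanishing coefficients then say that the
  last row r and the last column c of B meet in zero, that r annihilates c, and that det B = 0. If r
  or c is zero there is a common kernel on one side; otherwise \<open>beta22\<close>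
  results.\<close>

lemma rank_two_singular_classified:
  fixes x :: "'f::field tens"
  assumes root: "\<And>b c :: 'f. b\<^sup>2 = 4 * c \<Longrightarrow> \<exists>r. r\<^sup>2 - b * r + c = 0"
    and sing: "singular_pencil x" and P: "d3 p1 p2 n \<noteq> 0" "slice 1 x *v n = 0" and np: "\<not> parallel3 (slice 1 x *v p1) (slice 1 x *v p2)"
  shows "classified x"
proof -
  obtain q where Q: "d3 (slice 1 x *v p1) (slice 1 x *v p2) q \<noteq> 0" using extend2[OF np] by blast
  define y where "y = frame_coords p1 p2 n (slice 1 x *v p1) (slice 1 x *v p2) q x"
  have orb: "x \<in> orbit y" unfolding y_def by (rule frame_coords_orbit[OF P(1) Q])
  then have "singular_pencil y" using sing singular_pencil_orbit orbit_sym by blast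
  have z: "d3 a a b = 0" "d3 a b a = 0" "d3 b a a = 0" "d3 0 a b = 0" "d3 a 0 b = 0" "d3 a b 0 = 0" for a b :: "'f^3"
    by (simp_all add: d3_expand algebra_simps)
  have A: "slice 1 y $ i $ j = (if i = j \<and> i \<noteq> 3 then 1 else 0)" for i j
    using Q P(2) exhaust_3[of i] exhaust_3[of j]
    by (elim disjE) (simp_all add: y_def slice_def frame_coords_def z)
  define B where "B = slice 2 y"
  have s: "B$3$3 = 0" "B$1$3 * B$3$1 + B$2$3 * B$3$2 = 0" "det B = 0"
  proof -
    have "dpol (slice 1 y) B = 0" "dpol B (slice 1 y) = 0" "det B = 0"
      using \<open>singular_pencil y\<close> by (simp_all add: singular_pencil_iff B_def)
    then show "B$3$3 = 0" "det B = 0" by (simp_all add: dpol_def det_3 A)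
    have "dpol B (slice 1 y) = B$2$2 * B$3$3 - B$2$3 * B$3$2 + (B$1$1 * B$3$3 - B$1$3 * B$3$1)"
      by (simp add: dpol_def det_3 A)
    then show "B$1$3 * B$3$1 + B$2$3 * B$3$2 = 0"
      using \<open>dpol B (slice 1 y) = 0\<close> \<open>B$3$3 = 0\<close> by (simp add: eq_neg_iff_add_eq_0 algebra_simps)
  qed
  have Av: "slice 1 y *v v = vector [v$1, v$2, 0]" for v
    by (simp add: vec3_eq_iff mv3 A)
  have Bv: "slice 2 y *v v = vector [B$1$1 * v$1 + B$1$2 * v$2 + B$1$3 * v$3, B$2$1 * v$1 + B$2$2 * v$2 + B$2$3 * v$3,
      B$3$1 * v$1 + B$3$2 * v$2]" for v
    by (simp add: vec3_eq_iff mv3 B_def[symmetric] s)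
  consider "B$1$3 = 0 \<and> B$2$3 = 0" | "B$3$1 = 0 \<and> B$3$2 = 0"
    | "B$1$3 \<noteq> 0 \<or> B$2$3 \<noteq> 0" "B$3$1 \<noteq> 0 \<or> B$3$2 \<noteq> 0" by blast
  then have "classified y"
  proof cases
    case 1
    have "(vector [0, 0, 1] :: 'f^3) \<noteq> 0" by (simp add: vec3_eq_iff)
    then show ?thesis
      by (rule right_kernel_classified[rotated]) (use 1 root in \<open>simp_all add: Av Bv vec3_eq_iff\<close>)
  next
    case 2
    have "(vector [0, 0, 1] :: 'f^3) \<noteq> 0" by (simp add: vec3_eq_iff)
    then show ?thesis
      by (rule left_kernel_classified[rotated]) (use 2 root in \<open>simp_all add: Av Bv dot3_def\<close>)
  next
    case 3
    define c1 c2 r1 r2 where cr: "c1 = B$1$3" "c2 = B$2$3" "r1 = B$3$1" "r2 = B$3$2"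
    have nz: "c1 \<noteq> 0 \<or> c2 \<noteq> 0" "r1 \<noteq> 0 \<or> r2 \<noteq> 0" using 3 by (simp_all add: cr)
    have rc: "c1 * r1 + c2 * r2 = 0" using s(2) by (simp add: cr)
    have dB: "c1 * (B$2$1 * r2 - B$2$2 * r1) - c2 * (B$1$1 * r2 - B$1$2 * r1) = 0"
      using s(1,3) by (simp add: det_3 cr algebra_simps)
    \<comment> \<open>As r annihilates c and det B = 0, the upper left block of B maps c to a
      multiple of itself; \<open>G\<close> measures the failure of this.\<close>
    define G where "G = c1 * (B$2$1 * c1 + B$2$2 * c2) - c2 * (B$1$1 * c1 + B$1$2 * c2)"
    have "r2 * G = 0" "r1 * G = 0" using rc dB unfolding G_def by Groebner_Basis.algebra+
    then have G: "G = 0" using nz(2) by auto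
    obtain \<mu> where mu: "B$1$1 * c1 + B$1$2 * c2 = \<mu> * c1" "B$2$1 * c1 + B$2$2 * c2 = \<mu> * c2"
    proof (cases "c1 = 0")
      case True
      then show ?thesis using nz(1) G by (intro that[of "(B$2$1 * c1 + B$2$2 * c2) / c2"]) (simp_all add: G_def)
    next
      case False
      then show ?thesis using G
        by (intro that[of "(B$1$1 * c1 + B$1$2 * c2) / c1"]) (simp_all add: G_def eq_divide_eq, simp add: mult.commute)
    qed
    \<comment> \<open>The row r kills exactly the line of c, so a vector independent of c has
      non-zero pairing with r.\<close>
    obtain d1 d2 where d: "c1 * d2 - c2 * d1 \<noteq> 0" "r1 * d1 + r2 * d2 \<noteq> 0"
    proof (cases "c1 = 0")
      case True
      then have "c2 \<noteq> 0" "r2 = 0" "r1 \<noteq> 0" using nz rc by auto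
      then show ?thesis using True by (intro that[of 0 1]) auto
    next
      case False
      then have "r2 \<noteq> 0" using nz(2) rc by auto
      then show ?thesis using False by (intro that[of 1 0]) auto
    qed
    have "y \<in> orbit (tens01 {(1, 3, 1), (3, 1, 1), (2, 3, 2), (3, 2, 2)})"
    proof (rule frame_orbit)
      \<comment> \<open>The last entry -\<mu> cancels the eigenvalue, so that the second slice kills
        this vector.\<close>
      show "d3 (vector [c1, c2, - \<mu>]) (vector [0, 0, 1]) (vector [d1, d2, 0]) \<noteq> 0"
        using d(1) by (simp add: d3_expand algebra_simps)
      have "d3 (vector [d1, d2, 0]) (slice 2 y *v vector [d1, d2, 0]) (vector [c1, c2, 0]) =
          (r1 * d1 + r2 * d2) * (c1 * d2 - c2 * d1)"
        unfolding Bv by (simp add: d3_expand cr[symmetric] algebra_simps)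
      then show "d3 (vector [d1, d2, 0]) (slice 2 y *v vector [d1, d2, 0]) (vector [c1, c2, 0]) \<noteq> 0"
        using d by simp
      have "r1 * c1 + r2 * c2 = 0" using rc by (simp add: mult.commute)
      then show "slice 2 y *v vector [c1, c2, - \<mu>] = tens01 {(1, 3, 1), (3, 1, 1), (2, 3, 2), (3, 2, 2)} $ (1, 1, 2) *s vector [d1, d2, 0] +
         tens01 {(1, 3, 1), (3, 1, 1), (2, 3, 2), (3, 2, 2)} $ (2, 1, 2) *s (slice 2 y *v vector [d1, d2, 0]) +
         tens01 {(1, 3, 1), (3, 1, 1), (2, 3, 2), (3, 2, 2)} $ (3, 1, 2) *s vector [c1, c2, 0]"
        unfolding Bv by (simp add: vec3_eq_iff tens01_def mu cr[symmetric])
    qed (simp_all add: Av tens01_def, simp_all add: Bv vec3_eq_iff cr)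
    then show ?thesis by (intro classified_rep) (simp_all add: reps_def)
  qed
  then show ?thesis using orb by (rule classified_orbit[rotated])
qed

text \<open>By the rank-two case, A, B and A + B may all be taken of rank at most one. The 2 by 2
  minors of the sum are products of a minor of the column directions and one of the row directions,
  so one of these pairs is parallel and a common kernel appears on the corresponding side.\<close>

lemma singular_classified:
  fixes x :: "'f::field tens"
  assumes root: "\<And>b c :: 'f. b\<^sup>2 = 4 * c \<Longrightarrow> \<exists>r. r\<^sup>2 - b * r + c = 0"
    and sing: "singular_pencil x"
  shows "classified x"
proof -
  have mix: "classified x" if "det h \<noteq> 0" "d3 p1 p2 n \<noteq> 0" "slice 1 (act3 h x) *v n = 0"
    "\<not> parallel3 (slice 1 (act3 h x) *v p1) (slice 1 (act3 h x) *v p2)" for h p1 p2 n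
  proof -
    have o1: "act3 h x \<in> orbit x" by (rule act3_orbit[OF that(1)])
    then have "singular_pencil (act3 h x)" using sing singular_pencil_orbit by blast
    then have "classified (act3 h x)"
      by (rule rank_two_singular_classified[OF _ _ that(2-4), rotated]) (rule root)
    then show ?thesis using classified_orbit orbit_sym[OF o1] by blast
  qed
  have s: "slice 1 (act3 (vector [vector [a, b], vector [c, d]]) x) = (\<chi> i j. a * slice 1 x$i$j + b * slice 2 x$i$j)" for a b c d
    by (simp add: slice_act3_lin)
  have det: "det (slice 1 (act3 (vector [vector [a, b], vector [c, d]]) x)) = 0" for a b c d
    unfolding s det_lin_comb using sing by (simp add: singular_pencil_iff)
  have rk: "classified x \<or> (\<exists>u f. \<forall>v. slice 1 (act3 (vector [vector [a, b], vector [c, d]]) x) *v v = dot3 f v *s u)"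
    if "a * d - b * c \<noteq> 0" for a b c d
    using rank_cases[OF det[of a b c d]] mix[of "vector [vector [a, b], vector [c, d]]"] that
    by (metis det_2 vector_2)
  show ?thesis
  proof (rule ccontr)
    assume nc: "\<not> classified x"
    obtain u f where A: "\<And>v. slice 1 x *v v = dot3 f v *s u"
      using rk[of 1 1 0 0] nc by (auto simp: slice_act3)
    obtain w g where B: "\<And>v. slice 2 x *v v = dot3 g v *s w"
      using rk[of 0 0 1 1] nc by (auto simp: slice_act3)
    obtain t h where C: "\<And>v. slice 1 x *v v + slice 2 x *v v = dot3 h v *s t"
      using rk[of 1 1 1 0] nc by (auto simp: slice_act3)
    have "(u$i * w$j - u$j * w$i) * (f$k * g$l - f$l * g$k) = 0" for i j k l
    proof -
      have e: "dot3 f (axis k 1) = f$k" for f :: "'f^3" and k using exhaust_3[of k] by (auto simp: dot3_def axis_def)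
      have c: "f$k * u$i + g$k * w$i = h$k * t$i" for i k
        using arg_cong[OF C[of "axis k 1"], of "\<lambda>v. v$i"] by (simp add: A B e)
      have "(u$i * w$j - u$j * w$i) * (f$k * g$l - f$l * g$k) =
        (f$k * u$i + g$k * w$i) * (f$l * u$j + g$l * w$j) - (f$l * u$i + g$l * w$i) * (f$k * u$j + g$k * w$j)"
        by (simp add: algebra_simps)
      then show ?thesis unfolding c by (simp add: algebra_simps)
    qed
    then have "parallel3 u w \<or> parallel3 f g" unfolding parallel3_def by (metis eq_iff_diff_eq_0 mult_eq_0_iff)
    then show False
    proof
      assume "parallel3 u w"
      then obtain a z b where z: "u = a *s z" "w = b *s z" by (rule parallel3E)
      have "d3 z z z = 0" by (simp add: d3_expand)
      then obtain m where m: "m \<noteq> 0" "dot3 m z = 0" by (rule d3_perp)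
      have "classified x"
        by (rule left_kernel_classified[OF root m(1)]) (simp_all add: A B z dot3_lin m(2))
      then show False using nc by simp
    next
      assume "parallel3 f g"
      then obtain a z b where z: "f = a *s z" "g = b *s z" by (rule parallel3E)
      have "d3 z z z = 0" by (simp add: d3_expand)
      then obtain m where m: "m \<noteq> 0" "dot3 m z = 0" by (rule d3_perp)
      have "dot3 f m = a * dot3 m z" "dot3 g m = b * dot3 m z" by (simp_all add: z dot3_def algebra_simps)
      then have "dot3 f m = 0" "dot3 g m = 0" using m(2) by simp_all
      then have "classified x"
        by (intro right_kernel_classified[OF root m(1)]) (simp_all add: A B)
      then show False using nc by simp
    qed
  qed
qed

lemma double_root_classified:
  fixes x :: "'f::field tens"
  assumes root: "\<And>b c :: 'f. b\<^sup>2 = 4 * c \<Longrightarrow> \<exists>r. r\<^sup>2 - b * r + c = 0"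
    and "det (slice 1 x) = 0" "dpol (slice 1 x) (slice 2 x) = 0"
  shows "classified x"
  using assms regular_pencil_classified[of x] singular_classified[OF root, of x] singular_pencil_iff[of x] by blast

section \<open>Rationality of double roots over perfect fields\<close>

lemma map_poly_to_ac_mult: "map_poly to_ac (p * q) = map_poly to_ac p * map_poly to_ac q"
  by (rule poly_eqI) (simp add: coeff_map_poly coeff_mult to_ac_sum)

lemma map_poly_to_ac_add: "map_poly to_ac (p + q) = map_poly to_ac p + map_poly to_ac q"
  by (rule poly_eqI) (simp add: coeff_map_poly)

lemma map_poly_to_ac_eq_0: "map_poly to_ac p = 0 \<longleftrightarrow> p = 0"
  by (simp add: poly_eq_iff coeff_map_poly)

lemma minimal_polynomial:
  fixes \<theta> :: "'k::field alg_closure"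
  obtains q :: "'k poly" where "irreducible q" "\<And>p. poly (map_poly to_ac p) \<theta> = 0 \<longleftrightarrow> q dvd p"
proof -
  let ?F = "map_poly to_ac :: 'k poly \<Rightarrow> 'k alg_closure poly"
  define P where "P = (\<lambda>p :: 'k poly. p \<noteq> 0 \<and> poly (?F p) \<theta> = 0)"
  obtain p0 where "P p0" unfolding P_def using alg_closure_algebraic[of \<theta>] by blast
  then obtain q where q: "P q" "\<And>p. P p \<Longrightarrow> degree q \<le> degree p"
    using exists_least_iff[of "\<lambda>n. \<exists>p. P p \<and> degree p = n"] by (metis linorder_not_less)
  have q0: "q \<noteq> 0" "poly (?F q) \<theta> = 0" using q(1) by (auto simp: P_def)
  have dvd: "poly (?F p) \<theta> = 0 \<longleftrightarrow> q dvd p" for p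
  proof
    assume p: "poly (?F p) \<theta> = 0"
    have "?F p = ?F q * ?F (p div q) + ?F (p mod q)"
      by (simp only: map_poly_to_ac_mult[symmetric] map_poly_to_ac_add[symmetric] mult_div_mod_eq)
    then have "poly (?F (p mod q)) \<theta> = 0" using p q0 by simp
    then have "p mod q = 0"
      using q(2)[of "p mod q"] degree_mod_less[OF q0(1), of p]
      by (cases "p mod q = 0") (auto simp: P_def)
    then show "q dvd p" by (simp add: mod_eq_0_iff_dvd)
  next
    assume "q dvd p"
    then show "poly (?F p) \<theta> = 0" using q0 by (auto simp: map_poly_to_ac_mult elim!: dvdE)
  qed
  have "irreducible q"
  proof (rule irreducibleI)
    show "q \<noteq> 0" by (rule q0)
    show "\<not> q dvd 1" using dvd[of 1] by simp
    fix a b assume ab: "q = a * b"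
    then have nz: "a \<noteq> 0" "b \<noteq> 0" using q0 by auto
    have unit: "c dvd 1" if "P d" "q = d * c" "c \<noteq> 0" for c d
    proof -
      have "degree q = degree d + degree c" using that q0 by (auto simp: degree_mult_eq P_def)
      then have "degree c = 0" using q(2)[OF that(1)] by simp
      then show ?thesis using that(3) by (simp add: is_unit_iff_degree)
    qed
    have "poly (?F a) \<theta> = 0 \<or> poly (?F b) \<theta> = 0" using q0(2) by (simp add: ab map_poly_to_ac_mult)
    then show "a dvd 1 \<or> b dvd 1"
      using unit[of a b] unit[of b a] nz ab by (auto simp: P_def mult.commute)
  qed
  then show ?thesis using that dvd by blast
qed

text \<open>The minimal polynomial q of \<theta> is separable, so at a double root the cofactor of q
  vanishes too and q^2 divides \<open>f\<close>. Degree at most three leaves only a linear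
  q.\<close>

lemma rational_double_root:
  fixes f :: "'k::field poly"
  assumes perf: "perfect_field TYPE('k)" and f: "f \<noteq> 0" "degree f \<le> 3"
    and root: "poly (map_poly to_ac f) \<theta> = 0" "poly (pderiv (map_poly to_ac f)) \<theta> = 0"
  obtains r where "\<theta> = to_ac r"
proof -
  let ?F = "map_poly to_ac :: 'k poly \<Rightarrow> 'k alg_closure poly"
  obtain q where q: "irreducible q" "\<And>p. poly (?F p) \<theta> = 0 \<longleftrightarrow> q dvd p" by (rule minimal_polynomial[of \<theta>]) blast
  have sep: "rsquarefree (?F q)" using perf q(1) by (auto simp: perfect_field_def separable_poly_def)
  obtain h where h: "f = q * h" using q(2)[of f] root(1) by auto
  have q0: "q \<noteq> 0" "h \<noteq> 0" using f(1) h by auto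
  have "poly (?F h) \<theta> = 0"
  proof (rule ccontr)
    assume nz: "poly (?F h) \<theta> \<noteq> 0"
    have qr: "poly (?F q) \<theta> = 0" using q(2)[of q] by simp
    have "poly (pderiv (?F q)) \<theta> * poly (?F h) \<theta> = 0"
      using root(2) qr by (auto simp: h map_poly_to_ac_mult pderiv_mult)
    then have "poly (pderiv (?F q)) \<theta> = 0" using nz by simp
    moreover obtain s where s: "?F q = [:- \<theta>, 1:] * s" using qr by (auto simp: poly_eq_0_iff_dvd)
    ultimately have "poly s \<theta> = 0" unfolding s pderiv_mult by (simp del: mult_pCons_left mult_pCons_right add: pderiv_pCons)
    then have "[:- \<theta>, 1:] ^ 2 dvd ?F q" unfolding s power2_eq_square by (intro mult_dvd_mono) (simp_all add: poly_eq_0_iff_dvd)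
    moreover have "?F q \<noteq> 0" using q0(1) by (simp add: map_poly_to_ac_eq_0)
    ultimately have "2 \<le> order \<theta> (?F q)" by (simp add: order_divides)
    then show False using sep by (auto simp: rsquarefree_def dest: spec[of _ \<theta>])
  qed
  then obtain h' where h': "h = q * h'" using q(2)[of h] by auto
  then have "degree f = degree q + (degree q + degree h')"
    using q0 by (simp add: h degree_mult_eq)
  then have "degree q \<le> 1" using f(2) by simp
  moreover have "degree q \<noteq> 0" using q(1) q0(1) by (auto simp: irreducible_def is_unit_iff_degree)
  ultimately have "degree q = 1" by simp
  then have "q = [:coeff q 0, coeff q 1:]" "coeff q 1 \<noteq> 0"
    using coeff_eq_0[of q] leading_coeff_0_iff[of q] q0(1)
    by (auto simp: poly_eq_iff coeff_pCons split: nat.splits)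
  then obtain c d where qc: "q = [:c, d:]" "d \<noteq> 0" by blast
  have "to_ac c + \<theta> * to_ac d = 0" using q(2)[of q] by (simp add: qc map_poly_pCons)
  then have "\<theta> = to_ac (- c / d)" using qc(2) by (simp add: field_simps eq_neg_iff_add_eq_0)
  then show ?thesis by (rule that)
qed

text \<open>The condition makes every root over the closure a double root. Perfectness does its work
  in characteristic two, where b = 0 and a square root is required.\<close>

lemma perfect_quadratic_root:
  fixes b c :: "'k::field"
  assumes perf: "perfect_field TYPE('k)" and disc: "b\<^sup>2 = 4 * c"
  shows "\<exists>r. r\<^sup>2 - b * r + c = 0"
proof -
  have F: "map_poly to_ac [:c, - b, 1:] = [:to_ac c, - to_ac b, 1:]"
    by (simp add: map_poly_pCons)
  have "\<exists>\<theta>. poly [:to_ac c, - to_ac b, 1:] \<theta> = 0" by (rule alg_closed_imp_poly_has_root) simp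
  then obtain \<theta> where "poly [:to_ac c, - to_ac b, 1:] \<theta> = 0" by blast
  then have root: "\<theta>\<^sup>2 - to_ac b * \<theta> + to_ac c = 0" by (simp add: power2_eq_square algebra_simps)
  have "(to_ac b)\<^sup>2 = 4 * to_ac c" using arg_cong[OF disc, of to_ac] by simp
  moreover have "(2 * \<theta> - to_ac b)\<^sup>2 = 4 * (\<theta>\<^sup>2 - to_ac b * \<theta> + to_ac c) + ((to_ac b)\<^sup>2 - 4 * to_ac c)"
    by (simp add: power2_eq_square algebra_simps)
  ultimately have "2 * \<theta> - to_ac b = 0" using root by simp
  then have der: "poly (pderiv [:to_ac c, - to_ac b, 1:]) \<theta> = 0" by (simp add: pderiv_pCons algebra_simps)
  obtain r where "\<theta> = to_ac r"
    using rational_double_root[OF perf, of "[:c, - b, 1:]" \<theta>] root der unfolding F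
    by (auto simp: power2_eq_square algebra_simps)
  then have "to_ac (r\<^sup>2 - b * r + c) = 0" using root by simp
  then show ?thesis by (intro exI[of _ r]) (simp only: to_ac_eq_0_iff)
qed

lemma alg_closed_quadratic_root: "\<exists>r :: 'f::alg_closed_field. r\<^sup>2 - b * r + c = 0"
proof -
  have "\<exists>r. poly [:c, - b, 1:] r = 0" by (rule alg_closed_imp_poly_has_root) simp
  then show ?thesis by (auto simp: power2_eq_square algebra_simps)
qed

section \<open>Base change to the algebraic closure\<close>

definition emb :: "'k::field tens \<Rightarrow> 'k alg_closure tens" where
  "emb x = (\<chi> t. to_ac (x $ t))"

definition emb_mat :: "'k::field^'n^'n \<Rightarrow> 'k alg_closure^'n^'n" where
  "emb_mat g = (\<chi> i j. to_ac (g$i$j))"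

lemma emb_act: "emb (act (g1, g2, g3) x) = act (emb_mat g1, emb_mat g2, emb_mat g3) (emb x)"
  by (simp add: vec_eq_iff emb_def emb_mat_def to_ac_sum)

lemma emb_mat_mult: "emb_mat (g ** h) = emb_mat g ** emb_mat h"
  by (simp add: emb_mat_def vec_eq_iff matrix_matrix_mult_def to_ac_sum)

lemma emb_mat_one: "emb_mat (mat 1) = mat 1"
  by (simp add: emb_mat_def vec_eq_iff mat_def)

lemma invertible_emb_mat: "invertible g \<Longrightarrow> invertible (emb_mat g)"
  proof -
  assume "invertible g"
  then obtain h where "g ** h = mat 1" "h ** g = mat 1" unfolding invertible_def by blast
  then have "emb_mat g ** emb_mat h = mat 1" "emb_mat h ** emb_mat g = mat 1"
    by (simp_all add: emb_mat_mult[symmetric] emb_mat_one)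
  then show ?thesis unfolding invertible_def by blast
qed

lemma emb_orbit:
  assumes "x \<in> orbit y" shows "emb x \<in> orbit (emb y)"
proof -
  obtain g1 g2 g3 where g: "(g1, g2, g3) \<in> GG" "x = act (g1, g2, g3) y" using assms unfolding orbit_def by fast
  then have "(emb_mat g1, emb_mat g2, emb_mat g3) \<in> GG" by (simp add: GG_iff invertible_emb_mat)
  then show ?thesis unfolding g(2) emb_act orbit_def by blast
qed

lemma emb_tens01: "emb (tens01 S) = tens01 S"
  by (simp add: emb_def tens01_def vec_eq_iff)

lemma emb_quad_tens: "emb (quad_tens b c) = quad_tens (to_ac b) (to_ac c)"
  by (simp add: emb_def quad_tens_def vec_eq_iff)

lemma det_slice_emb: "det (slice l (emb x)) = to_ac (det (slice l x))"
  by (simp add: det_3 slice_def emb_def)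

lemma dpol_slice_emb: "dpol (slice k (emb x)) (slice l (emb x)) = to_ac (dpol (slice k x) (slice l x))"
  by (simp add: dpol_def det_3 slice_def emb_def)

lemma stratum_rat_iff: "x \<in> stratum_rat \<beta> \<longleftrightarrow> emb x \<in> stratum \<beta>"
  by (simp add: stratum_rat_def emb_def)

section \<open>The strata\<close>

text \<open>What disjointness uses of an element of \<open>BB\<close>. The sixteen vectors satisfy
  it by inspection, before they are known to lie in \<open>BB\<close>.\<close>

definition good_wt :: "wt \<Rightarrow> bool" where
  "good_wt \<beta> \<longleftrightarrow> rat_vec \<beta> \<and> \<beta> \<noteq> 0 \<and> \<beta> \<in> tstar_plus"

lemma BB_good: "\<beta> \<in> BB \<Longrightarrow> good_wt \<beta>"
  using BB_rational[of \<beta>] by (simp add: good_wt_def BB_def)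

lemma stratumE:
  assumes "x \<in> stratum \<beta>" obtains y where "y \<in> Y_ss \<beta>" "x \<in> orbit y"
  proof -
  obtain g y where "x = act g y" "g \<in> GG" "y \<in> Y_ss \<beta>" using assms unfolding stratum_def by blast
  then show ?thesis by (intro that[of y]) (simp_all add: orbit_def)
qed

lemma stratum_orbit: "x \<in> orbit y \<Longrightarrow> y \<in> stratum \<beta> \<Longrightarrow> x \<in> stratum \<beta>"
proof -
  assume "x \<in> orbit y" "y \<in> stratum \<beta>"
  then obtain z where z: "z \<in> Y_ss \<beta>" "x \<in> orbit z" using stratumE orbit_trans by metis
  then show ?thesis unfolding stratum_def orbit_def by blast
qed

lemma stratum_unique:
  assumes "good_wt \<beta>" "good_wt \<beta>'" "x \<in> stratum \<beta>" "x \<in> stratum \<beta>'"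
  shows "\<beta> = \<beta>'"
proof -
  obtain y where y: "y \<in> Y_ss \<beta>" "x \<in> orbit y" using assms(3) by (rule stratumE)
  obtain y' where y': "y' \<in> Y_ss \<beta>'" "x \<in> orbit y'" using assms(4) by (rule stratumE)
  have "y' \<in> orbit y" using orbit_trans[OF orbit_sym[OF y'(2)] y(2)] .
  then show ?thesis using Y_ss_orbit_unique y(1) y'(1) assms(1,2) unfolding good_wt_def by blast
qed

text \<open>The support of zero is empty and has empty hull.\<close>

lemma zero_notin_stratum:
  assumes "good_wt \<beta>" shows "(0 :: 'a::alg_closed_field tens) \<notin> stratum \<beta>"
proof
  assume "(0 :: 'a tens) \<in> stratum \<beta>"
  then obtain y :: "'a tens" where y: "y \<in> Y_ss \<beta>" "0 \<in> orbit y" by (rule stratumE)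
  have "y = 0" using orbit_zero orbit_sym[OF y(2)] by blast
  have L: "lu3 (mat 1 :: 'a^3^3)" "lu2 (mat 1 :: 'a^2^2)" by (auto simp: lu3_def lu2_def mat_def)
  have "\<beta> \<in> convex hull (weight ` {t. act (mat 1, mat 1, mat 1) y $ t \<noteq> 0})"
    using assms y(1) L unfolding good_wt_def by (intro lower_triangular_action(2)) auto
  then show False unfolding act_one \<open>y = 0\<close> by simp
qed

lemma explicit_ss_stratum: "z \<in> explicit_ss \<beta> \<Longrightarrow> z \<in> stratum \<beta>"
proof -
  assume "z \<in> explicit_ss \<beta>"
  then have "z + 0 \<in> Y_ss \<beta>" unfolding Y_ss_def using explicit_ss_Z_ss by (fastforce simp: W_space_iff)
  then have "z \<in> Y_ss \<beta>" by simp
  then show ?thesis unfolding stratum_def using one_GG act_one by (smt (verit) mem_Collect_eq)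
qed

lemma reps_ss: "(\<beta>, S) \<in> reps \<Longrightarrow> tens01 S \<in> explicit_ss \<beta>"
  unfolding reps_def insert_iff empty_iff prod.inject
  using beta4_ss beta5_ss beta6_ss beta11_ss beta22_ss beta28_ss beta38_ss beta39_ss beta40_ss
    beta41_ss beta42_ss beta45_ss beta47_ss beta48_ss beta49_ss
  by (elim disjE conjE) (simp_all only: simp_thms)

lemma sixteen_eq_reps: "sixteen = insert beta29 (fst ` reps)"
  unfolding sixteen_def reps_def image_insert fst_conv image_empty
  by (intro equalityI subsetI; elim insertE emptyE; simp)

lemma sixteen_rep: "\<beta> \<in> sixteen \<Longrightarrow> \<beta> = beta29 \<or> (\<exists>S. (\<beta>, S) \<in> reps)"
  by (auto simp: sixteen_eq_reps)

lemma reps_sixteen: "(\<beta>, S) \<in> reps \<Longrightarrow> \<beta> \<in> sixteen"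
  by (force simp: sixteen_eq_reps)

lemma tstar_plus_vector: "((vector [a1, a2, a3], vector [b1, b2, b3], vector [c1, c2]) :: wt) \<in> tstar_plus \<longleftrightarrow>
    a1 + a2 + a3 = 0 \<and> b1 + b2 + b3 = 0 \<and> c1 + c2 = 0 \<and> a1 \<le> a2 \<and> a2 \<le> a3 \<and> b1 \<le> b2 \<and> b2 \<le> b3 \<and> c1 \<le> c2"
  by (auto simp: tstar_plus_def in_tstar sum_3 sum_2)

lemma good_mk_wt:
  assumes "r > 0" "r \<in> \<rat>" "a1 + a2 + a3 = 0" "b1 + b2 + b3 = 0" "c1 + c2 = 0" "a1 \<le> a2" "a2 \<le> a3" "b1 \<le> b2" "b2 \<le> b3" "c1 \<le> c2"
    "a1 \<in> \<rat>" "a2 \<in> \<rat>" "a3 \<in> \<rat>" "b1 \<in> \<rat>" "b2 \<in> \<rat>" "b3 \<in> \<rat>" "c1 \<in> \<rat>" "c2 \<in> \<rat>"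
    "a1 \<noteq> 0 \<or> b1 \<noteq> 0 \<or> c1 \<noteq> 0"
  shows "good_wt (r *\<^sub>R mk_wt [a1, a2, a3] [b1, b2, b3] [c1, c2])"
proof -
  have "r *\<^sub>R mk_wt [a1, a2, a3] [b1, b2, b3] [c1, c2] =
      (vector [r * a1, r * a2, r * a3], vector [r * b1, r * b2, r * b3], vector [r * c1, r * c2])"
    by (simp add: mk_wt_def vec_eq_iff forall_3 forall_2)
  moreover have "good_wt (vector [r * a1, r * a2, r * a3], vector [r * b1, r * b2, r * b3], vector [r * c1, r * c2])"
    unfolding good_wt_def tstar_plus_vector rat_vec_wt
    using assms by (auto simp: forall_3 forall_2 distrib_left[symmetric] zero_prod_def vec_eq_iff)
  ultimately show ?thesis by simp
qed

lemma sixteen_good: "\<beta> \<in> sixteen \<Longrightarrow> good_wt \<beta>"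
  unfolding sixteen_def insert_iff empty_iff
  by (elim disjE; simp only: beta4_def beta5_def beta6_def beta11_def beta22_def beta28_def beta29_def beta38_def
      beta39_def beta40_def beta41_def beta42_def beta45_def beta47_def beta48_def beta49_def;
      rule good_mk_wt; simp)

text \<open>The vector lies in the hull of the support of \<open>z\<close>, where the pairing with
  it is constant; by Cauchy-Schwarz no point of the hull is shorter. This yields membership in
  \<open>BB\<close> without exhibiting convex combinations.\<close>

lemma Z_ss_in_BB:
  assumes good: "good_wt \<beta>" and z: "(z :: 'f::alg_closed_field tens) \<in> Z_ss \<beta>"
  shows "\<beta> \<in> BB"
proof -
  define S where "S = weight ` {t. z $ t \<noteq> 0}"
  have "\<beta> \<in> tstar" using good by (auto simp: good_wt_def tstar_plus_def)
  moreover have "(mat 1, mat 1, mat 1) \<in> M_grp \<beta>" using one_GG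
    by (cases \<beta>) (simp add: block_diag_def mat_def)
  ultimately have h: "\<beta> \<in> convex hull S"
    unfolding S_def using beta_in_hull_support[of \<beta> z] good z act_one[of z] unfolding good_wt_def by metis
  have fin: "finite S" by (simp add: S_def)
  then have cl: "closed (convex hull S)" using finite_imp_compact_convex_hull compact_imp_closed by blast
  have ne: "S \<noteq> {}" using h by auto
  have "closest_point (convex hull S) 0 = \<beta>"
  proof (rule closest_point_unique[OF _ cl h, symmetric])
    show "convex (convex hull S)" by simp
    show "\<forall>y\<in>convex hull S. dist 0 \<beta> \<le> dist 0 y"
    proof
      fix y assume y: "y \<in> convex hull S"
      have "convex hull S \<subseteq> {x. inner \<beta> x \<ge> inner \<beta> \<beta>}"
        using z by (intro hull_minimal convex_halfspace_ge) (auto simp: S_def inner_commute Z_ss_def Z_space_iff)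
      then have "inner \<beta> \<beta> \<le> inner \<beta> y" using y by blast
      also have "\<dots> \<le> norm \<beta> * norm y" by (rule norm_cauchy_schwarz)
      finally have "norm \<beta> * norm \<beta> \<le> norm \<beta> * norm y" by (simp add: power2_norm_eq_inner[symmetric] power2_eq_square)
      then have "norm \<beta> \<le> norm y" using good by (simp add: good_wt_def)
      then show "dist 0 \<beta> \<le> dist 0 y" by simp
    qed
  qed
  moreover have "S \<subseteq> range weight" by (auto simp: S_def)
  ultimately show ?thesis
    using good ne unfolding BB_def good_wt_def by (intro CollectI conjI exI[of _ S]) auto
qed

text \<open>A linear functional that separates the sixteen vectors.\<close>

definition wt_key :: "wt \<Rightarrow> real" where
  "wt_key = (\<lambda>(a, b, c). 2 * c$2 - a$1 - a$3 - 3 * b$3)"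

lemma wt_key_simps:
  "wt_key beta29 = - (1 / 3)" "wt_key beta4 = 1 / 6" "wt_key beta5 = - (1 / 2)" "wt_key beta6 = 1 / 33" "wt_key beta11 = - (2 / 9)" "wt_key beta22 = - (7 / 12)"
    "wt_key beta28 = - (1 / 6)" "wt_key beta38 = 1" "wt_key beta39 = - (2 / 3)" "wt_key beta40 = 1 / 15" "wt_key beta41 = - (8 / 15)"
    "wt_key beta42 = - (1 / 30)" "wt_key beta45 = 2 / 3" "wt_key beta47 = - (5 / 6)" "wt_key beta48 = - (11 / 6)" "wt_key beta49 = - (4 / 3)"
  by (simp_all add: wt_key_def mk_wt_def beta4_def beta5_def beta6_def beta11_def beta22_def beta28_def beta29_def
      beta38_def beta39_def beta40_def beta41_def beta42_def beta45_def beta47_def beta48_def beta49_def)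

lemma beta29_notin_reps: "(beta29, S) \<notin> reps"
proof
  assume "(beta29, S) \<in> reps"
  then have "wt_key beta29 \<in> wt_key ` fst ` reps" by force
  then show False unfolding reps_def by (simp add: wt_key_simps)
qed

text \<open>The support can be recovered from the value of \<open>wt_key\<close>, which replaces
  pairwise comparison of the vectors.\<close>

lemma reps_functional:
  assumes "(\<beta>, S) \<in> reps" "(\<beta>, S') \<in> reps" shows "S = S'"
proof -
  define h :: "real \<Rightarrow> (3 \<times> 3 \<times> 2) set" where "h = (\<lambda>v. if v = 1 / 6 then {(2, 1, 1), (2, 2, 2), (3, 2, 1), (3, 3, 2)} else
     if v = - (1 / 2) then {(1, 2, 1), (2, 2, 2), (2, 3, 1), (3, 3, 2)} else
     if v = 1 / 33 then {(2, 2, 1), (3, 3, 1), (1, 2, 2), (2, 1, 2)} else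
     if v = - (2 / 9) then {(3, 2, 1), (2, 3, 1), (1, 3, 2), (2, 2, 2), (3, 1, 2)} else
     if v = - (7 / 12) then {(1, 3, 1), (3, 1, 1), (2, 3, 2), (3, 2, 2)} else
     if v = - (1 / 6) then {(3, 3, 1), (1, 3, 2), (2, 2, 2), (3, 1, 2)} else
     if v = 1 then {(1, 1, 2), (2, 2, 2), (3, 3, 2)} else
     if v = - (2 / 3) then {(3, 3, 1), (2, 3, 2), (3, 2, 2)} else
     if v = 1 / 15 then {(3, 3, 1), (2, 2, 2), (3, 1, 2)} else
     if v = - (8 / 15) then {(3, 3, 1), (2, 2, 2), (1, 3, 2)} else
     if v = - (1 / 30) then {(3, 3, 1), (1, 1, 2), (2, 2, 2)} else
     if v = 2 / 3 then {(2, 2, 2), (3, 3, 2)} else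
     if v = - (5 / 6) then {(3, 2, 1), (3, 3, 2)} else
     if v = - (11 / 6) then {(2, 3, 1), (3, 3, 2)} else
     if v = - (4 / 3) then {(3, 3, 2)} else {})"
  have "\<forall>(\<beta>, S)\<in>reps. S = h (wt_key \<beta>)"
    unfolding reps_def ball_simps prod.case wt_key_simps by (intro conjI TrueI; simp only: h_def; simp)
  from bspec[OF this assms(1)] bspec[OF this assms(2)] show ?thesis by simp
qed

lemma beta29_sixteen: "beta29 \<in> sixteen"
  by (simp add: sixteen_def)

lemma classified_stratum:
  fixes x :: "'f::alg_closed_field tens"
  assumes "classified x" "x \<noteq> 0"
  obtains \<beta> where "\<beta> \<in> sixteen" "x \<in> stratum \<beta>"
proof -
  consider \<beta> S where "(\<beta>, S) \<in> reps" "x \<in> orbit (tens01 S)"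
    | b c where "b\<^sup>2 \<noteq> 4 * c" "x \<in> orbit (quad_tens b c)"
    using assms unfolding classified_def by blast
  then show ?thesis
  proof cases
    case 1
    then have "x \<in> stratum \<beta>" using stratum_orbit explicit_ss_stratum reps_ss by blast
    then show ?thesis using that 1 reps_sixteen by blast
  next
    case 2
    then have "x \<in> stratum beta29" using stratum_orbit explicit_ss_stratum beta29_ss by blast
    then show ?thesis using that beta29_sixteen by blast
  qed
qed

lemma sixteen_subset_BB: "sixteen \<subseteq> BB"
proof
  fix \<beta> assume \<beta>: "\<beta> \<in> sixteen"
  \<comment> \<open>\<open>BB\<close> does not depend on a field, so any algebraically closed field
    may supply the semistable points; b = 1, c = 0 has discriminant one.\<close>
  have "(quad_tens 1 0 :: real alg_closure tens) \<in> Z_ss beta29" using beta29_ss[of 1 "0 :: real alg_closure"] by (simp add: explicit_ss_Z_ss)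
  then have "\<exists>z :: real alg_closure tens. z \<in> Z_ss \<beta>"
    using sixteen_rep[OF \<beta>] reps_ss explicit_ss_Z_ss by blast
  then show "\<beta> \<in> BB" using Z_ss_in_BB sixteen_good[OF \<beta>] by blast
qed

lemma stratum_nonempty_iff:
  assumes "\<beta> \<in> BB"
  shows "(stratum \<beta> :: 'f::alg_closed_field tens set) \<noteq> {} \<longleftrightarrow> \<beta> \<in> sixteen"
proof
  assume "(stratum \<beta> :: 'f tens set) \<noteq> {}"
  then obtain y :: "'f tens" where y: "y \<in> Y_ss \<beta>" by (auto simp: stratum_def)
  have good: "good_wt \<beta>" by (rule BB_good[OF assms])
  have ys: "y \<in> stratum \<beta>" unfolding stratum_def using y one_GG act_one[of y] by (metis (mono_tags, lifting) mem_Collect_eq)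
  have "classified y"
    using good y alg_closed_quadratic_root unfolding good_wt_def
    by (intro double_root_classified Y_ss_double_root) auto
  moreover have "y \<noteq> 0" using ys zero_notin_stratum[OF good] by auto
  ultimately obtain \<beta>' where "\<beta>' \<in> sixteen" "y \<in> stratum \<beta>'" by (rule classified_stratum)
  then show "\<beta> \<in> sixteen" using stratum_unique[OF good sixteen_good ys] by blast
next
  assume "\<beta> \<in> sixteen"
  then have "\<exists>z :: 'f tens. z \<in> explicit_ss \<beta>"
    using sixteen_rep reps_ss beta29_ss[of 1 "0 :: 'f"] by fastforce
  then show "(stratum \<beta> :: 'f tens set) \<noteq> {}" using explicit_ss_stratum by blast
qed

text \<open>Over the closure some group element moves the double root of the cubic to the first
  slice, so the first row (a, b) of its last component is that root. The cubic has rational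
  coefficients, so the root is rational, and a rational change of slices moves it to the first
  slice.\<close>

lemma stratum_rat_double_root:
  fixes x :: "'k::field tens"
  assumes perf: "perfect_field TYPE('k)" and good: "good_wt \<beta>" and x: "x \<in> stratum_rat \<beta>"
  shows "classified x"
proof -
  note root = perfect_quadratic_root[OF perf]
  obtain y where y: "y \<in> Y_ss \<beta>" "emb x \<in> orbit y"
    using x unfolding stratum_rat_iff by (rule stratumE)
  obtain g1 g2 g3 where g: "invertible g1" "invertible g2" "invertible g3" "y = act (g1, g2, g3) (emb x)"
    using orbit_sym[OF y(2)] unfolding orbit_def GG_def by blast
  define c0 c1 c2 c3 where c: "c0 = det (slice 1 x)" "c1 = dpol (slice 1 x) (slice 2 x)"
    "c2 = dpol (slice 2 x) (slice 1 x)" "c3 = det (slice 2 x)"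
  define a b c d where h: "a = g3$1$1" "b = g3$1$2" "c = g3$2$1" "d = g3$2$2"
  have dets: "det g1 \<noteq> 0" "det (transpose g2) \<noteq> 0" "a * d - b * c \<noteq> 0"
    using g(1-3) by (simp_all add: invertible_det_nz det_transpose det_2 h)
  have "det (slice 1 y) = 0" "dpol (slice 1 y) (slice 2 y) = 0"
    using Y_ss_double_root y(1) good unfolding good_wt_def by blast+
  then have e: "a ^ 3 * to_ac c0 + a\<^sup>2 * b * to_ac c1 + a * b\<^sup>2 * to_ac c2 + b ^ 3 * to_ac c3 = 0"
    "3 * a\<^sup>2 * c * to_ac c0 + (a\<^sup>2 * d + 2 * a * b * c) * to_ac c1 + (b\<^sup>2 * c + 2 * a * b * d) * to_ac c2 + 3 * b\<^sup>2 * d * to_ac c3 = 0"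
    using dets unfolding g(4) slice_act_split det_mul dpol_mult_left dpol_mult_right slice_act3_lin
      det_lin_comb dpol_lin_comb det_slice_emb dpol_slice_emb h c by simp_all
  show ?thesis
  proof (cases "b = 0")
    case True
    then have "a \<noteq> 0" "d \<noteq> 0" using dets(3) by auto
    then have "c0 = 0" "c1 = 0" using e True by simp_all
    then show ?thesis using double_root_classified[OF root, of x] unfolding c by blast
  next
    case False
    define \<theta> where "\<theta> = a / b"
    have a: "a = \<theta> * b" using False by (simp add: \<theta>_def)
    have "b ^ 3 * (\<theta> ^ 3 * to_ac c0 + \<theta>\<^sup>2 * to_ac c1 + \<theta> * to_ac c2 + to_ac c3) = 0"
      using e(1) unfolding a by (simp add: power_mult_distrib power2_eq_square power3_eq_cube algebra_simps)
    then have r1: "\<theta> ^ 3 * to_ac c0 + \<theta>\<^sup>2 * to_ac c1 + \<theta> * to_ac c2 + to_ac c3 = 0" using False by simp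
    \<comment> \<open>Modulo the first equation, the second is the derivative of the cubic at
      \<theta> times c - d \<theta>, which is non-zero by invertibility.\<close>
    have "b\<^sup>2 * ((c - d * \<theta>) * (3 * \<theta>\<^sup>2 * to_ac c0 + 2 * \<theta> * to_ac c1 + to_ac c2)) =
      3 * a\<^sup>2 * c * to_ac c0 + (a\<^sup>2 * d + 2 * a * b * c) * to_ac c1 + (b\<^sup>2 * c + 2 * a * b * d) * to_ac c2 + 3 * b\<^sup>2 * d * to_ac c3
      - 3 * b\<^sup>2 * d * (\<theta> ^ 3 * to_ac c0 + \<theta>\<^sup>2 * to_ac c1 + \<theta> * to_ac c2 + to_ac c3)"
      unfolding a by (simp add: power_mult_distrib power2_eq_square power3_eq_cube algebra_simps)
    then have "(c - d * \<theta>) * (3 * \<theta>\<^sup>2 * to_ac c0 + 2 * \<theta> * to_ac c1 + to_ac c2) = 0"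
      using e(2) r1 False by simp
    moreover have "c - d * \<theta> \<noteq> 0" using dets(3) unfolding a by (auto simp: algebra_simps)
    ultimately have r2: "3 * \<theta>\<^sup>2 * to_ac c0 + 2 * \<theta> * to_ac c1 + to_ac c2 = 0" by simp
    show ?thesis
    proof (cases "[:c3, c2, c1, c0:] = 0")
      case True
      then show ?thesis using double_root_classified[OF root, of x] unfolding c by simp
    next
      case nz: False
      have F: "map_poly to_ac [:c3, c2, c1, c0:] = [:to_ac c3, to_ac c2, to_ac c1, to_ac c0:]"
        by (simp add: map_poly_pCons)
      have R: "poly (map_poly to_ac [:c3, c2, c1, c0:]) \<theta> = 0" "poly (pderiv (map_poly to_ac [:c3, c2, c1, c0:])) \<theta> = 0"
        using r1 r2 unfolding F by (simp_all add: pderiv_pCons power2_eq_square power3_eq_cube algebra_simps)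
      have "degree [:c3, c2, c1, c0:] \<le> 3" by (simp add: numeral_3_eq_3)
      then obtain r where r: "\<theta> = to_ac r" using rational_double_root[OF perf nz _ R] by metis
      have "to_ac (r ^ 3 * c0 + r\<^sup>2 * c1 + r * c2 + c3) = 0" "to_ac (3 * r\<^sup>2 * c0 + 2 * r * c1 + c2) = 0"
        using r1 r2 by (simp_all add: r)
      then have k: "r ^ 3 * c0 + r\<^sup>2 * c1 + r * c2 + c3 = 0" "3 * r\<^sup>2 * c0 + 2 * r * c1 + c2 = 0"
        by (simp_all only: to_ac_eq_0_iff)
      \<comment> \<open>The new first slice is r A + B, located at the double root.\<close>
      define x' where "x' = act3 (vector [vector [r, 1], vector [1, 0]]) x"
      have "classified x'"
      proof (rule double_root_classified[OF root])
        show "det (slice 1 x') = 0" "dpol (slice 1 x') (slice 2 x') = 0"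
          using k unfolding x'_def slice_act3_lin det_lin_comb dpol_lin_comb c by simp_all
      qed
      moreover have "x' \<in> orbit x" unfolding x'_def by (rule act3_orbit) (simp add: det_2)
      ultimately show ?thesis using classified_orbit orbit_sym by blast
    qed
  qed
qed

lemma stratum_rat_cases:
  fixes x :: "'k::field tens"
  assumes perf: "perfect_field TYPE('k)" and \<beta>: "\<beta> \<in> sixteen" and x: "x \<in> stratum_rat \<beta>"
  shows "(\<exists>S. (\<beta>, S) \<in> reps \<and> x \<in> orbit (tens01 S)) \<or>
    (\<beta> = beta29 \<and> (\<exists>b c. b\<^sup>2 \<noteq> 4 * c \<and> x \<in> orbit (quad_tens b c)))"
proof -
  have good: "good_wt \<beta>" by (rule sixteen_good[OF \<beta>])
  have xs: "emb x \<in> stratum \<beta>" using x by (simp add: stratum_rat_iff)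
  have "emb 0 = (0 :: 'k alg_closure tens)" by (simp add: emb_def vec_eq_iff)
  then have "x \<noteq> 0" using xs zero_notin_stratum[OF good] by auto
  then consider \<beta>' S where "(\<beta>', S) \<in> reps" "x \<in> orbit (tens01 S)"
    | b c where "b\<^sup>2 \<noteq> 4 * c" "x \<in> orbit (quad_tens b c)"
    using stratum_rat_double_root[OF perf good x] unfolding classified_def by blast
  then show ?thesis
  proof cases
    case 1
    have "emb x \<in> stratum \<beta>'"
      using emb_orbit[OF 1(2)] explicit_ss_stratum[OF reps_ss[OF 1(1)]] unfolding emb_tens01 by (rule stratum_orbit)
    then have "\<beta> = \<beta>'" using stratum_unique[OF good sixteen_good xs] reps_sixteen 1(1) by blast
    then show ?thesis using 1 by blast
  next
    case 2
    have "(to_ac b)\<^sup>2 \<noteq> 4 * to_ac c" using 2(1) by (metis to_ac_eq_iff to_ac_mult to_ac_numeral to_ac_power)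
    then have "quad_tens (to_ac b) (to_ac c) \<in> stratum beta29" by (rule explicit_ss_stratum[OF beta29_ss])
    then have "emb x \<in> stratum beta29"
      using emb_orbit[OF 2(2)] unfolding emb_quad_tens by (rule stratum_orbit[rotated])
    then have "\<beta> = beta29" using stratum_unique[OF good sixteen_good xs] beta29_sixteen by blast
    then show ?thesis using 2 by blast
  qed
qed

lemma stratum_rat_single_orbit:
  assumes perf: "perfect_field TYPE('k::field)" and \<beta>: "(\<beta>, S) \<in> reps"
  shows "(stratum_rat \<beta> :: 'k tens set) = orbit (tens01 S)"
proof (intro equalityI subsetI)
  fix x :: "'k tens" assume "x \<in> stratum_rat \<beta>"
  then obtain S' where "(\<beta>, S') \<in> reps" "x \<in> orbit (tens01 S')"
    using stratum_rat_cases[OF perf reps_sixteen[OF \<beta>]] beta29_notin_reps \<beta> by blast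
  moreover have "S' = S" using reps_functional \<beta> calculation(1) by blast
  ultimately show "x \<in> orbit (tens01 S)" by simp
next
  fix x :: "'k tens" assume "x \<in> orbit (tens01 S)"
  then have "emb x \<in> orbit (tens01 S)" using emb_orbit[of x "tens01 S"] by (simp add: emb_tens01)
  then show "x \<in> stratum_rat \<beta>"
    unfolding stratum_rat_iff using explicit_ss_stratum[OF reps_ss[OF \<beta>]] by (rule stratum_orbit)
qed

lemma stratum_rat_beta29:
  fixes x :: "'k::field tens"
  assumes perf: "perfect_field TYPE('k)"
  shows "x \<in> stratum_rat beta29 \<longleftrightarrow> (\<exists>b c. b\<^sup>2 \<noteq> 4 * c \<and> x \<in> orbit (quad_tens b c))"
proof
  assume "x \<in> stratum_rat beta29"
  then show "\<exists>b c. b\<^sup>2 \<noteq> 4 * c \<and> x \<in> orbit (quad_tens b c)"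
    using stratum_rat_cases[OF perf beta29_sixteen] beta29_notin_reps by blast
next
  assume "\<exists>b c. b\<^sup>2 \<noteq> 4 * c \<and> x \<in> orbit (quad_tens b c)"
  then obtain b c where bc: "b\<^sup>2 \<noteq> 4 * c" "x \<in> orbit (quad_tens b c)" by blast
  have "(to_ac b)\<^sup>2 \<noteq> 4 * to_ac c" using bc(1) by (metis to_ac_eq_iff to_ac_mult to_ac_numeral to_ac_power)
  then have "quad_tens (to_ac b) (to_ac c) \<in> stratum beta29" by (rule explicit_ss_stratum[OF beta29_ss])
  then show "x \<in> stratum_rat beta29"
    unfolding stratum_rat_iff using emb_orbit[OF bc(2)] unfolding emb_quad_tens by (rule stratum_orbit[rotated])
qed

section \<open>The field generated by the roots of the binary form\<close>

text \<open>For \<theta> in the ground field this is the ground field itself, so the trivial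
  extension is covered uniformly.\<close>

definition qfield :: "'k::field alg_closure \<Rightarrow> 'k alg_closure set" where
  "qfield \<theta> = {to_ac r + to_ac s * \<theta> |r s. True}"

definition quad_root :: "'k::field \<Rightarrow> 'k \<Rightarrow> 'k alg_closure \<Rightarrow> bool" where
  "quad_root b c \<theta> \<longleftrightarrow> \<theta> * \<theta> = to_ac b * \<theta> - to_ac c"

lemma qfieldI: "x = to_ac r + to_ac s * \<theta> \<Longrightarrow> x \<in> qfield \<theta>"
  by (auto simp: qfield_def)

lemma to_ac_in_qfield: "to_ac r \<in> qfield \<theta>"
  by (rule qfieldI[of _ r 0]) simp

lemma gen_in_qfield: "\<theta> \<in> qfield \<theta>"
  by (rule qfieldI[of _ 0 1]) simp

lemma qfield_rat: "qfield (to_ac t) = range to_ac"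
proof (intro equalityI subsetI)
  fix x assume "x \<in> qfield (to_ac t)"
  then obtain r s where "x = to_ac (r + s * t)" by (auto simp: qfield_def)
  then show "x \<in> range to_ac" by blast
qed (auto simp: to_ac_in_qfield)

lemma intermediate_fieldD:
  assumes "intermediate_field L"
  shows "to_ac r \<in> L" "x \<in> L \<Longrightarrow> y \<in> L \<Longrightarrow> x + y \<in> L" "x \<in> L \<Longrightarrow> y \<in> L \<Longrightarrow> x - y \<in> L"
    "x \<in> L \<Longrightarrow> y \<in> L \<Longrightarrow> x * y \<in> L" "x \<in> L \<Longrightarrow> y \<in> L \<Longrightarrow> x / y \<in> L"
proof -
  have L: "\<And>x. to_ac x \<in> L" "\<And>x y. x \<in> L \<Longrightarrow> y \<in> L \<Longrightarrow> x + y \<in> L \<and> x - y \<in> L \<and> x * y \<in> L"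
    "\<And>x. x \<in> L \<Longrightarrow> inverse x \<in> L"
    using assms unfolding intermediate_field_def by blast+
  show "to_ac r \<in> L" by (rule L)
  assume "x \<in> L" "y \<in> L"
  then show "x + y \<in> L" "x - y \<in> L" "x * y \<in> L" "x / y \<in> L"
    using L(2)[of x y] L(2)[of x "inverse y"] L(3)[of y] by (simp_all add: divide_inverse)
qed

lemma qfield_subset:
  assumes L: "intermediate_field L" and "\<theta> \<in> L" shows "qfield \<theta> \<subseteq> L"
proof
  fix x assume "x \<in> qfield \<theta>"
  then obtain r s where "x = to_ac r + to_ac s * \<theta>" by (auto simp: qfield_def)
  then show "x \<in> L"
    using intermediate_fieldD(2)[OF L intermediate_fieldD(1)[OF L] intermediate_fieldD(4)[OF L intermediate_fieldD(1)[OF L] assms(2)]]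
    by simp
qed

lemma qfield_intermediate:
  assumes \<theta>: "quad_root b c \<theta>" shows "intermediate_field (qfield \<theta>)"
proof -
  note sq = \<theta>[unfolded quad_root_def]
  have "x + y \<in> qfield \<theta> \<and> x - y \<in> qfield \<theta> \<and> x * y \<in> qfield \<theta>"
    if xy: "x \<in> qfield \<theta>" "y \<in> qfield \<theta>" for x y
  proof -
    obtain r s r' s' where xy: "x = to_ac r + to_ac s * \<theta>" "y = to_ac r' + to_ac s' * \<theta>"
      using xy by (auto simp: qfield_def)
    have "x * y = to_ac (r * r') + to_ac (r * s' + s * r') * \<theta> + to_ac (s * s') * (\<theta> * \<theta>)"
      unfolding xy by (simp add: algebra_simps)
    also have "\<dots> = to_ac (r * r' - s * s' * c) + to_ac (r * s' + s * r' + s * s' * b) * \<theta>"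
      unfolding sq to_ac_mult to_ac_add to_ac_diff by Groebner_Basis.algebra
    finally have "x * y \<in> qfield \<theta>" by (rule qfieldI)
    moreover have "x + y \<in> qfield \<theta>" by (rule qfieldI[of _ "r + r'" "s + s'"]) (simp add: xy algebra_simps)
    moreover have "x - y \<in> qfield \<theta>" by (rule qfieldI[of _ "r - r'" "s - s'"]) (simp add: xy algebra_simps)
    ultimately show ?thesis by blast
  qed
  moreover have "inverse x \<in> qfield \<theta>" if x: "x \<in> qfield \<theta>" for x
  proof -
    obtain r s where xe: "x = to_ac r + to_ac s * \<theta>" using x by (auto simp: qfield_def)
    define N where "N = r * r + r * s * b + s * s * c"
    define y where "y = to_ac (r + s * b) - to_ac s * \<theta>"
    have xy: "x * y = to_ac N"
      using sq unfolding xe y_def N_def to_ac_mult to_ac_add by Groebner_Basis.algebra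
    show ?thesis
    proof (cases "s = 0 \<or> \<theta> \<in> range to_ac")
      case True
      then obtain t where "x = to_ac t"
      proof
        assume "\<theta> \<in> range to_ac"
        then obtain u where "\<theta> = to_ac u" by blast
        then have "x = to_ac (r + s * u)" by (simp add: xe)
        then show ?thesis by (rule that)
      qed (use that xe in simp)
      then have "inverse x = to_ac (inverse t)" by simp
      then show ?thesis by (simp only: to_ac_in_qfield)
    next
      case False
      have "y \<noteq> 0"
      proof
        assume "y = 0"
        then have "\<theta> = to_ac ((r + s * b) / s)" using False by (simp add: y_def field_simps)
        then show False using False by blast
      qed
      moreover have "x \<noteq> 0"
      proof
        assume "x = 0"
        then have "\<theta> = to_ac (- r / s)" using False by (simp add: xe field_simps eq_neg_iff_add_eq_0)
        then show False using False by blast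
      qed
      ultimately have "to_ac N \<noteq> 0" using xy by (metis mult_eq_0_iff)
      then have "inverse x = y * to_ac (inverse N)" using xy \<open>x \<noteq> 0\<close> by (simp add: field_simps)
      then have "inverse x = to_ac ((r + s * b) * inverse N) + to_ac ((0 - s) * inverse N) * \<theta>"
        unfolding y_def to_ac_mult to_ac_add to_ac_diff to_ac_0 by Groebner_Basis.algebra
      then show ?thesis by (rule qfieldI)
    qed
  qed
  ultimately show ?thesis unfolding intermediate_field_def using to_ac_in_qfield by blast
qed

lemma quad_root_cases:
  assumes "quad_root b c \<theta>" "quad_root b c \<theta>'"
  shows "\<theta>' = \<theta> \<or> \<theta>' = to_ac b - \<theta>"
proof -
  have "(\<theta>' - \<theta>) * (\<theta>' - (to_ac b - \<theta>)) = (\<theta>' * \<theta>' - to_ac b * \<theta>') - (\<theta> * \<theta> - to_ac b * \<theta>)"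
    by (simp add: algebra_simps)
  then have "(\<theta>' - \<theta>) * (\<theta>' - (to_ac b - \<theta>)) = 0" using assms by (simp add: quad_root_def)
  then show ?thesis by simp
qed

lemma quad_root_field:
  assumes "quad_root b c \<theta>" "quad_root b c \<theta>'" "intermediate_field L" "\<theta>' \<in> L"
  shows "qfield \<theta> \<subseteq> L"
proof (rule qfield_subset[OF assms(3)])
  have "to_ac b - \<theta>' \<in> L" using intermediate_fieldD[OF assms(3)] assms(4) by blast
  then show "\<theta> \<in> L" using quad_root_cases[OF assms(1,2)] assms(4) by auto
qed

lemma quad_root_exists: "\<exists>\<theta>. quad_root b c \<theta>"
proof -
  obtain \<theta> where "\<theta>\<^sup>2 - to_ac b * \<theta> + to_ac c = 0" using alg_closed_quadratic_root by blast
  then have "quad_root b c \<theta>" by (simp add: quad_root_def power2_eq_square algebra_simps eq_neg_iff_add_eq_0 eq_diff_eq)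
  then show ?thesis by blast
qed

lemma qfield_span: "ac.span {1, \<theta>} = qfield \<theta>"
  by (auto simp: qfield_def ac.span_breakdown_eq diff_diff_eq eq_diff_eq) blast

lemma perfect_separable_ext:
  assumes "perfect_field TYPE('k::field)" shows "separable_ext (F :: 'k alg_closure set)"
  unfolding separable_ext_def
proof
  fix x :: "'k alg_closure"
  obtain q :: "'k poly" where q: "irreducible q" "\<And>p. poly (map_poly to_ac p) x = 0 \<longleftrightarrow> q dvd p"
    by (rule minimal_polynomial[of x]) blast
  then show "\<exists>p :: 'k poly. irreducible p \<and> poly (map_poly to_ac p) x = 0 \<and> separable_poly p"
    using assms unfolding perfect_field_def by (intro exI[of _ q]) simp
qed

lemma qfield_sep_exts2:
  fixes \<theta> :: "'k::field alg_closure"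
  assumes "perfect_field TYPE('k)" "quad_root b c \<theta>"
  shows "qfield \<theta> \<in> sep_exts2"
proof -
  obtain B where B: "B \<subseteq> {1, \<theta>}" "ac.independent B" "{1, \<theta>} \<subseteq> ac.span B"
    by (rule ac.maximal_independent_subset)
  then have "ac.span B = qfield \<theta>"
    unfolding qfield_span[symmetric] using ac.span_mono ac.span_minimal ac.subspace_span by (metis subset_antisym)
  moreover have "card B \<le> card {1, \<theta>}" using B(1) by (intro card_mono) simp_all
  then have "card B \<le> 2" using card_insert_le_m1[of 2 "{\<theta>}" 1] by simp
  moreover have "finite B" using B(1) by (rule finite_subset) simp
  ultimately show ?thesis
    unfolding sep_exts2_def degree_at_most_def
    using B(2) perfect_separable_ext[OF assms(1)] qfield_intermediate[OF assms(2)] by blast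
qed

text \<open>Any \<theta> outside the ground field spans F together with 1, so \<theta>^2 is a
  combination of both. A vanishing discriminant would make \<theta> a double root and thus rational
  by perfectness.\<close>

lemma sep_exts2_qfield:
  fixes F :: "'k::field alg_closure set"
  assumes perf: "perfect_field TYPE('k)" and F: "F \<in> sep_exts2"
  obtains b c \<theta> where "b\<^sup>2 \<noteq> 4 * c" "quad_root b c \<theta>" "F = qfield \<theta>"
proof (cases "F = range to_ac")
  case True
  show ?thesis
  proof (rule that)
    \<comment> \<open>The trivial extension is represented by t^2 - t, which splits with distinct
      roots.\<close>
    show "(1 :: 'k)\<^sup>2 \<noteq> 4 * 0" by simp
    show "quad_root 1 0 (to_ac 0)" by (simp add: quad_root_def)
    show "F = qfield (to_ac 0)" unfolding qfield_rat by (rule True)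
  qed
next
  case False
  have L: "intermediate_field F" using F by (simp add: sep_exts2_def)
  note Ld = intermediate_fieldD[OF L]
  obtain B where B: "ac.span B = F" "finite B" "card B \<le> 2"
    using F by (auto simp: sep_exts2_def degree_at_most_def)
  obtain \<theta> where \<theta>: "\<theta> \<in> F" "\<theta> \<notin> range to_ac" using False Ld(1) by blast
  have ind: "ac.independent {\<theta>, 1}" and ne: "\<theta> \<noteq> 1"
    using \<theta>(2) rangeI[of to_ac 1] by (auto simp: ac.independent_insert ac.span_breakdown_eq)
  have 1: "1 \<in> F" using Ld(1)[of 1] by simp
  have sub: "F \<subseteq> qfield \<theta>"
  proof
    fix y assume y: "y \<in> F"
    show "y \<in> qfield \<theta>"
    proof (rule ccontr)
      assume "y \<notin> qfield \<theta>"
      then have ny: "y \<notin> ac.span {\<theta>, 1}" unfolding qfield_span[symmetric] by (simp add: insert_commute)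
      then have nm: "y \<notin> {\<theta>, 1}" using ac.span_base by blast
      have "ac.independent {y, \<theta>, 1}" using ind ny nm by (simp add: ac.independent_insert)
      moreover have "{y, \<theta>, 1} \<subseteq> ac.span B" using y \<theta>(1) 1 B(1) by simp
      ultimately have "card {y, \<theta>, 1} \<le> card B" using ac.independent_span_bound[OF B(2)] by blast
      then show False using B(3) nm ne by simp
    qed
  qed
  then have Fq: "F = qfield \<theta>" using qfield_subset[OF L \<theta>(1)] by blast
  have "\<theta> * \<theta> \<in> qfield \<theta>" using Ld(4)[OF \<theta>(1) \<theta>(1)] sub by blast
  then obtain r s where rs: "\<theta> * \<theta> = to_ac r + to_ac s * \<theta>" by (auto simp: qfield_def)
  then have root: "quad_root s (- r) \<theta>" by (simp add: quad_root_def)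
  have "s\<^sup>2 \<noteq> 4 * (- r)"
  proof
    assume "s\<^sup>2 = 4 * (- r)"
    then obtain t where t: "t\<^sup>2 - s * t + (- r) = 0" using perfect_quadratic_root[OF perf] by blast
    then have "t * t = s * t + r" by (simp add: power2_eq_square algebra_simps)
    then have "to_ac (t * t) = to_ac (s * t + r)" by (simp only:)
    then have "quad_root s (- r) (to_ac t)" by (simp add: quad_root_def)
    then have "\<theta> = to_ac t \<or> \<theta> = to_ac (s - t)" using quad_root_cases[OF _ root] by simp
    then show False using \<theta>(2) by blast
  qed
  then show ?thesis using root Fq by (rule that)
qed

text \<open>An isomorphism sends \<theta> to \<theta> or to b - \<theta>, both of which lie in F:
  fields of degree at most two are normal, and isomorphic ones inside the closure coincide.\<close>

lemma ext_iso_eq: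
  assumes perf: "perfect_field TYPE('k::field)"
    and F: "F \<in> sep_exts2" and F': "F' \<in> sep_exts2" and iso: "ext_iso F (F' :: 'k alg_closure set)"
  shows "F = F'"
proof -
  obtain b c \<theta> where root: "quad_root b c \<theta>" and Fe: "F = qfield \<theta>" by (rule sep_exts2_qfield[OF perf F])
  obtain \<phi> where \<phi>: "bij_betw \<phi> F F'" "\<And>x y. x \<in> F \<Longrightarrow> y \<in> F \<Longrightarrow> \<phi> (x + y) = \<phi> x + \<phi> y"
    "\<And>x y. x \<in> F \<Longrightarrow> y \<in> F \<Longrightarrow> \<phi> (x * y) = \<phi> x * \<phi> y" "\<And>r. \<phi> (to_ac r) = to_ac r"
    using iso unfolding ext_iso_def by blast
  have L: "intermediate_field F" using F by (simp add: sep_exts2_def)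
  have L': "intermediate_field F'" using F' by (simp add: sep_exts2_def)
  note Ld = intermediate_fieldD[OF L]
  have \<theta>: "\<theta> \<in> F" unfolding Fe by (rule gen_in_qfield)
  have "to_ac b * \<theta> = \<theta> * \<theta> + to_ac c" using root by (simp add: quad_root_def)
  then have "\<phi> (to_ac b * \<theta>) = \<phi> (\<theta> * \<theta> + to_ac c)" by simp
  then have "to_ac b * \<phi> \<theta> = \<phi> \<theta> * \<phi> \<theta> + to_ac c" using \<phi>(2-4) \<theta> Ld(1,4) by simp
  then have root': "quad_root b c (\<phi> \<theta>)" by (simp add: quad_root_def)
  have mem: "\<phi> \<theta> \<in> F'" using \<phi>(1) \<theta> by (auto simp: bij_betw_def)
  have "\<phi> \<theta> \<in> F" using quad_root_cases[OF root root'] \<theta> Ld(3)[OF Ld(1) \<theta>] by auto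
  have "F \<subseteq> F'" unfolding Fe by (rule quad_root_field[OF root root' L' mem])
  moreover have "F' \<subseteq> F"
  proof
    fix y assume "y \<in> F'"
    then obtain x where x: "x \<in> F" "y = \<phi> x" using \<phi>(1) by (auto simp: bij_betw_def)
    then obtain r s where "x = to_ac r + to_ac s * \<theta>" by (auto simp: Fe qfield_def)
    then have "y = to_ac r + to_ac s * \<phi> \<theta>" using x(2) \<phi>(2-4) \<theta> Ld(1,4) by simp
    then show "y \<in> F" using Ld(1,2,4) \<open>\<phi> \<theta> \<in> F\<close> by simp
  qed
  ultimately show ?thesis by blast
qed

lemma Ex2_eq:
  assumes "perfect_field TYPE('k::field)"
  shows "(Ex2 :: 'k alg_closure set set set) = (\<lambda>F. {F}) ` sep_exts2"
proof -
  have refl: "ext_iso F F" for F :: "'k alg_closure set"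
    unfolding ext_iso_def by (intro exI[of _ id]) simp
  have "{(F, F'). F \<in> sep_exts2 \<and> F' \<in> sep_exts2 \<and> ext_iso F F'} = {(F, F'). F \<in> sep_exts2 \<and> F' = (F :: 'k alg_closure set)}"
    using ext_iso_eq[OF assms] refl by blast
  then show ?thesis unfolding Ex2_def quotient_def by auto
qed

section \<open>The splitting field of a pencil\<close>

text \<open>Only the coefficients are confined to \<open>L\<close>; p and q may live in the whole
  field, since rank is insensitive to field extension.\<close>

definition splits :: "'f::field set \<Rightarrow> 'f tens \<Rightarrow> bool" where
  "splits L x \<longleftrightarrow> (\<exists>u\<in>L. \<exists>v\<in>L. (u \<noteq> 0 \<or> v \<noteq> 0) \<and>
     (\<exists>p q :: 'f^3. \<forall>i j. u * x$(i, j, 1) + v * x$(i, j, 2) = p$i * q$j))"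

definition split_field :: "'k::field tens \<Rightarrow> 'k alg_closure set" where
  "split_field x = \<Inter>{L. intermediate_field L \<and> splits L (emb x)}"

lemma splits_orbit:
  assumes L: "intermediate_field L" and x: "x \<in> orbit y" and s: "splits L (emb y)"
  shows "splits L (emb x)"
proof -
  obtain g1 g2 g3 where g: "invertible g3" "x = act (g1, g2, g3) y"
    using x unfolding orbit_def GG_def by blast
  define G1 G2 G3 Y where G: "G1 = emb_mat g1" "G2 = emb_mat g2" "G3 = emb_mat g3" "Y = emb y"
  define d where "d = det G3"
  have mem: "G3$i$j \<in> L" for i j using L by (simp add: G emb_mat_def intermediate_fieldD)
  have dd: "d = G3$1$1 * G3$2$2 - G3$1$2 * G3$2$1" by (simp add: d_def det_2)
  have d: "d \<noteq> 0" "d \<in> L"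
    using invertible_emb_mat[OF g(1)] by (simp add: d_def G invertible_det_nz)
      (unfold dd, intro intermediate_fieldD[OF L] mem)
  obtain u v p q where uv: "u \<in> L" "v \<in> L" "u \<noteq> 0 \<or> v \<noteq> 0"
    and pq: "\<And>i j. u * Y$(i, j, 1) + v * Y$(i, j, 2) = p$i * (q$j :: 'a alg_closure)"
    using s unfolding splits_def G by blast
  \<comment> \<open>Cramer's rule for (u', v') G3 = (u, v), which keeps the coefficients in
    \<open>L\<close>.\<close>
  define u' v' where w: "u' = (u * G3$2$2 - v * G3$2$1) / d" "v' = (v * G3$1$1 - u * G3$1$2) / d"
  have inL: "u' \<in> L" "v' \<in> L" unfolding w by (intro intermediate_fieldD[OF L] mem d uv)+
  have "(u' * G3$1$1 + v' * G3$2$1) * d = u * d" "(u' * G3$1$2 + v' * G3$2$2) * d = v * d"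
    using d(1) by (simp_all add: w add_divide_distrib[symmetric] distrib_right) (simp_all add: dd algebra_simps)
  then have uv': "u = u' * G3$1$1 + v' * G3$2$1" "v = u' * G3$1$2 + v' * G3$2$2" using d(1) by simp_all
  have "u' * emb x$(i, j, 1) + v' * emb x$(i, j, 2) =
      (\<Sum>i'\<in>UNIV. G1$i$i' * p$i') * (\<Sum>j'\<in>UNIV. G2$j$j' * q$j')" for i j
  proof -
    have "u' * emb x$(i, j, 1) + v' * emb x$(i, j, 2) =
      (\<Sum>i'\<in>UNIV. \<Sum>j'\<in>UNIV. G1$i$i' * G2$j$j' * (u * Y$(i', j', 1) + v * Y$(i', j', 2)))"
      unfolding g(2) emb_act G[symmetric] uv'
      by (simp add: sum_2 sum_distrib_left sum.distrib[symmetric] algebra_simps)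
    also have "\<dots> = (\<Sum>i'\<in>UNIV. \<Sum>j'\<in>UNIV. (G1$i$i' * p$i') * (G2$j$j' * q$j'))"
      unfolding pq by (simp add: algebra_simps)
    finally show ?thesis by (simp add: sum_product)
  qed
  then have "\<exists>p q :: 'a alg_closure^3. \<forall>i j. u' * emb x$(i, j, 1) + v' * emb x$(i, j, 2) = p$i * q$j"
    by (intro exI[of _ "\<chi> i. \<Sum>i'\<in>UNIV. G1$i$i' * p$i'"] exI[of _ "\<chi> j. \<Sum>j'\<in>UNIV. G2$j$j' * q$j'"]) simp
  moreover have "u' \<noteq> 0 \<or> v' \<noteq> 0" using uv(3) uv' by auto
  ultimately show ?thesis unfolding splits_def using inL by blast
qed

lemma split_field_orbit: "x \<in> orbit y \<Longrightarrow> split_field x = split_field y"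
proof -
  assume "x \<in> orbit y"
  then have "splits L (emb x) \<longleftrightarrow> splits L (emb y)" if "intermediate_field L" for L
    using splits_orbit[OF that] orbit_sym by blast
  then show ?thesis by (simp add: split_field_def cong: conj_cong)
qed

text \<open>A combination of rank at most one has vanishing block determinant, which makes -u / v a
  root. Conversely a root \<theta> gives the coefficients (-\<theta>, 1).\<close>

lemma splits_quad_tens:
  assumes L: "intermediate_field L"
  shows "splits L (emb (quad_tens b c)) \<longleftrightarrow> (\<exists>\<theta>\<in>L. quad_root b c \<theta>)"
proof
  assume "splits L (emb (quad_tens b c))"
  then obtain u v p q where uv: "u \<in> L" "v \<in> L" "u \<noteq> 0 \<or> v \<noteq> 0"
    and pq: "\<And>i j. u * quad_tens (to_ac b) (to_ac c)$(i, j, 1) + v * quad_tens (to_ac b) (to_ac c)$(i, j, 2) =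
      p$i * (q$j :: 'a alg_closure)"
    unfolding splits_def emb_quad_tens by blast
  have e: "p$2 * q$2 = - (u * to_ac b) - v * to_ac c" "p$2 * q$3 = u" "p$3 * q$2 = u" "p$3 * q$3 = v"
    unfolding pq[symmetric] by (simp_all add: quad_tens_def)
  have "(p$2 * q$2) * (p$3 * q$3) = (p$2 * q$3) * (p$3 * q$2)" by (simp add: ac_simps)
  then have uu: "(- (u * to_ac b) - v * to_ac c) * v = u * u" unfolding e .
  then have v: "v \<noteq> 0" using uv(3) by auto
  have "(- u / v) * (- u / v) = u * u / (v * v)" by simp
  also have "\<dots> = to_ac b * (- u / v) - to_ac c"
    unfolding uu[symmetric] using v by (simp add: field_simps)
  finally have "quad_root b c (- u / v)" by (simp add: quad_root_def)
  moreover have "(0 - u) / v \<in> L"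
    using intermediate_fieldD(3)[OF L, of 0 u] intermediate_fieldD(5)[OF L, of "0 - u" v] intermediate_fieldD(1)[OF L, of 0] uv by simp
  ultimately show "\<exists>\<theta>\<in>L. quad_root b c \<theta>" by auto
next
  assume "\<exists>\<theta>\<in>L. quad_root b c \<theta>"
  then obtain \<theta> where \<theta>: "\<theta> \<in> L" "\<theta> * \<theta> = to_ac b * \<theta> - to_ac c" by (auto simp: quad_root_def)
  \<comment> \<open>The combination with coefficients -\<theta> and 1 is the symmetric product of
    this vector with itself.\<close>
  define p :: "'a alg_closure^3" where "p = vector [0, - \<theta>, 1]"
  have "\<forall>i j. (0 - \<theta>) * emb (quad_tens b c)$(i, j, 1) + 1 * emb (quad_tens b c)$(i, j, 2) = p$i * p$j"
    unfolding emb_quad_tens p_def using \<theta>(2) by (simp add: forall_3 quad_tens_def algebra_simps)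
  moreover have "0 - \<theta> \<in> L" "1 \<in> L"
    using intermediate_fieldD(3)[OF L, of 0 \<theta>] intermediate_fieldD(1)[OF L, of 0] intermediate_fieldD(1)[OF L, of 1] \<theta>(1) by simp_all
  ultimately show "splits L (emb (quad_tens b c))" unfolding splits_def
    by (intro rev_bexI[of "0 - \<theta>"] rev_bexI[of 1] conjI exI[of _ p]) simp_all
qed

lemma split_field_quad_tens:
  assumes "quad_root b c \<theta>" shows "split_field (quad_tens b c) = qfield \<theta>"
proof -
  have "qfield \<theta> \<subseteq> L" if "intermediate_field L" "splits L (emb (quad_tens b c))" for L
    using that splits_quad_tens quad_root_field[OF assms _ that(1)] by blast
  moreover have "splits (qfield \<theta>) (emb (quad_tens b c))"
    using splits_quad_tens[OF qfield_intermediate[OF assms]] assms gen_in_qfield by blast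
  ultimately show ?thesis unfolding split_field_def using qfield_intermediate[OF assms] by blast
qed

section \<open>Orbits of the quadratic family\<close>

text \<open>If \<theta> has trace b and norm c, then m + n \<theta> has the trace and norm on the
  left. Passing from the companion matrix M to m + n M is an invertible change of the two
  slices.\<close>

lemma quad_tens_shift:
  assumes "n \<noteq> 0"
  shows "quad_tens (2 * m + n * b) (m * m + m * n * b + n * n * c) \<in> orbit (quad_tens b c)"
proof -
  let ?y = "quad_tens (2 * m + n * b) (m * m + m * n * b + n * n * c)"
  have "block_tens 1 0 0 1 m (- n * c) n (m + n * b) \<in> orbit (quad_tens (m + (m + n * b)) (m * (m + n * b) - (- n * c) * n))"
    by (rule block_identity_quad[of 1 _ _ 0]) (use assms in simp)
  moreover have "quad_tens (m + (m + n * b)) (m * (m + n * b) - (- n * c) * n) = ?y"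
    by (rule arg_cong2[of _ _ _ _ quad_tens]) (simp_all add: algebra_simps)
  ultimately have 1: "block_tens 1 0 0 1 m (- n * c) n (m + n * b) \<in> orbit ?y" by simp
  have "block_tens 1 0 0 1 0 (- c) 1 b \<in> orbit ?y"
    by (rule block_mix[of 1 n 0 m]) (use assms 1 in simp_all)
  moreover have "block_tens 1 0 0 1 0 (- c) 1 b \<in> orbit (quad_tens b c)"
    using block_identity_quad[of 1 1 b 0 0 "- c"] by simp
  ultimately show ?thesis by (rule orbit_trans[OF orbit_sym])
qed

text \<open>The roots are t and b - t, the images of 0 and 1 under the shift with m = t and n = b -
  2 t; the discriminant condition makes n non-zero.\<close>

lemma quad_tens_rational:
  assumes root: "quad_root b c (to_ac t)" and disc: "b\<^sup>2 \<noteq> 4 * c"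
  shows "quad_tens b c \<in> orbit (quad_tens 1 0)"
proof -
  have "to_ac (t * t) = to_ac (b * t - c)" using root by (simp add: quad_root_def)
  then have c: "c = b * t - t * t" by (simp only: to_ac_eq_iff) simp
  have "b - 2 * t \<noteq> 0"
  proof
    assume "b - 2 * t = 0"
    then have "b = 2 * t" by simp
    then show False using disc by (simp add: c power2_eq_square)
  qed
  then have "quad_tens (2 * t + (b - 2 * t) * 1) (t * t + t * (b - 2 * t) * 1 + (b - 2 * t) * (b - 2 * t) * 0) \<in> orbit (quad_tens 1 0)"
    by (rule quad_tens_shift)
  moreover have "t * t + t * (b - 2 * t) = c" by (simp add: c algebra_simps)
  ultimately show ?thesis by simp
qed

lemma quad_tens_same_field:
  assumes disc: "b\<^sup>2 \<noteq> 4 * c" "b'\<^sup>2 \<noteq> 4 * c'"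
    and root: "quad_root b c \<theta>" "quad_root b' c' \<theta>'" and eq: "qfield \<theta> = qfield \<theta>'"
  shows "quad_tens b' c' \<in> orbit (quad_tens b c)"
proof (cases "\<theta> \<in> range to_ac")
  case True
  then obtain t where t: "\<theta> = to_ac t" by blast
  then have "qfield \<theta>' = range to_ac" using eq qfield_rat by metis
  then obtain t' where t': "\<theta>' = to_ac t'" using gen_in_qfield[of \<theta>'] by auto
  show ?thesis
    using quad_tens_rational[OF root(1)[unfolded t] disc(1)] quad_tens_rational[OF root(2)[unfolded t'] disc(2)]
      orbit_trans orbit_sym by blast
next
  case False
  have "\<theta>' \<in> qfield \<theta>" unfolding eq by (rule gen_in_qfield)
  then obtain m n where \<theta>': "\<theta>' = to_ac m + to_ac n * \<theta>" by (auto simp: qfield_def)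
  have "n \<noteq> 0"
  proof
    assume "n = 0"
    then have "qfield \<theta> = range to_ac" unfolding eq \<theta>' using qfield_rat[of m] by simp
    then show False using False gen_in_qfield[of \<theta>] by simp
  qed
  \<comment> \<open>Both quadratic equations are combined into a linear one for \<theta>; as
    \<theta> is irrational, its two coefficients vanish and express b' and c' through m, n, b,
    c.\<close>
  have lin: "to_ac (2 * m * n + n * n * b - b' * n) * \<theta> = to_ac (b' * m - c' - m * m + n * n * c)"
    using root unfolding quad_root_def \<theta>' to_ac_mult to_ac_add to_ac_diff to_ac_numeral by Groebner_Basis.algebra
  have z: "2 * m * n + n * n * b - b' * n = 0"
  proof (rule ccontr)
    assume nz: "2 * m * n + n * n * b - b' * n \<noteq> 0" (is "?z \<noteq> 0")
    then have "\<theta> = to_ac ((b' * m - c' - m * m + n * n * c) / ?z)"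
      using lin unfolding to_ac_divide by (metis nonzero_mult_div_cancel_left to_ac_eq_0_iff)
    then show False using False by blast
  qed
  then have "n * (2 * m + n * b - b') = 0" by (simp add: algebra_simps)
  then have b': "2 * m + n * b = b'" using \<open>n \<noteq> 0\<close> by simp
  have "to_ac (b' * m - c' - m * m + n * n * c) = 0" using lin unfolding z by simp
  then have "b' * m - c' - m * m + n * n * c = 0" by (simp only: to_ac_eq_0_iff)
  then have c': "m * m + m * n * b + n * n * c = c'" unfolding b'[symmetric] by (simp add: algebra_simps)
  show ?thesis using quad_tens_shift[OF \<open>n \<noteq> 0\<close>, of m b c] unfolding b' c' .
qed

lemma split_field_image: "split_field ` orbit x = {split_field x}"
proof (intro equalityI subsetI)
  fix F assume "F \<in> split_field ` orbit x"
  then show "F \<in> {split_field x}" using split_field_orbit[of _ x] by blast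
next
  fix F assume "F \<in> {split_field x}"
  then show "F \<in> split_field ` orbit x" using orbit_refl[of x] by blast
qed

text \<open>\<open>split_field\<close> is constant on orbits and the classes in \<open>Ex2\<close>
  are singletons, so the image of an orbit under \<open>split_field\<close> is itself an element of
  \<open>Ex2\<close>.\<close>

lemma beta29_bijection:
  assumes perf: "perfect_field TYPE('k::field)"
  shows "bij_betw (image split_field) (orbit ` (stratum_rat beta29 :: 'k tens set)) (Ex2 :: 'k alg_closure set set set)"
proof (rule bij_betw_imageI)
  show "inj_on (image split_field) (orbit ` (stratum_rat beta29 :: 'k tens set))"
  proof (rule inj_onI, elim imageE)
    fix O1 O2 and x y :: "'k tens"
    assume x: "O1 = orbit x" "x \<in> stratum_rat beta29" and y: "O2 = orbit y" "y \<in> stratum_rat beta29"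
      and eq: "split_field ` O1 = split_field ` O2"
    obtain b c where bc: "b\<^sup>2 \<noteq> 4 * c" "x \<in> orbit (quad_tens b c)" using x(2) stratum_rat_beta29[OF perf] by blast
    obtain b' c' where bc': "b'\<^sup>2 \<noteq> 4 * c'" "y \<in> orbit (quad_tens b' c')" using y(2) stratum_rat_beta29[OF perf] by blast
    obtain \<theta> \<theta>' where root: "quad_root b c \<theta>" "quad_root b' c' \<theta>'" using quad_root_exists by metis
    have "qfield \<theta> = qfield \<theta>'"
      using eq split_field_orbit[OF bc(2)] split_field_orbit[OF bc'(2)]
      unfolding x(1) y(1) split_field_image split_field_quad_tens[OF root(1)] split_field_quad_tens[OF root(2)] by simp
    then have "quad_tens b' c' \<in> orbit (quad_tens b c)" by (rule quad_tens_same_field[OF bc(1) bc'(1) root])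
    then show "O1 = O2" unfolding x(1) y(1) using bc(2) bc'(2) orbit_eq by metis
  qed
  have "split_field x \<in> sep_exts2" if x: "x \<in> stratum_rat beta29" for x :: "'k tens"
  proof -
    obtain b c where bc: "x \<in> orbit (quad_tens b c)" using x stratum_rat_beta29[OF perf] by blast
    obtain \<theta> where root: "quad_root b c \<theta>" using quad_root_exists by blast
    show ?thesis unfolding split_field_orbit[OF bc] split_field_quad_tens[OF root] by (rule qfield_sep_exts2[OF perf root])
  qed
  moreover have "\<exists>x\<in>stratum_rat beta29. split_field x = F" if F: "F \<in> sep_exts2" for F :: "'k alg_closure set"
  proof -
    obtain b c \<theta> where bc: "b\<^sup>2 \<noteq> 4 * c" "quad_root b c \<theta>" "F = qfield \<theta>" by (rule sep_exts2_qfield[OF perf F])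
    have "quad_tens b c \<in> stratum_rat beta29" using stratum_rat_beta29[OF perf] bc(1) orbit_refl by blast
    then show ?thesis using split_field_quad_tens[OF bc(2)] bc(3) by blast
  qed
  ultimately have "split_field ` stratum_rat beta29 = (sep_exts2 :: 'k alg_closure set set)" by blast
  moreover have "image split_field ` orbit ` (stratum_rat beta29 :: 'k tens set) = (\<lambda>F. {F}) ` split_field ` stratum_rat beta29"
    by (simp add: image_image split_field_image)
  ultimately show "image split_field ` orbit ` (stratum_rat beta29 :: 'k tens set) = Ex2"
    unfolding Ex2_eq[OF perf] by simp
qed

theorem theorem3p9:
  assumes "perfect_field TYPE('k::field)"
  shows "sixteen \<subseteq> BB \<and>
    (\<forall>\<beta>\<in>BB. (stratum \<beta> :: 'k alg_closure tens set) \<noteq> {} \<longleftrightarrow> \<beta> \<in> sixteen) \<and>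
    (\<forall>\<beta>\<in>sixteen - {beta29}. \<exists>x. (stratum_rat \<beta> :: 'k tens set) = orbit x) \<and>
    (\<exists>f. bij_betw f (orbit ` (stratum_rat beta29 :: 'k tens set)) (Ex2 :: 'k alg_closure set set set))"
proof (intro conjI ballI)
  show "sixteen \<subseteq> BB" by (rule sixteen_subset_BB)
  show "(stratum \<beta> :: 'k alg_closure tens set) \<noteq> {} \<longleftrightarrow> \<beta> \<in> sixteen" if "\<beta> \<in> BB" for \<beta>
    using that by (rule stratum_nonempty_iff)
  show "\<exists>x. (stratum_rat \<beta> :: 'k tens set) = orbit x" if \<beta>: "\<beta> \<in> sixteen - {beta29}" for \<beta>
  proof -
    obtain S where "(\<beta>, S) \<in> reps" using \<beta> sixteen_rep[of \<beta>] by blast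
    then show ?thesis using stratum_rat_single_orbit[OF assms] by blast
  qed
  show "\<exists>f. bij_betw f (orbit ` (stratum_rat beta29 :: 'k tens set)) (Ex2 :: 'k alg_closure set set set)"
    using beta29_bijection[OF assms] by blast
qed

end
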